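(* Consider the diatomic chain described in the context, with $V_i,W_i\in C^4(\mathbb R)$ and coefficients satisfying the standing assumptions. Let $\omega_2>\omega_1>0$ and $\vartheta_1,\vartheta_2\in(-\pi,\pi]$ with $\det H(\omega_n,\vartheta_n)=0$, $n=1,2$, and suppose one of the following two cases holds. Case (NR) (non-resonant): $\det H(2\omega_n,2\vartheta_n)\neq0$ for $n=1,2$ and $\det H(\omega_1\pm\omega_2,\vartheta_1\pm\vartheta_2)\neq 0$. For $n=1,2$ write $\omega_n=\omega_{\sigma_n}(\vartheta_n)$ with $\sigma_n\in\{+,-\}$. The amplitudes $A_{1,n}=(A_{1,n}^{(1)},A_{1,n}^{(2)})^T$ satisfy: if $\vartheta_n\neq\pm\pi$, then $A_{1,n}^{(2)}=-\rho_nA_{1,n}^{(1)}$ and $\partial_\tau A_{1,n}^{(1)}-\omega_{\sigma_n}'(\vartheta_n)\partial_yA_{1,n}^{(1)}=0$; if $\vartheta_n=\pm\pi$ and $\omega_n^2=c_1$, then $A_{1,n}^{(2)}=0$ and $\partial_\tau A^{(1)}_{1,n}=0$; if $\vartheta_n=\pm\pi$ and $\omega_n^2=c_2$, then $A_{1,n}^{(1)}=0$ and $\partial_\tau A^{(2)}_{1,n}=0$. Case (R) (resonant): $\omega_1=\omega_-(\vartheta_1)$, $\vartheta_2\equiv2\vartheta_1 \pmod{2\pi}$, $\omega_2=\omega_+(\vartheta_2)=2\omega_1$, and $\det H(k\omega_1,k\vartheta_1)\neq0$ for $k=3,4$. The amplitudes satisfy: (R1) if $\vartheta_1\notin\{\pm\frac\pi2,\pm\pi\}$: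 $A_{1,n}^{(2)}=-\rho_nA_{1,n}^{(1)}$ ($n=1,2$) and $$\partial_\tau A^{(1)}_{1,1}-\omega_-'(\vartheta_1)\partial_yA^{(1)}_{1,1}=\frac{d_1}{i\omega_1}\frac{\omega_1^2-c_2}{2\omega_1^2-c_1-c_2}\,\overline{A^{(1)}_{1,1}}A^{(1)}_{1,2},\qquad \partial_\tau A^{(1)}_{1,2}-\omega_+'(\vartheta_2)\partial_yA^{(1)}_{1,2}=\frac{d_2}{2i\omega_2}\frac{\omega_2^2-c_2}{2\omega_2^2-c_1-c_2}\big(A^{(1)}_{1,1}\big)^2,$$ where, with $D:=\dfrac{v_{1,1}v_{2,1}^2(2+4\cos\vartheta_1+2\cos\vartheta_2)}{(\omega_1^2-c_2)^2(\omega_2^2-c_2)}$, $$d_1:=Dv_{2,2}\Big(\tfrac{e^{-i\vartheta_1}-1}{\bar\rho_1\rho_2}+\tfrac{e^{-2i\vartheta_1}-1}{\rho_2}+\tfrac{e^{i\vartheta_1}-1}{\bar\rho_1}\Big)+v_{1,2}\Big(\bar\rho_1\rho_2(e^{i\vartheta_1}-1)+\rho_2(e^{2i\vartheta_1}-1)+\bar\rho_1(e^{-i\vartheta_1}-1)\Big)+Dw_{2,2}-w_{1,2},$$ $$d_2:=Dv_{2,2}\Big(\tfrac{e^{-2i\vartheta_1}-1}{\rho_1^2}+2\tfrac{e^{-i\vartheta_1}-1}{\rho_1}\Big)+v_{1,2}\Big(\rho_1^2(e^{2i\vartheta_1}-1)+2\rho_1(e^{i\vartheta_1}-1)\Big)+Dw_{2,2}-w_{1,2};$$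 (R2) if $\vartheta_1=\pm\frac\pi2$ (so $\omega_2=\sqrt{c_2}$): $A_{1,1}^{(2)}=-\rho_1A_{1,1}^{(1)}$, $A_{1,2}^{(1)}=0$, and $$\partial_\tau A^{(1)}_{1,1}-\omega_-'(\pm\tfrac\pi2)\partial_yA^{(1)}_{1,1}=\frac{\tilde d_1}{i\omega_1}\frac{\omega_1^2-c_2}{2\omega_1^2-c_1-c_2}\overline{A^{(1)}_{1,1}}A^{(2)}_{1,2},\qquad \partial_\tau A^{(2)}_{1,2}=\frac{1}{2i\omega_2}\Big(2v_{2,2}\big(1+\rho_1(1\pm i)\big)-w_{2,2}\rho_1^2\Big)\big(A^{(1)}_{1,1}\big)^2,$$ with $\tilde d_1:=\Big(\frac{v_{2,2}}{v_{2,1}}\mp i\frac{w_{2,2}}{\omega_1^2-c_2}\Big)(\omega_1^2-c_1)+v_{1,2}\big(\rho_1(1\pm i)+2\big)$ (upper signs for $\vartheta_1=\frac\pi2$); (R3) if $\vartheta_1=\pm\pi$ (so $\omega_1=\sqrt{c_1}$, $\vartheta_2=0$): $A_{1,1}^{(2)}=0$, $A_{1,2}^{(2)}=-\rho_2A_{1,2}^{(1)}$, and $$\partial_\tau A^{(1)}_{1,1}=\frac{-w_{1,2}}{i\omega_1}\frac{\omega_1^2-c_2}{2\omega_1^2-c_1-c_2}\overline{A^{(1)}_{1,1}}A^{(1)}_{1,2},\qquad \partial_\tau A^{(1)}_{1,2}=\frac{-w_{1,2}}{2i\omega_2}\frac{\omega_2^2-c_2}{2\omega_2^2-c_1-c_2}\big(A^{(1)}_{1,1}\big)^2.$$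 Let $\tau_0>0$ and let the (evolving) components $A_{1,n}^{(1)}$ or $A_{1,n}^{(2)}:[0,\tau_0]\times\mathbb R\to\mathbb C$ be the unique solutions of the respective system above with initial data in $H^4(\mathbb R;\mathbb C)$, the other components being determined by the stated algebraic relations. Let $U^{A,1}_\varepsilon$ be the corresponding approximation. Then for every $c>0$ and $\beta\in(1,3/2]$ there exist $\varepsilon_0,C>0$ such that for all $\varepsilon\in(0,\varepsilon_0)$ and every solution $u$ of the chain: if $\big\|(u-U^{A,1}_\varepsilon,\dot u-\dot U^{A,1}_\varepsilon)(0)\big\|_{(\ell^2)^4}\le c\varepsilon^\beta$, then $\big\|(u-U^{A,1}_\varepsilon,\dot u-\dot U^{A,1}_\varepsilon)(t)\big\|_{(\ell^2)^4}\le C\varepsilon^\beta$ for all $t\in[0,\tau_0/\varepsilon]$.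
   Context: Diatomic chain: $\ddot x_{2j+1}=V_1'(x_{2j+2}-x_{2j+1})-V_1'(x_{2j+1}-x_{2j})-W_1'(x_{2j+1})$, $\ddot x_{2j}=V_2'(x_{2j+1}-x_{2j})-V_2'(x_{2j}-x_{2j-1})-W_2'(x_{2j})$, $j\in\mathbb Z$, with $V_i,W_i\in C^4(\mathbb R)$ and $V_i'(x)=v_{i,1}x+v_{i,2}x^2+O(|x|^3)$, $W_i'(x)=w_{i,1}x+w_{i,2}x^2+O(|x|^3)$ as $x\to0$. Write $u_j=(u_{j,1},u_{j,2})^T:=(x_{2j+1},x_{2j})^T$; the $(\ell^2)^4$ norm of $(u,\dot u)$ is $\big(\sum_j\sum_{k=1,2}(|u_{j,k}|^2+|\dot u_{j,k}|^2)\big)^{1/2}$. Standing assumptions: $v_{1,1}=v_1/M$, $v_{2,1}=v_1/m$ with $M,m>0$, $v_1\neq0$, $w_{i,1}>0$, $4v_1+\min\{Mw_{1,1},mw_{2,1}\}>0$, $4v_{i,1}+w_{i,1}>0$, $v_{1,1}v_{2,1}>0$, and $c_2>c_1$ where $c_i:=2v_{i,1}+w_{i,1}$. Dispersion matrix: $H(\omega,\vartheta):=\begin{pmatrix}\omega^2-c_1 & v_{1,1}(e^{i\vartheta}+1)\\ v_{2,1}(1+e^{-i\vartheta}) & \omega^2-c_2\end{pmatrix}$. Branches: $\omega_\pm(\vartheta):=\sqrt{\frac12\big(c_1+c_2\pm\sqrt{(c_1-c_2)^2+8v_{1,1}v_{2,1}(\cos\vartheta+1)}\big)}>0$; $\det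 H(\omega,\vartheta)=0$ with $\omega>0$ iff $\omega\in\{\omega_+(\vartheta),\omega_-(\vartheta)\}$. For $\vartheta_n\neq\pm\pi$ set $\rho_n:=\dfrac{\omega_n^2-c_1}{v_{1,1}(e^{i\vartheta_n}+1)}$ ($=\dfrac{v_{2,1}(e^{-i\vartheta_n}+1)}{\omega_n^2-c_2}$). Amplitudes $A_{1,n}(\tau,y)=(A^{(1)}_{1,n},A^{(2)}_{1,n})^T\in\mathbb C^2$ are functions of macroscopic variables $\tau=\varepsilon t$, $y=\varepsilon j$. Approximation: $(U^{A,1}_\varepsilon)_j(t):=\varepsilon\sum_{n=1}^2A_{1,n}(\varepsilon t,\varepsilon j)e^{i(\omega_nt+j\vartheta_n)}+\text{c.c.}$, where c.c. denotes the complex conjugate of the preceding terms. *)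

theory Defs
  imports "HOL-Analysis.Analysis" "HOL-Library.Landau_Symbols"
begin

definition Ck :: "nat \<Rightarrow> (real \<Rightarrow> real) \<Rightarrow> bool" where
  "Ck k f \<longleftrightarrow> (\<forall>j<k. \<forall>x. ((deriv ^^ j) f) differentiable (at x))
                 \<and> continuous_on UNIV ((deriv ^^ k) f)"

definition cc :: "(nat \<Rightarrow> nat \<Rightarrow> real) \<Rightarrow> (nat \<Rightarrow> nat \<Rightarrow> real) \<Rightarrow> nat \<Rightarrow> real" where
  "cc v w i = 2 * v i 1 + w i 1"

definition Hmat :: "(nat \<Rightarrow> nat \<Rightarrow> real) \<Rightarrow> (nat \<Rightarrow> nat \<Rightarrow> real) \<Rightarrow> real \<Rightarrow> real \<Rightarrow> complex^2^2" where
  "Hmat v w om th = vector [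
      vector [of_real (om^2 - cc v w 1), of_real (v 1 1) * (exp (\<i> * of_real th) + 1)],
      vector [of_real (v 2 1) * (1 + exp (- \<i> * of_real th)), of_real (om^2 - cc v w 2)]]"

definition om_plus :: "(nat \<Rightarrow> nat \<Rightarrow> real) \<Rightarrow> (nat \<Rightarrow> nat \<Rightarrow> real) \<Rightarrow> real \<Rightarrow> real" where
  "om_plus v w th = sqrt ((cc v w 1 + cc v w 2
      + sqrt ((cc v w 1 - cc v w 2)^2 + 8 * v 1 1 * v 2 1 * (cos th + 1))) / 2)"

definition om_minus :: "(nat \<Rightarrow> nat \<Rightarrow> real) \<Rightarrow> (nat \<Rightarrow> nat \<Rightarrow> real) \<Rightarrow> real \<Rightarrow> real" where
  "om_minus v w th = sqrt ((cc v w 1 + cc v w 2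
      - sqrt ((cc v w 1 - cc v w 2)^2 + 8 * v 1 1 * v 2 1 * (cos th + 1))) / 2)"

definition rho :: "(nat \<Rightarrow> nat \<Rightarrow> real) \<Rightarrow> (nat \<Rightarrow> nat \<Rightarrow> real) \<Rightarrow> real \<Rightarrow> real \<Rightarrow> complex" where
  "rho v w om th = of_real (om^2 - cc v w 1) / (of_real (v 1 1) * (exp (\<i> * of_real th) + 1))"

(* Sobolev space H^4(R;C) via weak derivatives, tested against C_c^infinity functions,
   together with a bound K on the H^4 norm. *)
definition test_fun :: "(real \<Rightarrow> real) \<Rightarrow> bool" where
  "test_fun \<phi> \<longleftrightarrow> (\<forall>k x. ((deriv ^^ k) \<phi>) differentiable (at x)) \<and> bounded {x. \<phi> x \<noteq> 0}"

definition H4_norm_le :: "real \<Rightarrow> (real \<Rightarrow> complex) \<Rightarrow> bool" where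
  "H4_norm_le K f \<longleftrightarrow> (\<exists>g :: nat \<Rightarrow> real \<Rightarrow> complex. g 0 = f \<and>
     (\<forall>j\<le>4. g j \<in> borel_measurable lborel \<and> integrable lborel (\<lambda>x. (cmod (g j x))^2)) \<and>
     (\<forall>j<4. \<forall>\<phi>. test_fun \<phi> \<longrightarrow>
        (\<integral>x. g j x * of_real (deriv \<phi> x) \<partial>lborel) = - (\<integral>x. g (Suc j) x * of_real (\<phi> x) \<partial>lborel)) \<and>
     (\<Sum>j\<le>4. \<integral>x. (cmod (g j x))^2 \<partial>lborel) \<le> K^2)"

definition chain_rhs :: "(real \<Rightarrow> real) \<Rightarrow> (real \<Rightarrow> real) \<Rightarrow> (real \<Rightarrow> real) \<Rightarrow> (real \<Rightarrow> real)
    \<Rightarrow> (int \<Rightarrow> real) \<Rightarrow> int \<Rightarrow> real" where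
  "chain_rhs V1 V2 W1 W2 x k =
     (if odd k then deriv V1 (x (k+1) - x k) - deriv V1 (x k - x (k-1)) - deriv W1 (x k)
      else deriv V2 (x (k+1) - x k) - deriv V2 (x k - x (k-1)) - deriv W2 (x k))"

definition chain_solution :: "(real \<Rightarrow> real) \<Rightarrow> (real \<Rightarrow> real) \<Rightarrow> (real \<Rightarrow> real) \<Rightarrow> (real \<Rightarrow> real)
    \<Rightarrow> real \<Rightarrow> (int \<Rightarrow> real \<Rightarrow> real) \<Rightarrow> (int \<Rightarrow> real \<Rightarrow> real) \<Rightarrow> bool" where
  "chain_solution V1 V2 W1 W2 T x xd \<longleftrightarrow>
     (\<forall>k. \<forall>t\<in>{0..T}. (x k has_real_derivative xd k t) (at t within {0..T}) \<and>
        (xd k has_real_derivative chain_rhs V1 V2 W1 W2 (\<lambda>i. x i t) k) (at t within {0..T})) \<and>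
     (\<forall>t\<in>{0..T}. (\<lambda>k. (x k t)^2) summable_on UNIV \<and> (\<lambda>k. (xd k t)^2) summable_on UNIV) \<and>
     (\<forall>t0\<in>{0..T}. ((\<lambda>t. \<Sum>\<^sub>\<infinity>k. (x k t - x k t0)^2 + (xd k t - xd k t0)^2) \<longlongrightarrow> 0)
                      (at t0 within {0..T}))"

definition ucomp :: "(int \<Rightarrow> real \<Rightarrow> real) \<Rightarrow> int \<Rightarrow> nat \<Rightarrow> real \<Rightarrow> real" where
  "ucomp x j k t = (if k = 1 then x (2*j+1) t else x (2*j) t)"

(* A n k tau y = A_{1,n}^{(k)}(tau,y); At, Ay its partial derivatives in tau, y. *)
definition Uapp :: "real \<Rightarrow> (nat \<Rightarrow> real) \<Rightarrow> (nat \<Rightarrow> real) \<Rightarrow> (nat \<Rightarrow> nat \<Rightarrow> real \<Rightarrow> real \<Rightarrow> complex)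
    \<Rightarrow> int \<Rightarrow> nat \<Rightarrow> real \<Rightarrow> real" where
  "Uapp \<epsilon> om th A j k t =
     (let z = of_real \<epsilon> * (\<Sum>n\<in>{1,2}. A n k (\<epsilon>*t) (\<epsilon> * of_int j)
                 * exp (\<i> * of_real (om n * t + of_int j * th n)))
      in Re (z + cnj z))"

definition Udot :: "real \<Rightarrow> (nat \<Rightarrow> real) \<Rightarrow> (nat \<Rightarrow> real) \<Rightarrow> (nat \<Rightarrow> nat \<Rightarrow> real \<Rightarrow> real \<Rightarrow> complex)
    \<Rightarrow> (nat \<Rightarrow> nat \<Rightarrow> real \<Rightarrow> real \<Rightarrow> complex) \<Rightarrow> int \<Rightarrow> nat \<Rightarrow> real \<Rightarrow> real" where
  "Udot \<epsilon> om th A At j k t =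
     (let z = of_real \<epsilon> * (\<Sum>n\<in>{1,2}.
                 (of_real \<epsilon> * At n k (\<epsilon>*t) (\<epsilon> * of_int j) + \<i> * of_real (om n) * A n k (\<epsilon>*t) (\<epsilon> * of_int j))
                 * exp (\<i> * of_real (om n * t + of_int j * th n)))
      in Re (z + cnj z))"

definition approx_err :: "real \<Rightarrow> (nat \<Rightarrow> real) \<Rightarrow> (nat \<Rightarrow> real) \<Rightarrow> (nat \<Rightarrow> nat \<Rightarrow> real \<Rightarrow> real \<Rightarrow> complex)
    \<Rightarrow> (nat \<Rightarrow> nat \<Rightarrow> real \<Rightarrow> real \<Rightarrow> complex) \<Rightarrow> (int \<Rightarrow> real \<Rightarrow> real) \<Rightarrow> (int \<Rightarrow> real \<Rightarrow> real) \<Rightarrow> real \<Rightarrow> real" where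
  "approx_err \<epsilon> om th A At x xd t =
     sqrt (\<Sum>\<^sub>\<infinity>(j,k)\<in>UNIV \<times> {1,2}.
        (ucomp x j k t - Uapp \<epsilon> om th A j k t)^2 + (ucomp xd j k t - Udot \<epsilon> om th A At j k t)^2)"

definition NR_case :: "(nat \<Rightarrow> nat \<Rightarrow> real) \<Rightarrow> (nat \<Rightarrow> nat \<Rightarrow> real) \<Rightarrow> (nat \<Rightarrow> real) \<Rightarrow> (nat \<Rightarrow> real) \<Rightarrow> real
    \<Rightarrow> (nat \<Rightarrow> nat \<Rightarrow> real \<Rightarrow> real \<Rightarrow> complex) \<Rightarrow> (nat \<Rightarrow> nat \<Rightarrow> real \<Rightarrow> real \<Rightarrow> complex)
    \<Rightarrow> (nat \<Rightarrow> nat \<Rightarrow> real \<Rightarrow> real \<Rightarrow> complex) \<Rightarrow> bool" where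
  "NR_case v w om th \<tau>0 A At Ay \<longleftrightarrow>
     (\<forall>n\<in>{1,2}. det (Hmat v w (2 * om n) (2 * th n)) \<noteq> 0) \<and>
     det (Hmat v w (om 1 + om 2) (th 1 + th 2)) \<noteq> 0 \<and>
     det (Hmat v w (om 1 - om 2) (th 1 - th 2)) \<noteq> 0 \<and>
     (\<forall>n\<in>{1,2}. \<forall>\<tau>\<in>{0..\<tau>0}. \<forall>y.
        ((th n \<noteq> pi \<and> th n \<noteq> - pi) \<longrightarrow>
            A n 2 \<tau> y = - rho v w (om n) (th n) * A n 1 \<tau> y \<and>
            (om n = om_plus v w (th n) \<longrightarrow>
               At n 1 \<tau> y - of_real (deriv (om_plus v w) (th n)) * Ay n 1 \<tau> y = 0) \<and>
            (om n = om_minus v w (th n) \<longrightarrow>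
               At n 1 \<tau> y - of_real (deriv (om_minus v w) (th n)) * Ay n 1 \<tau> y = 0)) \<and>
        ((th n = pi \<or> th n = - pi) \<and> (om n)^2 = cc v w 1 \<longrightarrow> A n 2 \<tau> y = 0 \<and> At n 1 \<tau> y = 0) \<and>
        ((th n = pi \<or> th n = - pi) \<and> (om n)^2 = cc v w 2 \<longrightarrow> A n 1 \<tau> y = 0 \<and> At n 2 \<tau> y = 0))"

definition Dcoef :: "(nat \<Rightarrow> nat \<Rightarrow> real) \<Rightarrow> (nat \<Rightarrow> nat \<Rightarrow> real) \<Rightarrow> (nat \<Rightarrow> real) \<Rightarrow> (nat \<Rightarrow> real) \<Rightarrow> complex" where
  "Dcoef v w om th = of_real (v 1 1 * (v 2 1)^2 * (2 + 4 * cos (th 1) + 2 * cos (th 2))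
       / (((om 1)^2 - cc v w 2)^2 * ((om 2)^2 - cc v w 2)))"

definition d1coef :: "(nat \<Rightarrow> nat \<Rightarrow> real) \<Rightarrow> (nat \<Rightarrow> nat \<Rightarrow> real) \<Rightarrow> (nat \<Rightarrow> real) \<Rightarrow> (nat \<Rightarrow> real) \<Rightarrow> complex" where
  "d1coef v w om th =
     (let D = Dcoef v w om th; r1 = rho v w (om 1) (th 1); r2 = rho v w (om 2) (th 2);
          e = (\<lambda>s::real. exp (\<i> * of_real (s * th 1)))
      in D * of_real (v 2 2) * ((e (-1) - 1) / (cnj r1 * r2) + (e (-2) - 1) / r2 + (e 1 - 1) / cnj r1)
         + of_real (v 1 2) * (cnj r1 * r2 * (e 1 - 1) + r2 * (e 2 - 1) + cnj r1 * (e (-1) - 1))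
         + D * of_real (w 2 2) - of_real (w 1 2))"

definition d2coef :: "(nat \<Rightarrow> nat \<Rightarrow> real) \<Rightarrow> (nat \<Rightarrow> nat \<Rightarrow> real) \<Rightarrow> (nat \<Rightarrow> real) \<Rightarrow> (nat \<Rightarrow> real) \<Rightarrow> complex" where
  "d2coef v w om th =
     (let D = Dcoef v w om th; r1 = rho v w (om 1) (th 1);
          e = (\<lambda>s::real. exp (\<i> * of_real (s * th 1)))
      in D * of_real (v 2 2) * ((e (-2) - 1) / r1^2 + 2 * (e (-1) - 1) / r1)
         + of_real (v 1 2) * (r1^2 * (e 2 - 1) + 2 * r1 * (e 1 - 1))
         + D * of_real (w 2 2) - of_real (w 1 2))"

(* s = +1 for th 1 = pi/2, s = -1 for th 1 = -pi/2 *)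
definition d1tilde :: "(nat \<Rightarrow> nat \<Rightarrow> real) \<Rightarrow> (nat \<Rightarrow> nat \<Rightarrow> real) \<Rightarrow> (nat \<Rightarrow> real) \<Rightarrow> (nat \<Rightarrow> real) \<Rightarrow> real \<Rightarrow> complex" where
  "d1tilde v w om th s =
     (of_real (v 2 2 / v 2 1) - of_real s * \<i> * of_real (w 2 2 / ((om 1)^2 - cc v w 2)))
       * of_real ((om 1)^2 - cc v w 1)
     + of_real (v 1 2) * (rho v w (om 1) (th 1) * (1 + of_real s * \<i>) + 2)"

definition R_case :: "(nat \<Rightarrow> nat \<Rightarrow> real) \<Rightarrow> (nat \<Rightarrow> nat \<Rightarrow> real) \<Rightarrow> (nat \<Rightarrow> real) \<Rightarrow> (nat \<Rightarrow> real) \<Rightarrow> real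
    \<Rightarrow> (nat \<Rightarrow> nat \<Rightarrow> real \<Rightarrow> real \<Rightarrow> complex) \<Rightarrow> (nat \<Rightarrow> nat \<Rightarrow> real \<Rightarrow> real \<Rightarrow> complex)
    \<Rightarrow> (nat \<Rightarrow> nat \<Rightarrow> real \<Rightarrow> real \<Rightarrow> complex) \<Rightarrow> bool" where
  "R_case v w om th \<tau>0 A At Ay \<longleftrightarrow>
     om 1 = om_minus v w (th 1) \<and>
     (\<exists>k::int. th 2 = 2 * th 1 + 2 * pi * of_int k) \<and>
     om 2 = om_plus v w (th 2) \<and> om 2 = 2 * om 1 \<and>
     (\<forall>k\<in>{3,4::nat}. det (Hmat v w (real k * om 1) (real k * th 1)) \<noteq> 0) \<and>
     (let c1 = cc v w 1; c2 = cc v w 2;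
          q1 = of_real (((om 1)^2 - c2) / (2 * (om 1)^2 - c1 - c2)) :: complex;
          q2 = of_real (((om 2)^2 - c2) / (2 * (om 2)^2 - c1 - c2)) :: complex;
          r1 = rho v w (om 1) (th 1); r2 = rho v w (om 2) (th 2)
      in
     \<comment> \<open>(R1)\<close>
     ((th 1 \<notin> {pi/2, -pi/2, pi, -pi}) \<longrightarrow>
       (\<forall>\<tau>\<in>{0..\<tau>0}. \<forall>y.
          A 1 2 \<tau> y = - r1 * A 1 1 \<tau> y \<and> A 2 2 \<tau> y = - r2 * A 2 1 \<tau> y \<and>
          At 1 1 \<tau> y - of_real (deriv (om_minus v w) (th 1)) * Ay 1 1 \<tau> y
            = d1coef v w om th / (\<i> * of_real (om 1)) * q1 * cnj (A 1 1 \<tau> y) * A 2 1 \<tau> y \<and>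
          At 2 1 \<tau> y - of_real (deriv (om_plus v w) (th 2)) * Ay 2 1 \<tau> y
            = d2coef v w om th / (2 * \<i> * of_real (om 2)) * q2 * (A 1 1 \<tau> y)^2)) \<and>
     \<comment> \<open>(R2)\<close>
     ((th 1 = pi/2 \<or> th 1 = -pi/2) \<longrightarrow>
       (let s = (if th 1 = pi/2 then 1 else -1 :: real) in
        \<forall>\<tau>\<in>{0..\<tau>0}. \<forall>y.
          A 1 2 \<tau> y = - r1 * A 1 1 \<tau> y \<and> A 2 1 \<tau> y = 0 \<and>
          At 1 1 \<tau> y - of_real (deriv (om_minus v w) (th 1)) * Ay 1 1 \<tau> y
            = d1tilde v w om th s / (\<i> * of_real (om 1)) * q1 * cnj (A 1 1 \<tau> y) * A 2 2 \<tau> y \<and>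
          At 2 2 \<tau> y
            = 1 / (2 * \<i> * of_real (om 2))
              * (2 * of_real (v 2 2) * (1 + r1 * (1 + of_real s * \<i>)) - of_real (w 2 2) * r1^2)
              * (A 1 1 \<tau> y)^2)) \<and>
     \<comment> \<open>(R3)\<close>
     ((th 1 = pi \<or> th 1 = -pi) \<longrightarrow>
       (\<forall>\<tau>\<in>{0..\<tau>0}. \<forall>y.
          A 1 2 \<tau> y = 0 \<and> A 2 2 \<tau> y = - r2 * A 2 1 \<tau> y \<and>
          At 1 1 \<tau> y = - of_real (w 1 2) / (\<i> * of_real (om 1)) * q1 * cnj (A 1 1 \<tau> y) * A 2 1 \<tau> y \<and>
          At 2 1 \<tau> y = - of_real (w 1 2) / (2 * \<i> * of_real (om 2)) * q2 * (A 1 1 \<tau> y)^2)))"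

end

theory Submission
  imports Defs
begin

text \<open>The approximation is refined to \<open>\<Psi> = Re \<psi>\<close>, \<open>\<Phi> = Re \<phi>\<close> by adding correctors of size \<open>\<epsilon>\<^sup>2\<close>: a
  multiple of the discrete gradient of the amplitudes, and the quadratic interaction of each pair of modes, with the
  complex conjugates counted as modes of negative frequency. The amplitude system consists exactly of the
  solvability conditions for these correctors. Taking the discrete gradient instead of \<open>\<epsilon> \<partial>\<^sub>y\<close> keeps the
  correctors differentiable in time, so that \<open>\<Psi>' - \<Phi>\<close> and \<open>\<Phi>' - force(\<Psi>)\<close> have squared \<open>\<ell>\<^sup>2\<close> norm
  \<open>O(\<epsilon>\<^sup>5)\<close>; here sampling a Sobolev function on the grid \<open>\<epsilon> \<int>\<close> gains the factor \<open>1 / \<epsilon>\<close>.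
  The difference between solution and \<open>\<Psi>\<close> then solves a linear chain, with forcing \<open>O(\<epsilon>)\<close> relative to its size plus
  the residual, whose energy is equivalent to the \<open>\<ell>\<^sup>2\<close> norm by the standing assumptions. Gronwall's inequality on
  times of order \<open>1 / \<epsilon>\<close> gives \<open>O(\<epsilon>\<^bsup>\<beta>\<^esup>)\<close>, and a first exit argument keeps the error below \<open>\<epsilon>\<close>.\<close>

section \<open>Smooth cut-off functions\<close>

text \<open>No regularity of \<open>At\<close> in time or of \<open>Ay\<close> in y is given
  directly, and the Sobolev hypothesis speaks of weak derivatives. This shapes two constructions.
  The velocity profile \<Phi> is not \<Psi>' but \<Psi>' with the amplitude equation inserted and
  the higher-order terms dropped, so that it can be differentiated once more; the mismatch survives
  as a forcing in the first of two first-order equations. And the weak second derivative is tied to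
  the pointwise f' by testing with ever steeper smooth steps, which asks nothing of f' beyond its
  existence. The exponents fit exactly: residuals of squared norm \<epsilon>^5 enter the energy
  balance divided by \<epsilon> (Young's inequality) and act for a time of order 1 / \<epsilon>, so
  the squared error gains \<epsilon>^3. This, and the squared distance O(\<epsilon>^3) between
  \<Psi> and the leading term, is why \<beta> stops at 3/2, while \<beta> > 1 keeps the error below
  \<epsilon>. The masses M and m weight the energy because they turn v1 / M and v1 / m into one
  symmetric coupling v1.\<close>

inductive smooth_gen :: "(real \<Rightarrow> real) \<Rightarrow> bool" where
  flat: "smooth_gen (\<lambda>x. if x > 0 then (1 / x) ^ n * exp (- (1 / x)) else 0)"
| const: "smooth_gen (\<lambda>x. c)"
| add: "smooth_gen f \<Longrightarrow> smooth_gen g \<Longrightarrow> smooth_gen (\<lambda>x. f x + g x)"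
| mult: "smooth_gen f \<Longrightarrow> smooth_gen g \<Longrightarrow> smooth_gen (\<lambda>x. f x * g x)"
| inverse: "smooth_gen f \<Longrightarrow> (\<And>x. f x \<noteq> 0) \<Longrightarrow> smooth_gen (\<lambda>x. inverse (f x))"
| affine: "smooth_gen f \<Longrightarrow> smooth_gen (\<lambda>x. f (a * x + b))"

text \<open>Away from 0 this is the product rule. At 0 the left difference quotient is 0, and with u
  = 1 / y the right one is u ^ (n + 1) / exp u, which vanishes as u grows.\<close>

lemma flat_deriv:
  fixes n :: nat
  defines "f \<equiv> \<lambda>n x::real. if x > 0 then (1 / x) ^ n * exp (- (1 / x)) else 0"
  shows "(f n has_real_derivative (- real n) * f (n + 1) x + f (n + 2) x) (at x)"
proof -
  consider "x > 0" | "x < 0" | "x = 0" by linarith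
  then show ?thesis
  proof cases
    case 1
    have "((\<lambda>x. (1 / x) ^ n * exp (- (1 / x))) has_real_derivative
        (- real n) * f (n + 1) x + f (n + 2) x) (at x)"
    proof (cases n)
      case (Suc l)
      have "l = 0 \<or> x ^ l = x * x ^ (l - Suc 0)"
        using power_minus_mult[of l x] by (cases "l = 0") (simp_all add: mult.commute)
      with Suc show ?thesis using 1
        by (auto simp: f_def intro!: derivative_eq_intros simp: field_simps power2_eq_square)
    qed (use 1 in \<open>auto simp: f_def intro!: derivative_eq_intros simp: field_simps power2_eq_square\<close>)
    then show ?thesis
      by (rule has_field_derivative_transform_within_open[of _ _ _ "{0<..}"]) (use 1 in \<open>auto simp: f_def\<close>)
  next
    case 2
    have "((\<lambda>x. 0) has_real_derivative (- real n) * f (n + 1) x + f (n + 2) x) (at x)"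
      using 2 by (auto simp: f_def)
    then show ?thesis
      by (rule has_field_derivative_transform_within_open[of _ _ _ "{..<0}"]) (use 2 in \<open>auto simp: f_def\<close>)
  next
    case 3
    have "((\<lambda>y. f n y / y) \<longlongrightarrow> 0) (at_right 0)"
    proof -
      have "((\<lambda>u::real. u ^ (n + 1) / exp u) \<longlongrightarrow> 0) at_top"
        by (rule tendsto_power_div_exp_0)
      then have "((\<lambda>y::real. inverse y ^ (n + 1) / exp (inverse y)) \<longlongrightarrow> 0) (at_right 0)"
        by (rule filterlim_compose[OF _ filterlim_inverse_at_top_right])
      then show ?thesis
        by (rule Lim_transform_eventually)
          (auto simp: f_def eventually_at_filter field_simps exp_minus)
    qed
    moreover have "((\<lambda>y. f n y / y) \<longlongrightarrow> 0) (at_left 0)"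
      by (rule Lim_transform_eventually[of "\<lambda>_. 0"]) (auto simp: f_def eventually_at_filter)
    ultimately have "((\<lambda>y. f n y / y) \<longlongrightarrow> 0) (at 0)"
      by (simp add: filterlim_split_at)
    then show ?thesis
      using 3 by (simp add: has_field_derivative_iff f_def)
  qed
qed

text \<open>\<open>test_fun\<close> asks for derivatives of all orders. A class closed under one
  differentiation has them all by induction; the flat functions form a family in n because
  differentiating raises the power of 1 / x.\<close>

lemma smooth_gen_deriv:
  assumes "smooth_gen f"
  shows "\<exists>f'. smooth_gen f' \<and> (\<forall>x. (f has_real_derivative f' x) (at x))"
  using assms
proof induction
  case (flat n)
  show ?case
    by (rule exI, rule conjI[OF _ allI[OF flat_deriv]]) (intro smooth_gen.intros)
next
  case (const c)
  show ?case by (rule exI[of _ "\<lambda>_. 0"]) (auto intro: smooth_gen.const)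
next
  case (add f g)
  then obtain f' g' where "smooth_gen f'" "smooth_gen g'"
    "\<And>x. (f has_real_derivative f' x) (at x)" "\<And>x. (g has_real_derivative g' x) (at x)" by blast
  then show ?case
    by (intro exI[of _ "\<lambda>x. f' x + g' x"]) (auto intro: smooth_gen.add DERIV_add)
next
  case (mult f g)
  then obtain f' g' where "smooth_gen f'" "smooth_gen g'"
    "\<And>x. (f has_real_derivative f' x) (at x)" "\<And>x. (g has_real_derivative g' x) (at x)" by blast
  with mult show ?case
    by (intro exI[of _ "\<lambda>x. f' x * g x + g' x * f x"]) (auto intro!: smooth_gen.intros DERIV_mult)
next
  case (inverse f)
  then obtain f' where "smooth_gen f'" "\<And>x. (f has_real_derivative f' x) (at x)" by blast
  \<comment> \<open>The derivative - f' / f^2 is spelled as a product of generators so that the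
    introduction rules accept it.\<close>
  with inverse show ?case
    by (intro exI[of _ "\<lambda>x. (-1) * (inverse (f x) * f' x * inverse (f x))"] conjI smooth_gen.intros allI
        DERIV_inverse'[THEN DERIV_cong]) auto
next
  case (affine f a b)
  then obtain f' where f': "smooth_gen f'" "\<And>x. (f has_real_derivative f' x) (at x)" by blast
  have "((\<lambda>x. f (a * x + b)) has_real_derivative f' (a * x + b) * a) (at x)" for x
    by (rule DERIV_chain2[OF f'(2)]) (auto intro!: derivative_eq_intros)
  with f' show ?case
    by (intro exI[of _ "\<lambda>x. f' (a * x + b) * a"]) (auto intro!: smooth_gen.intros)
qed

lemma smooth_gen_higher_deriv:
  assumes "smooth_gen f" shows "smooth_gen ((deriv ^^ k) f)"
proof (induction k)
  case (Suc k)
  then obtain f' where f': "smooth_gen f'" "\<And>x. ((deriv ^^ k) f has_real_derivative f' x) (at x)"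
    using smooth_gen_deriv by blast
  then have "deriv ((deriv ^^ k) f) = f'"
    using DERIV_imp_deriv by blast
  with f' show ?case by simp
qed (use assms in auto)

lemma smooth_gen_test_fun:
  assumes "smooth_gen f" "bounded {x. f x \<noteq> 0}"
  shows "test_fun f"
  unfolding test_fun_def
  using assms smooth_gen_higher_deriv[OF assms(1)] smooth_gen_deriv
  by (meson real_differentiable_def)

text \<open>Rescaled as \<theta>(n (x - a)) this becomes a steep smooth step at a. Both derivatives
  are recorded with their supports because the weak identity is tested against second
  derivatives.\<close>

lemma smooth_step:
  obtains \<theta> \<eta> \<zeta> :: "real \<Rightarrow> real" where
    "smooth_gen \<theta>" "smooth_gen \<eta>" "smooth_gen \<zeta>"
    "\<And>x. (\<theta> has_real_derivative \<eta> x) (at x)" "\<And>x. (\<eta> has_real_derivative \<zeta> x) (at x)"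
    "\<And>x. x \<le> 0 \<Longrightarrow> \<theta> x = 0" "\<And>x. x \<ge> 1 \<Longrightarrow> \<theta> x = 1" "\<And>x. \<bar>\<theta> x\<bar> \<le> 1"
    "\<And>x. x \<le> 0 \<or> x \<ge> 1 \<Longrightarrow> \<eta> x = 0" "\<And>x. x \<le> 0 \<or> x \<ge> 1 \<Longrightarrow> \<zeta> x = 0"
proof -
  define \<psi> where "\<psi> = (\<lambda>x::real. if x > 0 then (1 / x) ^ 0 * exp (- (1 / x)) else 0)"
  \<comment> \<open>One of x and 1 - x is positive, so the denominator never vanishes, and beyond
    each end of [0, 1] one of the two terms drops out. The reflected argument is written
    \<open>(-1) * x + 1\<close> to match the rule \<open>affine\<close>.\<close>
  define \<theta> where "\<theta> = (\<lambda>x. \<psi> x * inverse (\<psi> x + \<psi> ((-1) * x + 1)))"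
  have pos: "\<psi> x + \<psi> ((-1) * x + 1) > 0" for x
    by (auto simp: \<psi>_def add_pos_pos)
  have \<psi>: "smooth_gen \<psi>" unfolding \<psi>_def by (rule smooth_gen.flat)
  have \<theta>: "smooth_gen \<theta>" unfolding \<theta>_def
    using pos by (intro smooth_gen.intros \<psi>) (metis less_irrefl)
  obtain \<eta> where \<eta>: "smooth_gen \<eta>" "\<And>x. (\<theta> has_real_derivative \<eta> x) (at x)"
    using smooth_gen_deriv[OF \<theta>] by blast
  obtain \<zeta> where \<zeta>: "smooth_gen \<zeta>" "\<And>x. (\<eta> has_real_derivative \<zeta> x) (at x)"
    using smooth_gen_deriv[OF \<eta>(1)] by blast
  have z0: "\<theta> x = 0" if "x \<le> 0" for x using that by (simp add: \<theta>_def \<psi>_def)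
  have z1: "\<theta> x = 1" if "x \<ge> 1" for x using that by (simp add: \<theta>_def \<psi>_def)
  have "\<psi> x \<ge> 0" for x by (simp add: \<psi>_def)
  then have "\<theta> x \<le> 1" "\<theta> x \<ge> 0" for x
    using pos[of x] by (auto simp: \<theta>_def field_simps)
  then have le: "\<bar>\<theta> x\<bar> \<le> 1" for x by (simp add: abs_le_iff)
  \<comment> \<open>A differentiable function that is constant on a half line has zero derivative there,
     end point included, since the one-sided difference quotients vanish.\<close>
  have flat0: "f' x = 0" if "\<And>x. (f has_real_derivative f' x) (at x)" "\<And>y. y \<le> 0 \<Longrightarrow> f y = c" "x \<le> 0"
    for f f' :: "real \<Rightarrow> real" and c x
  proof -
    have "((\<lambda>y. (f y - f x) / (y - x)) \<longlongrightarrow> f' x) (at_left x)"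
      using has_field_derivative_at_within[OF that(1)] by (simp add: has_field_derivative_iff)
    moreover have "((\<lambda>y. (f y - f x) / (y - x)) \<longlongrightarrow> 0) (at_left x)"
      by (rule Lim_transform_eventually[of "\<lambda>_. 0"])
        (use that in \<open>auto simp: eventually_at_filter intro!: always_eventually\<close>)
    ultimately show ?thesis
      using tendsto_unique trivial_limit_at_left_real by blast
  qed
  have flat1: "f' x = 0" if f: "\<And>x. (f has_real_derivative f' x) (at x)" "\<And>y. y \<ge> 1 \<Longrightarrow> f y = c" "x \<ge> 1"
    for f f' :: "real \<Rightarrow> real" and c x
  proof -
    \<comment> \<open>The reflection y to 1 - y carries the right half line to the left one.\<close>
    have "((\<lambda>y. f (1 - y)) has_real_derivative - f' (1 - y)) (at y)" for y
      by (rule DERIV_chain2[OF f(1), THEN DERIV_cong]) (auto intro!: derivative_eq_intros)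
    from flat0[of "\<lambda>y. f (1 - y)", OF this, of c "1 - x"] f show ?thesis by auto
  qed
  have e: "\<eta> x = 0" if "x \<le> 0 \<or> x \<ge> 1" for x
    using flat0[OF \<eta>(2) z0] flat1[OF \<eta>(2) z1] that by blast
  have "\<zeta> x = 0" if "x \<le> 0 \<or> x \<ge> 1" for x
    using flat0[OF \<zeta>(2), of 0] flat1[OF \<zeta>(2), of 0] e that by blast
  from that[OF \<theta> \<eta>(1) \<zeta>(1) \<eta>(2) \<zeta>(2) z0 z1 le e this] show ?thesis .
qed

section \<open>Weak derivatives and sampling of Sobolev functions\<close>

lemma integrable_of_square_integrable:
  fixes h :: "real \<Rightarrow> real"
  assumes "h \<in> borel_measurable lborel" "integrable lborel (\<lambda>x. (h x)\<^sup>2)"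
  shows "integrable lborel (\<lambda>x. indicator {a..b} x * h x)"
proof (rule Bochner_Integration.integrable_bound)
  show "integrable lborel (\<lambda>x. indicator {a..b} x + (h x)\<^sup>2 :: real)"
    using assms emeasure_compact_finite[OF compact_Icc, of a b]
    by (intro Bochner_Integration.integrable_add integrable_real_indicator) auto
  have "\<bar>h x\<bar> \<le> 1 + (h x)\<^sup>2" for x
    using zero_le_power2[of "\<bar>h x\<bar> - 1"] abs_ge_zero[of "h x"]
    unfolding power2_diff by simp
  then show "AE x in lborel. norm (indicator {a..b} x * h x) \<le> norm (indicator {a..b} x + (h x)\<^sup>2 :: real)"
    by (auto simp: indicator_def)
qed (use assms in auto)

text \<open>The pointwise derivative f' comes without continuity or integrability, so it is
  recovered by testing. For the test function \<theta>(n (x - a)) - \<theta>(n (x - b)) the left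
  side consists of integrals of f against n^2 \<zeta>(n (x - c)) for c = a and c = b. They tend to -
  f'(c), since \<zeta> has mean 0 and first moment -1, and only differentiability at c enters. The
  test functions themselves tend to the indicator of (a, b].\<close>

lemma weak_second_derivative:
  fixes f f' g :: "real \<Rightarrow> complex"
  assumes d: "\<And>y. (f has_vector_derivative f' y) (at y)"
    and g: "g \<in> borel_measurable lborel" "integrable lborel (\<lambda>x. (cmod (g x))\<^sup>2)"
    and weak: "\<And>\<phi>. test_fun \<phi> \<Longrightarrow>
      (\<integral>x. f x * of_real (deriv (deriv \<phi>) x) \<partial>lborel) = (\<integral>x. g x * of_real (\<phi> x) \<partial>lborel)"
    and ab: "a < b"
  shows "f' b - f' a = (\<integral>x. g x * indicator {a<..b} x \<partial>lborel)"
proof -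
  obtain \<theta> \<eta> \<zeta> :: "real \<Rightarrow> real" where sg: "smooth_gen \<theta>" "smooth_gen \<eta>" "smooth_gen \<zeta>"
    and d1: "\<And>x. (\<theta> has_real_derivative \<eta> x) (at x)" and d2: "\<And>x. (\<eta> has_real_derivative \<zeta> x) (at x)"
    and th: "\<And>x. x \<le> 0 \<Longrightarrow> \<theta> x = 0" "\<And>x. x \<ge> 1 \<Longrightarrow> \<theta> x = 1" "\<And>x. \<bar>\<theta> x\<bar> \<le> 1"
    and et: "\<And>x. x \<le> 0 \<or> x \<ge> 1 \<Longrightarrow> \<eta> x = 0" and ze: "\<And>x. x \<le> 0 \<or> x \<ge> 1 \<Longrightarrow> \<zeta> x = 0"
    by (rule smooth_step) blast
  have c\<zeta>: "continuous_on A \<zeta>" for A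
    using smooth_gen_deriv[OF sg(3)] by (meson DERIV_isCont continuous_at_imp_continuous_on)
  have c\<theta>: "continuous_on A \<theta>" for A
    using d1 by (meson DERIV_isCont continuous_at_imp_continuous_on)
  have [measurable]: "\<zeta> \<in> borel_measurable borel" "\<theta> \<in> borel_measurable borel"
    by (rule borel_measurable_continuous_onI c\<zeta> c\<theta>)+
  have cf: "continuous_on A f" for A
    using d by (meson continuous_at_imp_continuous_on has_vector_derivative_continuous)
  have [measurable]: "f \<in> borel_measurable borel" by (rule borel_measurable_continuous_onI cf)+
  have [measurable]: "g \<in> borel_measurable borel" using g by simp
  \<comment> \<open>\<zeta> is the derivative of \<eta>, which vanishes at both ends of
    [0, 1].\<close>
  have i0: "(\<integral>s. indicator {0..1} s *\<^sub>R \<zeta> s \<partial>lborel) = 0"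
    using integral_FTC_Icc[of 0 1 \<eta> \<zeta>] d2 c\<zeta> et
    by (auto simp: has_real_derivative_iff_has_vector_derivative has_vector_derivative_at_within)
  \<comment> \<open>s \<eta> - \<theta> is a primitive of s \<zeta>, and \<theta> rises from 0 to
    1.\<close>
  have i1: "(\<integral>s. indicator {0..1} s *\<^sub>R (s * \<zeta> s) \<partial>lborel) = -1"
  proof -
    have "(\<integral>s. indicator {0..1} s *\<^sub>R (s * \<zeta> s) \<partial>lborel) = (1 * \<eta> 1 - \<theta> 1) - (0 * \<eta> 0 - \<theta> 0)"
    proof (rule integral_FTC_Icc)
      show "((\<lambda>s. s * \<eta> s - \<theta> s) has_vector_derivative s * \<zeta> s) (at s within {0..1})" for s
        unfolding has_real_derivative_iff_has_vector_derivative[symmetric]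
        by (auto intro!: derivative_eq_intros has_field_derivative_at_within[OF d1] has_field_derivative_at_within[OF d2])
    qed (auto intro!: continuous_intros c\<zeta>)
    then show ?thesis using th et by simp
  qed
  have sz: "indicator {0..1} s * \<zeta> s = \<zeta> s" for s using ze[of s] by (cases "0 \<le> s \<and> s \<le> 1") auto
  have int0: "integrable lborel (\<lambda>s. indicator {0..1} s *\<^sub>R \<zeta> s)"
    by (rule borel_integrable_compact) (auto intro: c\<zeta>)
  have i0': "(\<integral>s. \<zeta> s \<partial>lborel) = 0" and int0': "integrable lborel \<zeta>" using i0 int0 by (simp_all add: sz)
  have int1: "integrable lborel (\<lambda>s. indicator {0..1} s *\<^sub>R (s * \<zeta> s))"
    by (rule borel_integrable_compact) (auto intro!: c\<zeta> continuous_intros)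
  have sz1: "indicator {0..1} s *\<^sub>R (s * \<zeta> s) = s * \<zeta> s" for s using ze[of s] by (cases "0 \<le> s \<and> s \<le> 1") auto
  have i1': "(\<integral>s. s * \<zeta> s \<partial>lborel) = -1" and int1': "integrable lborel (\<lambda>s. s * \<zeta> s)"
    using i1 int1 by (simp_all only: sz1)
  \<comment> \<open>f paired with the second derivative of the step \<theta>(n (x - c)).\<close>
  define J where "J = (\<lambda>c (n::nat). (\<integral>x. f x * of_real ((real n)\<^sup>2 * \<zeta> (real n * (x - c))) \<partial>lborel))"
  have intJ: "integrable lborel (\<lambda>x. f x * of_real ((real n)\<^sup>2 * \<zeta> (real n * (x - c))))" if "n > 0" for c n
  proof -
    have "integrable lborel (\<lambda>x. indicator {c..c + 1 / real n} x *\<^sub>R (f x * of_real ((real n)\<^sup>2 * \<zeta> (real n * (x - c)))))"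
      by (rule borel_integrable_compact)
        (auto intro!: continuous_intros cf continuous_on_compose2[OF c\<zeta>[of UNIV]])
    moreover have "indicator {c..c + 1 / real n} x *\<^sub>R (f x * of_real ((real n)\<^sup>2 * \<zeta> (real n * (x - c))))
        = f x * of_real ((real n)\<^sup>2 * \<zeta> (real n * (x - c)))" for x
      using ze[of "real n * (x - c)"] \<open>n > 0\<close>
      by (auto simp: indicator_def field_simps mult_le_0_iff split: if_splits)
    ultimately show ?thesis by simp
  qed
  have limJ: "(\<lambda>n. J c n) \<longlonglongrightarrow> - f' c" for c
  proof -
    \<comment> \<open>Substitute x = c + s / n. As \<zeta> has mean 0, n f(c) may be subtracted,
      which leaves a difference quotient of f at c times s \<zeta>(s).\<close>
    have J: "J c n = (\<integral>s. (of_nat n * (f (c + s / n) - f c)) * of_real (\<zeta> s) \<partial>lborel)" if "n > 0" for n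
    proof -
      have "J c n = \<bar>1 / real n\<bar> *\<^sub>R (\<integral>s. f (c + 1 / real n * s) * of_real ((real n)\<^sup>2 * \<zeta> (real n * (c + 1 / real n * s - c))) \<partial>lborel)"
        unfolding J_def by (rule lborel_integral_real_affine) (use that in auto)
      also have "\<dots> = (\<integral>s. of_nat n * (f (c + s / n) * of_real (\<zeta> s)) \<partial>lborel)"
        using that by (subst integral_scaleR_right[symmetric])
          (intro Bochner_Integration.integral_cong refl, simp add: scaleR_conv_of_real power2_eq_square field_simps)
      also have "\<dots> = (\<integral>s. of_nat n * (f (c + s / n) * of_real (\<zeta> s)) - of_nat n * f c * of_real (\<zeta> s) \<partial>lborel)"
      proof -
        have "integrable lborel (\<lambda>s. of_nat n * f c * complex_of_real (\<zeta> s))"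
          using int0' by (intro integrable_mult_right integrable_of_real)
        moreover have "integrable lborel (\<lambda>s. of_nat n * (f (c + s / n) * complex_of_real (\<zeta> s)))"
        proof -
          have "integrable lborel (\<lambda>s. indicator {0..1} s *\<^sub>R (of_nat n * (f (c + s / n) * complex_of_real (\<zeta> s))))"
            using that by (intro borel_integrable_compact)
              (auto intro!: continuous_intros c\<zeta> continuous_on_compose2[OF cf[of UNIV]])
          moreover have "indicator {0..1} s *\<^sub>R (of_nat n * (f (c + s / n) * complex_of_real (\<zeta> s)))
             = of_nat n * (f (c + s / n) * complex_of_real (\<zeta> s))" for s
            using ze[of s] by (cases "0 \<le> s \<and> s \<le> 1") auto
          ultimately show ?thesis by simp
        qed
        ultimately show ?thesis
          by (subst Bochner_Integration.integral_diff) (use i0' in auto)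
      qed
      finally show ?thesis by (simp add: algebra_simps)
    qed
    \<comment> \<open>This is the source of the majorant: within \<delta> of c the increment of f is
      at most (|f'(c)| + 1) |h|.\<close>
    obtain \<delta> where \<delta>: "\<delta> > 0" "\<And>h. \<bar>h\<bar> < \<delta> \<Longrightarrow> cmod (f (c + h) - f c - of_real h * f' c) \<le> \<bar>h\<bar>"
    proof -
      have "(f has_derivative (\<lambda>h. h *\<^sub>R f' c)) (at c)"
        using d[of c] by (simp add: has_vector_derivative_def)
      then obtain e where "e > 0" and e: "\<And>y. norm (y - c) < e \<Longrightarrow> norm (f y - f c - (y - c) *\<^sub>R f' c) \<le> 1 * norm (y - c)"
        unfolding has_derivative_at_alt by (metis zero_less_one)
      then show ?thesis
      proof (intro that[of e] \<open>e > 0\<close>)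
        show "cmod (f (c + h) - f c - of_real h * f' c) \<le> \<bar>h\<bar>" if "\<bar>h\<bar> < e" for h
          using e[of "c + h"] that by (simp add: scaleR_conv_of_real)
      qed
    qed
    \<comment> \<open>Domination is needed for every member of the sequence, so the sequence starts
      at N, where 1 / N < \<delta> puts all points c + s / n with s in [0, 1] into that
      neighbourhood.\<close>
    obtain N where N: "N > 0" "1 / real N < \<delta>"
      using real_arch_invD[OF \<delta>(1)] by (auto simp: inverse_eq_divide)
    have "(\<lambda>n. \<integral>s. (of_nat (n + N) * (f (c + s / real (n + N)) - f c)) * of_real (\<zeta> s) \<partial>lborel)
        \<longlonglongrightarrow> (\<integral>s. f' c * of_real (s * \<zeta> s) \<partial>lborel)"
    proof (rule integral_dominated_convergence[where w="\<lambda>s. (cmod (f' c) + 1) * norm (s * \<zeta> s)"])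
      show "AE s in lborel. (\<lambda>n. (of_nat (n + N) * (f (c + s / real (n + N)) - f c)) * of_real (\<zeta> s))
          \<longlonglongrightarrow> f' c * of_real (s * \<zeta> s)"
      proof (intro AE_I2)
        fix s :: real
        show "(\<lambda>n. (of_nat (n + N) * (f (c + s / real (n + N)) - f c)) * of_real (\<zeta> s)) \<longlonglongrightarrow> f' c * of_real (s * \<zeta> s)"
        proof (cases "s = 0")
          case False
          have "((\<lambda>h. (f (c + h) - f c) /\<^sub>R h) \<longlongrightarrow> f' c) (at 0)"
          proof -
            have "((\<lambda>h. norm (f (c + h) - f c - h *\<^sub>R f' c) / norm h) \<longlongrightarrow> 0) (at 0)"
              using d[of c] by (simp add: has_vector_derivative_def has_derivative_at)
            then have "((\<lambda>h. norm ((f (c + h) - f c) /\<^sub>R h - f' c)) \<longlongrightarrow> 0) (at 0)"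
            proof (rule Lim_transform_eventually)
              have "norm (f (c + h) - f c - h *\<^sub>R f' c) / norm h = norm ((f (c + h) - f c) /\<^sub>R h - f' c)" if "h \<noteq> 0" for h
              proof -
                have "(f (c + h) - f c) /\<^sub>R h - f' c = (f (c + h) - f c - h *\<^sub>R f' c) /\<^sub>R h"
                  using that by (simp add: scaleR_diff_right)
                then show ?thesis by (simp add: divide_inverse mult.commute)
              qed
              then show "\<forall>\<^sub>F h in at 0. norm (f (c + h) - f c - h *\<^sub>R f' c) / norm h = norm ((f (c + h) - f c) /\<^sub>R h - f' c)"
                by (auto simp: eventually_at_filter)
            qed
            then show ?thesis by (rule LIM_zero_cancel[OF tendsto_norm_zero_cancel])
          qed
          moreover have "filterlim (\<lambda>n. s / real (n + N)) (at 0) sequentially"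
            unfolding filterlim_at using N False LIMSEQ_ignore_initial_segment[OF lim_const_over_n, of s N]
            by simp
          ultimately have "(\<lambda>n. (f (c + s / real (n + N)) - f c) /\<^sub>R (s / real (n + N))) \<longlonglongrightarrow> f' c"
            by (rule filterlim_compose)
          then have "(\<lambda>n. (f (c + s / real (n + N)) - f c) /\<^sub>R (s / real (n + N)) * of_real (s * \<zeta> s)) \<longlonglongrightarrow> f' c * of_real (s * \<zeta> s)"
            by (rule tendsto_mult[OF _ tendsto_const])
          moreover have "(f (c + s / real (n + N)) - f c) /\<^sub>R (s / real (n + N)) * of_real (s * \<zeta> s)
             = (of_nat (n + N) * (f (c + s / real (n + N)) - f c)) * of_real (\<zeta> s)" for n
            using False by (simp add: scaleR_conv_of_real field_simps)
          ultimately show ?thesis by (simp only:)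
        qed (use ze in simp)
      qed
      show "AE s in lborel. norm ((of_nat (n + N) * (f (c + s / real (n + N)) - f c)) * of_real (\<zeta> s))
          \<le> (cmod (f' c) + 1) * norm (s * \<zeta> s)" for n
      proof (intro AE_I2)
        fix s :: real
        show "norm ((of_nat (n + N) * (f (c + s / real (n + N)) - f c)) * of_real (\<zeta> s))
          \<le> (cmod (f' c) + 1) * norm (s * \<zeta> s)"
        proof (cases "0 \<le> s \<and> s \<le> 1")
          case True
          let ?h = "s / real (n + N)"
          have "?h \<le> 1 / real N" using True N by (intro frac_le) auto
          then have h: "\<bar>?h\<bar> < \<delta>" using N True by auto
          have "cmod (f (c + ?h) - f c) \<le> cmod (f (c + ?h) - f c - of_real ?h * f' c) + cmod (of_real ?h * f' c)"
            by (metis diff_add_cancel norm_triangle_ineq)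
          also have "\<dots> \<le> \<bar>?h\<bar> + \<bar>?h\<bar> * cmod (f' c)"
            using \<delta>(2)[OF h] by (simp only: norm_mult norm_of_real add_right_mono)
          finally have "real (n + N) * cmod (f (c + ?h) - f c) \<le> real (n + N) * (\<bar>?h\<bar> + \<bar>?h\<bar> * cmod (f' c))"
            by (intro mult_left_mono) auto
          also have "\<dots> = s * (cmod (f' c) + 1)"
          proof -
            have "real (n + N) * \<bar>?h\<bar> = s" using True N by simp
            then show ?thesis by (metis (no_types) distrib_left mult.assoc mult.commute mult.right_neutral add.commute)
          qed
          finally have "real (n + N) * cmod (f (c + ?h) - f c) * \<bar>\<zeta> s\<bar> \<le> s * (cmod (f' c) + 1) * \<bar>\<zeta> s\<bar>"
            by (intro mult_right_mono) auto
          then show ?thesis using True by (simp only: norm_mult norm_of_nat norm_of_real real_norm_def abs_mult) (simp add: mult_ac)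
        qed (use ze[of s] in auto)
      qed
    qed (use int1' in \<open>auto intro!: integrable_norm integrable_mult_right\<close>)
    also have "(\<integral>s. f' c * of_real (s * \<zeta> s) \<partial>lborel) = - f' c"
      by (subst integral_mult_right_zero, subst integral_complex_of_real, simp only: i1') simp
    finally have "(\<lambda>n. J c (n + N)) \<longlonglongrightarrow> - f' c" using N by (simp add: J)
    then show ?thesis by (rule LIMSEQ_offset)
  qed
  define \<phi> where "\<phi> = (\<lambda>(n::nat) x. \<theta> (real n * (x - a)) - \<theta> (real n * (x - b)))"
  have eq: "J a n - J b n = (\<integral>x. g x * of_real (\<phi> n x) \<partial>lborel)" if n: "n > 0" for n
  proof -
    have "smooth_gen (\<lambda>x. \<theta> (real n * x + (- real n * a)) + (-1) * \<theta> (real n * x + (- real n * b)))"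
      by (intro smooth_gen.intros sg)
    then have s: "smooth_gen (\<phi> n)" by (simp add: \<phi>_def algebra_simps)
    \<comment> \<open>For n \<ge> 1 the falling edge lies in [b, b + 1 / n], hence the bound b +
      1.\<close>
    have "{x. \<phi> n x \<noteq> 0} \<subseteq> {a..b + 1}"
    proof safe
      fix x assume x: "\<phi> n x \<noteq> 0"
      have "\<phi> n x = 0" if "x < a"
        using that n ab th(1)[of "real n * (x - a)"] th(1)[of "real n * (x - b)"]
        by (simp add: \<phi>_def mult_nonneg_nonpos)
      moreover have "\<phi> n x = 0" if "x > b + 1"
      proof -
        have "real n * (x - a) \<ge> 1 * 1" "real n * (x - b) \<ge> 1 * 1"
          using that n ab by (intro mult_mono; simp)+
        then show ?thesis using th(2) by (simp add: \<phi>_def)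
      qed
      ultimately show "x \<in> {a..b + 1}" using x by force
    qed
    then have "test_fun (\<phi> n)"
      using s bounded_subset[OF bounded_closed_interval] smooth_gen_test_fun by blast
    have sc: "((\<lambda>x. q (real n * (x - c))) has_real_derivative real n * q' (real n * (x - c))) (at x)"
      if "\<And>x. (q has_real_derivative q' x) (at x)" for q q' :: "real \<Rightarrow> real" and c x
      by (rule DERIV_chain2[OF that, THEN DERIV_cong]) (auto intro!: derivative_eq_intros)
    from weak[OF \<open>test_fun (\<phi> n)\<close>] have "(\<integral>x. f x * of_real (deriv (deriv (\<phi> n)) x) \<partial>lborel) = (\<integral>x. g x * of_real (\<phi> n x) \<partial>lborel)" .
    moreover have "deriv (\<phi> n) = (\<lambda>x. real n * \<eta> (real n * (x - a)) - real n * \<eta> (real n * (x - b)))"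
      unfolding \<phi>_def by (rule ext, rule DERIV_imp_deriv, rule DERIV_diff; rule sc[OF d1])
    moreover have "deriv (\<lambda>x. real n * \<eta> (real n * (x - a)) - real n * \<eta> (real n * (x - b)))
       = (\<lambda>x. (real n)\<^sup>2 * \<zeta> (real n * (x - a)) - (real n)\<^sup>2 * \<zeta> (real n * (x - b)))"
      by (rule ext, rule DERIV_imp_deriv, rule DERIV_diff;
          rule DERIV_cmult[OF sc[OF d2], THEN DERIV_cong]; simp add: power2_eq_square)
    ultimately have "(\<integral>x. f x * of_real ((real n)\<^sup>2 * \<zeta> (real n * (x - a)) - (real n)\<^sup>2 * \<zeta> (real n * (x - b))) \<partial>lborel)
       = (\<integral>x. g x * of_real (\<phi> n x) \<partial>lborel)" by simp
    moreover have "(\<integral>x. f x * of_real ((real n)\<^sup>2 * \<zeta> (real n * (x - a)) - (real n)\<^sup>2 * \<zeta> (real n * (x - b))) \<partial>lborel)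
      = J a n - J b n"
      unfolding J_def using intJ[OF n]
      by (subst Bochner_Integration.integral_diff[symmetric]) (auto simp: algebra_simps)
    ultimately show ?thesis by simp
  qed
  have "(\<lambda>n. (\<integral>x. g x * of_real (\<phi> n x) \<partial>lborel)) \<longlonglongrightarrow> (\<integral>x. g x * indicator {a<..b} x \<partial>lborel)"
  proof (rule integral_dominated_convergence[where w="\<lambda>x. 2 * (indicator {a..b + 1} x * cmod (g x))"])
    show "integrable lborel (\<lambda>x. 2 * (indicator {a..b + 1} x * cmod (g x)))"
      using g by (intro integrable_mult_right integrable_of_square_integrable) auto
    show "AE x in lborel. (\<lambda>n. g x * of_real (\<phi> n x)) \<longlonglongrightarrow> g x * indicator {a<..b} x"
    proof (intro AE_I2 tendsto_mult tendsto_const)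
      fix x
      \<comment> \<open>At x = c every step has the value \<theta>(0) = 0, hence the open half line
        here and the half-open interval in the limit.\<close>
      have step: "(\<lambda>n. \<theta> (real n * (x - c))) \<longlonglongrightarrow> indicator {c<..} x" for c
      proof (cases "x > c")
        case True
        have "eventually (\<lambda>n. \<theta> (real n * (x - c)) = 1) sequentially"
          using eventually_ge_at_top[of "nat \<lceil>1 / (x - c)\<rceil>"]
        proof eventually_elim
          case (elim n)
          then have "real n \<ge> 1 / (x - c)" by linarith
          then show ?case using True by (intro th) (simp add: field_simps)
        qed
        then show ?thesis using True by (simp add: tendsto_eventually)
      qed (use th(1) in \<open>auto intro!: tendsto_eventually always_eventually simp: mult_nonneg_nonpos\<close>)
      have "(\<lambda>n. complex_of_real (\<phi> n x)) \<longlonglongrightarrow> of_real (indicator {a<..} x - indicator {b<..} x)"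
        unfolding \<phi>_def by (intro tendsto_intros step)
      moreover have "(of_real (indicator {a<..} x - indicator {b<..} x) :: complex) = indicator {a<..b} x"
        using ab by (auto simp: indicator_def)
      ultimately show "(\<lambda>n. complex_of_real (\<phi> n x)) \<longlonglongrightarrow> indicator {a<..b} x" by simp
    qed
    show "AE x in lborel. norm (g x * of_real (\<phi> n x)) \<le> 2 * (indicator {a..b + 1} x * cmod (g x))" for n
    proof (intro AE_I2)
      fix x
      have "\<bar>\<phi> n x\<bar> \<le> 2" using th(3)[of "real n * (x - a)"] th(3)[of "real n * (x - b)"] by (simp add: \<phi>_def)
      moreover have "\<phi> n x = 0" if "x \<notin> {a..b + 1}"
      \<comment> \<open>For n = 0 both steps are evaluated at 0 and cancel.\<close>
      proof (cases "n = 0 \<or> x < a")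
        case True
        then show ?thesis
          using that ab th(1)[of "real n * (x - a)"] th(1)[of "real n * (x - b)"]
          by (auto simp: \<phi>_def mult_nonneg_nonpos)
      next
        case False
        then have "real n * (x - a) \<ge> 1 * 1" "real n * (x - b) \<ge> 1 * 1"
          using that ab by (intro mult_mono; simp)+
        then show ?thesis using th(2) by (simp add: \<phi>_def)
      qed
      ultimately show "norm (g x * of_real (\<phi> n x)) \<le> 2 * (indicator {a..b + 1} x * cmod (g x))"
        using mult_right_mono[of "\<bar>\<phi> n x\<bar>" 2 "cmod (g x)"]
        by (cases "x \<in> {a..b + 1}") (auto simp: norm_mult mult.commute)
    qed
  qed (auto simp: \<phi>_def)
  moreover have "(\<lambda>n. J a n - J b n) \<longlonglongrightarrow> - f' a - - f' b" by (intro tendsto_diff limJ)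
  moreover have "eventually (\<lambda>n. J a n - J b n = (\<integral>x. g x * of_real (\<phi> n x) \<partial>lborel)) sequentially"
    using eventually_gt_at_top[of 0] by eventually_elim (rule eq)
  ultimately show ?thesis
  proof -
    assume *: "(\<lambda>n. \<integral>x. g x * of_real (\<phi> n x) \<partial>lborel) \<longlonglongrightarrow> (\<integral>x. g x * indicator {a<..b} x \<partial>lborel)"
      "(\<lambda>n. J a n - J b n) \<longlonglongrightarrow> - f' a - - f' b"
      "eventually (\<lambda>n. J a n - J b n = (\<integral>x. g x * of_real (\<phi> n x) \<partial>lborel)) sequentially"
    have "(\<lambda>n. \<integral>x. g x * of_real (\<phi> n x) \<partial>lborel) \<longlonglongrightarrow> - f' a - - f' b"
      by (rule Lim_transform_eventually[OF *(2,3)])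
    from LIMSEQ_unique[OF this *(1)] show ?thesis by (simp only: minus_diff_minus) (simp only: minus_diff_eq)
  qed
qed

section \<open>Windowed integrals and sampling on the grid of step \<epsilon>\<close>

abbreviation window :: "(real \<Rightarrow> real) \<Rightarrow> real \<Rightarrow> real \<Rightarrow> real" where
  "window h a b \<equiv> \<integral>x. indicator {a..b} x * h x \<partial>lborel"

text \<open>Cauchy-Schwarz on [a, b], obtained from the nonnegative integral of (h - c)^2 with c the
  mean of h.\<close>

lemma window_square_le:
  fixes h :: "real \<Rightarrow> real"
  assumes h: "h \<in> borel_measurable lborel" "integrable lborel (\<lambda>x. (h x)\<^sup>2)" and ab: "a < b"
  shows "(window h a b)\<^sup>2 \<le> (b - a) * window (\<lambda>x. (h x)\<^sup>2) a b"
proof -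
  define c where "c = window h a b / (b - a)"
  have i1: "integrable lborel (\<lambda>x. indicator {a..b} x * h x)"
    by (rule integrable_of_square_integrable[OF h])
  have i2: "integrable lborel (\<lambda>x. indicator {a..b} x * (h x)\<^sup>2)"
    by (rule integrable_mult_indicator[where 'b=real, simplified]) (use h in auto)
  have i0: "integrable lborel (indicator {a..b} :: real \<Rightarrow> real)"
    using emeasure_compact_finite[OF compact_Icc, of a b] by (intro integrable_real_indicator) auto
  have "0 \<le> (\<integral>x. indicator {a..b} x * (h x - c)\<^sup>2 \<partial>lborel)"
    by (intro Bochner_Integration.integral_nonneg) auto
  also have "\<dots> = (\<integral>x. indicator {a..b} x * (h x)\<^sup>2 - 2 * c * (indicator {a..b} x * h x) + c\<^sup>2 * indicator {a..b} x \<partial>lborel)"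
    by (intro Bochner_Integration.integral_cong refl) (simp add: power2_eq_square algebra_simps)
  also have "\<dots> = window (\<lambda>x. (h x)\<^sup>2) a b - 2 * c * window h a b + c\<^sup>2 * (b - a)"
    using i0 i1 i2 ab
    by (subst Bochner_Integration.integral_add Bochner_Integration.integral_diff; simp)+
  finally have "0 \<le> window (\<lambda>x. (h x)\<^sup>2) a b - 2 * c * window h a b + c\<^sup>2 * (b - a)" .
  moreover have "window h a b = c * (b - a)" using ab by (simp add: c_def)
  ultimately have "0 \<le> window (\<lambda>x. (h x)\<^sup>2) a b - 2 * c * (c * (b - a)) + c\<^sup>2 * (b - a)" by (simp only:)
  also have "\<dots> = window (\<lambda>x. (h x)\<^sup>2) a b - c\<^sup>2 * (b - a)" by (simp add: power2_eq_square algebra_simps)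
  finally have "c\<^sup>2 * (b - a) \<le> window (\<lambda>x. (h x)\<^sup>2) a b" by simp
  then have "(b - a) * (c\<^sup>2 * (b - a)) \<le> (b - a) * window (\<lambda>x. (h x)\<^sup>2) a b"
    using ab by (intro mult_left_mono) auto
  moreover have "(window h a b)\<^sup>2 = (b - a) * (c\<^sup>2 * (b - a))"
    unfolding \<open>window h a b = c * (b - a)\<close> by (simp add: power2_eq_square)
  ultimately show ?thesis by (simp only:)
qed

text \<open>The left ends are \<epsilon> apart, so a point lies in at most L / \<epsilon> + 1 of the
  windows; summing the Cauchy-Schwarz bounds counts it that often. Below, L = 3 costs a factor 1 /
  \<epsilon>, while L = \<epsilon> gives an overlap of two.\<close>

lemma sum_windows_square_le:
  fixes h :: "real \<Rightarrow> real"
  assumes h: "h \<in> borel_measurable lborel" "integrable lborel (\<lambda>x. (h x)\<^sup>2)"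
    and pos: "\<epsilon> > 0" "L > 0" and F: "finite F"
  shows "(\<Sum>j\<in>F. (window h (\<epsilon> * of_int j + s) (\<epsilon> * of_int j + s + L))\<^sup>2)
      \<le> L * (L / \<epsilon> + 1) * (\<integral>x. (h x)\<^sup>2 \<partial>lborel)"
proof -
  let ?A = "\<lambda>j::int. {\<epsilon> * of_int j + s..\<epsilon> * of_int j + s + L}"
  have i2: "integrable lborel (\<lambda>x. indicator (?A j) x * (h x)\<^sup>2)" for j
    by (rule integrable_mult_indicator[where 'b=real, simplified]) (use h in auto)
  have mult: "(\<Sum>j\<in>F. indicator (?A j) x) \<le> L / \<epsilon> + 1" for x :: real
  proof -
    have "(\<Sum>j\<in>F. indicator (?A j) x :: real) = real (card {j\<in>F. x \<in> ?A j})"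
      using sum.inter_filter[OF F, of "\<lambda>_. 1::real" "\<lambda>j. x \<in> ?A j"]
      by (simp add: indicator_def of_bool_def)
    also have "\<dots> \<le> real (card {\<lceil>(x - s - L) / \<epsilon>\<rceil>..\<lfloor>(x - s) / \<epsilon>\<rfloor>})"
      using pos by (intro of_nat_mono card_mono)
        (auto simp: ceiling_le_iff le_floor_iff field_simps)
    also have "\<dots> \<le> L / \<epsilon> + 1"
    proof -
      have "(x - s) / \<epsilon> - (x - s - L) / \<epsilon> = L / \<epsilon>" by (simp add: diff_divide_distrib)
      moreover have "L / \<epsilon> > 0" using pos by simp
      ultimately show ?thesis by (simp add: nat_plus_as_int) linarith
    qed
    finally show ?thesis .
  qed
  have "(\<Sum>j\<in>F. (window h (\<epsilon> * of_int j + s) (\<epsilon> * of_int j + s + L))\<^sup>2)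
      \<le> (\<Sum>j\<in>F. L * window (\<lambda>x. (h x)\<^sup>2) (\<epsilon> * of_int j + s) (\<epsilon> * of_int j + s + L))"
  proof (intro sum_mono)
    fix j
    show "(window h (\<epsilon> * of_int j + s) (\<epsilon> * of_int j + s + L))\<^sup>2
        \<le> L * window (\<lambda>x. (h x)\<^sup>2) (\<epsilon> * of_int j + s) (\<epsilon> * of_int j + s + L)"
      using window_square_le[OF h, of "\<epsilon> * of_int j + s" "\<epsilon> * of_int j + s + L"] pos by simp
  qed
  also have "\<dots> = L * (\<integral>x. (\<Sum>j\<in>F. indicator (?A j) x) * (h x)\<^sup>2 \<partial>lborel)"
    by (simp add: sum_distrib_left[symmetric] sum_distrib_right i2)
  also have "\<dots> \<le> L * (\<integral>x. (L / \<epsilon> + 1) * (h x)\<^sup>2 \<partial>lborel)"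
  proof (intro mult_left_mono integral_mono mult_right_mono mult)
    show "integrable lborel (\<lambda>x. (\<Sum>j\<in>F. indicator (?A j) x) * (h x)\<^sup>2)"
      unfolding sum_distrib_right by (intro Bochner_Integration.integrable_sum i2)
    show "integrable lborel (\<lambda>x. (L / \<epsilon> + 1) * (h x)\<^sup>2)" by (intro integrable_mult_right h)
  qed (use pos in simp_all)
  finally show ?thesis by (simp only: integral_mult_right_zero mult.assoc)
qed

lemma square_integrable_add:
  fixes f g :: "real \<Rightarrow> complex"
  assumes "f \<in> borel_measurable lborel" "integrable lborel (\<lambda>x. (cmod (f x))\<^sup>2)"
    "g \<in> borel_measurable lborel" "integrable lborel (\<lambda>x. (cmod (g x))\<^sup>2)"
  shows "integrable lborel (\<lambda>x. (cmod (f x) + cmod (g x))\<^sup>2)"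
    "(\<integral>x. (cmod (f x) + cmod (g x))\<^sup>2 \<partial>lborel)
      \<le> 2 * (\<integral>x. (cmod (f x))\<^sup>2 \<partial>lborel) + 2 * (\<integral>x. (cmod (g x))\<^sup>2 \<partial>lborel)"
proof -
  have le: "(cmod (f x) + cmod (g x))\<^sup>2 \<le> 2 * (cmod (f x))\<^sup>2 + 2 * (cmod (g x))\<^sup>2" for x
    using zero_le_power2[of "cmod (f x) - cmod (g x)"] by (simp add: power2_eq_square algebra_simps)
  have i: "integrable lborel (\<lambda>x. 2 * (cmod (f x))\<^sup>2 + 2 * (cmod (g x))\<^sup>2)" using assms by simp
  show *: "integrable lborel (\<lambda>x. (cmod (f x) + cmod (g x))\<^sup>2)"
    by (rule Bochner_Integration.integrable_bound[OF i]) (use assms le in auto)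
  have "(\<integral>x. (cmod (f x) + cmod (g x))\<^sup>2 \<partial>lborel) \<le> (\<integral>x. 2 * (cmod (f x))\<^sup>2 + 2 * (cmod (g x))\<^sup>2 \<partial>lborel)"
    by (intro integral_mono * i le)
  then show "(\<integral>x. (cmod (f x) + cmod (g x))\<^sup>2 \<partial>lborel)
      \<le> 2 * (\<integral>x. (cmod (f x))\<^sup>2 \<partial>lborel) + 2 * (\<integral>x. (cmod (g x))\<^sup>2 \<partial>lborel)"
    using assms by simp
qed

lemma window_mono:
  assumes h: "h \<in> borel_measurable lborel" "integrable lborel (\<lambda>x. (h x)\<^sup>2)" "\<And>x. h x \<ge> 0"
    and sub: "c \<le> a" "b \<le> d"
  shows "window h a b \<le> window h c d"
  using sub h(3) by (intro integral_mono integrable_of_square_integrable h(1,2) mult_right_mono)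
    (auto simp: indicator_def)

text \<open>One majorant, h = |f| + |f''| with f'' the weak second derivative, governs increments of
  f' as well as values of f and f'. It is expressed through windows of h because these can be summed
  over the grid.\<close>

lemma H4_control:
  assumes H: "H4_norm_le K f" and d: "\<And>y. (f has_vector_derivative f' y) (at y)"
  shows "\<exists>h :: real \<Rightarrow> real. h \<in> borel_measurable lborel \<and> integrable lborel (\<lambda>x. (h x)\<^sup>2) \<and>
    (\<forall>x. h x \<ge> 0) \<and> (\<integral>x. (h x)\<^sup>2 \<partial>lborel) \<le> 4 * K\<^sup>2 \<and>
    (\<forall>a b. a \<le> b \<longrightarrow> cmod (f' b - f' a) \<le> window h a b) \<and>
    (\<forall>y. cmod (f y) \<le> 20 * window h y (y + 3) \<and> cmod (f' y) \<le> 20 * window h y (y + 3))"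
proof -
  obtain g :: "nat \<Rightarrow> real \<Rightarrow> complex" where g: "g 0 = f \<and>
     (\<forall>j\<le>4. g j \<in> borel_measurable lborel \<and> integrable lborel (\<lambda>x. (cmod (g j x))\<^sup>2)) \<and>
     (\<forall>j<4. \<forall>\<phi>. test_fun \<phi> \<longrightarrow>
        (\<integral>x. g j x * of_real (deriv \<phi> x) \<partial>lborel) = - (\<integral>x. g (Suc j) x * of_real (\<phi> x) \<partial>lborel)) \<and>
     (\<Sum>j\<le>4. \<integral>x. (cmod (g j x))\<^sup>2 \<partial>lborel) \<le> K\<^sup>2"
    using H unfolding H4_norm_le_def by (elim exE) (rule that)
  have g0: "g 0 = f"
    and gm: "\<And>j. j \<le> 4 \<Longrightarrow> g j \<in> borel_measurable lborel"
    and gi: "\<And>j. j \<le> 4 \<Longrightarrow> integrable lborel (\<lambda>x. (cmod (g j x))\<^sup>2)"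
    and gw: "\<And>j \<phi>. j < 4 \<Longrightarrow> test_fun \<phi> \<Longrightarrow>
        (\<integral>x. g j x * of_real (deriv \<phi> x) \<partial>lborel) = - (\<integral>x. g (Suc j) x * of_real (\<phi> x) \<partial>lborel)"
    and gK: "(\<Sum>j\<le>4. \<integral>x. (cmod (g j x))\<^sup>2 \<partial>lborel) \<le> K\<^sup>2"
    using g[THEN conjunct1] g[THEN conjunct2, THEN conjunct1] g[THEN conjunct2, THEN conjunct2, THEN conjunct1]
      g[THEN conjunct2, THEN conjunct2, THEN conjunct2]
    by simp_all
  \<comment> \<open>The derivative of a test function is supported in the closure of the old
    support, so the weak relation can be used twice; the two signs then cancel.\<close>
  have test_deriv: "test_fun (deriv \<phi>)" if "test_fun \<phi>" for \<phi>
  proof -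
    have "{x. deriv \<phi> x \<noteq> 0} \<subseteq> closure {x. \<phi> x \<noteq> 0}"
    proof
      fix x assume x: "x \<in> {x. deriv \<phi> x \<noteq> 0}"
      show "x \<in> closure {x. \<phi> x \<noteq> 0}"
      proof (rule ccontr)
        assume "x \<notin> closure {x. \<phi> x \<noteq> 0}"
        then have op: "x \<in> - closure {x. \<phi> x \<noteq> 0}" "open (- closure {x. \<phi> x \<noteq> 0})" by auto
        have "(\<phi> has_real_derivative 0) (at x)"
          by (rule has_field_derivative_transform_within_open[of "\<lambda>_. 0", OF DERIV_const op(2,1)])
            (use closure_subset[of "{x. \<phi> x \<noteq> 0}"] in auto)
        from DERIV_imp_deriv[OF this] show False using x by simp
      qed
    qed
    then have "bounded {x. deriv \<phi> x \<noteq> 0}"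
      using that bounded_subset[OF bounded_closure] unfolding test_fun_def by blast
    moreover have "((deriv ^^ k) (deriv \<phi>)) differentiable (at x)" for k x
    proof -
      have "(deriv ^^ k) (deriv \<phi>) = (deriv ^^ Suc k) \<phi>" by (simp add: funpow_swap1)
      then show ?thesis using that unfolding test_fun_def by presburger
    qed
    ultimately show ?thesis unfolding test_fun_def by blast
  qed
  have weak2: "(\<integral>x. f x * of_real (deriv (deriv \<phi>) x) \<partial>lborel) = (\<integral>x. g 2 x * of_real (\<phi> x) \<partial>lborel)"
    if "test_fun \<phi>" for \<phi>
    using gw[of 0 "deriv \<phi>"] gw[of 1 \<phi>] that test_deriv[OF that] by (simp add: g0 numeral_2_eq_2)
  define h where "h = (\<lambda>x. cmod (f x) + cmod (g 2 x))"
  have [measurable]: "f \<in> borel_measurable borel" "g 2 \<in> borel_measurable borel" using gm[of 0] gm[of 2] g0 by auto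
  have hm: "h \<in> borel_measurable lborel" unfolding h_def by simp
  have hi: "integrable lborel (\<lambda>x. (h x)\<^sup>2)"
    unfolding h_def using gm[of 0] gm[of 2] gi[of 0] gi[of 2] g0 by (intro square_integrable_add) auto
  have hpos: "h x \<ge> 0" for x by (simp add: h_def)
  have hK: "(\<integral>x. (h x)\<^sup>2 \<partial>lborel) \<le> 4 * K\<^sup>2"
  proof -
    have nn: "0 \<le> (\<integral>x. (cmod (g j x))\<^sup>2 \<partial>lborel)" for j by (intro Bochner_Integration.integral_nonneg) auto
    have *: "(\<integral>x. (cmod (g j x))\<^sup>2 \<partial>lborel) \<le> K\<^sup>2" if "j \<le> 4" for j
      using member_le_sum[of j "{..4}" "\<lambda>j. \<integral>x. (cmod (g j x))\<^sup>2 \<partial>lborel"] nn gK that by force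
    have "(\<integral>x. (cmod (f x))\<^sup>2 \<partial>lborel) \<le> K\<^sup>2" using *[of 0] g0 by simp
    moreover have "(\<integral>x. (cmod (g 2 x))\<^sup>2 \<partial>lborel) \<le> K\<^sup>2" by (rule *) simp
    moreover have "(\<integral>x. (cmod (f x) + cmod (g 2 x))\<^sup>2 \<partial>lborel)
      \<le> 2 * (\<integral>x. (cmod (f x))\<^sup>2 \<partial>lborel) + 2 * (\<integral>x. (cmod (g 2 x))\<^sup>2 \<partial>lborel)"
      using gm[of 0] gm[of 2] gi[of 0] gi[of 2] g0 by (intro square_integrable_add(2)) auto
    ultimately show ?thesis unfolding h_def by linarith
  qed
  have dif: "cmod (f' b - f' a) \<le> window h a b" if "a \<le> b" for a b
  proof (cases "a = b")
    case False
    then have "a < b" using that by simp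
    have "f' b - f' a = (\<integral>x. g 2 x * indicator {a<..b} x \<partial>lborel)"
      by (rule weak_second_derivative[OF d _ _ weak2 \<open>a < b\<close>]) (use gm[of 2] gi[of 2] in auto)
    then have "cmod (f' b - f' a) \<le> (\<integral>x. norm (g 2 x * indicator {a<..b} x) \<partial>lborel)"
      by (simp only: integral_norm_bound)
    also have "\<dots> \<le> window h a b"
    proof (rule integral_mono)
      show "integrable lborel (\<lambda>x. indicator {a..b} x * h x)" by (rule integrable_of_square_integrable[OF hm hi])
      show "integrable lborel (\<lambda>x. norm (g 2 x * indicator {a<..b} x))"
        by (rule Bochner_Integration.integrable_bound[OF integrable_of_square_integrable[OF hm hi, of a b]])
          (auto simp: h_def indicator_def)
    qed (auto simp: h_def indicator_def)
    finally show ?thesis .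
  qed (simp add: Bochner_Integration.integral_nonneg hpos)
  have cf: "continuous_on A f" for A
    using d by (meson continuous_at_imp_continuous_on has_vector_derivative_continuous)
  \<comment> \<open>Every unit interval contains a point where \<open>f\<close> is at most its mean; two such points at
     distance between 1 and 3 control value and slope, since \<open>f'\<close> varies by at most the integral of \<open>h\<close>.\<close>
  have mean: "\<exists>x\<in>{a..a+1}. cmod (f x) \<le> window h a (a + 1)" for a
  proof -
    obtain x where x: "x \<in> {a..a+1}" "\<And>y. y \<in> {a..a+1} \<Longrightarrow> cmod (f x) \<le> cmod (f y)"
      using continuous_attains_inf[OF compact_Icc _ continuous_on_norm[OF cf], of a "a + 1"]
      by (metis atLeastAtMost_iff empty_iff le_add_same_cancel1 order_refl zero_le_one)
    have "cmod (f x) = window (\<lambda>_. cmod (f x)) a (a + 1)" by simp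
    also have "\<dots> \<le> window h a (a + 1)"
    proof (rule integral_mono)
      show "integrable lborel (\<lambda>y. indicator {a..a+1} y * cmod (f x))"
        using emeasure_compact_finite[OF compact_Icc, of a "a+1"]
        by (intro integrable_mult_left integrable_real_indicator) auto
      show "indicator {a..a+1} y * cmod (f x) \<le> indicator {a..a+1} y * h y" for y
        using x(2)[of y] by (auto simp: h_def indicator_def intro: order_trans)
    qed (rule integrable_of_square_integrable[OF hm hi])
    finally show ?thesis using x by blast
  qed
  have both: "cmod (f y) \<le> 20 * window h y (y + 3) \<and> cmod (f' y) \<le> 20 * window h y (y + 3)" for y
  proof -
    let ?w = "window h y (y + 3)"
    have w0: "?w \<ge> 0" by (intro Bochner_Integration.integral_nonneg) (simp add: hpos)
    obtain x1 where x1: "x1 \<in> {y..y+1}" "cmod (f x1) \<le> ?w"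
      using mean[of y] window_mono[OF hm hi hpos, of y y "y+1" "y+3"] by force
    obtain x2 where x2: "x2 \<in> {y+2..y+3}" "cmod (f x2) \<le> ?w"
      using mean[of "y+2"] window_mono[OF hm hi hpos, of y "y+2" "y+3" "y+3"] by (force simp: add.assoc)
    \<comment> \<open>f(u) - u f'(y) has derivative f'(u) - f'(y), at most \<open>?w\<close>, over a
      length of at most 3.\<close>
    have tay: "cmod (f z - f y - of_real (z - y) * f' y) \<le> 3 * ?w" if "z \<in> {y..y+3}" for z
    proof -
      have "norm ((f z - z *\<^sub>R f' y) - (f y - y *\<^sub>R f' y)) \<le> ?w * norm (z - y)"
      proof (rule differentiable_bound[of "{y..y+3}" "\<lambda>u. f u - u *\<^sub>R f' y" "\<lambda>u h. h *\<^sub>R (f' u - f' y)"])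
        show "((\<lambda>u. f u - u *\<^sub>R f' y) has_derivative (\<lambda>h. h *\<^sub>R (f' u - f' y))) (at u within {y..y+3})" for u
          using d[of u, unfolded has_vector_derivative_def, THEN has_derivative_at_withinI]
          by (auto intro!: derivative_eq_intros simp: scaleR_diff_right)
        show "onorm (\<lambda>h. h *\<^sub>R (f' u - f' y)) \<le> ?w" if "u \<in> {y..y+3}" for u
        proof (rule onorm_le)
          fix h' :: real
          have "norm (f' u - f' y) \<le> ?w"
            using dif[of y u] window_mono[OF hm hi hpos, of y y u "y+3"] that by force
          then show "norm (h' *\<^sub>R (f' u - f' y)) \<le> ?w * norm h'"
            unfolding norm_scaleR real_norm_def mult.commute[of "\<bar>h'\<bar>"] by (rule mult_right_mono) simp
        qed
      qed (use that in auto)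
      also have "\<dots> \<le> ?w * 3" using that w0 by (intro mult_left_mono) auto
      finally show ?thesis by (simp add: scaleR_conv_of_real algebra_simps)
    qed
    \<comment> \<open>x1 and x2 are at least 1 apart, so the slope is at most the increment plus two
      Taylor errors: 1 + 1 + 3 + 3 = 8 times \<open>?w\<close>. The value then costs 1 + 3 + 8 = 12;
      the 20 of the claim covers both.\<close>
    have "cmod (of_real (x2 - x1) * f' y) = cmod ((f x2 - f x1) - (f x2 - f y - of_real (x2 - y) * f' y)
        + (f x1 - f y - of_real (x1 - y) * f' y))" by (simp add: algebra_simps)
    also have "\<dots> \<le> cmod (f x2) + cmod (f x1) + cmod (f x2 - f y - of_real (x2 - y) * f' y)
        + cmod (f x1 - f y - of_real (x1 - y) * f' y)"
      by (intro norm_triangle_le norm_triangle_le_diff add_mono order_refl norm_triangle_ineq4)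
    also have "\<dots> \<le> 8 * ?w" using x1 x2 tay[of x1] tay[of x2] by force
    finally have "\<bar>x2 - x1\<bar> * cmod (f' y) \<le> 8 * ?w" by (simp only: norm_mult norm_of_real)
    moreover have "1 * cmod (f' y) \<le> \<bar>x2 - x1\<bar> * cmod (f' y)" using x1 x2 by (intro mult_right_mono) auto
    ultimately have f': "cmod (f' y) \<le> 8 * ?w" by linarith
    have "cmod (f y) = cmod (f x1 - (f x1 - f y - of_real (x1 - y) * f' y) - of_real (x1 - y) * f' y)" by simp
    also have "\<dots> \<le> cmod (f x1) + cmod (f x1 - f y - of_real (x1 - y) * f' y) + cmod (of_real (x1 - y) * f' y)"
      by (intro norm_triangle_le_diff add_mono order_refl)
    also have "cmod (of_real (x1 - y) * f' y) \<le> 1 * cmod (f' y)"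
      unfolding norm_mult norm_of_real using x1 by (intro mult_right_mono) auto
    finally have "cmod (f y) \<le> 12 * ?w" using x1 tay[of x1] f' by force
    with f' w0 show ?thesis by linarith
  qed
  show ?thesis by (intro exI[of _ h] conjI allI impI hm hi hpos hK dif both[THEN conjunct1] both[THEN conjunct2])
qed

text \<open>Values and slopes are controlled by windows of length 3, which overlap about 3 /
  \<epsilon> times, so their sums of squares are O(1 / \<epsilon>). Increments of f' and Taylor
  remainders over one grid step use windows of length \<epsilon> and stay small. The constants are
  generous: 80 |K| is bounded by 200 (|K| + 1), and 4800 (3 + \<epsilon>) by 20000.\<close>

lemma H4_sampling:
  assumes H: "H4_norm_le K f" and d: "\<And>y. (f has_vector_derivative f' y) (at y)"
  shows "cmod (f y) \<le> 200 * (\<bar>K\<bar> + 1)"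
    and "0 < \<epsilon> \<Longrightarrow> \<epsilon> < 1 \<Longrightarrow> finite F \<Longrightarrow> \<epsilon> * (\<Sum>j\<in>F. (cmod (f (\<epsilon> * of_int j)))\<^sup>2) \<le> 20000 * K\<^sup>2"
    and "0 < \<epsilon> \<Longrightarrow> \<epsilon> < 1 \<Longrightarrow> finite F \<Longrightarrow> \<epsilon> * (\<Sum>j\<in>F. (cmod (f' (\<epsilon> * of_int j)))\<^sup>2) \<le> 20000 * K\<^sup>2"
    and "0 < \<epsilon> \<Longrightarrow> finite F \<Longrightarrow>
      (\<Sum>j\<in>F. (cmod (f' (\<epsilon> * of_int j + \<epsilon>) - f' (\<epsilon> * of_int j)))\<^sup>2) \<le> 8 * K\<^sup>2 * \<epsilon>"
    and "0 < \<epsilon> \<Longrightarrow> finite F \<Longrightarrow>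
      (\<Sum>j\<in>F. (cmod (f (\<epsilon> * of_int j + \<epsilon>) - f (\<epsilon> * of_int j) - of_real \<epsilon> * f' (\<epsilon> * of_int j)))\<^sup>2) \<le> 8 * K\<^sup>2 * \<epsilon> ^ 3"
proof -
  obtain h where H': "h \<in> borel_measurable lborel \<and> integrable lborel (\<lambda>x. (h x)\<^sup>2) \<and>
    (\<forall>x. h x \<ge> 0) \<and> (\<integral>x. (h x)\<^sup>2 \<partial>lborel) \<le> 4 * K\<^sup>2 \<and>
    (\<forall>a b. a \<le> b \<longrightarrow> cmod (f' b - f' a) \<le> window h a b) \<and>
    (\<forall>y. cmod (f y) \<le> 20 * window h y (y + 3) \<and> cmod (f' y) \<le> 20 * window h y (y + 3))"
    using H4_control[OF H d] by (elim exE) (rule that)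
  have h: "h \<in> borel_measurable lborel" "integrable lborel (\<lambda>x. (h x)\<^sup>2)"
    and hpos: "\<And>x. h x \<ge> 0" and hK: "(\<integral>x. (h x)\<^sup>2 \<partial>lborel) \<le> 4 * K\<^sup>2"
    and dif: "\<And>a b. a \<le> b \<Longrightarrow> cmod (f' b - f' a) \<le> window h a b"
    and fw: "\<And>y. cmod (f y) \<le> 20 * window h y (y + 3)" and f'w: "\<And>y. cmod (f' y) \<le> 20 * window h y (y + 3)"
    using H' by simp_all
  show "cmod (f y) \<le> 200 * (\<bar>K\<bar> + 1)"
  proof -
    have "window (\<lambda>x. (h x)\<^sup>2) y (y + 3) \<le> (\<integral>x. (h x)\<^sup>2 \<partial>lborel)"
      using h by (intro integral_mono integrable_mult_indicator[where 'b=real, simplified]) (auto simp: indicator_def)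
    then have "(window h y (y + 3))\<^sup>2 \<le> 3 * (4 * K\<^sup>2)" using window_square_le[OF h, of y "y+3"] hK by simp
    also have "\<dots> \<le> (4 * \<bar>K\<bar>)\<^sup>2" by (simp add: power_mult_distrib)
    finally have "window h y (y + 3) \<le> 4 * \<bar>K\<bar>" by (rule power2_le_imp_le) simp
    then show ?thesis using fw[of y] by simp
  qed
  have big: "\<epsilon> * (\<Sum>j\<in>F. (q j)\<^sup>2) \<le> 20000 * K\<^sup>2"
    if e: "0 < \<epsilon>" "\<epsilon> < 1" "finite F" and q: "\<And>j. 0 \<le> q j \<and> q j \<le> 20 * window h (\<epsilon> * of_int j) (\<epsilon> * of_int j + 3)"
    for \<epsilon> F and q :: "int \<Rightarrow> real"
  proof -
    have "(\<Sum>j\<in>F. (q j)\<^sup>2) \<le> (\<Sum>j\<in>F. (20 * window h (\<epsilon> * of_int j) (\<epsilon> * of_int j + 3))\<^sup>2)"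
      by (intro sum_mono power_mono) (use q in auto)
    also have "\<dots> = 400 * (\<Sum>j\<in>F. (window h (\<epsilon> * of_int j) (\<epsilon> * of_int j + 3))\<^sup>2)"
      by (simp add: power_mult_distrib sum_distrib_left)
    also have "\<dots> \<le> 400 * (3 * (3 / \<epsilon> + 1) * (4 * K\<^sup>2))"
      using sum_windows_square_le[OF h e(1) _ e(3), of 3 0] hK e(1)
      by (intro mult_left_mono) (auto intro!: order_trans[OF _ mult_left_mono[OF hK]])
    finally have "\<epsilon> * (\<Sum>j\<in>F. (q j)\<^sup>2) \<le> \<epsilon> * (400 * (3 * (3 / \<epsilon> + 1) * (4 * K\<^sup>2)))"
      using e by (intro mult_left_mono) auto
    also have "\<dots> = 4800 * (3 + \<epsilon>) * K\<^sup>2" using e by (simp add: field_simps)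
    also have "\<dots> \<le> 20000 * K\<^sup>2" using e by (intro mult_right_mono) auto
    finally show ?thesis .
  qed
  show "0 < \<epsilon> \<Longrightarrow> \<epsilon> < 1 \<Longrightarrow> finite F \<Longrightarrow> \<epsilon> * (\<Sum>j\<in>F. (cmod (f (\<epsilon> * of_int j)))\<^sup>2) \<le> 20000 * K\<^sup>2"
    using fw by (intro big) auto
  show "0 < \<epsilon> \<Longrightarrow> \<epsilon> < 1 \<Longrightarrow> finite F \<Longrightarrow> \<epsilon> * (\<Sum>j\<in>F. (cmod (f' (\<epsilon> * of_int j)))\<^sup>2) \<le> 20000 * K\<^sup>2"
    using f'w by (intro big) auto
  have small: "(\<Sum>j\<in>F. (window h (\<epsilon> * of_int j) (\<epsilon> * of_int j + \<epsilon>))\<^sup>2) \<le> 8 * K\<^sup>2 * \<epsilon>"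
    if "0 < \<epsilon>" "finite F" for \<epsilon> F
  proof -
    have "(\<Sum>j\<in>F. (window h (\<epsilon> * of_int j) (\<epsilon> * of_int j + \<epsilon>))\<^sup>2) \<le> \<epsilon> * (\<epsilon> / \<epsilon> + 1) * (\<integral>x. (h x)\<^sup>2 \<partial>lborel)"
      using sum_windows_square_le[OF h that(1,1,2), of 0] by simp
    also have "\<dots> \<le> \<epsilon> * (\<epsilon> / \<epsilon> + 1) * (4 * K\<^sup>2)"
      using that(1) by (intro mult_left_mono hK) auto
    also have "\<dots> = 8 * K\<^sup>2 * \<epsilon>" using that(1) by simp
    finally show ?thesis .
  qed
  show "(\<Sum>j\<in>F. (cmod (f' (\<epsilon> * of_int j + \<epsilon>) - f' (\<epsilon> * of_int j)))\<^sup>2) \<le> 8 * K\<^sup>2 * \<epsilon>"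
    if "0 < \<epsilon>" "finite F"
    by (rule order_trans[OF sum_mono small[OF that]]) (use dif that in \<open>auto intro!: power_mono\<close>)
  have tay: "cmod (f (y + \<epsilon>) - f y - of_real \<epsilon> * f' y) \<le> \<epsilon> * window h y (y + \<epsilon>)" if "0 < \<epsilon>" for y \<epsilon>
  proof -
    have "norm ((f (y + \<epsilon>) - (y + \<epsilon>) *\<^sub>R f' y) - (f y - y *\<^sub>R f' y)) \<le> window h y (y + \<epsilon>) * norm (y + \<epsilon> - y)"
    proof (rule differentiable_bound[of "{y..y+\<epsilon>}" "\<lambda>u. f u - u *\<^sub>R f' y" "\<lambda>u h. h *\<^sub>R (f' u - f' y)"])
      show "((\<lambda>u. f u - u *\<^sub>R f' y) has_derivative (\<lambda>h. h *\<^sub>R (f' u - f' y))) (at u within {y..y+\<epsilon>})" for u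
        using d[of u, unfolded has_vector_derivative_def, THEN has_derivative_at_withinI]
        by (auto intro!: derivative_eq_intros simp: scaleR_diff_right)
      show "onorm (\<lambda>h. h *\<^sub>R (f' u - f' y)) \<le> window h y (y + \<epsilon>)" if "u \<in> {y..y+\<epsilon>}" for u
      proof (rule onorm_le)
        fix h' :: real
        have "norm (f' u - f' y) \<le> window h y (y + \<epsilon>)"
          using dif[of y u] window_mono[OF h hpos, of y y u "y+\<epsilon>"] that by force
        then show "norm (h' *\<^sub>R (f' u - f' y)) \<le> window h y (y + \<epsilon>) * norm h'"
          unfolding norm_scaleR real_norm_def mult.commute[of "\<bar>h'\<bar>"] by (rule mult_right_mono) simp
      qed
    qed (use that in auto)
    then show ?thesis using that by (simp add: scaleR_conv_of_real algebra_simps)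
  qed
  show "(\<Sum>j\<in>F. (cmod (f (\<epsilon> * of_int j + \<epsilon>) - f (\<epsilon> * of_int j) - of_real \<epsilon> * f' (\<epsilon> * of_int j)))\<^sup>2) \<le> 8 * K\<^sup>2 * \<epsilon> ^ 3"
    if e: "0 < \<epsilon>" "finite F"
  proof -
    have "(\<Sum>j\<in>F. (cmod (f (\<epsilon> * of_int j + \<epsilon>) - f (\<epsilon> * of_int j) - of_real \<epsilon> * f' (\<epsilon> * of_int j)))\<^sup>2)
      \<le> (\<Sum>j\<in>F. (\<epsilon> * window h (\<epsilon> * of_int j) (\<epsilon> * of_int j + \<epsilon>))\<^sup>2)"
      by (intro sum_mono power_mono tay e norm_ge_zero)
    also have "\<dots> = \<epsilon>\<^sup>2 * (\<Sum>j\<in>F. (window h (\<epsilon> * of_int j) (\<epsilon> * of_int j + \<epsilon>))\<^sup>2)"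
      by (simp add: power_mult_distrib sum_distrib_left)
    also have "\<dots> \<le> \<epsilon>\<^sup>2 * (8 * K\<^sup>2 * \<epsilon>)" by (intro mult_left_mono small e) simp
    finally show ?thesis by (simp add: power2_eq_square power3_eq_cube mult_ac)
  qed
qed

section \<open>Energy estimate for perturbed chains\<close>

text \<open>With G the right-hand side of the hypothesis, G(t) exp(-b t) - c t is nonincreasing: N
  \<le> G absorbs the growth term and exp(-b t) \<le> 1 the constant one.\<close>

lemma gronwall_integral:
  fixes N :: "real \<Rightarrow> real"
  assumes cN: "continuous_on {0..T} N" and b: "b \<ge> 0" and c: "c \<ge> 0"
    and N: "\<And>t. t \<in> {0..T} \<Longrightarrow> N t \<le> a + integral {0..t} (\<lambda>s. b * N s + c)"
    and t: "t \<in> {0..T}"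
  shows "N t \<le> (a + c * t) * exp (b * t)"
proof -
  define G where "G = (\<lambda>t. a + integral {0..t} (\<lambda>s. b * N s + c))"
  define \<phi> where "\<phi> = (\<lambda>t. G t * exp (- (b * t)) - c * t)"
  have cf: "continuous_on {0..T} (\<lambda>s. b * N s + c)" by (intro continuous_intros cN)
  have G: "(G has_real_derivative (b * N s + c)) (at s within {0..T})" if "s \<in> {0..T}" for s
    unfolding G_def has_real_derivative_iff_has_vector_derivative
    using integral_has_vector_derivative[OF cf that]
    by (auto intro!: derivative_eq_intros)
  have d\<phi>: "(\<phi> has_real_derivative ((b * N s + c) * exp (- (b * s)) - b * G s * exp (- (b * s)) - c)) (at s within {0..T})"
    if "s \<in> {0..T}" for s
    unfolding \<phi>_def
    by (rule derivative_eq_intros G[OF that] refl | simp add: algebra_simps)+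
  have le0: "(b * N s + c) * exp (- (b * s)) - b * G s * exp (- (b * s)) - c \<le> 0" if "s \<in> {0..T}" for s
  proof -
    have "b * N s \<le> b * G s" using N[OF that] b unfolding G_def by (intro mult_left_mono) auto
    then have "(b * N s + c) * exp (- (b * s)) \<le> (b * G s + c) * exp (- (b * s))"
      by (intro mult_right_mono) auto
    moreover have "c * exp (- (b * s)) \<le> c * 1" using b c that by (intro mult_left_mono) auto
    ultimately show ?thesis by (simp add: algebra_simps)
  qed
  have sub: "{0..t} \<subseteq> {0..T}" using t by auto
  have "((\<lambda>s. (b * N s + c) * exp (- (b * s)) - b * G s * exp (- (b * s)) - c) has_integral (\<phi> t - \<phi> 0)) {0..t}"
  proof (rule fundamental_theorem_of_calculus)
    fix s assume s: "s \<in> {0..t}"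
    then have "s \<in> {0..T}" using sub by blast
    from has_field_derivative_subset[OF d\<phi>[OF this] sub]
    show "(\<phi> has_vector_derivative ((b * N s + c) * exp (- (b * s)) - b * G s * exp (- (b * s)) - c)) (at s within {0..t})"
      by (simp add: has_real_derivative_iff_has_vector_derivative)
  qed (use t in auto)
  from has_integral_le[OF this has_integral_0] le0 sub have "\<phi> t - \<phi> 0 \<le> 0" by blast
  moreover have "\<phi> 0 = a" by (simp add: \<phi>_def G_def)
  ultimately have "G t * exp (- (b * t)) \<le> a + c * t" by (simp add: \<phi>_def)
  then have "G t * exp (- (b * t)) * exp (b * t) \<le> (a + c * t) * exp (b * t)" by (intro mult_right_mono) auto
  then have "G t \<le> (a + c * t) * exp (b * t)" by (simp add: mult.assoc flip: exp_add)
  with N[OF t] show ?thesis unfolding G_def by linarith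
qed

lemma symmetric_sums_tendsto:
  fixes f :: "int \<Rightarrow> real"
  assumes "f summable_on UNIV"
  shows "(\<lambda>n. \<Sum>k\<in>{- int n..int n}. f k) \<longlonglongrightarrow> (\<Sum>\<^sub>\<infinity>k. f k)"
proof (rule filterlim_compose[OF infsum_tendsto[OF assms]])
  show "filterlim (\<lambda>n. {- int n..int n}) (finite_subsets_at_top UNIV) sequentially"
    unfolding filterlim_finite_subsets_at_top
  proof (intro allI impI)
    fix X :: "int set" assume X: "finite X \<and> X \<subseteq> UNIV"
    define m where "m = nat (Max (insert 0 (abs ` X)))"
    have m: "\<bar>x\<bar> \<le> int m" if "x \<in> X" for x
    proof -
      have "\<bar>x\<bar> \<le> Max (insert 0 (abs ` X))" using X that by (intro Max_ge) auto
      then show ?thesis unfolding m_def by linarith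
    qed
    show "\<forall>\<^sub>F n in sequentially. finite {- int n..int n} \<and> X \<subseteq> {- int n..int n} \<and> {- int n..int n} \<subseteq> UNIV"
      using eventually_ge_at_top[of m]
    proof eventually_elim
      case (elim n)
      have "X \<subseteq> {- int n..int n}"
      proof
        fix x assume "x \<in> X"
        from m[OF this] elim show "x \<in> {- int n..int n}" by auto
      qed
      then show ?case by simp
    qed
  qed
qed

text \<open>Consecutive symmetric sums differ by f(n + 1) + f(-n - 1), two nonnegative terms. The
  sequences are those met at the ends of a symmetric interval of sites when the energy flux is
  evaluated there.\<close>

lemma tendsto_zero_of_summable_int:
  fixes f :: "int \<Rightarrow> real"
  assumes f: "f summable_on UNIV" and nn: "\<And>k. f k \<ge> 0"
  shows "(\<lambda>n. f (int n + 1)) \<longlonglongrightarrow> 0" "(\<lambda>n. f (- int n)) \<longlonglongrightarrow> 0" "(\<lambda>n. f (- int n - 1)) \<longlonglongrightarrow> 0"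
proof -
  let ?s = "\<lambda>n. \<Sum>k\<in>{- int n..int n}. f k"
  have lim: "(\<lambda>n. ?s (Suc n) - ?s n) \<longlonglongrightarrow> 0"
    using tendsto_diff[OF LIMSEQ_Suc[OF symmetric_sums_tendsto[OF f]] symmetric_sums_tendsto[OF f]] by simp
  have step: "?s (Suc n) - ?s n = f (int n + 1) + f (- int n - 1)" for n
  proof -
    have "{- int (Suc n)..int (Suc n)} = insert (int n + 1) (insert (- int n - 1) {- int n..int n})" by auto
    then show ?thesis by simp
  qed
  have lim': "(\<lambda>n. f (int n + 1) + f (- int n - 1)) \<longlonglongrightarrow> 0" using lim by (simp only: step)
  show "(\<lambda>n. f (int n + 1)) \<longlonglongrightarrow> 0"
    by (rule tendsto_sandwich[OF _ _ tendsto_const lim']) (auto simp: nn)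
  show l: "(\<lambda>n. f (- int n - 1)) \<longlonglongrightarrow> 0"
    by (rule tendsto_sandwich[OF _ _ tendsto_const lim']) (auto simp: nn)
  then have "(\<lambda>n. f (- int (Suc n))) \<longlonglongrightarrow> 0"
    by (rule Lim_transform_eventually) (auto intro!: always_eventually arg_cong[of _ _ f])
  then show "(\<lambda>n. f (- int n)) \<longlonglongrightarrow> 0" by (rule LIMSEQ_imp_Suc)
qed

lemma sum_telescope_symmetric:
  fixes f :: "int \<Rightarrow> real"
  shows "(\<Sum>k\<in>{- int n..int n}. f (k + 1) - f k) = f (int n + 1) - f (- int n)"
proof (induction n)
  case (Suc n)
  have eq: "{- int (Suc n)..int (Suc n)} = insert (int n + 1) (insert (- int n - 1) {- int n..int n})" by auto
  have "(\<Sum>k\<in>{- int (Suc n)..int (Suc n)}. f (k + 1) - f k)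
      = (f (int n + 1 + 1) - f (int n + 1)) + ((f (- int n - 1 + 1) - f (- int n - 1)) + (f (int n + 1) - f (- int n)))"
    unfolding eq Suc[symmetric] by (subst sum.insert; simp)+
  moreover have "f (- int n - 1 + 1) = f (- int n)" by (rule arg_cong[of _ _ f]) simp
  moreover have "f (- int n - 1) = f (- int (Suc n))" by (rule arg_cong[of _ _ f]) simp
  moreover have "f (int n + 1) = f (int (Suc n))" by (rule arg_cong[of _ _ f]) simp
  moreover have "f (int n + 1 + 1) = f (int (Suc n) + 1)" by (rule arg_cong[of _ _ f]) simp
  ultimately show ?case by linarith
qed simp

lemma two_mult_le: "2 * (x::real) * y \<le> e * x\<^sup>2 + y\<^sup>2 / e" if "e > 0"
proof -
  have "0 \<le> (e * x - y)\<^sup>2 / e" using that by simp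
  also have "\<dots> = e * x\<^sup>2 - 2 * x * y + y\<^sup>2 / e" using that by (simp add: power2_eq_square field_simps)
  finally show ?thesis by simp
qed

lemma square_sum_bounds:
  fixes R S :: "int \<Rightarrow> real"
  assumes "(\<lambda>k. (R k)\<^sup>2 + (S k)\<^sup>2) summable_on UNIV" "finite F"
  defines "N \<equiv> (\<Sum>\<^sub>\<infinity>k. (R k)\<^sup>2 + (S k)\<^sup>2)"
  shows "(\<Sum>k\<in>F. (R (k + a))\<^sup>2) \<le> N" "(\<Sum>k\<in>F. (S (k + a))\<^sup>2) \<le> N" "(\<Sum>k\<in>F. (R k)\<^sup>2 + (S k)\<^sup>2) \<le> N"
proof -
  have *: "(\<Sum>k\<in>G. (R k)\<^sup>2 + (S k)\<^sup>2) \<le> N" if "finite G" for G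
    unfolding N_def using assms that by (intro finite_sum_le_infsum) auto
  show "(\<Sum>k\<in>F. (R k)\<^sup>2 + (S k)\<^sup>2) \<le> N" using * assms by blast
  have sh: "(\<Sum>k\<in>F. f (k + a)) = (\<Sum>k\<in>(\<lambda>k. k + a) ` F. f k)" for f :: "int \<Rightarrow> real"
    by (subst sum.reindex) (auto simp: inj_on_def)
  have "(\<Sum>k\<in>(\<lambda>k. k + a) ` F. (R k)\<^sup>2) \<le> (\<Sum>k\<in>(\<lambda>k. k + a) ` F. (R k)\<^sup>2 + (S k)\<^sup>2)"
    "(\<Sum>k\<in>(\<lambda>k. k + a) ` F. (S k)\<^sup>2) \<le> (\<Sum>k\<in>(\<lambda>k. k + a) ` F. (R k)\<^sup>2 + (S k)\<^sup>2)"
    by (intro sum_mono; simp)+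
  then show "(\<Sum>k\<in>F. (R (k + a))\<^sup>2) \<le> N" "(\<Sum>k\<in>F. (S (k + a))\<^sup>2) \<le> N"
    using *[of "(\<lambda>k. k + a) ` F"] assms(2) sh[of "\<lambda>k. (R k)\<^sup>2"] sh[of "\<lambda>k. (S k)\<^sup>2"] by auto
qed

text \<open>Young's inequality with weight e for every product of an unknown with a source d, p or
  p', so that sources appear divided by e and unknowns multiplied by e. Products of S0 with the
  R-terms of q already carry a factor e and are split evenly.\<close>

lemma bulk_bound:
  fixes S0 q Ra Rb Rc Rd d p p' \<mu> mw v1 B L e :: real
  assumes e: "0 < e" and L: "0 \<le> L" and B: "0 \<le> \<mu>" "\<mu> \<le> B" "0 \<le> mw" "mw \<le> B" "\<bar>v1\<bar> \<le> B"
    and q: "\<bar>q\<bar> \<le> L * e * (\<bar>Ra\<bar> + \<bar>Rb\<bar> + \<bar>Rc\<bar>) + \<bar>d\<bar>"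
  shows "2 * \<mu> * S0 * q + 2 * mw * Rb * p + 2 * v1 * (Rc - Rb) * (p' - p)
    \<le> B * ((3 * L + 1) * e * S0\<^sup>2 + L * e * (Ra\<^sup>2 + Rb\<^sup>2 + Rc\<^sup>2) + d\<^sup>2 / e + e * Rb\<^sup>2 + p\<^sup>2 / e
        + e * (2 * Rc\<^sup>2 + 2 * Rb\<^sup>2) + (2 * p'\<^sup>2 + 2 * p\<^sup>2) / e)"
proof -
  have B0: "0 \<le> B" using B by linarith
  have ab: "2 * \<bar>x\<bar> * \<bar>y\<bar> \<le> x\<^sup>2 + y\<^sup>2" for x y :: real using two_mult_le[of 1 "\<bar>x\<bar>" "\<bar>y\<bar>"] by simp
  have ae: "2 * \<bar>x\<bar> * \<bar>y\<bar> \<le> e * x\<^sup>2 + y\<^sup>2 / e" for x y :: real using two_mult_le[OF e, of "\<bar>x\<bar>" "\<bar>y\<bar>"] by simp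
  have sq: "(x - y)\<^sup>2 \<le> 2 * x\<^sup>2 + 2 * y\<^sup>2" for x y :: real
    using zero_le_power2[of "x + y"] by (simp add: power2_eq_square algebra_simps)
  have mm: "c * x * y \<le> B * (\<bar>x\<bar> * \<bar>y\<bar>)" if "\<bar>c\<bar> \<le> B" for c x y :: real
  proof -
    have "c * x * y \<le> \<bar>c\<bar> * (\<bar>x\<bar> * \<bar>y\<bar>)" by (metis abs_ge_self abs_mult mult.assoc)
    also have "\<dots> \<le> B * (\<bar>x\<bar> * \<bar>y\<bar>)" using that by (intro mult_right_mono) auto
    finally show ?thesis .
  qed
  have t1: "2 * (\<bar>S0\<bar> * \<bar>q\<bar>) \<le> (3 * L + 1) * e * S0\<^sup>2 + L * e * (Ra\<^sup>2 + Rb\<^sup>2 + Rc\<^sup>2) + d\<^sup>2 / e"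
  proof -
    have "\<bar>S0\<bar> * \<bar>q\<bar> \<le> \<bar>S0\<bar> * (L * e * (\<bar>Ra\<bar> + \<bar>Rb\<bar> + \<bar>Rc\<bar>) + \<bar>d\<bar>)" using q by (intro mult_left_mono) auto
    then have "2 * (\<bar>S0\<bar> * \<bar>q\<bar>) \<le> L * e * (2 * \<bar>S0\<bar> * \<bar>Ra\<bar> + 2 * \<bar>S0\<bar> * \<bar>Rb\<bar> + 2 * \<bar>S0\<bar> * \<bar>Rc\<bar>) + 2 * \<bar>S0\<bar> * \<bar>d\<bar>"
      by (simp add: algebra_simps)
    also have "\<dots> \<le> L * e * ((S0\<^sup>2 + Ra\<^sup>2) + (S0\<^sup>2 + Rb\<^sup>2) + (S0\<^sup>2 + Rc\<^sup>2)) + (e * S0\<^sup>2 + d\<^sup>2 / e)"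
      using L e by (intro add_mono mult_left_mono ab ae) auto
    finally show ?thesis by (simp add: algebra_simps)
  qed
  have "2 * \<mu> * S0 * q \<le> B * (2 * (\<bar>S0\<bar> * \<bar>q\<bar>))" using mm[of \<mu> S0 q] B by simp
  moreover have "2 * mw * Rb * p \<le> B * (2 * (\<bar>Rb\<bar> * \<bar>p\<bar>))" using mm[of mw Rb p] B by simp
  moreover have "2 * v1 * (Rc - Rb) * (p' - p) \<le> B * (2 * (\<bar>Rc - Rb\<bar> * \<bar>p' - p\<bar>))" using mm[of v1 "Rc - Rb" "p' - p"] B by simp
  ultimately have "2 * \<mu> * S0 * q + 2 * mw * Rb * p + 2 * v1 * (Rc - Rb) * (p' - p)
     \<le> B * (2 * (\<bar>S0\<bar> * \<bar>q\<bar>) + 2 * (\<bar>Rb\<bar> * \<bar>p\<bar>) + 2 * (\<bar>Rc - Rb\<bar> * \<bar>p' - p\<bar>))"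
    by (simp only: distrib_left)
  also have "\<dots> \<le> B * (((3 * L + 1) * e * S0\<^sup>2 + L * e * (Ra\<^sup>2 + Rb\<^sup>2 + Rc\<^sup>2) + d\<^sup>2 / e) + (e * Rb\<^sup>2 + p\<^sup>2 / e)
      + (e * (2 * Rc\<^sup>2 + 2 * Rb\<^sup>2) + (2 * p'\<^sup>2 + 2 * p\<^sup>2) / e))"
  proof (intro mult_left_mono add_mono t1 B0)
    show "2 * (\<bar>Rb\<bar> * \<bar>p\<bar>) \<le> e * Rb\<^sup>2 + p\<^sup>2 / e" using ae[of Rb p] by simp
    have "2 * (\<bar>Rc - Rb\<bar> * \<bar>p' - p\<bar>) \<le> e * (Rc - Rb)\<^sup>2 + (p' - p)\<^sup>2 / e" using ae[of "Rc - Rb" "p' - p"] by simp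
    also have "\<dots> \<le> e * (2 * Rc\<^sup>2 + 2 * Rb\<^sup>2) + (2 * p'\<^sup>2 + 2 * p\<^sup>2) / e"
      using e by (intro add_mono mult_left_mono divide_right_mono sq) auto
    finally show "2 * (\<bar>Rc - Rb\<bar> * \<bar>p' - p\<bar>) \<le> e * (2 * Rc\<^sup>2 + 2 * Rb\<^sup>2) + (2 * p'\<^sup>2 + 2 * p\<^sup>2) / e" .
  qed
  finally show ?thesis by (simp add: algebra_simps)
qed

text \<open>The linearised chain in first-order form: \<open>\<mu> k\<close> is the mass of site k
  and \<open>\<omega> k\<close> its on-site stiffness per mass. The defect p of the relation R' = S
  is kept because the approximate velocity is not exactly the derivative of the approximate
  position.\<close>

definition perturbed_chain :: "real \<Rightarrow> (int \<Rightarrow> real) \<Rightarrow> (int \<Rightarrow> real) \<Rightarrow> real \<Rightarrow> (int \<Rightarrow> real \<Rightarrow> real) \<Rightarrow>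
    (int \<Rightarrow> real \<Rightarrow> real) \<Rightarrow> (int \<Rightarrow> real \<Rightarrow> real) \<Rightarrow> (int \<Rightarrow> real \<Rightarrow> real) \<Rightarrow> bool" where
  "perturbed_chain v1 \<mu> \<omega> T R S p q \<longleftrightarrow>
    (\<forall>t\<in>{0..T}. (\<lambda>k. (R k t)\<^sup>2 + (S k t)\<^sup>2) summable_on UNIV) \<and>
    continuous_on {0..T} (\<lambda>t. \<Sum>\<^sub>\<infinity>k. (R k t)\<^sup>2 + (S k t)\<^sup>2) \<and>
    (\<forall>k. \<forall>t\<in>{0..T}. (R k has_real_derivative S k t + p k t) (at t within {0..T})) \<and>
    (\<forall>k. \<forall>t\<in>{0..T}. (S k has_real_derivative
       v1 / \<mu> k * (R (k + 1) t - 2 * R k t + R (k - 1) t) - \<omega> k * R k t + q k t) (at t within {0..T}))"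

lemma perturbed_chain_restrict:
  assumes "perturbed_chain v1 \<mu> \<omega> T R S p q" "t \<in> {0..T}"
  shows "perturbed_chain v1 \<mu> \<omega> t R S p q"
proof -
  have sub: "{0..t} \<subseteq> {0..T}" using assms(2) by auto
  show ?thesis
    using assms(1) sub continuous_on_subset[OF _ sub] has_field_derivative_subset[OF _ sub]
    unfolding perturbed_chain_def by blast
qed

text \<open>Energy method for the sum of \<mu> S^2 + \<mu> \<omega> R^2 + v1 (R (k+1) - R k)^2.
  Multiplication by \<mu> makes the coupling symmetric, so the interaction terms telescope.
  Derivatives are only known site by site, hence the energy is cut to [-n, n]; the flux through the
  ends disappears as n grows. Since v1 may be negative, coercivity rests on the bound for \<mu>
  \<omega> + 4 v1.\<close>

lemma energy_bound:
  fixes \<mu> \<omega> :: "int \<Rightarrow> real" and v1 c0 B L D \<tau> :: real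
  assumes c0: "0 < c0" "\<And>k. c0 \<le> \<mu> k" "\<And>k. c0 \<le> \<mu> k * \<omega> k" "\<And>k. c0 \<le> \<mu> k * \<omega> k + 4 * v1"
    and B: "\<And>k. \<mu> k \<le> B" "\<And>k. \<mu> k * \<omega> k \<le> B" "\<bar>v1\<bar> \<le> B"
    and LD: "0 \<le> L" "0 \<le> D" "0 \<le> \<tau>"
  shows "\<exists>C>0. \<forall>\<epsilon> T R S p q d. 0 < \<epsilon> \<longrightarrow> 0 \<le> T \<longrightarrow> \<epsilon> * T \<le> \<tau> \<longrightarrow>
    perturbed_chain v1 \<mu> \<omega> T R S p q \<longrightarrow>
    (\<forall>k. \<forall>t\<in>{0..T}. \<bar>q k t\<bar> \<le> L * \<epsilon> * (\<bar>R (k - 1) t\<bar> + \<bar>R k t\<bar> + \<bar>R (k + 1) t\<bar>) + \<bar>d k t\<bar>) \<longrightarrow>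
    (\<forall>t\<in>{0..T}. \<forall>F. finite F \<longrightarrow> (\<Sum>k\<in>F. (d k t)\<^sup>2) \<le> D * \<epsilon> ^ 5 \<and> (\<Sum>k\<in>F. (p k t)\<^sup>2) \<le> D * \<epsilon> ^ 5) \<longrightarrow>
    (\<forall>t\<in>{0..T}. (\<Sum>\<^sub>\<infinity>k. (R k t)\<^sup>2 + (S k t)\<^sup>2) \<le> C * ((\<Sum>\<^sub>\<infinity>k. (R k 0)\<^sup>2 + (S k 0)\<^sup>2) + \<epsilon> ^ 3))"
proof -
  have B0: "0 < B" using c0(1) c0(2)[of 0] B(1)[of 0] by linarith
  \<comment> \<open>Initial energy over the coercivity constant, plus the sources accumulated over
    the time \<tau> / \<epsilon>, times the exponential from Gronwall's inequality.\<close>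
  define C where "C = (6 * B / c0 + 6 * B * D * \<tau> / c0) * exp (B * (6 * L + 6) * \<tau> / c0)"
  have Cpos: "C > 0" unfolding C_def using B0 c0 LD by (intro mult_pos_pos add_pos_nonneg) auto
  show ?thesis
  proof (intro exI[of _ C] conjI Cpos allI impI ballI)
    fix \<epsilon> T :: real and R S p q d :: "int \<Rightarrow> real \<Rightarrow> real" and t
    assume e: "0 < \<epsilon>" and T: "0 \<le> T" "\<epsilon> * T \<le> \<tau>"
      and pc: "perturbed_chain v1 \<mu> \<omega> T R S p q"
      and q: "\<forall>k. \<forall>t\<in>{0..T}. \<bar>q k t\<bar> \<le> L * \<epsilon> * (\<bar>R (k - 1) t\<bar> + \<bar>R k t\<bar> + \<bar>R (k + 1) t\<bar>) + \<bar>d k t\<bar>"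
      and dp: "\<forall>t\<in>{0..T}. \<forall>F. finite F \<longrightarrow> (\<Sum>k\<in>F. (d k t)\<^sup>2) \<le> D * \<epsilon> ^ 5 \<and> (\<Sum>k\<in>F. (p k t)\<^sup>2) \<le> D * \<epsilon> ^ 5"
      and t: "t \<in> {0..T}"
    have sm: "\<forall>t\<in>{0..T}. (\<lambda>k. (R k t)\<^sup>2 + (S k t)\<^sup>2) summable_on UNIV"
      and cN: "continuous_on {0..T} (\<lambda>t. \<Sum>\<^sub>\<infinity>k. (R k t)\<^sup>2 + (S k t)\<^sup>2)"
      and dR: "\<forall>k. \<forall>t\<in>{0..T}. (R k has_real_derivative S k t + p k t) (at t within {0..T})"
      and dS: "\<forall>k. \<forall>t\<in>{0..T}. (S k has_real_derivative
       v1 / \<mu> k * (R (k + 1) t - 2 * R k t + R (k - 1) t) - \<omega> k * R k t + q k t) (at t within {0..T})"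
      using pc unfolding perturbed_chain_def by blast+
    define N where "N = (\<lambda>t. \<Sum>\<^sub>\<infinity>k. (R k t)\<^sup>2 + (S k t)\<^sup>2)"
    have cN': "continuous_on {0..T} N" using cN by (simp add: N_def)
    define J where "J = (\<lambda>n::nat. {- int n..int n})"
    have J: "finite (J n)" for n by (simp add: J_def)
    define E where "E = (\<lambda>n t. \<Sum>k\<in>J n. \<mu> k * (S k t)\<^sup>2 + \<mu> k * \<omega> k * (R k t)\<^sup>2 + v1 * (R (k + 1) t - R k t)\<^sup>2)"
    \<comment> \<open>\<open>2 * v1 * g k\<close> is the energy passing between the sites k - 1 and
      k; its differences are all that the coupling terms leave in the time derivative.\<close>
    define g where "g = (\<lambda>k t. (R k t - R (k - 1) t) * S k t)"
    define bulk where "bulk = (\<lambda>k t. 2 * \<mu> k * S k t * q k t + 2 * (\<mu> k * \<omega> k) * R k t * p k t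
        + 2 * v1 * (R (k + 1) t - R k t) * (p (k + 1) t - p k t))"
    define flux where "flux = (\<lambda>n t. 2 * v1 * (g (int n + 1) t - g (- int n) t))"
    \<comment> \<open>Counting in \<open>bulk_bound\<close>: N occurs with weight (3 L + 1) + 3 L +
      1 + 4 = 6 L + 6, and the sources, each of size D \<epsilon>^5 / \<epsilon>, with weight 1 + 1
      + 4 = 6.\<close>
    define b where "b = B * (6 * L + 6) * \<epsilon>"
    define c where "c = 6 * B * D * \<epsilon> ^ 4"
    have bc: "0 \<le> b" "0 \<le> c" using B0 LD e by (auto simp: b_def c_def)
    have mu0: "\<mu> k \<noteq> 0" "0 \<le> \<mu> k" "0 \<le> \<mu> k * \<omega> k" for k
      using c0(1) c0(2)[of k] c0(3)[of k] by linarith+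
    have Nnn: "0 \<le> N s" for s unfolding N_def by (intro infsum_nonneg) auto
    have bnds: "(\<Sum>k\<in>J n. (R (k + a) s)\<^sup>2) \<le> N s" "(\<Sum>k\<in>J n. (S (k + a) s)\<^sup>2) \<le> N s"
      if "s \<in> {0..T}" for s n a
      unfolding N_def using sm that J by (intro square_sum_bounds[of "\<lambda>k. R k s" "\<lambda>k. S k s"]; simp)+
    have pt: "(R k s)\<^sup>2 \<le> N s" "(S k s)\<^sup>2 \<le> N s" if "s \<in> {0..T}" for s k
      unfolding N_def using sm that
        square_sum_bounds(1)[of "\<lambda>k. R k s" "\<lambda>k. S k s" "{k}" 0] square_sum_bounds(2)[of "\<lambda>k. R k s" "\<lambda>k. S k s" "{k}" 0]
      by auto
    have dE: "(E n has_real_derivative (\<Sum>k\<in>J n. bulk k s) + flux n s) (at s within {0..T})" if s: "s \<in> {0..T}" for n s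
    proof -
      note dR' = dR[rule_format, OF s] and dS' = dS[rule_format, OF s]
      have "(E n has_real_derivative (\<Sum>k\<in>J n. bulk k s + 2 * v1 * (g (k + 1) s - g k s))) (at s within {0..T})"
        unfolding E_def
      proof (rule DERIV_sum)
        fix k
        have "((\<lambda>t. \<mu> k * (S k t)\<^sup>2 + \<mu> k * \<omega> k * (R k t)\<^sup>2 + v1 * (R (k + 1) t - R k t)\<^sup>2) has_real_derivative
          \<mu> k * (2 * S k s * (v1 / \<mu> k * (R (k + 1) s - 2 * R k s + R (k - 1) s) - \<omega> k * R k s + q k s))
          + \<mu> k * \<omega> k * (2 * R k s * (S k s + p k s))
          + v1 * (2 * (R (k + 1) s - R k s) * (S (k + 1) s + p (k + 1) s - (S k s + p k s)))) (at s within {0..T})"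
          by (rule derivative_eq_intros dR' dS' refl | simp)+
        moreover have "\<mu> k * (2 * S k s * (v1 / \<mu> k * (R (k + 1) s - 2 * R k s + R (k - 1) s) - \<omega> k * R k s + q k s))
          + \<mu> k * \<omega> k * (2 * R k s * (S k s + p k s))
          + v1 * (2 * (R (k + 1) s - R k s) * (S (k + 1) s + p (k + 1) s - (S k s + p k s)))
          = bulk k s + 2 * v1 * (g (k + 1) s - g k s)"
          using mu0(1)[of k] by (simp add: bulk_def g_def field_simps)
        ultimately show "((\<lambda>t. \<mu> k * (S k t)\<^sup>2 + \<mu> k * \<omega> k * (R k t)\<^sup>2 + v1 * (R (k + 1) t - R k t)\<^sup>2) has_real_derivative
          bulk k s + 2 * v1 * (g (k + 1) s - g k s)) (at s within {0..T})" by simp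
      qed
      moreover have "(\<Sum>k\<in>J n. g (k + 1) s - g k s) = g (int n + 1) s - g (- int n) s"
        using sum_telescope_symmetric[of "\<lambda>k. g k s" n] by (simp add: J_def)
      ultimately show ?thesis by (simp add: sum.distrib flux_def sum_distrib_left[symmetric])
    qed
    have bulk: "(\<Sum>k\<in>J n. bulk k s) \<le> b * N s + c" if s: "s \<in> {0..T}" for n s
    proof -
      have "(\<Sum>k\<in>J n. bulk k s) \<le> (\<Sum>k\<in>J n. B * ((3 * L + 1) * \<epsilon> * (S (k + 0) s)\<^sup>2
          + L * \<epsilon> * ((R (k + (-1)) s)\<^sup>2 + (R (k + 0) s)\<^sup>2 + (R (k + 1) s)\<^sup>2) + (d k s)\<^sup>2 / \<epsilon> + \<epsilon> * (R (k + 0) s)\<^sup>2 + (p k s)\<^sup>2 / \<epsilon>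
          + \<epsilon> * (2 * (R (k + 1) s)\<^sup>2 + 2 * (R (k + 0) s)\<^sup>2) + (2 * (p (k + 1) s)\<^sup>2 + 2 * (p k s)\<^sup>2) / \<epsilon>))"
        unfolding bulk_def
      proof (rule sum_mono)
        fix k
        show "2 * \<mu> k * S k s * q k s + 2 * (\<mu> k * \<omega> k) * R k s * p k s
            + 2 * v1 * (R (k + 1) s - R k s) * (p (k + 1) s - p k s)
          \<le> B * ((3 * L + 1) * \<epsilon> * (S (k + 0) s)\<^sup>2
          + L * \<epsilon> * ((R (k + (-1)) s)\<^sup>2 + (R (k + 0) s)\<^sup>2 + (R (k + 1) s)\<^sup>2) + (d k s)\<^sup>2 / \<epsilon> + \<epsilon> * (R (k + 0) s)\<^sup>2 + (p k s)\<^sup>2 / \<epsilon>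
          + \<epsilon> * (2 * (R (k + 1) s)\<^sup>2 + 2 * (R (k + 0) s)\<^sup>2) + (2 * (p (k + 1) s)\<^sup>2 + 2 * (p k s)\<^sup>2) / \<epsilon>)"
          using bulk_bound[OF e LD(1) mu0(2)[of k] B(1)[of k] mu0(3)[of k] B(2)[of k] B(3) q[rule_format, OF s, of k], of "S k s"]
          by simp
      qed
      also have "\<dots> = B * ((3 * L + 1) * \<epsilon> * (\<Sum>k\<in>J n. (S (k + 0) s)\<^sup>2)
          + L * \<epsilon> * ((\<Sum>k\<in>J n. (R (k + (-1)) s)\<^sup>2) + (\<Sum>k\<in>J n. (R (k + 0) s)\<^sup>2) + (\<Sum>k\<in>J n. (R (k + 1) s)\<^sup>2))
          + (\<Sum>k\<in>J n. (d k s)\<^sup>2) / \<epsilon> + \<epsilon> * (\<Sum>k\<in>J n. (R (k + 0) s)\<^sup>2) + (\<Sum>k\<in>J n. (p k s)\<^sup>2) / \<epsilon>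
          + \<epsilon> * (2 * (\<Sum>k\<in>J n. (R (k + 1) s)\<^sup>2) + 2 * (\<Sum>k\<in>J n. (R (k + 0) s)\<^sup>2))
          + (2 * (\<Sum>k\<in>J n. (p (k + 1) s)\<^sup>2) + 2 * (\<Sum>k\<in>J n. (p k s)\<^sup>2)) / \<epsilon>)"
        by (simp only: sum.distrib sum_distrib_left[symmetric] sum_divide_distrib[symmetric])
      also have "\<dots> \<le> B * ((3 * L + 1) * \<epsilon> * N s + L * \<epsilon> * (N s + N s + N s) + D * \<epsilon> ^ 5 / \<epsilon> + \<epsilon> * N s + D * \<epsilon> ^ 5 / \<epsilon>
          + \<epsilon> * (2 * N s + 2 * N s) + (2 * (D * \<epsilon> ^ 5) + 2 * (D * \<epsilon> ^ 5)) / \<epsilon>)"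
      proof -
        have "(\<Sum>k\<in>J n. (p (k + 1) s)\<^sup>2) = (\<Sum>k\<in>(\<lambda>k. k + 1) ` J n. (p k s)\<^sup>2)"
          by (subst sum.reindex) (auto simp: inj_on_def)
        then have p1: "(\<Sum>k\<in>J n. (p (k + 1) s)\<^sup>2) \<le> D * \<epsilon> ^ 5" using dp s J by simp
        have p2: "(\<Sum>k\<in>J n. (p k s)\<^sup>2) \<le> D * \<epsilon> ^ 5" "(\<Sum>k\<in>J n. (d k s)\<^sup>2) \<le> D * \<epsilon> ^ 5" using dp s J by auto
        show ?thesis
          by (intro mult_left_mono add_mono divide_right_mono bnds[OF s] p1 p2) (use B0 LD e in auto)
      qed
      also have "\<dots> = b * N s + c"
      proof -
        have "\<epsilon> ^ 5 = \<epsilon> ^ 4 * \<epsilon>" by (simp add: eval_nat_numeral)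
        then have 5: "D * \<epsilon> ^ 5 / \<epsilon> = D * \<epsilon> ^ 4" "(2 * (D * \<epsilon> ^ 5) + 2 * (D * \<epsilon> ^ 5)) / \<epsilon> = 4 * (D * \<epsilon> ^ 4)"
          using e by simp_all
        show ?thesis unfolding 5 b_def c_def by (simp add: algebra_simps)
      qed
      finally show ?thesis .
    qed
    have cR: "continuous_on {0..T} (R k)" "continuous_on {0..T} (S k)" for k
      using dR dS unfolding continuous_on_eq_continuous_within
      by (blast intro: DERIV_continuous)+
    have cflux: "continuous_on {0..T} (flux n)" for n
      unfolding flux_def g_def by (intro continuous_intros cR)
    have main: "c0 * N t \<le> 6 * B * N 0 + integral {0..t} (\<lambda>s. b * N s + c)" if t: "t \<in> {0..T}" for t
    proof -
      have sub: "{0..t} \<subseteq> {0..T}" using t by auto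
      have 0: "0 \<in> {0..T}" using T by auto
      have cNt: "continuous_on {0..t} N" using cN' sub continuous_on_subset by blast
      have up: "E n t \<le> E n 0 + (integral {0..t} (\<lambda>s. b * N s + c) + integral {0..t} (flux n))" for n
      proof -
        have "((\<lambda>s. (\<Sum>k\<in>J n. bulk k s) + flux n s) has_integral (E n t - E n 0)) {0..t}"
        proof (rule fundamental_theorem_of_calculus)
          fix s assume "s \<in> {0..t}"
          then have "s \<in> {0..T}" using sub by blast
          from has_field_derivative_subset[OF dE[OF this] sub]
          show "(E n has_vector_derivative ((\<Sum>k\<in>J n. bulk k s) + flux n s)) (at s within {0..t})"
            by (simp add: has_real_derivative_iff_has_vector_derivative)
        qed (use t in auto)
        moreover have "((\<lambda>s. (b * N s + c) + flux n s) has_integral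
            (integral {0..t} (\<lambda>s. b * N s + c) + integral {0..t} (flux n))) {0..t}"
          by (intro has_integral_add integrable_integral integrable_continuous_real continuous_intros cNt
              continuous_on_subset[OF cflux sub])
        ultimately have "E n t - E n 0 \<le> integral {0..t} (\<lambda>s. b * N s + c) + integral {0..t} (flux n)"
        proof (rule has_integral_le)
          fix s assume "s \<in> {0..t}"
          then show "(\<Sum>k\<in>J n. bulk k s) + flux n s \<le> (b * N s + c) + flux n s" using bulk[of s n] sub by auto
        qed
        then show ?thesis by simp
      qed
      \<comment> \<open>B for S, B for \<mu> \<omega> R^2, and 4 B for the squared
        differences.\<close>
      have init: "E n 0 \<le> 6 * B * N 0" for n
      proof -
        have "E n 0 \<le> (\<Sum>k\<in>J n. B * (S (k + 0) 0)\<^sup>2 + B * (R (k + 0) 0)\<^sup>2 + B * (2 * (R (k + 1) 0)\<^sup>2 + 2 * (R (k + 0) 0)\<^sup>2))"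
          unfolding E_def
        proof (intro sum_mono add_mono)
          fix k
          have "(R (k + 1) 0 - R k 0)\<^sup>2 \<le> 2 * (R (k + 1) 0)\<^sup>2 + 2 * (R (k + 0) 0)\<^sup>2"
            using zero_le_power2[of "R (k + 1) 0 + R k 0"] by (simp add: power2_eq_square algebra_simps)
          then show "v1 * (R (k + 1) 0 - R k 0)\<^sup>2 \<le> B * (2 * (R (k + 1) 0)\<^sup>2 + 2 * (R (k + 0) 0)\<^sup>2)"
            using B(3) B0 by (intro mult_mono) auto
        qed (use B in \<open>auto intro!: mult_right_mono\<close>)
        also have "\<dots> = B * (\<Sum>k\<in>J n. (S (k + 0) 0)\<^sup>2) + B * (\<Sum>k\<in>J n. (R (k + 0) 0)\<^sup>2)
            + B * (2 * (\<Sum>k\<in>J n. (R (k + 1) 0)\<^sup>2) + 2 * (\<Sum>k\<in>J n. (R (k + 0) 0)\<^sup>2))"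
          by (simp only: sum.distrib sum_distrib_left[symmetric])
        also have "\<dots> \<le> B * N 0 + B * N 0 + B * (2 * N 0 + 2 * N 0)"
          by (intro add_mono mult_left_mono bnds[OF 0]) (use B0 in auto)
        finally show ?thesis by (simp add: algebra_simps)
      qed
      \<comment> \<open>Coercivity up to a boundary term. Only the negative part v' of v1 hurts, and
        (R (k+1) - R k)^2 \<le> 2 R (k+1)^2 + 2 (R k)^2 charges 2 v' to each neighbour, 4 v' per
        site in total. Shifting the index in one half of this costs the term at n + 1, which
        vanishes in the limit.\<close>
      have low: "c0 * (\<Sum>k\<in>J n. (R k t)\<^sup>2 + (S k t)\<^sup>2) - 2 * B * (R (int n + 1) t)\<^sup>2 \<le> E n t" for n
      proof -
        define v' where "v' = min v1 0"
        have v': "v' \<le> 0" "v' \<le> v1" "- B \<le> v'" "c0 \<le> \<mu> k * \<omega> k + 4 * v'" for k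
          using B(3) c0(3)[of k] c0(4)[of k] B0 by (auto simp: v'_def min_def)
        have "(\<Sum>k\<in>J n. (R (k + 1) t)\<^sup>2 - (R k t)\<^sup>2) = (R (int n + 1) t)\<^sup>2 - (R (- int n) t)\<^sup>2"
          using sum_telescope_symmetric[of "\<lambda>k. (R k t)\<^sup>2" n] by (simp add: J_def)
        then have tel: "(\<Sum>k\<in>J n. (R (k + 1) t)\<^sup>2) \<le> (\<Sum>k\<in>J n. (R k t)\<^sup>2) + (R (int n + 1) t)\<^sup>2"
          unfolding sum_subtractf using zero_le_power2[of "R (- int n) t"] by linarith
        have "c0 * (\<Sum>k\<in>J n. (R k t)\<^sup>2 + (S k t)\<^sup>2) = (\<Sum>k\<in>J n. c0 * (S k t)\<^sup>2 + c0 * (R k t)\<^sup>2)"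
          by (simp add: sum_distrib_left algebra_simps)
        also have "\<dots> \<le> (\<Sum>k\<in>J n. \<mu> k * (S k t)\<^sup>2 + (\<mu> k * \<omega> k + 4 * v') * (R k t)\<^sup>2)"
          using c0(2) v'(4) by (intro sum_mono add_mono mult_right_mono) auto
        also have "\<dots> = (\<Sum>k\<in>J n. \<mu> k * (S k t)\<^sup>2 + \<mu> k * \<omega> k * (R k t)\<^sup>2) + 4 * v' * (\<Sum>k\<in>J n. (R k t)\<^sup>2)"
          by (simp add: sum.distrib sum_distrib_left algebra_simps)
        finally have s1: "c0 * (\<Sum>k\<in>J n. (R k t)\<^sup>2 + (S k t)\<^sup>2) \<le> (\<Sum>k\<in>J n. \<mu> k * (S k t)\<^sup>2 + \<mu> k * \<omega> k * (R k t)\<^sup>2)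
            + 4 * v' * (\<Sum>k\<in>J n. (R k t)\<^sup>2)" .
        have "2 * v' * (\<Sum>k\<in>J n. (R k t)\<^sup>2) \<le> 2 * v' * ((\<Sum>k\<in>J n. (R (k + 1) t)\<^sup>2) - (R (int n + 1) t)\<^sup>2)"
          using tel v'(1) by (intro mult_left_mono_neg) auto
        also have "\<dots> \<le> 2 * v' * (\<Sum>k\<in>J n. (R (k + 1) t)\<^sup>2) + 2 * B * (R (int n + 1) t)\<^sup>2"
        proof -
          have "- v' * (R (int n + 1) t)\<^sup>2 \<le> B * (R (int n + 1) t)\<^sup>2" using v'(3) by (intro mult_right_mono) auto
          then show ?thesis by (simp add: algebra_simps)
        qed
        finally have s2: "2 * v' * (\<Sum>k\<in>J n. (R k t)\<^sup>2)
            \<le> 2 * v' * (\<Sum>k\<in>J n. (R (k + 1) t)\<^sup>2) + 2 * B * (R (int n + 1) t)\<^sup>2" .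
        have "c0 * (\<Sum>k\<in>J n. (R k t)\<^sup>2 + (S k t)\<^sup>2) \<le> (\<Sum>k\<in>J n. \<mu> k * (S k t)\<^sup>2 + \<mu> k * \<omega> k * (R k t)\<^sup>2)
            + 2 * v' * (\<Sum>k\<in>J n. (R k t)\<^sup>2) + (2 * v' * (\<Sum>k\<in>J n. (R (k + 1) t)\<^sup>2) + 2 * B * (R (int n + 1) t)\<^sup>2)"
          using s1 s2 by linarith
        also have "(\<Sum>k\<in>J n. \<mu> k * (S k t)\<^sup>2 + \<mu> k * \<omega> k * (R k t)\<^sup>2)
            + 2 * v' * (\<Sum>k\<in>J n. (R k t)\<^sup>2) + (2 * v' * (\<Sum>k\<in>J n. (R (k + 1) t)\<^sup>2) + 2 * B * (R (int n + 1) t)\<^sup>2)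
          = (\<Sum>k\<in>J n. \<mu> k * (S k t)\<^sup>2 + \<mu> k * \<omega> k * (R k t)\<^sup>2 + v' * (2 * (R (k + 1) t)\<^sup>2 + 2 * (R k t)\<^sup>2)) + 2 * B * (R (int n + 1) t)\<^sup>2"
          by (simp add: sum.distrib sum_distrib_left algebra_simps)
        also have "\<dots> \<le> E n t + 2 * B * (R (int n + 1) t)\<^sup>2"
          unfolding E_def
        proof (intro add_mono sum_mono order_refl)
          fix k
          have "v' * (2 * (R (k + 1) t)\<^sup>2 + 2 * (R k t)\<^sup>2) \<le> v' * (R (k + 1) t - R k t)\<^sup>2"
            using zero_le_power2[of "R (k + 1) t + R k t"] v'(1)
            by (intro mult_left_mono_neg) (auto simp: power2_eq_square algebra_simps)
          also have "\<dots> \<le> v1 * (R (k + 1) t - R k t)\<^sup>2" using v'(2) by (intro mult_right_mono) auto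
          finally show "v' * (2 * (R (k + 1) t)\<^sup>2 + 2 * (R k t)\<^sup>2) \<le> v1 * (R (k + 1) t - R k t)\<^sup>2" .
        qed
        finally show ?thesis by simp
      qed
      \<comment> \<open>Square-summable sequences vanish at infinity, so the flux tends to 0 at
        every time; |g| \<le> 3 N / 2 supplies the majorant 6 B N.\<close>
      have flux0: "(\<lambda>n. integral {0..t} (flux n)) \<longlonglongrightarrow> integral {0..t} (\<lambda>_. 0)"
      proof (rule dominated_convergence(2)[where h="\<lambda>s. 6 * B * N s"])
        show "flux n integrable_on {0..t}" for n
          by (intro integrable_continuous_real continuous_on_subset[OF cflux sub])
        show "(\<lambda>s. 6 * B * N s) integrable_on {0..t}"
          by (intro integrable_continuous_real continuous_intros cNt)
        show "norm (flux n s) \<le> 6 * B * N s" if "s \<in> {0..t}" for n s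
        proof -
          have s: "s \<in> {0..T}" using that sub by auto
          have gb: "\<bar>g k s\<bar> \<le> 3 / 2 * N s" for k
          proof -
            have "2 * \<bar>g k s\<bar> = 2 * \<bar>R k s - R (k - 1) s\<bar> * \<bar>S k s\<bar>" by (simp add: g_def abs_mult)
            also have "\<dots> \<le> (R k s - R (k - 1) s)\<^sup>2 + (S k s)\<^sup>2"
              using two_mult_le[of 1 "\<bar>R k s - R (k - 1) s\<bar>" "\<bar>S k s\<bar>"] by simp
            also have "(R k s - R (k - 1) s)\<^sup>2 \<le> 2 * ((R k s)\<^sup>2 + (R (k - 1) s)\<^sup>2)"
              using zero_le_power2[of "R k s + R (k - 1) s"] by (simp add: power2_eq_square algebra_simps)
            also have "(R k s)\<^sup>2 + (R (k - 1) s)\<^sup>2 \<le> N s"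
              unfolding N_def using sm s square_sum_bounds(1)[of "\<lambda>k. R k s" "\<lambda>k. S k s" "{k, k - 1}" 0] by simp
            finally show ?thesis using pt(2)[OF s, of k] by linarith
          qed
          have "norm (flux n s) = 2 * \<bar>v1\<bar> * \<bar>g (int n + 1) s - g (- int n) s\<bar>" by (simp add: flux_def abs_mult)
          also have "\<dots> \<le> 2 * B * (3 * N s)"
            using B(3) B0 gb[of "int n + 1"] gb[of "- int n"] by (intro mult_mono) auto
          finally show ?thesis by simp
        qed
        show "(\<lambda>n. flux n s) \<longlonglongrightarrow> 0" if "s \<in> {0..t}" for s
        proof -
          have s: "s \<in> {0..T}" using that sub by auto
          have sN: "(\<lambda>k. (R k s)\<^sup>2 + (S k s)\<^sup>2) summable_on UNIV" using sm s by blast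
          have z: "(\<lambda>n. R (f n) s) \<longlonglongrightarrow> 0 \<and> (\<lambda>n. S (f n) s) \<longlonglongrightarrow> 0"
            if l: "(\<lambda>n. (R (f n) s)\<^sup>2 + (S (f n) s)\<^sup>2) \<longlonglongrightarrow> 0" for f :: "nat \<Rightarrow> int"
          proof -
            have "(\<lambda>n. (R (f n) s)\<^sup>2) \<longlonglongrightarrow> 0" "(\<lambda>n. (S (f n) s)\<^sup>2) \<longlonglongrightarrow> 0"
              by (rule tendsto_sandwich[OF _ _ tendsto_const l]; simp)+
            then have "(\<lambda>n. sqrt ((R (f n) s)\<^sup>2)) \<longlonglongrightarrow> sqrt 0" "(\<lambda>n. sqrt ((S (f n) s)\<^sup>2)) \<longlonglongrightarrow> sqrt 0"
              by (intro tendsto_real_sqrt; simp)+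
            then show ?thesis by (simp add: tendsto_rabs_zero_iff)
          qed
          note z1 = z[of "\<lambda>n. int n + 1", OF tendsto_zero_of_summable_int(1)[OF sN sum_power2_ge_zero]]
            and z2 = z[of "\<lambda>n. - int n", OF tendsto_zero_of_summable_int(2)[OF sN sum_power2_ge_zero]]
            and z3 = z[of "\<lambda>n. - int n - 1", OF tendsto_zero_of_summable_int(3)[OF sN sum_power2_ge_zero]]
          have "(\<lambda>n. R (int n) s) \<longlonglongrightarrow> 0"
          proof (rule LIMSEQ_imp_Suc)
            show "(\<lambda>n. R (int (Suc n)) s) \<longlonglongrightarrow> 0"
              using z1[THEN conjunct1] by (simp add: add.commute)
          qed
          then have "(\<lambda>n. 2 * v1 * ((R (int n + 1) s - R (int n) s) * S (int n + 1) s - (R (- int n) s - R (- int n - 1) s) * S (- int n) s))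
              \<longlonglongrightarrow> 2 * v1 * ((0 - 0) * 0 - (0 - 0) * 0)"
            by (intro tendsto_intros z1[THEN conjunct1] z1[THEN conjunct2] z2[THEN conjunct1] z2[THEN conjunct2] z3[THEN conjunct1])
          then show ?thesis by (simp add: flux_def g_def)
        qed
      qed
      have a1: "(\<lambda>n. c0 * (\<Sum>k\<in>J n. (R k t)\<^sup>2 + (S k t)\<^sup>2) - 2 * B * (R (int n + 1) t)\<^sup>2) \<longlonglongrightarrow> c0 * N t - 2 * B * 0"
      proof (intro tendsto_intros)
        have sN: "(\<lambda>k. (R k t)\<^sup>2 + (S k t)\<^sup>2) summable_on UNIV" using sm t by blast
        show "(\<lambda>n. \<Sum>k\<in>J n. (R k t)\<^sup>2 + (S k t)\<^sup>2) \<longlonglongrightarrow> N t"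
          unfolding N_def J_def by (rule symmetric_sums_tendsto[OF sN])
        show "(\<lambda>n. (R (int n + 1) t)\<^sup>2) \<longlonglongrightarrow> 0"
          by (rule tendsto_sandwich[OF _ _ tendsto_const tendsto_zero_of_summable_int(1)[OF sN sum_power2_ge_zero]]) simp_all
      qed
      have a2: "(\<lambda>n. 6 * B * N 0 + (integral {0..t} (\<lambda>s. b * N s + c) + integral {0..t} (flux n)))
          \<longlonglongrightarrow> 6 * B * N 0 + (integral {0..t} (\<lambda>s. b * N s + c) + integral {0..t} (\<lambda>_. 0))"
        by (intro tendsto_intros flux0)
      have a3: "c0 * (\<Sum>k\<in>J n. (R k t)\<^sup>2 + (S k t)\<^sup>2) - 2 * B * (R (int n + 1) t)\<^sup>2
          \<le> 6 * B * N 0 + (integral {0..t} (\<lambda>s. b * N s + c) + integral {0..t} (flux n))" for n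
        using low[of n] up[of n] init[of n] by linarith
      have "c0 * N t - 2 * B * 0 \<le> 6 * B * N 0 + (integral {0..t} (\<lambda>s. b * N s + c) + integral {0..t} (\<lambda>_. 0))"
        by (rule lim_mono[of 0, OF _ a1 a2]) (rule a3)
      then show ?thesis by simp
    qed
    have "N t \<le> (6 * B / c0 * N 0 + c / c0 * t) * exp (b / c0 * t)"
    proof (rule gronwall_integral[OF cN' _ _ _ t])
      fix t assume t: "t \<in> {0..T}"
      have "N t = (c0 * N t) / c0" using c0 by simp
      also have "\<dots> \<le> (6 * B * N 0 + integral {0..t} (\<lambda>s. b * N s + c)) / c0"
        using main[OF t] c0 by (intro divide_right_mono) auto
      also have "\<dots> = 6 * B / c0 * N 0 + integral {0..t} (\<lambda>s. (1 / c0) * (b * N s + c))"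
        by (simp only: integral_mult_right) (simp add: add_divide_distrib)
      also have "(\<lambda>s. (1 / c0) * (b * N s + c)) = (\<lambda>s. b / c0 * N s + c / c0)"
        by (simp add: fun_eq_iff add_divide_distrib)
      finally show "N t \<le> 6 * B / c0 * N 0 + integral {0..t} (\<lambda>s. b / c0 * N s + c / c0)" .
    qed (use bc c0 in auto)
    also have "\<dots> \<le> (6 * B / c0 * N 0 + 6 * B * D * \<tau> / c0 * \<epsilon> ^ 3) * exp (B * (6 * L + 6) * \<tau> / c0)"
    proof (rule mult_mono)
      \<comment> \<open>The length of time uses up one power of \<epsilon>: the rate b of order
        \<epsilon> becomes a constant, the source c of order \<epsilon>^4 becomes
        \<epsilon>^3.\<close>
      have et: "\<epsilon> * t \<le> \<tau>"
        by (rule order_trans[OF mult_left_mono[of t T \<epsilon>] T(2)]) (use t e in auto)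
      have "c / c0 * t = 6 * B * D / c0 * \<epsilon> ^ 3 * (\<epsilon> * t)" by (simp add: c_def eval_nat_numeral)
      also have "\<dots> \<le> 6 * B * D / c0 * \<epsilon> ^ 3 * \<tau>" using B0 LD c0 e et by (intro mult_left_mono) auto
      finally show "6 * B / c0 * N 0 + c / c0 * t \<le> 6 * B / c0 * N 0 + 6 * B * D * \<tau> / c0 * \<epsilon> ^ 3" by (simp add: mult_ac)
      have "b / c0 * t = B * (6 * L + 6) / c0 * (\<epsilon> * t)" by (simp add: b_def)
      also have "\<dots> \<le> B * (6 * L + 6) / c0 * \<tau>" using B0 LD c0 et by (intro mult_left_mono) auto
      finally show "exp (b / c0 * t) \<le> exp (B * (6 * L + 6) * \<tau> / c0)" by simp
      show "0 \<le> 6 * B / c0 * N 0 + 6 * B * D * \<tau> / c0 * \<epsilon> ^ 3"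
        using B0 LD c0 e Nnn by (intro add_nonneg_nonneg mult_nonneg_nonneg) auto
    qed auto
    also have "\<dots> \<le> C * (N 0 + \<epsilon> ^ 3)"
    proof -
      have "6 * B / c0 * N 0 + 6 * B * D * \<tau> / c0 * \<epsilon> ^ 3 \<le> (6 * B / c0 + 6 * B * D * \<tau> / c0) * (N 0 + \<epsilon> ^ 3)"
        using B0 LD c0 e Nnn by (simp add: distrib_left distrib_right)
      then show ?thesis unfolding C_def by (simp add: mult.assoc mult.left_commute mult_right_mono mult.commute)
    qed
    finally show "(\<Sum>\<^sub>\<infinity>k. (R k t)\<^sup>2 + (S k t)\<^sup>2) \<le> C * ((\<Sum>\<^sub>\<infinity>k. (R k 0)\<^sup>2 + (S k 0)\<^sup>2) + \<epsilon> ^ 3)"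
      by (simp add: N_def)
  qed
qed

text \<open>The bound on q is available only while all |R k| \<le> \<epsilon>, which N \<le>
  \<epsilon>^2 guarantees. At the first time with N = \<epsilon>^2 the linear estimate, valid up to
  then, yields N \<le> C' \<epsilon>^(2 \<beta>) \<le> \<epsilon>^2 / 2, a contradiction. Here
  \<beta> > 1 makes the last inequality possible for small \<epsilon>, and \<beta> \<le> 3/2 lets
  \<epsilon>^3 be absorbed in \<epsilon>^(2 \<beta>).\<close>

lemma energy_bootstrap:
  fixes \<mu> \<omega> :: "int \<Rightarrow> real" and v1 c0 B L D \<tau> \<beta> c :: real
  assumes c0: "0 < c0" "\<And>k. c0 \<le> \<mu> k" "\<And>k. c0 \<le> \<mu> k * \<omega> k" "\<And>k. c0 \<le> \<mu> k * \<omega> k + 4 * v1"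
    and B: "\<And>k. \<mu> k \<le> B" "\<And>k. \<mu> k * \<omega> k \<le> B" "\<bar>v1\<bar> \<le> B"
    and LD: "0 \<le> L" "0 \<le> D" "0 \<le> \<tau>" and c: "0 \<le> c" and \<beta>: "1 < \<beta>" "\<beta> \<le> 3 / 2"
  shows "\<exists>C>0. \<exists>\<epsilon>0>0. \<forall>\<epsilon> T R S p q d. 0 < \<epsilon> \<longrightarrow> \<epsilon> < \<epsilon>0 \<longrightarrow> 0 \<le> T \<longrightarrow> \<epsilon> * T \<le> \<tau> \<longrightarrow>
    perturbed_chain v1 \<mu> \<omega> T R S p q \<longrightarrow>
    (\<forall>t\<in>{0..T}. (\<forall>k. \<bar>R k t\<bar> \<le> \<epsilon>) \<longrightarrow>
      (\<forall>k. \<bar>q k t\<bar> \<le> L * \<epsilon> * (\<bar>R (k - 1) t\<bar> + \<bar>R k t\<bar> + \<bar>R (k + 1) t\<bar>) + \<bar>d k t\<bar>)) \<longrightarrow>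
    (\<forall>t\<in>{0..T}. \<forall>F. finite F \<longrightarrow> (\<Sum>k\<in>F. (d k t)\<^sup>2) \<le> D * \<epsilon> ^ 5 \<and> (\<Sum>k\<in>F. (p k t)\<^sup>2) \<le> D * \<epsilon> ^ 5) \<longrightarrow>
    (\<Sum>\<^sub>\<infinity>k. (R k 0)\<^sup>2 + (S k 0)\<^sup>2) \<le> c * \<epsilon> powr (2 * \<beta>) \<longrightarrow>
    (\<forall>t\<in>{0..T}. (\<Sum>\<^sub>\<infinity>k. (R k t)\<^sup>2 + (S k t)\<^sup>2) \<le> C * \<epsilon> powr (2 * \<beta>))"
proof -
  obtain C where "C > 0" and C:
    "\<forall>\<epsilon> T R S p q d. 0 < \<epsilon> \<longrightarrow> 0 \<le> T \<longrightarrow> \<epsilon> * T \<le> \<tau> \<longrightarrow>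
    perturbed_chain v1 \<mu> \<omega> T R S p q \<longrightarrow>
    (\<forall>k. \<forall>t\<in>{0..T}. \<bar>q k t\<bar> \<le> L * \<epsilon> * (\<bar>R (k - 1) t\<bar> + \<bar>R k t\<bar> + \<bar>R (k + 1) t\<bar>) + \<bar>d k t\<bar>) \<longrightarrow>
    (\<forall>t\<in>{0..T}. \<forall>F. finite F \<longrightarrow> (\<Sum>k\<in>F. (d k t)\<^sup>2) \<le> D * \<epsilon> ^ 5 \<and> (\<Sum>k\<in>F. (p k t)\<^sup>2) \<le> D * \<epsilon> ^ 5) \<longrightarrow>
    (\<forall>t\<in>{0..T}. (\<Sum>\<^sub>\<infinity>k. (R k t)\<^sup>2 + (S k t)\<^sup>2) \<le> C * ((\<Sum>\<^sub>\<infinity>k. (R k 0)\<^sup>2 + (S k 0)\<^sup>2) + \<epsilon> ^ 3))"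
    using energy_bound[where \<mu>=\<mu> and \<omega>=\<omega>, OF c0 B LD] by - (elim exE conjE, rule that)
  \<comment> \<open>c accounts for the initial error, 1 for the term \<epsilon>^3.\<close>
  define C' where "C' = C * (c + 1)"
  have C': "C' > 0" using \<open>C > 0\<close> c by (simp add: C'_def)
  \<comment> \<open>Chosen so that 2 max(1, c, C') \<epsilon>^(2 \<beta> - 2) \<le> 1. Including c
    places the starting value below \<epsilon>^2 / 2 as well.\<close>
  define \<epsilon>0 where "\<epsilon>0 = min 1 ((1 / (2 * max 1 (max c C'))) powr (1 / (2 * \<beta> - 2)))"
  have \<epsilon>0: "\<epsilon>0 > 0" by (simp add: \<epsilon>0_def)
  show ?thesis
  proof (rule exI[of _ C'], rule conjI[OF C'], rule exI[of _ \<epsilon>0], rule conjI[OF \<epsilon>0], intro allI impI)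
    fix \<epsilon> T :: real and R S p q d :: "int \<Rightarrow> real \<Rightarrow> real"
    assume e: "0 < \<epsilon>" "\<epsilon> < \<epsilon>0" and T: "0 \<le> T" "\<epsilon> * T \<le> \<tau>"
      and pc: "perturbed_chain v1 \<mu> \<omega> T R S p q"
      and q: "\<forall>t\<in>{0..T}. (\<forall>k. \<bar>R k t\<bar> \<le> \<epsilon>) \<longrightarrow>
      (\<forall>k. \<bar>q k t\<bar> \<le> L * \<epsilon> * (\<bar>R (k - 1) t\<bar> + \<bar>R k t\<bar> + \<bar>R (k + 1) t\<bar>) + \<bar>d k t\<bar>)"
      and dp: "\<forall>t\<in>{0..T}. \<forall>F. finite F \<longrightarrow> (\<Sum>k\<in>F. (d k t)\<^sup>2) \<le> D * \<epsilon> ^ 5 \<and> (\<Sum>k\<in>F. (p k t)\<^sup>2) \<le> D * \<epsilon> ^ 5"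
      and init: "(\<Sum>\<^sub>\<infinity>k. (R k 0)\<^sup>2 + (S k 0)\<^sup>2) \<le> c * \<epsilon> powr (2 * \<beta>)"
    have sm: "\<forall>t\<in>{0..T}. (\<lambda>k. (R k t)\<^sup>2 + (S k t)\<^sup>2) summable_on UNIV"
      and cN: "continuous_on {0..T} (\<lambda>t. \<Sum>\<^sub>\<infinity>k. (R k t)\<^sup>2 + (S k t)\<^sup>2)"
      and dR: "\<forall>k. \<forall>t\<in>{0..T}. (R k has_real_derivative S k t + p k t) (at t within {0..T})"
      and dS: "\<forall>k. \<forall>t\<in>{0..T}. (S k has_real_derivative
       v1 / \<mu> k * (R (k + 1) t - 2 * R k t + R (k - 1) t) - \<omega> k * R k t + q k t) (at t within {0..T})"
      using pc unfolding perturbed_chain_def by blast+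
    define N where "N = (\<lambda>t. \<Sum>\<^sub>\<infinity>k. (R k t)\<^sup>2 + (S k t)\<^sup>2)"
    have e1: "\<epsilon> < 1" using e by (simp add: \<epsilon>0_def)
    have e3: "\<epsilon> ^ 3 \<le> \<epsilon> powr (2 * \<beta>)"
    proof -
      have "\<epsilon> ^ 3 = \<epsilon> powr 3" using e by (simp add: powr_realpow)
      also have "\<dots> \<le> \<epsilon> powr (2 * \<beta>)" using e e1 \<beta> by (intro powr_mono') auto
      finally show ?thesis .
    qed
    have small: "\<epsilon> powr (2 * \<beta>) * max 1 (max c C') \<le> \<epsilon>\<^sup>2 / 2"
    proof -
      let ?m = "max 1 (max c C')"
      have "\<epsilon> powr (2 * \<beta> - 2) \<le> ((1 / (2 * ?m)) powr (1 / (2 * \<beta> - 2))) powr (2 * \<beta> - 2)"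
        using e \<beta> by (intro powr_mono2) (auto simp: \<epsilon>0_def)
      also have "\<dots> = 1 / (2 * ?m)" using \<beta> by (simp add: powr_powr)
      finally have 1: "\<epsilon> powr (2 * \<beta> - 2) * ?m \<le> 1 / (2 * ?m) * ?m" by (intro mult_right_mono) auto
      have "\<epsilon> powr (2 * \<beta>) = \<epsilon> powr ((2 * \<beta> - 2) + 2)" by simp
      also have "\<dots> = \<epsilon> powr (2 * \<beta> - 2) * \<epsilon>\<^sup>2"
        using e(1) by (simp only: powr_add powr_numeral)
      finally have "\<epsilon> powr (2 * \<beta>) = \<epsilon> powr (2 * \<beta> - 2) * \<epsilon>\<^sup>2" .
      then have "\<epsilon> powr (2 * \<beta>) * ?m = \<epsilon> powr (2 * \<beta> - 2) * ?m * \<epsilon>\<^sup>2" by simp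
      also have "\<dots> \<le> 1 / (2 * ?m) * ?m * \<epsilon>\<^sup>2" by (intro mult_right_mono 1) simp
      also have "\<dots> = \<epsilon>\<^sup>2 / 2" by simp
      finally show ?thesis .
    qed
    have pt: "\<bar>R k s\<bar> \<le> \<epsilon>" if "s \<in> {0..T}" "N s \<le> \<epsilon>\<^sup>2" for k s
    proof -
      have "(R k s)\<^sup>2 \<le> N s"
        unfolding N_def using sm that(1) square_sum_bounds(1)[of "\<lambda>k. R k s" "\<lambda>k. S k s" "{k}" 0] by simp
      then have "\<bar>R k s\<bar>\<^sup>2 \<le> \<epsilon>\<^sup>2" using that(2) by simp
      then show ?thesis using e by (intro power2_le_imp_le[of "\<bar>R k s\<bar>" \<epsilon>]) auto
    qed
    have est: "N t \<le> C' * \<epsilon> powr (2 * \<beta>)"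
      if t: "t \<in> {0..T}" and le: "\<And>s. s \<in> {0..t} \<Longrightarrow> N s \<le> \<epsilon>\<^sup>2" for t
    proof -
      have sub: "{0..t} \<subseteq> {0..T}" using t by auto
      have et: "\<epsilon> * t \<le> \<tau>"
        by (rule order_trans[OF mult_left_mono[of t T \<epsilon>] T(2)]) (use t e in auto)
      have "(\<Sum>\<^sub>\<infinity>k. (R k t)\<^sup>2 + (S k t)\<^sup>2) \<le> C * ((\<Sum>\<^sub>\<infinity>k. (R k 0)\<^sup>2 + (S k 0)\<^sup>2) + \<epsilon> ^ 3)"
      proof (rule C[rule_format, OF e(1) _ et perturbed_chain_restrict[OF pc t]])
        show "t \<in> {0..t}" using t by simp
        show "0 \<le> t" using t by simp
        show "\<bar>q k s\<bar> \<le> L * \<epsilon> * (\<bar>R (k - 1) s\<bar> + \<bar>R k s\<bar> + \<bar>R (k + 1) s\<bar>) + \<bar>d k s\<bar>" if "s \<in> {0..t}" for k s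
          using q[rule_format, of s k] pt[of s] le[OF that] that sub by blast
        show "(\<Sum>k\<in>F. (d k s)\<^sup>2) \<le> D * \<epsilon> ^ 5 \<and> (\<Sum>k\<in>F. (p k s)\<^sup>2) \<le> D * \<epsilon> ^ 5" if "s \<in> {0..t}" "finite F" for s F
          using dp that sub by blast
      qed
      then have "N t \<le> C * (N 0 + \<epsilon> ^ 3)" using t by (simp add: N_def)
      also have "\<dots> \<le> C * (c * \<epsilon> powr (2 * \<beta>) + \<epsilon> powr (2 * \<beta>))"
        using \<open>C > 0\<close> e3 init by (intro mult_left_mono add_mono) (auto simp: N_def)
      also have "\<dots> = C' * \<epsilon> powr (2 * \<beta>)" by (simp add: C'_def algebra_simps)
      finally show ?thesis .
    qed
    have half: "x * \<epsilon> powr (2 * \<beta>) \<le> \<epsilon>\<^sup>2 / 2" if "x \<le> max 1 (max c C')" for x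
    proof -
      have "x * \<epsilon> powr (2 * \<beta>) \<le> max 1 (max c C') * \<epsilon> powr (2 * \<beta>)" by (intro mult_right_mono that) simp
      then show ?thesis using small by (simp add: mult.commute)
    qed
    have eh: "\<epsilon>\<^sup>2 / 2 < \<epsilon>\<^sup>2" using e by simp
    have N0: "N 0 \<le> \<epsilon>\<^sup>2 / 2" using init half[of c] by (simp add: N_def le_max_iff_disj)
    have all: "N t \<le> \<epsilon>\<^sup>2" if t: "t \<in> {0..T}" for t
    proof (rule ccontr)
      assume neg: "\<not> N t \<le> \<epsilon>\<^sup>2"
      \<comment> \<open>The level set is closed in [0, t], so a first time t1 exists, and the
        intermediate value theorem excludes larger values before it.\<close>
      define Z where "Z = {s \<in> {0..t}. N s = \<epsilon>\<^sup>2}"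
      have cNt: "continuous_on {0..t} N" unfolding N_def by (rule continuous_on_subset[OF cN]) (use t in auto)
      have ivt: "\<exists>x\<ge>0. x \<le> s \<and> N x = \<epsilon>\<^sup>2" if "0 \<le> s" "s \<le> t" "N s > \<epsilon>\<^sup>2" for s
        using IVT'[of N 0 "\<epsilon>\<^sup>2" s] that N0 eh continuous_on_subset[OF cNt, of "{0..s}"] by auto
      have "Z \<noteq> {}" using ivt[of t] neg t by (auto simp: Z_def)
      moreover have "compact Z"
      proof -
        have "closedin (top_of_set {0..t}) {s \<in> {0..t}. N s = \<epsilon>\<^sup>2}"
          by (rule continuous_closedin_preimage_constant[OF cNt])
        then show ?thesis unfolding Z_def by (rule closedin_compact[OF compact_Icc])
      qed
      ultimately obtain t1 where t1: "t1 \<in> Z" "\<And>s. s \<in> Z \<Longrightarrow> t1 \<le> s"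
        using compact_attains_inf[of Z] by auto
      have before: "N s \<le> \<epsilon>\<^sup>2" if s: "s \<in> {0..t1}" for s
      proof (rule ccontr)
        assume "\<not> N s \<le> \<epsilon>\<^sup>2"
        then obtain x where x: "0 \<le> x" "x \<le> s" "N x = \<epsilon>\<^sup>2" using ivt[of s] s t1(1) by (auto simp: Z_def)
        then have "x \<in> Z" using s t1(1) by (auto simp: Z_def)
        then have "x = s" using t1(2)[of x] x s by auto
        with x \<open>\<not> N s \<le> \<epsilon>\<^sup>2\<close> show False by simp
      qed
      have "N t1 \<le> C' * \<epsilon> powr (2 * \<beta>)" using t1(1) t by (intro est before) (auto simp: Z_def)
      also have "\<dots> \<le> \<epsilon>\<^sup>2 / 2" by (rule half) (simp add: le_max_iff_disj)
      finally show False using t1(1) eh by (simp add: Z_def)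
    qed
    show "\<forall>t\<in>{0..T}. (\<Sum>\<^sub>\<infinity>k. (R k t)\<^sup>2 + (S k t)\<^sup>2) \<le> C' * \<epsilon> powr (2 * \<beta>)"
    proof
      fix t assume t: "t \<in> {0..T}"
      have "N t \<le> C' * \<epsilon> powr (2 * \<beta>)" by (rule est[OF t]) (use all t in auto)
      then show "(\<Sum>\<^sub>\<infinity>k. (R k t)\<^sup>2 + (S k t)\<^sup>2) \<le> C' * \<epsilon> powr (2 * \<beta>)" by (simp add: N_def)
    qed
  qed
qed

section \<open>Residual of the modulation ansatz\<close>

text \<open>n is the power of \<epsilon> in the squared norm, so a factor \<epsilon> adds 2.
  Bounding all finite sums gives summability together with the bound; the constant is uniform in
  time up to \<tau> / \<epsilon>.\<close>

definition l2O :: "real \<Rightarrow> nat \<Rightarrow> (real \<Rightarrow> int \<Rightarrow> real \<Rightarrow> complex) \<Rightarrow> bool" where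
  "l2O \<tau> n f \<longleftrightarrow> (\<exists>C\<ge>0. \<forall>\<epsilon> t F. 0 < \<epsilon> \<longrightarrow> \<epsilon> < 1 \<longrightarrow> t \<in> {0..\<tau> / \<epsilon>} \<longrightarrow> finite F \<longrightarrow>
     (\<Sum>j\<in>F. (cmod (f \<epsilon> j t))\<^sup>2) \<le> C * \<epsilon> ^ n)"

definition bddO :: "real \<Rightarrow> (real \<Rightarrow> int \<Rightarrow> real \<Rightarrow> complex) \<Rightarrow> bool" where
  "bddO \<tau> f \<longleftrightarrow> (\<exists>C\<ge>0. \<forall>\<epsilon> t j. 0 < \<epsilon> \<longrightarrow> \<epsilon> < 1 \<longrightarrow> t \<in> {0..\<tau> / \<epsilon>} \<longrightarrow> cmod (f \<epsilon> j t) \<le> C)"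

lemma l2O_I:
  assumes "0 \<le> C" "\<And>\<epsilon> t F. 0 < \<epsilon> \<Longrightarrow> \<epsilon> < 1 \<Longrightarrow> t \<in> {0..\<tau> / \<epsilon>} \<Longrightarrow> finite F \<Longrightarrow>
     (\<Sum>j\<in>F. (cmod (f \<epsilon> j t))\<^sup>2) \<le> C * \<epsilon> ^ n"
  shows "l2O \<tau> n f"
  unfolding l2O_def using assms by (intro exI[of _ C] conjI allI impI)

lemma l2O_E:
  assumes "l2O \<tau> n f"
  obtains C where "0 \<le> C" "\<And>\<epsilon> t F. 0 < \<epsilon> \<Longrightarrow> \<epsilon> < 1 \<Longrightarrow> t \<in> {0..\<tau> / \<epsilon>} \<Longrightarrow> finite F \<Longrightarrow>
     (\<Sum>j\<in>F. (cmod (f \<epsilon> j t))\<^sup>2) \<le> C * \<epsilon> ^ n"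
  using assms unfolding l2O_def by blast

lemma bddO_I:
  assumes "0 \<le> C" "\<And>\<epsilon> t j. 0 < \<epsilon> \<Longrightarrow> \<epsilon> < 1 \<Longrightarrow> t \<in> {0..\<tau> / \<epsilon>} \<Longrightarrow> cmod (f \<epsilon> j t) \<le> C"
  shows "bddO \<tau> f"
  unfolding bddO_def using assms by (intro exI[of _ C] conjI allI impI)

lemma bddO_E:
  assumes "bddO \<tau> f"
  obtains C where "0 \<le> C" "\<And>\<epsilon> t j. 0 < \<epsilon> \<Longrightarrow> \<epsilon> < 1 \<Longrightarrow> t \<in> {0..\<tau> / \<epsilon>} \<Longrightarrow> cmod (f \<epsilon> j t) \<le> C"
  using assms unfolding bddO_def by blast

lemma bddO_const: "bddO \<tau> (\<lambda>\<epsilon> j t. c)"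
  by (rule bddO_I[of "cmod c"]) auto

lemma bddO_eps: "bddO \<tau> (\<lambda>\<epsilon> j t. of_real \<epsilon>)"
  by (rule bddO_I[of 1]) auto

lemma bddO_add: assumes "bddO \<tau> f" "bddO \<tau> g" shows "bddO \<tau> (\<lambda>\<epsilon> j t. f \<epsilon> j t + g \<epsilon> j t)"
proof -
  obtain C D where "0 \<le> C" "0 \<le> D"
    and C: "\<And>\<epsilon> t j. 0 < \<epsilon> \<Longrightarrow> \<epsilon> < 1 \<Longrightarrow> t \<in> {0..\<tau> / \<epsilon>} \<Longrightarrow> cmod (f \<epsilon> j t) \<le> C"
    and D: "\<And>\<epsilon> t j. 0 < \<epsilon> \<Longrightarrow> \<epsilon> < 1 \<Longrightarrow> t \<in> {0..\<tau> / \<epsilon>} \<Longrightarrow> cmod (g \<epsilon> j t) \<le> D"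
    using bddO_E[OF assms(1)] bddO_E[OF assms(2)] by metis
  show ?thesis
    by (rule bddO_I[of "C + D"]) (use \<open>0 \<le> C\<close> \<open>0 \<le> D\<close> C D in \<open>auto intro!: norm_triangle_le add_mono\<close>)
qed

lemma bddO_mult: assumes "bddO \<tau> f" "bddO \<tau> g" shows "bddO \<tau> (\<lambda>\<epsilon> j t. f \<epsilon> j t * g \<epsilon> j t)"
proof -
  obtain C D where "0 \<le> C" "0 \<le> D"
    and C: "\<And>\<epsilon> t j. 0 < \<epsilon> \<Longrightarrow> \<epsilon> < 1 \<Longrightarrow> t \<in> {0..\<tau> / \<epsilon>} \<Longrightarrow> cmod (f \<epsilon> j t) \<le> C"
    and D: "\<And>\<epsilon> t j. 0 < \<epsilon> \<Longrightarrow> \<epsilon> < 1 \<Longrightarrow> t \<in> {0..\<tau> / \<epsilon>} \<Longrightarrow> cmod (g \<epsilon> j t) \<le> D"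
    using bddO_E[OF assms(1)] bddO_E[OF assms(2)] by metis
  show ?thesis
    by (rule bddO_I[of "C * D"]) (use \<open>0 \<le> C\<close> \<open>0 \<le> D\<close> C D in \<open>auto simp: norm_mult intro!: mult_mono\<close>)
qed

lemma bddO_sum: assumes "finite A" "\<And>i. i \<in> A \<Longrightarrow> bddO \<tau> (f i)" shows "bddO \<tau> (\<lambda>\<epsilon> j t. \<Sum>i\<in>A. f i \<epsilon> j t)"
  using assms
proof (induction A rule: finite_induct)
  case empty
  show ?case using bddO_const[of \<tau> 0] by simp
next
  case (insert i A)
  then show ?case using bddO_add[of \<tau> "f i" "\<lambda>\<epsilon> j t. \<Sum>i\<in>A. f i \<epsilon> j t"] by simp
qed

lemma bddO_diff: assumes "bddO \<tau> f" "bddO \<tau> g" shows "bddO \<tau> (\<lambda>\<epsilon> j t. f \<epsilon> j t - g \<epsilon> j t)"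
  using bddO_add[OF assms(1) bddO_mult[OF bddO_const[of _ "-1"] assms(2)]] by simp

lemma bddO_shift: assumes "bddO \<tau> f" shows "bddO \<tau> (\<lambda>\<epsilon> j t. f \<epsilon> (h j) t)"
  using assms unfolding bddO_def by blast

lemma l2O_add: assumes "l2O \<tau> n f" "l2O \<tau> n g" shows "l2O \<tau> n (\<lambda>\<epsilon> j t. f \<epsilon> j t + g \<epsilon> j t)"
proof -
  obtain C where C0: "0 \<le> C" and C: "\<And>\<epsilon> t F. 0 < \<epsilon> \<Longrightarrow> \<epsilon> < 1 \<Longrightarrow> t \<in> {0..\<tau> / \<epsilon>} \<Longrightarrow> finite F \<Longrightarrow>
     (\<Sum>j\<in>F. (cmod (f \<epsilon> j t))\<^sup>2) \<le> C * \<epsilon> ^ n"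
    using l2O_E[OF assms(1)] by metis
  obtain D where D0: "0 \<le> D" and D: "\<And>\<epsilon> t F. 0 < \<epsilon> \<Longrightarrow> \<epsilon> < 1 \<Longrightarrow> t \<in> {0..\<tau> / \<epsilon>} \<Longrightarrow> finite F \<Longrightarrow>
     (\<Sum>j\<in>F. (cmod (g \<epsilon> j t))\<^sup>2) \<le> D * \<epsilon> ^ n"
    using l2O_E[OF assms(2)] by metis
  show ?thesis
  proof (rule l2O_I[of "2 * C + 2 * D"])
    fix \<epsilon> t :: real and F :: "int set" assume a: "0 < \<epsilon>" "\<epsilon> < 1" "t \<in> {0..\<tau> / \<epsilon>}" "finite F"
    have sq: "(cmod (x + y))\<^sup>2 \<le> 2 * (cmod x)\<^sup>2 + 2 * (cmod y)\<^sup>2" for x y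
    proof -
      have "(cmod (x + y))\<^sup>2 \<le> (cmod x + cmod y)\<^sup>2" by (intro power_mono norm_triangle_ineq) simp
      also have "\<dots> \<le> 2 * (cmod x)\<^sup>2 + 2 * (cmod y)\<^sup>2"
        using zero_le_power2[of "cmod x - cmod y"] by (simp add: power2_eq_square algebra_simps)
      finally show ?thesis .
    qed
    have "(\<Sum>j\<in>F. (cmod (f \<epsilon> j t + g \<epsilon> j t))\<^sup>2) \<le> (\<Sum>j\<in>F. 2 * (cmod (f \<epsilon> j t))\<^sup>2 + 2 * (cmod (g \<epsilon> j t))\<^sup>2)"
      by (intro sum_mono sq)
    also have "\<dots> \<le> 2 * (C * \<epsilon> ^ n) + 2 * (D * \<epsilon> ^ n)"
      unfolding sum.distrib sum_distrib_left[symmetric] by (intro add_mono mult_left_mono C D a) auto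
    finally show "(\<Sum>j\<in>F. (cmod (f \<epsilon> j t + g \<epsilon> j t))\<^sup>2) \<le> (2 * C + 2 * D) * \<epsilon> ^ n" by (simp add: algebra_simps)
  qed (use C0 D0 in auto)
qed

lemma l2O_mult_bdd: assumes "bddO \<tau> g" "l2O \<tau> n f" shows "l2O \<tau> n (\<lambda>\<epsilon> j t. g \<epsilon> j t * f \<epsilon> j t)"
proof -
  obtain C where C0: "0 \<le> C" and C: "\<And>\<epsilon> t F. 0 < \<epsilon> \<Longrightarrow> \<epsilon> < 1 \<Longrightarrow> t \<in> {0..\<tau> / \<epsilon>} \<Longrightarrow> finite F \<Longrightarrow>
     (\<Sum>j\<in>F. (cmod (f \<epsilon> j t))\<^sup>2) \<le> C * \<epsilon> ^ n"
    using l2O_E[OF assms(2)] by metis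
  obtain D where D0: "0 \<le> D" and D: "\<And>\<epsilon> t j. 0 < \<epsilon> \<Longrightarrow> \<epsilon> < 1 \<Longrightarrow> t \<in> {0..\<tau> / \<epsilon>} \<Longrightarrow> cmod (g \<epsilon> j t) \<le> D"
    using bddO_E[OF assms(1)] by metis
  show ?thesis
  proof (rule l2O_I[of "D\<^sup>2 * C"])
    fix \<epsilon> t :: real and F :: "int set" assume a: "0 < \<epsilon>" "\<epsilon> < 1" "t \<in> {0..\<tau> / \<epsilon>}" "finite F"
    have "(\<Sum>j\<in>F. (cmod (g \<epsilon> j t * f \<epsilon> j t))\<^sup>2) \<le> (\<Sum>j\<in>F. D\<^sup>2 * (cmod (f \<epsilon> j t))\<^sup>2)"
      unfolding norm_mult power_mult_distrib
      by (intro sum_mono mult_right_mono power_mono D a) auto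
    also have "\<dots> \<le> D\<^sup>2 * (C * \<epsilon> ^ n)"
      unfolding sum_distrib_left[symmetric] by (intro mult_left_mono C a) auto
    finally show "(\<Sum>j\<in>F. (cmod (g \<epsilon> j t * f \<epsilon> j t))\<^sup>2) \<le> D\<^sup>2 * C * \<epsilon> ^ n" by (simp only: mult.assoc)
  qed (use C0 in auto)
qed

lemma l2O_mult_bdd': assumes "bddO \<tau> g" "l2O \<tau> n f" shows "l2O \<tau> n (\<lambda>\<epsilon> j t. f \<epsilon> j t * g \<epsilon> j t)"
  using l2O_mult_bdd[OF assms] by (simp only: mult.commute)

lemma l2O_zero: "l2O \<tau> n (\<lambda>\<epsilon> j t. 0)"
  by (rule l2O_I[of 0]) auto

lemma l2O_sum: assumes "finite A" "\<And>i. i \<in> A \<Longrightarrow> l2O \<tau> n (f i)" shows "l2O \<tau> n (\<lambda>\<epsilon> j t. \<Sum>i\<in>A. f i \<epsilon> j t)"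
  using assms
proof (induction A rule: finite_induct)
  case empty
  show ?case using l2O_zero by simp
next
  case (insert i A)
  then show ?case using l2O_add[of \<tau> n "f i" "\<lambda>\<epsilon> j t. \<Sum>i\<in>A. f i \<epsilon> j t"] by simp
qed

lemma l2O_diff: assumes "l2O \<tau> n f" "l2O \<tau> n g" shows "l2O \<tau> n (\<lambda>\<epsilon> j t. f \<epsilon> j t - g \<epsilon> j t)"
  using l2O_add[OF assms(1) l2O_mult_bdd[OF bddO_const[of _ "-1"] assms(2)]] by simp

lemma l2O_shift: assumes "l2O \<tau> n f" "inj h" shows "l2O \<tau> n (\<lambda>\<epsilon> j t. f \<epsilon> (h j) t)"
proof -
  obtain C where C0: "0 \<le> C" and C: "\<And>\<epsilon> t F. 0 < \<epsilon> \<Longrightarrow> \<epsilon> < 1 \<Longrightarrow> t \<in> {0..\<tau> / \<epsilon>} \<Longrightarrow> finite F \<Longrightarrow>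
     (\<Sum>j\<in>F. (cmod (f \<epsilon> j t))\<^sup>2) \<le> C * \<epsilon> ^ n"
    using l2O_E[OF assms(1)] by metis
  show ?thesis
  proof (rule l2O_I[of C])
    fix \<epsilon> t :: real and F :: "int set" assume a: "0 < \<epsilon>" "\<epsilon> < 1" "t \<in> {0..\<tau> / \<epsilon>}" "finite F"
    have "(\<Sum>j\<in>F. (cmod (f \<epsilon> (h j) t))\<^sup>2) = (\<Sum>j\<in>h ` F. (cmod (f \<epsilon> j t))\<^sup>2)"
      by (subst sum.reindex) (use assms(2) in \<open>auto simp: inj_on_def\<close>)
    also have "\<dots> \<le> C * \<epsilon> ^ n" using a by (intro C) auto
    finally show "(\<Sum>j\<in>F. (cmod (f \<epsilon> (h j) t))\<^sup>2) \<le> C * \<epsilon> ^ n" .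
  qed (rule C0)
qed

lemma l2O_eps: assumes "l2O \<tau> n f" shows "l2O \<tau> (n + 2) (\<lambda>\<epsilon> j t. of_real \<epsilon> * f \<epsilon> j t)"
proof -
  obtain C where C0: "0 \<le> C" and C: "\<And>\<epsilon> t F. 0 < \<epsilon> \<Longrightarrow> \<epsilon> < 1 \<Longrightarrow> t \<in> {0..\<tau> / \<epsilon>} \<Longrightarrow> finite F \<Longrightarrow>
     (\<Sum>j\<in>F. (cmod (f \<epsilon> j t))\<^sup>2) \<le> C * \<epsilon> ^ n"
    using l2O_E[OF assms(1)] by metis
  show ?thesis
  proof (rule l2O_I[of C])
    fix \<epsilon> t :: real and F :: "int set" assume a: "0 < \<epsilon>" "\<epsilon> < 1" "t \<in> {0..\<tau> / \<epsilon>}" "finite F"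
    have "(\<Sum>j\<in>F. (cmod (of_real \<epsilon> * f \<epsilon> j t))\<^sup>2) = \<epsilon>\<^sup>2 * (\<Sum>j\<in>F. (cmod (f \<epsilon> j t))\<^sup>2)"
      by (simp add: norm_mult power_mult_distrib sum_distrib_left)
    also have "\<dots> \<le> \<epsilon>\<^sup>2 * (C * \<epsilon> ^ n)" by (intro mult_left_mono C a) auto
    finally show "(\<Sum>j\<in>F. (cmod (of_real \<epsilon> * f \<epsilon> j t))\<^sup>2) \<le> C * \<epsilon> ^ (n + 2)"
      by (simp add: power_add power2_eq_square mult_ac)
  qed (rule C0)
qed

lemma l2O_mono: assumes "l2O \<tau> n f" "m \<le> n" shows "l2O \<tau> m f"
proof -
  obtain C where C0: "0 \<le> C" and C: "\<And>\<epsilon> t F. 0 < \<epsilon> \<Longrightarrow> \<epsilon> < 1 \<Longrightarrow> t \<in> {0..\<tau> / \<epsilon>} \<Longrightarrow> finite F \<Longrightarrow>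
     (\<Sum>j\<in>F. (cmod (f \<epsilon> j t))\<^sup>2) \<le> C * \<epsilon> ^ n"
    using l2O_E[OF assms(1)] by metis
  show ?thesis
    by (rule l2O_I[of C], rule C0, rule order_trans[OF C])
      (use C0 assms(2) in \<open>auto intro!: mult_left_mono power_decreasing\<close>)
qed

lemma l2O_cong:
  assumes "\<And>\<epsilon> j t. 0 < \<epsilon> \<Longrightarrow> \<epsilon> < 1 \<Longrightarrow> t \<in> {0..\<tau> / \<epsilon>} \<Longrightarrow> f \<epsilon> j t = g \<epsilon> j t"
  shows "l2O \<tau> n f = l2O \<tau> n g"
  unfolding l2O_def using assms by (simp cong: conj_cong)

text \<open>Abstract form of the ansatz in which all cases of the theorem look alike. The index set
  holds the modes and their conjugates; mode i has carrier \<open>E i\<close>, time exponent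
  \<open>lam i\<close>, shift factor \<open>e i\<close> with inverse \<open>ei i\<close>, kernel
  vector \<open>r i\<close> of the dispersion matrix and velocity \<open>g i\<close>. The vector
  \<open>s i\<close> corrects for the slope of the amplitude (\<open>lin1\<close>,
  \<open>lin2\<close>), and \<open>X p q\<close> for the product of the modes p and q
  (\<open>quad1\<close>, \<open>quad2\<close>). The numbers \<open>kap i p q\<close> are the
  quadratic coefficients of the amplitude equations, nonzero only at resonance. Their sums carry a
  factor 2 because the quadratic part of \<open>bt\<close> is met in each of two time derivatives.
  The constants p, n and m with index 1 or 2 stand for linear coupling, quadratic coupling and
  quadratic on-site force.\<close>

locale modulation =
  fixes I :: "'i set" and lam e ei g :: "'i \<Rightarrow> complex" and r s :: "'i \<Rightarrow> nat \<Rightarrow> complex"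
    and kap :: "'i \<Rightarrow> 'i \<Rightarrow> 'i \<Rightarrow> complex" and X :: "'i \<Rightarrow> 'i \<Rightarrow> nat \<Rightarrow> complex"
    and E :: "'i \<Rightarrow> int \<Rightarrow> real \<Rightarrow> complex" and b bt by' :: "'i \<Rightarrow> real \<Rightarrow> real \<Rightarrow> complex" and \<tau> :: real
    and c1 c2 p1 p2 n1 n2 m1 m2 :: complex
  assumes fin: "finite I" and tau: "\<tau> > 0"
    and e_ei: "\<And>i. i \<in> I \<Longrightarrow> e i * ei i = 1"
    and E_shift: "\<And>i j t. i \<in> I \<Longrightarrow> E i (j + 1) t = e i * E i j t"
    and E_norm: "\<And>i j t. i \<in> I \<Longrightarrow> cmod (E i j t) \<le> 1"
    and E_deriv: "\<And>i j t S. i \<in> I \<Longrightarrow> (E i j has_vector_derivative lam i * E i j t) (at t within S)"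
    and kernel1: "\<And>i. i \<in> I \<Longrightarrow> ((lam i)\<^sup>2 + c1) * r i 1 = p1 * (e i + 1) * r i 2"
    and kernel2: "\<And>i. i \<in> I \<Longrightarrow> ((lam i)\<^sup>2 + c2) * r i 2 = p2 * (1 + ei i) * r i 1"
    and lin1: "\<And>i. i \<in> I \<Longrightarrow> 2 * lam i * g i * r i 1 + ((lam i)\<^sup>2 + c1) * s i 1 = p1 * (e i + 1) * s i 2 + p1 * e i * r i 2"
    and lin2: "\<And>i. i \<in> I \<Longrightarrow> 2 * lam i * g i * r i 2 + ((lam i)\<^sup>2 + c2) * s i 2 = p2 * (1 + ei i) * s i 1 - p2 * ei i * r i 1"
    and quad1: "\<And>p q. p \<in> I \<Longrightarrow> q \<in> I \<Longrightarrow>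
      ((lam p + lam q)\<^sup>2 + c1) * X p q 1 + 2 * (\<Sum>i\<in>I. lam i * r i 1 * kap i p q)
      = p1 * (e p * e q + 1) * X p q 2
        + (n1 * ((e p * r p 2 - r p 1) * (e q * r q 2 - r q 1) - (r p 1 - r p 2) * (r q 1 - r q 2)) - m1 * r p 1 * r q 1)"
    and quad2: "\<And>p q. p \<in> I \<Longrightarrow> q \<in> I \<Longrightarrow>
      ((lam p + lam q)\<^sup>2 + c2) * X p q 2 + 2 * (\<Sum>i\<in>I. lam i * r i 2 * kap i p q)
      = p2 * (1 + ei p * ei q) * X p q 1
        + (n2 * ((r p 1 - r p 2) * (r q 1 - r q 2) - (r p 2 - ei p * r p 1) * (r q 2 - ei q * r q 1)) - m2 * r p 2 * r q 2)"
    and res_E: "\<And>i p q j t. i \<in> I \<Longrightarrow> p \<in> I \<Longrightarrow> q \<in> I \<Longrightarrow> kap i p q \<noteq> 0 \<Longrightarrow> E i j t = E p j t * E q j t"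
    and res_lam: "\<And>i p q. i \<in> I \<Longrightarrow> p \<in> I \<Longrightarrow> q \<in> I \<Longrightarrow> kap i p q \<noteq> 0 \<Longrightarrow> lam i = lam p + lam q"
    and pde: "\<And>i t y. i \<in> I \<Longrightarrow> t \<in> {0..\<tau>} \<Longrightarrow>
      bt i t y = g i * by' i t y + (\<Sum>p\<in>I. \<Sum>q\<in>I. kap i p q * b p t y * b q t y)"
    and b_deriv: "\<And>i t y. i \<in> I \<Longrightarrow> t \<in> {0..\<tau>} \<Longrightarrow>
      ((\<lambda>t. b i t y) has_vector_derivative bt i t y) (at t within {0..\<tau>})"
    and b_bdd: "\<And>i. i \<in> I \<Longrightarrow> bddO \<tau> (\<lambda>\<epsilon> j t. b i (\<epsilon> * t) (\<epsilon> * of_int j))"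
    and b_l2: "\<And>i. i \<in> I \<Longrightarrow> l2O \<tau> 1 (\<lambda>\<epsilon> j t. of_real \<epsilon> * b i (\<epsilon> * t) (\<epsilon> * of_int j))"
    and by_l2: "\<And>i. i \<in> I \<Longrightarrow> l2O \<tau> 1 (\<lambda>\<epsilon> j t. of_real \<epsilon> * by' i (\<epsilon> * t) (\<epsilon> * of_int j))"
    and by_diff: "\<And>i. i \<in> I \<Longrightarrow> l2O \<tau> 1 (\<lambda>\<epsilon> j t. by' i (\<epsilon> * t) (\<epsilon> * of_int (j + 1)) - by' i (\<epsilon> * t) (\<epsilon> * of_int j))"
    and b_taylor: "\<And>i. i \<in> I \<Longrightarrow> l2O \<tau> 3 (\<lambda>\<epsilon> j t. b i (\<epsilon> * t) (\<epsilon> * of_int (j + 1)) - b i (\<epsilon> * t) (\<epsilon> * of_int j)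
        - of_real \<epsilon> * by' i (\<epsilon> * t) (\<epsilon> * of_int j))"
begin

section \<open>The corrected profile, its velocity and the first residual\<close>

definition "A i \<epsilon> j t = b i (\<epsilon> * t) (\<epsilon> * of_int j)"
definition "At i \<epsilon> j t = bt i (\<epsilon> * t) (\<epsilon> * of_int j)"
definition "Ay i \<epsilon> j t = by' i (\<epsilon> * t) (\<epsilon> * of_int j)"
definition "D i \<epsilon> j t = A i \<epsilon> (j + 1) t - A i \<epsilon> j t"
definition "Dt i \<epsilon> j t = At i \<epsilon> (j + 1) t - At i \<epsilon> j t"
definition "Q i \<epsilon> j t = (\<Sum>p\<in>I. \<Sum>q\<in>I. kap i p q * (A p \<epsilon> j t * A q \<epsilon> j t))"

definition "psi c \<epsilon> j t = (\<Sum>i\<in>I. (of_real \<epsilon> * (r i c * A i \<epsilon> j t + s i c * D i \<epsilon> j t)) * E i j t)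
  + (\<Sum>p\<in>I. \<Sum>q\<in>I. ((of_real \<epsilon>)\<^sup>2 * X p q c * (A p \<epsilon> j t * A q \<epsilon> j t)) * (E p j t * E q j t))"

text \<open>The time derivative of \<open>psi\<close> after inserting the amplitude equation, with
  \<epsilon> times the y-derivative replaced by the difference \<open>D\<close> and the terms
  collected in \<open>res1\<close> left out. It contains no time derivative of an amplitude and can
  therefore be differentiated once more.\<close>

definition "phi c \<epsilon> j t = (\<Sum>i\<in>I. (of_real \<epsilon> * (lam i * r i c * A i \<epsilon> j t + (r i c * g i + lam i * s i c) * D i \<epsilon> j t)) * E i j t)
  + (\<Sum>p\<in>I. \<Sum>q\<in>I. ((of_real \<epsilon>)\<^sup>2 * ((\<Sum>i\<in>I. r i c * kap i p q) + (lam p + lam q) * X p q c)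
      * (A p \<epsilon> j t * A q \<epsilon> j t)) * (E p j t * E q j t))"

text \<open>The uncorrected approximation; \<open>zd\<close> is its exact time derivative. These are
  the quantities that the error in the theorem refers to.\<close>

definition "z c \<epsilon> j t = (\<Sum>i\<in>I. (of_real \<epsilon> * r i c * A i \<epsilon> j t) * E i j t)"
definition "zd c \<epsilon> j t = (\<Sum>i\<in>I. (of_real \<epsilon> * r i c * (of_real \<epsilon> * At i \<epsilon> j t + lam i * A i \<epsilon> j t)) * E i j t)"

definition "res1 c \<epsilon> j t = (\<Sum>i\<in>I. (of_real \<epsilon> * r i c * g i * (of_real \<epsilon> * Ay i \<epsilon> j t - D i \<epsilon> j t)
     + (of_real \<epsilon>)\<^sup>2 * s i c * Dt i \<epsilon> j t) * E i j t)
  + (\<Sum>p\<in>I. \<Sum>q\<in>I. ((of_real \<epsilon>)\<^sup>2 * X p q c * (of_real \<epsilon> * (At p \<epsilon> j t * A q \<epsilon> j t + A p \<epsilon> j t * At q \<epsilon> j t)))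
      * (E p j t * E q j t))"

lemma E_back: "i \<in> I \<Longrightarrow> E i (j - 1) t = ei i * E i j t"
  using E_shift[of i "j - 1" t] e_ei[of i] by (simp add: mult.assoc[symmetric] mult.commute[of "ei i"])

lemma A_bdd: "i \<in> I \<Longrightarrow> bddO \<tau> (A i)" using b_bdd by (simp add: A_def[abs_def])
lemma A_l2: "i \<in> I \<Longrightarrow> l2O \<tau> 1 (\<lambda>\<epsilon> j t. of_real \<epsilon> * A i \<epsilon> j t)" using b_l2 by (simp add: A_def[abs_def])
lemma Ay_l2: "i \<in> I \<Longrightarrow> l2O \<tau> 1 (\<lambda>\<epsilon> j t. of_real \<epsilon> * Ay i \<epsilon> j t)" using by_l2 by (simp add: Ay_def[abs_def])
lemma Ay_diff: "i \<in> I \<Longrightarrow> l2O \<tau> 1 (\<lambda>\<epsilon> j t. Ay i \<epsilon> (j + 1) t - Ay i \<epsilon> j t)" using by_diff by (simp add: Ay_def[abs_def])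
lemma A_taylor: "i \<in> I \<Longrightarrow> l2O \<tau> 3 (\<lambda>\<epsilon> j t. D i \<epsilon> j t - of_real \<epsilon> * Ay i \<epsilon> j t)"
  using b_taylor by (simp add: Ay_def[abs_def] A_def[abs_def] D_def[abs_def])
lemma A_taylor': "i \<in> I \<Longrightarrow> l2O \<tau> 3 (\<lambda>\<epsilon> j t. of_real \<epsilon> * Ay i \<epsilon> j t - D i \<epsilon> j t)"
  using l2O_diff[OF l2O_zero A_taylor] by simp

lemma D_l2: assumes "i \<in> I" shows "l2O \<tau> 1 (D i)"
  using l2O_add[OF l2O_mono[OF A_taylor[OF assms], of 1] Ay_l2[OF assms]] by simp

lemma D_bdd: assumes "i \<in> I" shows "bddO \<tau> (D i)"
  unfolding D_def[abs_def] by (intro bddO_diff A_bdd[OF assms] bddO_shift[OF A_bdd[OF assms], of "\<lambda>j. j + 1"])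

lemma E_bdd: assumes "i \<in> I" shows "bddO \<tau> (\<lambda>\<epsilon> j t. E i j t)"
  by (rule bddO_I[of 1]) (use E_norm assms in auto)

text \<open>Two Taylor remainders trade the second difference of the amplitude for \<epsilon> times
  the first difference of its y-derivative, which is small in l2.\<close>

lemma D_diff: assumes "i \<in> I" shows "l2O \<tau> 3 (\<lambda>\<epsilon> j t. D i \<epsilon> (j + 1) t - D i \<epsilon> j t)"
proof -
  have "l2O \<tau> 3 (\<lambda>\<epsilon> j t. (D i \<epsilon> (j + 1) t - of_real \<epsilon> * Ay i \<epsilon> (j + 1) t) - (D i \<epsilon> j t - of_real \<epsilon> * Ay i \<epsilon> j t))"
    by (intro l2O_diff A_taylor assms l2O_shift[OF A_taylor[OF assms], of "\<lambda>j. j + 1"]) (auto simp: inj_def)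
  moreover have "l2O \<tau> (1 + 2) (\<lambda>\<epsilon> j t. of_real \<epsilon> * (Ay i \<epsilon> (j + 1) t - Ay i \<epsilon> j t))"
    by (intro l2O_eps Ay_diff assms)
  ultimately have "l2O \<tau> 3 (\<lambda>\<epsilon> j t. ((D i \<epsilon> (j + 1) t - of_real \<epsilon> * Ay i \<epsilon> (j + 1) t) - (D i \<epsilon> j t - of_real \<epsilon> * Ay i \<epsilon> j t))
      + of_real \<epsilon> * (Ay i \<epsilon> (j + 1) t - Ay i \<epsilon> j t))"
    by (intro l2O_add) (simp_all add: numeral_3_eq_3)
  then show ?thesis by (simp add: algebra_simps)
qed

lemma D_diff': assumes "i \<in> I" shows "l2O \<tau> 3 (\<lambda>\<epsilon> j t. D i \<epsilon> j t - D i \<epsilon> (j - 1) t)"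
  using l2O_shift[OF D_diff[OF assms], of "\<lambda>j. j - 1"] by (simp add: inj_def)

lemma At_eq:
  assumes "i \<in> I" "0 < \<epsilon>" "t \<in> {0..\<tau> / \<epsilon>}"
  shows "At i \<epsilon> j t = g i * Ay i \<epsilon> j t + Q i \<epsilon> j t"
proof -
  have "\<epsilon> * t \<in> {0..\<tau>}" using assms by (auto simp: field_simps)
  from pde[OF assms(1) this] show ?thesis
    by (simp add: At_def Ay_def Q_def A_def mult.assoc)
qed

lemma AA_diff: assumes "p \<in> I" "q \<in> I"
  shows "l2O \<tau> 1 (\<lambda>\<epsilon> j t. A p \<epsilon> (j + 1) t * A q \<epsilon> (j + 1) t - A p \<epsilon> j t * A q \<epsilon> j t)"
proof -
  have "l2O \<tau> 1 (\<lambda>\<epsilon> j t. D p \<epsilon> j t * A q \<epsilon> (j + 1) t + A p \<epsilon> j t * D q \<epsilon> j t)"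
    by (intro l2O_add l2O_mult_bdd l2O_mult_bdd' D_l2 A_bdd assms bddO_shift[OF A_bdd[OF assms(2)], of "\<lambda>j. j + 1"])
  then show ?thesis by (simp add: D_def algebra_simps)
qed

lemma AA_diff': assumes "p \<in> I" "q \<in> I"
  shows "l2O \<tau> 1 (\<lambda>\<epsilon> j t. A p \<epsilon> (j - 1) t * A q \<epsilon> (j - 1) t - A p \<epsilon> j t * A q \<epsilon> j t)"
  using l2O_diff[OF l2O_zero l2O_shift[OF AA_diff[OF assms], of "\<lambda>j. j - 1"]] by (simp add: inj_def)

lemma At_l2: assumes "i \<in> I" shows "l2O \<tau> 1 (\<lambda>\<epsilon> j t. of_real \<epsilon> * At i \<epsilon> j t)"
proof -
  have "l2O \<tau> 1 (\<lambda>\<epsilon> j t. g i * (of_real \<epsilon> * Ay i \<epsilon> j t) + (\<Sum>p\<in>I. \<Sum>q\<in>I. kap i p q * ((of_real \<epsilon> * A p \<epsilon> j t) * A q \<epsilon> j t)))"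
    by (intro l2O_add l2O_sum fin l2O_mult_bdd[OF bddO_const] l2O_mult_bdd'[OF A_bdd] Ay_l2 A_l2 assms)
  then show ?thesis
    by (rule l2O_cong[THEN iffD1, rotated])
      (simp add: At_eq[OF assms] Q_def sum_distrib_left algebra_simps)
qed

text \<open>The amplitude equation expresses \<open>At\<close> by \<open>Ay\<close> and products of
  amplitudes, and the increments of both over one cell are small. No mixed derivative of the
  amplitudes is needed.\<close>

lemma Dt_l2: assumes "i \<in> I" shows "l2O \<tau> 1 (Dt i)"
proof -
  have "l2O \<tau> 1 (\<lambda>\<epsilon> j t. g i * (Ay i \<epsilon> (j + 1) t - Ay i \<epsilon> j t)
      + (\<Sum>p\<in>I. \<Sum>q\<in>I. kap i p q * (A p \<epsilon> (j + 1) t * A q \<epsilon> (j + 1) t - A p \<epsilon> j t * A q \<epsilon> j t)))"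
    by (intro l2O_add l2O_sum fin l2O_mult_bdd[OF bddO_const] Ay_diff AA_diff assms)
  then show ?thesis
    by (rule l2O_cong[THEN iffD1, rotated])
      (simp add: Dt_def At_eq[OF assms] Q_def right_diff_distrib sum_subtractf)
qed

lemma A_has_deriv:
  assumes "i \<in> I" "0 < \<epsilon>" "t \<in> {0..\<tau> / \<epsilon>}"
  shows "(A i \<epsilon> j has_vector_derivative of_real \<epsilon> * At i \<epsilon> j t) (at t within {0..\<tau> / \<epsilon>})"
proof -
  have im: "(\<lambda>t. \<epsilon> * t) ` {0..\<tau> / \<epsilon>} \<subseteq> {0..\<tau>}" using assms(2) by (auto simp: field_simps)
  have "((\<lambda>s. b i s (\<epsilon> * of_int j)) has_vector_derivative bt i (\<epsilon> * t) (\<epsilon> * of_int j)) (at (\<epsilon> * t) within (\<lambda>t. \<epsilon> * t) ` {0..\<tau> / \<epsilon>})"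
    using im assms(3) by (intro has_vector_derivative_within_subset[OF b_deriv[OF assms(1)] im]) blast
  moreover have "((\<lambda>t. \<epsilon> * t) has_vector_derivative \<epsilon>) (at t within {0..\<tau> / \<epsilon>})"
    by (auto intro!: derivative_eq_intros simp: has_real_derivative_iff_has_vector_derivative[symmetric])
  ultimately have "((\<lambda>s. b i s (\<epsilon> * of_int j)) \<circ> (\<lambda>t. \<epsilon> * t) has_vector_derivative \<epsilon> *\<^sub>R bt i (\<epsilon> * t) (\<epsilon> * of_int j)) (at t within {0..\<tau> / \<epsilon>})"
    by (intro vector_diff_chain_within)
  then show ?thesis by (simp add: A_def[abs_def] At_def o_def scaleR_conv_of_real)
qed

lemma modes_deriv:
  assumes f: "\<And>i. i \<in> I \<Longrightarrow> (f i has_vector_derivative f' i) (at t within S)"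
    and h: "\<And>p q. p \<in> I \<Longrightarrow> q \<in> I \<Longrightarrow> (h p q has_vector_derivative h' p q) (at t within S)"
  shows "((\<lambda>t. (\<Sum>i\<in>I. f i t * E i j t) + (\<Sum>p\<in>I. \<Sum>q\<in>I. h p q t * (E p j t * E q j t))) has_vector_derivative
     ((\<Sum>i\<in>I. (f' i + lam i * f i t) * E i j t)
       + (\<Sum>p\<in>I. \<Sum>q\<in>I. (h' p q + (lam p + lam q) * h p q t) * (E p j t * E q j t)))) (at t within S)"
proof (intro has_vector_derivative_add has_vector_derivative_sum)
  fix i assume i: "i \<in> I"
  have "((\<lambda>t. f i t * E i j t) has_vector_derivative f i t * (lam i * E i j t) + f' i * E i j t) (at t within S)"
    by (intro has_vector_derivative_mult f E_deriv i)
  then show "((\<lambda>t. f i t * E i j t) has_vector_derivative (f' i + lam i * f i t) * E i j t) (at t within S)"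
    by (simp add: algebra_simps)
next
  fix p q assume pq: "p \<in> I" "q \<in> I"
  have "((\<lambda>t. h p q t * (E p j t * E q j t)) has_vector_derivative
     h p q t * (E p j t * (lam q * E q j t) + lam p * E p j t * E q j t) + h' p q * (E p j t * E q j t)) (at t within S)"
    by (intro has_vector_derivative_mult h E_deriv pq)
  then show "((\<lambda>t. h p q t * (E p j t * E q j t)) has_vector_derivative
     (h' p q + (lam p + lam q) * h p q t) * (E p j t * E q j t)) (at t within S)"
    by (simp add: algebra_simps)
qed

text \<open>Where the coefficient is nonzero the carrier of i equals the product of the carriers of
  p and q, so the quadratic part of the amplitude equation of mode i can be booked under the pair
  (p, q).\<close>

lemma kap_swap:
  "(\<Sum>i\<in>I. (\<rho> i * Q i \<epsilon> j t) * E i j t)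
    = (\<Sum>p\<in>I. \<Sum>q\<in>I. ((\<Sum>i\<in>I. \<rho> i * kap i p q) * (A p \<epsilon> j t * A q \<epsilon> j t)) * (E p j t * E q j t))"
proof -
  have "(\<Sum>i\<in>I. (\<rho> i * Q i \<epsilon> j t) * E i j t)
      = (\<Sum>i\<in>I. \<Sum>p\<in>I. \<Sum>q\<in>I. \<rho> i * kap i p q * (A p \<epsilon> j t * A q \<epsilon> j t) * (E p j t * E q j t))"
    unfolding Q_def sum_distrib_left sum_distrib_right
  proof (intro sum.cong refl)
    fix i p q assume "i \<in> I" "p \<in> I" "q \<in> I"
    then show "\<rho> i * (kap i p q * (A p \<epsilon> j t * A q \<epsilon> j t)) * E i j t
      = \<rho> i * kap i p q * (A p \<epsilon> j t * A q \<epsilon> j t) * (E p j t * E q j t)"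
      using res_E[of i p q j t] by (cases "kap i p q = 0") auto
  qed
  also have "\<dots> = (\<Sum>p\<in>I. \<Sum>q\<in>I. \<Sum>i\<in>I. \<rho> i * kap i p q * (A p \<epsilon> j t * A q \<epsilon> j t) * (E p j t * E q j t))"
    by (subst sum.swap, rule sum.cong[OF refl], rule sum.swap)
  finally show ?thesis by (simp add: sum_distrib_right)
qed

lemma assemble: "x = a + r' + k \<Longrightarrow> y + k = c + d \<Longrightarrow> x + y = (a + c) + (r' + d)" for x :: complex
  by algebra

text \<open>An exact identity. The linear part of \<epsilon> \<open>At\<close> becomes g D plus a
  Taylor defect, its quadratic part moves to the pairs of modes, and what \<open>phi\<close> lacks
  is \<open>res1\<close>.\<close>

lemma psi_deriv:
  assumes eps: "0 < \<epsilon>" and t: "t \<in> {0..\<tau> / \<epsilon>}"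
  shows "(psi c \<epsilon> j has_vector_derivative phi c \<epsilon> j t + res1 c \<epsilon> j t) (at t within {0..\<tau> / \<epsilon>})"
proof -
  let ?e = "of_real \<epsilon> :: complex"
  note dA = A_has_deriv[OF _ eps t]
  have D: "(D i \<epsilon> j has_vector_derivative ?e * Dt i \<epsilon> j t) (at t within {0..\<tau> / \<epsilon>})" if "i \<in> I" for i j
    unfolding D_def[abs_def] Dt_def right_diff_distrib by (intro has_vector_derivative_diff dA that)
  let ?f' = "\<lambda>i. ?e * (r i c * (?e * At i \<epsilon> j t) + s i c * (?e * Dt i \<epsilon> j t))"
  let ?f = "\<lambda>i t. ?e * (r i c * A i \<epsilon> j t + s i c * D i \<epsilon> j t)"
  let ?h' = "\<lambda>p q. ?e\<^sup>2 * X p q c * (A p \<epsilon> j t * (?e * At q \<epsilon> j t) + ?e * At p \<epsilon> j t * A q \<epsilon> j t)"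
  let ?h = "\<lambda>p q t. ?e\<^sup>2 * X p q c * (A p \<epsilon> j t * A q \<epsilon> j t)"
  have d: "(psi c \<epsilon> j has_vector_derivative
     ((\<Sum>i\<in>I. (?f' i + lam i * ?f i t) * E i j t)
       + (\<Sum>p\<in>I. \<Sum>q\<in>I. (?h' p q + (lam p + lam q) * ?h p q t) * (E p j t * E q j t)))) (at t within {0..\<tau> / \<epsilon>})"
    unfolding psi_def[abs_def]
    by (intro modes_deriv has_vector_derivative_add has_vector_derivative_mult_right has_vector_derivative_mult dA D)
  have 1: "(\<Sum>i\<in>I. (?f' i + lam i * ?f i t) * E i j t)
    = (\<Sum>i\<in>I. (?e * (lam i * r i c * A i \<epsilon> j t + (r i c * g i + lam i * s i c) * D i \<epsilon> j t)) * E i j t)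
    + (\<Sum>i\<in>I. (?e * r i c * g i * (?e * Ay i \<epsilon> j t - D i \<epsilon> j t) + ?e\<^sup>2 * s i c * Dt i \<epsilon> j t) * E i j t)
    + (\<Sum>i\<in>I. ((?e\<^sup>2 * r i c) * Q i \<epsilon> j t) * E i j t)"
    unfolding sum.distrib[symmetric] distrib_right[symmetric]
    by (intro sum.cong refl arg_cong2[of _ _ _ _ "(*)"])
      (simp add: At_eq[OF _ eps t] algebra_simps power2_eq_square)
  have 2: "(\<Sum>p\<in>I. \<Sum>q\<in>I. (?h' p q + (lam p + lam q) * ?h p q t) * (E p j t * E q j t))
      + (\<Sum>i\<in>I. ((?e\<^sup>2 * r i c) * Q i \<epsilon> j t) * E i j t)
    = (\<Sum>p\<in>I. \<Sum>q\<in>I. (?e\<^sup>2 * ((\<Sum>i\<in>I. r i c * kap i p q) + (lam p + lam q) * X p q c) * (A p \<epsilon> j t * A q \<epsilon> j t)) * (E p j t * E q j t))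
    + (\<Sum>p\<in>I. \<Sum>q\<in>I. (?e\<^sup>2 * X p q c * (?e * (At p \<epsilon> j t * A q \<epsilon> j t + A p \<epsilon> j t * At q \<epsilon> j t))) * (E p j t * E q j t))"
    unfolding kap_swap sum.distrib[symmetric] distrib_right[symmetric]
    by (intro sum.cong refl arg_cong2[of _ _ _ _ "(*)"])
      (simp add: algebra_simps sum_distrib_left)
  have "(\<Sum>i\<in>I. (?f' i + lam i * ?f i t) * E i j t)
      + (\<Sum>p\<in>I. \<Sum>q\<in>I. (?h' p q + (lam p + lam q) * ?h p q t) * (E p j t * E q j t))
    = phi c \<epsilon> j t + res1 c \<epsilon> j t"
    unfolding phi_def res1_def by (rule assemble[OF 1 2])
  with d show ?thesis by (simp only:)
qed

lemma l2O_5I: "l2O \<tau> 3 f \<Longrightarrow> l2O \<tau> 5 (\<lambda>\<epsilon> j t. of_real \<epsilon> * f \<epsilon> j t)"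
  using l2O_eps[of \<tau> 3 f] by simp
lemma l2O_3I: "l2O \<tau> 1 f \<Longrightarrow> l2O \<tau> 3 (\<lambda>\<epsilon> j t. of_real \<epsilon> * f \<epsilon> j t)"
  using l2O_eps[of \<tau> 1 f] by (simp add: numeral_3_eq_3)
lemma l2O_5I2: "l2O \<tau> 1 f \<Longrightarrow> l2O \<tau> 5 (\<lambda>\<epsilon> j t. (of_real \<epsilon>)\<^sup>2 * f \<epsilon> j t)"
  using l2O_5I[OF l2O_3I] by (simp add: power2_eq_square mult.assoc)

lemma AtA_l2: assumes "p \<in> I" "q \<in> I"
  shows "l2O \<tau> 1 (\<lambda>\<epsilon> j t. of_real \<epsilon> * (At p \<epsilon> j t * A q \<epsilon> j t + A p \<epsilon> j t * At q \<epsilon> j t))"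
proof -
  have "l2O \<tau> 1 (\<lambda>\<epsilon> j t. (of_real \<epsilon> * At p \<epsilon> j t) * A q \<epsilon> j t + A p \<epsilon> j t * (of_real \<epsilon> * At q \<epsilon> j t))"
    by (intro l2O_add l2O_mult_bdd l2O_mult_bdd' At_l2 A_bdd assms)
  then show ?thesis by (simp add: algebra_simps)
qed

text \<open>Order 5 arises as \<epsilon> times a Taylor remainder of order 3, or as \<epsilon>^2
  times a quantity of order 1.\<close>

lemma res1_l2: "l2O \<tau> 5 (res1 c)"
proof -
  have "l2O \<tau> 5 (\<lambda>\<epsilon> j t. (\<Sum>i\<in>I. (of_real \<epsilon> * (r i c * g i * (of_real \<epsilon> * Ay i \<epsilon> j t - D i \<epsilon> j t))
     + (of_real \<epsilon>)\<^sup>2 * (s i c * Dt i \<epsilon> j t)) * E i j t)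
  + (\<Sum>p\<in>I. \<Sum>q\<in>I. ((of_real \<epsilon>)\<^sup>2 * (X p q c * (of_real \<epsilon> * (At p \<epsilon> j t * A q \<epsilon> j t + A p \<epsilon> j t * At q \<epsilon> j t))))
      * (E p j t * E q j t)))"
    by (intro l2O_add l2O_sum fin l2O_mult_bdd' bddO_mult E_bdd l2O_5I l2O_5I2 l2O_mult_bdd[OF bddO_const]
        A_taylor' Dt_l2 AtA_l2)
  then show ?thesis by (simp add: res1_def[abs_def] mult.assoc)
qed

lemma z_l2: "l2O \<tau> 1 (z c)"
proof -
  have "l2O \<tau> 1 (\<lambda>\<epsilon> j t. \<Sum>i\<in>I. (r i c * (of_real \<epsilon> * A i \<epsilon> j t)) * E i j t)"
    by (intro l2O_sum fin l2O_mult_bdd' E_bdd l2O_mult_bdd[OF bddO_const] A_l2)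
  then show ?thesis by (simp add: z_def[abs_def] mult_ac)
qed

lemma zd_l2: "l2O \<tau> 1 (zd c)"
proof -
  have "l2O \<tau> 1 (\<lambda>\<epsilon> j t. \<Sum>i\<in>I. (r i c * (of_real \<epsilon> * (of_real \<epsilon> * At i \<epsilon> j t) + lam i * (of_real \<epsilon> * A i \<epsilon> j t))) * E i j t)"
    by (intro l2O_sum fin l2O_mult_bdd' E_bdd l2O_mult_bdd[OF bddO_const] l2O_add A_l2 l2O_mult_bdd[OF bddO_eps] At_l2)
  then show ?thesis by (simp add: zd_def[abs_def] algebra_simps)
qed

lemma eps_AA_l2: assumes "p \<in> I" "q \<in> I" shows "l2O \<tau> 3 (\<lambda>\<epsilon> j t. (of_real \<epsilon>)\<^sup>2 * (A p \<epsilon> j t * A q \<epsilon> j t))"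
proof -
  have "l2O \<tau> 3 (\<lambda>\<epsilon> j t. of_real \<epsilon> * ((of_real \<epsilon> * A p \<epsilon> j t) * A q \<epsilon> j t))"
    by (intro l2O_3I l2O_mult_bdd' A_bdd A_l2 assms)
  then show ?thesis by (simp add: power2_eq_square mult.assoc)
qed

lemma psi_z: "l2O \<tau> 3 (\<lambda>\<epsilon> j t. psi c \<epsilon> j t - z c \<epsilon> j t)"
proof -
  have "l2O \<tau> 3 (\<lambda>\<epsilon> j t. (\<Sum>i\<in>I. (s i c * (of_real \<epsilon> * D i \<epsilon> j t)) * E i j t)
    + (\<Sum>p\<in>I. \<Sum>q\<in>I. (X p q c * ((of_real \<epsilon>)\<^sup>2 * (A p \<epsilon> j t * A q \<epsilon> j t))) * (E p j t * E q j t)))"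
    by (intro l2O_add l2O_sum fin l2O_mult_bdd' bddO_mult E_bdd l2O_3I l2O_mult_bdd[OF bddO_const] D_l2 eps_AA_l2)
  then show ?thesis
    by (simp add: psi_def z_def distrib_left distrib_right sum.distrib mult_ac)
qed

lemma add_diff_swap: "(x + y) - w = (x - w) + y" for x :: complex
  by simp

lemma phi_zd: "l2O \<tau> 3 (\<lambda>\<epsilon> j t. phi c \<epsilon> j t - zd c \<epsilon> j t)"
proof -
  have "l2O \<tau> 3 (\<lambda>\<epsilon> j t. (\<Sum>i\<in>I. ((r i c * g i + lam i * s i c) * (of_real \<epsilon> * D i \<epsilon> j t)
       - r i c * (of_real \<epsilon> * (of_real \<epsilon> * At i \<epsilon> j t))) * E i j t)
    + (\<Sum>p\<in>I. \<Sum>q\<in>I. (((\<Sum>i\<in>I. r i c * kap i p q) + (lam p + lam q) * X p q c) * ((of_real \<epsilon>)\<^sup>2 * (A p \<epsilon> j t * A q \<epsilon> j t))) * (E p j t * E q j t)))"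
    by (intro l2O_add l2O_diff l2O_sum fin l2O_mult_bdd' bddO_mult E_bdd l2O_3I l2O_mult_bdd[OF bddO_const] D_l2 At_l2 eps_AA_l2)
  moreover have "(\<Sum>i\<in>I. ((r i c * g i + lam i * s i c) * (of_real \<epsilon> * D i \<epsilon> j t)
       - r i c * (of_real \<epsilon> * (of_real \<epsilon> * At i \<epsilon> j t))) * E i j t)
    + (\<Sum>p\<in>I. \<Sum>q\<in>I. (((\<Sum>i\<in>I. r i c * kap i p q) + (lam p + lam q) * X p q c) * ((of_real \<epsilon>)\<^sup>2 * (A p \<epsilon> j t * A q \<epsilon> j t))) * (E p j t * E q j t))
    = phi c \<epsilon> j t - zd c \<epsilon> j t" for \<epsilon> j t
    unfolding phi_def zd_def add_diff_swap sum_subtractf[symmetric]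
    by (intro arg_cong2[of _ _ _ _ "(+)"] sum.cong refl) (simp_all add: algebra_simps)
  ultimately show ?thesis by simp
qed

lemma psi_l2: "l2O \<tau> 1 (psi c)"
  using l2O_add[OF z_l2[of c] l2O_mono[OF psi_z[of c], of 1]] by simp

lemma phi_l2: "l2O \<tau> 1 (phi c)"
  using l2O_add[OF zd_l2[of c] l2O_mono[OF phi_zd[of c], of 1]] by simp

lemma psi_bound: "\<exists>C\<ge>0. \<forall>\<epsilon> t j. 0 < \<epsilon> \<longrightarrow> \<epsilon> < 1 \<longrightarrow> t \<in> {0..\<tau> / \<epsilon>} \<longrightarrow> cmod (psi c \<epsilon> j t) \<le> C * \<epsilon>"
proof -
  let ?P = "\<lambda>\<epsilon> j t. (\<Sum>i\<in>I. (r i c * A i \<epsilon> j t + s i c * D i \<epsilon> j t) * E i j t)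
    + (\<Sum>p\<in>I. \<Sum>q\<in>I. (of_real \<epsilon> * X p q c * (A p \<epsilon> j t * A q \<epsilon> j t)) * (E p j t * E q j t))"
  have "bddO \<tau> ?P"
    by (intro bddO_add bddO_sum fin bddO_mult bddO_const bddO_eps E_bdd A_bdd D_bdd)
  then obtain C where C: "0 \<le> C" "\<And>\<epsilon> t j. 0 < \<epsilon> \<Longrightarrow> \<epsilon> < 1 \<Longrightarrow> t \<in> {0..\<tau> / \<epsilon>} \<Longrightarrow> cmod (?P \<epsilon> j t) \<le> C"
    by (rule bddO_E) blast
  have "psi c \<epsilon> j t = of_real \<epsilon> * ?P \<epsilon> j t" for \<epsilon> j t
    by (simp add: psi_def sum_distrib_left distrib_left distrib_right power2_eq_square mult.assoc)
  then have "cmod (psi c \<epsilon> j t) \<le> C * \<epsilon>" if "0 < \<epsilon>" "\<epsilon> < 1" "t \<in> {0..\<tau> / \<epsilon>}" for \<epsilon> j t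
    using C(2)[OF that, of j] that(1) by (simp add: norm_mult mult.commute mult_left_mono)
  with C(1) show ?thesis by blast
qed

lemma z_bound: "\<exists>C\<ge>0. \<forall>\<epsilon> t j. 0 < \<epsilon> \<longrightarrow> \<epsilon> < 1 \<longrightarrow> t \<in> {0..\<tau> / \<epsilon>} \<longrightarrow> cmod (z c \<epsilon> j t) \<le> C * \<epsilon>"
proof -
  let ?P = "\<lambda>\<epsilon> j t. (\<Sum>i\<in>I. (r i c * A i \<epsilon> j t) * E i j t)"
  have "bddO \<tau> ?P" by (intro bddO_sum fin bddO_mult bddO_const E_bdd A_bdd)
  then obtain C where C: "0 \<le> C" "\<And>\<epsilon> t j. 0 < \<epsilon> \<Longrightarrow> \<epsilon> < 1 \<Longrightarrow> t \<in> {0..\<tau> / \<epsilon>} \<Longrightarrow> cmod (?P \<epsilon> j t) \<le> C"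
    by (rule bddO_E) blast
  have "z c \<epsilon> j t = of_real \<epsilon> * ?P \<epsilon> j t" for \<epsilon> j t
    by (simp add: z_def sum_distrib_left mult.assoc)
  then have "cmod (z c \<epsilon> j t) \<le> C * \<epsilon>" if "0 < \<epsilon>" "\<epsilon> < 1" "t \<in> {0..\<tau> / \<epsilon>}" for \<epsilon> j t
    using C(2)[OF that, of j] that(1) by (simp add: norm_mult mult.commute mult_left_mono)
  with C(1) show ?thesis by blast
qed

text \<open>What remains of the linear terms of mode i after \<open>kernel1\<close> and
  \<open>lin1\<close>: the Taylor defect, the time derivative of \<open>D\<close>, and a second
  difference because the neighbouring cell sees \<open>D\<close> one step further on. In
  \<open>lin2_res\<close> the neighbour is the previous cell.\<close>

definition "lin1_res i \<epsilon> j t = of_real \<epsilon> * (lam i * r i 1 * g i * (of_real \<epsilon> * Ay i \<epsilon> j t - D i \<epsilon> j t))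
  + (of_real \<epsilon>)\<^sup>2 * ((r i 1 * g i + lam i * s i 1) * Dt i \<epsilon> j t)
  - of_real \<epsilon> * (p1 * s i 2 * e i * (D i \<epsilon> (j + 1) t - D i \<epsilon> j t))"

definition "lin2_res i \<epsilon> j t = of_real \<epsilon> * (lam i * r i 2 * g i * (of_real \<epsilon> * Ay i \<epsilon> j t - D i \<epsilon> j t))
  + (of_real \<epsilon>)\<^sup>2 * ((r i 2 * g i + lam i * s i 2) * Dt i \<epsilon> j t)
  + of_real \<epsilon> * (p2 * ei i * (s i 1 - r i 1) * (D i \<epsilon> j t - D i \<epsilon> (j - 1) t))"

definition "Y c p q = (\<Sum>i\<in>I. r i c * kap i p q) + (lam p + lam q) * X p q c"

definition "quad1_res p q \<epsilon> j t = (of_real \<epsilon>)\<^sup>2 * (Y 1 p q * (of_real \<epsilon> * (At p \<epsilon> j t * A q \<epsilon> j t + A p \<epsilon> j t * At q \<epsilon> j t)))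
  - (of_real \<epsilon>)\<^sup>2 * (p1 * X p q 2 * (e p * e q) * (A p \<epsilon> (j + 1) t * A q \<epsilon> (j + 1) t - A p \<epsilon> j t * A q \<epsilon> j t))"

definition "quad2_res p q \<epsilon> j t = (of_real \<epsilon>)\<^sup>2 * (Y 2 p q * (of_real \<epsilon> * (At p \<epsilon> j t * A q \<epsilon> j t + A p \<epsilon> j t * At q \<epsilon> j t)))
  - (of_real \<epsilon>)\<^sup>2 * (p2 * X p q 1 * (ei p * ei q) * (A p \<epsilon> (j - 1) t * A q \<epsilon> (j - 1) t - A p \<epsilon> j t * A q \<epsilon> j t))"

text \<open>The strains of the leading order term, split into the part that sees the amplitudes of the own cell
  (\<open>S1\<close>, \<open>S2\<close>) and the part that sees their differences (\<open>T1\<close>, \<open>T2\<close>).\<close>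

definition "S1 \<epsilon> j t = (\<Sum>i\<in>I. ((e i * r i 2 - r i 1) * A i \<epsilon> j t) * E i j t)"
definition "T1 \<epsilon> j t = (\<Sum>i\<in>I. (e i * r i 2 * D i \<epsilon> j t) * E i j t)"
definition "S2 \<epsilon> j t = (\<Sum>i\<in>I. ((r i 2 - ei i * r i 1) * A i \<epsilon> j t) * E i j t)"
definition "T2 \<epsilon> j t = (\<Sum>i\<in>I. (ei i * r i 1 * D i \<epsilon> (j - 1) t) * E i j t)"

definition "res2 c \<epsilon> j t = (if c = (1::nat)
   then (\<Sum>i\<in>I. lin1_res i \<epsilon> j t * E i j t) + (\<Sum>p\<in>I. \<Sum>q\<in>I. quad1_res p q \<epsilon> j t * (E p j t * E q j t))
     - (of_real \<epsilon>)\<^sup>2 * (n1 * ((2 * S1 \<epsilon> j t + T1 \<epsilon> j t) * T1 \<epsilon> j t))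
   else (\<Sum>i\<in>I. lin2_res i \<epsilon> j t * E i j t) + (\<Sum>p\<in>I. \<Sum>q\<in>I. quad2_res p q \<epsilon> j t * (E p j t * E q j t))
     + (of_real \<epsilon>)\<^sup>2 * (n2 * ((2 * S2 \<epsilon> j t + T2 \<epsilon> j t) * T2 \<epsilon> j t)))"

text \<open>The linear forces act on the corrected profile \<open>psi\<close>, the quadratic ones
  only on the leading term \<open>z\<close>. Exchanging \<open>z\<close> for \<open>psi\<close> in
  the squares costs O(\<epsilon>) times their difference; \<open>expands_defect\<close> accounts for
  that.\<close>

definition "force c \<epsilon> j t = (if c = (1::nat)
   then p1 * (psi 2 \<epsilon> (j + 1) t + psi 2 \<epsilon> j t) - c1 * psi 1 \<epsilon> j t
     + n1 * ((z 2 \<epsilon> (j + 1) t - z 1 \<epsilon> j t)\<^sup>2 - (z 1 \<epsilon> j t - z 2 \<epsilon> j t)\<^sup>2) - m1 * (z 1 \<epsilon> j t)\<^sup>2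
   else p2 * (psi 1 \<epsilon> j t + psi 1 \<epsilon> (j - 1) t) - c2 * psi 2 \<epsilon> j t
     + n2 * ((z 1 \<epsilon> j t - z 2 \<epsilon> j t)\<^sup>2 - (z 2 \<epsilon> j t - z 1 \<epsilon> (j - 1) t)\<^sup>2) - m2 * (z 2 \<epsilon> j t)\<^sup>2)"

lemma res2_l2: "l2O \<tau> 5 (res2 c)"
proof -
  have sh: "l2O \<tau> 1 (\<lambda>\<epsilon> j t. D i \<epsilon> (j - 1) t)" "bddO \<tau> (\<lambda>\<epsilon> j t. D i \<epsilon> (j - 1) t)" if "i \<in> I" for i
    using l2O_shift[OF D_l2[OF that], of "\<lambda>j. j - 1"] bddO_shift[OF D_bdd[OF that], of "\<lambda>j. j - 1"] by (simp_all add: inj_def)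
  have b: "bddO \<tau> S1" "bddO \<tau> S2" "bddO \<tau> T1" "bddO \<tau> T2"
    unfolding S1_def[abs_def] S2_def[abs_def] T1_def[abs_def] T2_def[abs_def]
    by (intro bddO_sum fin bddO_mult bddO_const E_bdd A_bdd D_bdd sh; assumption)+
  have T: "l2O \<tau> 1 T1" "l2O \<tau> 1 T2"
    unfolding T1_def[abs_def] T2_def[abs_def]
    by (intro l2O_sum fin l2O_mult_bdd' E_bdd l2O_mult_bdd[OF bddO_const] D_l2 sh; assumption)+
  have lin: "l2O \<tau> 5 (lin1_res i)" "l2O \<tau> 5 (lin2_res i)" if "i \<in> I" for i
    unfolding lin1_res_def[abs_def] lin2_res_def[abs_def]
    by (intro l2O_add l2O_diff l2O_5I l2O_5I2 l2O_mult_bdd[OF bddO_const] A_taylor' Dt_l2 D_diff D_diff' that)+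
  have quad: "l2O \<tau> 5 (quad1_res p q)" "l2O \<tau> 5 (quad2_res p q)" if "p \<in> I" "q \<in> I" for p q
    unfolding quad1_res_def[abs_def] quad2_res_def[abs_def]
    by (intro l2O_diff l2O_5I2 l2O_mult_bdd[OF bddO_const] AtA_l2 AA_diff AA_diff' that)+
  have "l2O \<tau> 5 (\<lambda>\<epsilon> j t. (\<Sum>i\<in>I. lin1_res i \<epsilon> j t * E i j t) + (\<Sum>p\<in>I. \<Sum>q\<in>I. quad1_res p q \<epsilon> j t * (E p j t * E q j t))
     - (of_real \<epsilon>)\<^sup>2 * (n1 * ((2 * S1 \<epsilon> j t + T1 \<epsilon> j t) * T1 \<epsilon> j t)))"
    by (intro l2O_add l2O_diff l2O_sum fin l2O_mult_bdd' bddO_mult E_bdd lin quad l2O_5I2 l2O_mult_bdd[OF bddO_const]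
        l2O_mult_bdd[OF bddO_add[OF bddO_mult[OF bddO_const b(1)] b(3)]] T)
  moreover have "l2O \<tau> 5 (\<lambda>\<epsilon> j t. (\<Sum>i\<in>I. lin2_res i \<epsilon> j t * E i j t) + (\<Sum>p\<in>I. \<Sum>q\<in>I. quad2_res p q \<epsilon> j t * (E p j t * E q j t))
     + (of_real \<epsilon>)\<^sup>2 * (n2 * ((2 * S2 \<epsilon> j t + T2 \<epsilon> j t) * T2 \<epsilon> j t)))"
    by (intro l2O_add l2O_sum fin l2O_mult_bdd' bddO_mult E_bdd lin quad l2O_5I2 l2O_mult_bdd[OF bddO_const]
        l2O_mult_bdd[OF bddO_add[OF bddO_mult[OF bddO_const b(2)] b(4)]] T)
  ultimately show ?thesis by (cases "c = 1") (simp_all add: res2_def[abs_def])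
qed

lemma square_modes:
  "(\<Sum>i\<in>I. (x i * A i \<epsilon> j t) * E i j t)\<^sup>2 = (\<Sum>p\<in>I. \<Sum>q\<in>I. (x p * x q * (A p \<epsilon> j t * A q \<epsilon> j t)) * (E p j t * E q j t))"
  unfolding power2_eq_square sum_product by (intro sum.cong refl) (simp add: mult_ac)

lemma phi_deriv_modes:
  assumes eps: "0 < \<epsilon>" and t: "t \<in> {0..\<tau> / \<epsilon>}"
  shows "(phi c \<epsilon> j has_vector_derivative
     ((\<Sum>i\<in>I. (of_real \<epsilon> * (lam i * r i c * (of_real \<epsilon> * At i \<epsilon> j t) + (r i c * g i + lam i * s i c) * (of_real \<epsilon> * Dt i \<epsilon> j t))
         + lam i * (of_real \<epsilon> * (lam i * r i c * A i \<epsilon> j t + (r i c * g i + lam i * s i c) * D i \<epsilon> j t))) * E i j t)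
       + (\<Sum>p\<in>I. \<Sum>q\<in>I. ((of_real \<epsilon>)\<^sup>2 * Y c p q * (A p \<epsilon> j t * (of_real \<epsilon> * At q \<epsilon> j t) + of_real \<epsilon> * At p \<epsilon> j t * A q \<epsilon> j t)
         + (lam p + lam q) * ((of_real \<epsilon>)\<^sup>2 * Y c p q * (A p \<epsilon> j t * A q \<epsilon> j t))) * (E p j t * E q j t)))) (at t within {0..\<tau> / \<epsilon>})"
proof -
  note dA = A_has_deriv[OF _ eps t]
  have D: "(D i \<epsilon> j has_vector_derivative of_real \<epsilon> * Dt i \<epsilon> j t) (at t within {0..\<tau> / \<epsilon>})" if "i \<in> I" for i j
    unfolding D_def[abs_def] Dt_def right_diff_distrib by (intro has_vector_derivative_diff dA that)
  show ?thesis
    unfolding phi_def[abs_def] Y_def[symmetric]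
    by (intro modes_deriv has_vector_derivative_add has_vector_derivative_mult_right has_vector_derivative_mult dA D)
qed

lemma lam_kap: assumes "p \<in> I" "q \<in> I"
  shows "(lam p + lam q) * (\<Sum>i\<in>I. r i c * kap i p q) = (\<Sum>i\<in>I. lam i * r i c * kap i p q)"
  unfolding sum_distrib_left
proof (intro sum.cong refl)
  fix i assume "i \<in> I"
  then show "(lam p + lam q) * (r i c * kap i p q) = lam i * r i c * kap i p q"
    using res_lam[of i p q] assms by (cases "kap i p q = 0") auto
qed

lemma force_assemble:
  fixes F lin N N' res ql sl sr L H kq pN K :: complex
  assumes "F = lin + N + (sl + sr - K)" "lin = L + ql" "N = N' + K" "pN = ql + N'"
    "L' = L + sl + kq" "H + kq = pN + sr"
  shows "F = L' + H"
  using assms by algebra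

text \<open>Comparison of coefficients: those of A cancel by \<open>kernel1\<close>, those of D by
  \<open>lin1\<close>, and those of the products of two amplitudes by \<open>quad1\<close>. Only
  terms with one more difference or time derivative are left, and they form
  \<open>res2\<close>.\<close>

lemma phi_deriv1:
  assumes eps: "0 < \<epsilon>" and t: "t \<in> {0..\<tau> / \<epsilon>}"
  shows "(phi 1 \<epsilon> j has_vector_derivative force 1 \<epsilon> j t + res2 1 \<epsilon> j t) (at t within {0..\<tau> / \<epsilon>})"
proof -
  let ?e = "of_real \<epsilon> :: complex"
  let ?L = "\<lambda>i. ?e * (lam i * r i 1 * (?e * At i \<epsilon> j t) + (r i 1 * g i + lam i * s i 1) * (?e * Dt i \<epsilon> j t))
         + lam i * (?e * (lam i * r i 1 * A i \<epsilon> j t + (r i 1 * g i + lam i * s i 1) * D i \<epsilon> j t))"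
  let ?H = "\<lambda>p q. ?e\<^sup>2 * Y 1 p q * (A p \<epsilon> j t * (?e * At q \<epsilon> j t) + ?e * At p \<epsilon> j t * A q \<epsilon> j t)
         + (lam p + lam q) * (?e\<^sup>2 * Y 1 p q * (A p \<epsilon> j t * A q \<epsilon> j t))"
  let ?pl = "\<lambda>i. p1 * (?e * (r i 2 * A i \<epsilon> (j + 1) t + s i 2 * D i \<epsilon> (j + 1) t) * e i + ?e * (r i 2 * A i \<epsilon> j t + s i 2 * D i \<epsilon> j t))
       - c1 * (?e * (r i 1 * A i \<epsilon> j t + s i 1 * D i \<epsilon> j t))"
  let ?pq = "\<lambda>p q. p1 * (?e\<^sup>2 * X p q 2 * (A p \<epsilon> (j + 1) t * A q \<epsilon> (j + 1) t) * (e p * e q) + ?e\<^sup>2 * X p q 2 * (A p \<epsilon> j t * A q \<epsilon> j t))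
       - c1 * (?e\<^sup>2 * X p q 1 * (A p \<epsilon> j t * A q \<epsilon> j t))"
  let ?N = "\<lambda>p q. n1 * ((e p * r p 2 - r p 1) * (e q * r q 2 - r q 1) - (r p 1 - r p 2) * (r q 1 - r q 2)) - m1 * r p 1 * r q 1"
  have lin: "?L i = ?pl i + lin1_res i \<epsilon> j t + (?e\<^sup>2 * lam i * r i 1) * Q i \<epsilon> j t" if i: "i \<in> I" for i
  proof -
    have A1: "A i \<epsilon> (j + 1) t = A i \<epsilon> j t + D i \<epsilon> j t" by (simp add: D_def)
    have "?L i - (?pl i + lin1_res i \<epsilon> j t + (?e\<^sup>2 * lam i * r i 1) * Q i \<epsilon> j t)
      = ?e * A i \<epsilon> j t * (((lam i)\<^sup>2 + c1) * r i 1 - p1 * (e i + 1) * r i 2)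
       + ?e * D i \<epsilon> j t * (2 * lam i * g i * r i 1 + ((lam i)\<^sup>2 + c1) * s i 1 - (p1 * (e i + 1) * s i 2 + p1 * e i * r i 2))"
      unfolding lin1_res_def At_eq[OF i eps t] A1 by (simp add: algebra_simps power2_eq_square)
    also have "\<dots> = 0" unfolding kernel1[OF i] lin1[OF i] by simp
    finally show ?thesis by (simp only: right_minus_eq)
  qed
  have quad: "?H p q + (\<Sum>i\<in>I. (?e\<^sup>2 * lam i * r i 1) * kap i p q) * (A p \<epsilon> j t * A q \<epsilon> j t)
      = ?pq p q + ?e\<^sup>2 * ?N p q * (A p \<epsilon> j t * A q \<epsilon> j t) + quad1_res p q \<epsilon> j t" if pq: "p \<in> I" "q \<in> I" for p q
  proof -
    have k: "(\<Sum>i\<in>I. (?e\<^sup>2 * lam i * r i 1) * kap i p q) = ?e\<^sup>2 * (\<Sum>i\<in>I. lam i * r i 1 * kap i p q)"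
      by (simp add: sum_distrib_left mult.assoc)
    \<comment> \<open>By resonance the first sum over \<open>kap\<close> is the same as the one
      moved in by \<open>kap_swap\<close>; together they give the factor 2 in
      \<open>quad1\<close>.\<close>
    have y: "(lam p + lam q) * Y 1 p q = (\<Sum>i\<in>I. lam i * r i 1 * kap i p q) + (lam p + lam q)\<^sup>2 * X p q 1"
      unfolding Y_def distrib_left lam_kap[OF pq] by (simp add: power2_eq_square mult.assoc)
    have "?H p q + ?e\<^sup>2 * (\<Sum>i\<in>I. lam i * r i 1 * kap i p q) * (A p \<epsilon> j t * A q \<epsilon> j t)
      - (?pq p q + ?e\<^sup>2 * ?N p q * (A p \<epsilon> j t * A q \<epsilon> j t) + quad1_res p q \<epsilon> j t)
      = ?e\<^sup>2 * (A p \<epsilon> j t * A q \<epsilon> j t) * ((lam p + lam q) * Y 1 p q + (\<Sum>i\<in>I. lam i * r i 1 * kap i p q)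
         + c1 * X p q 1 - (p1 * (e p * e q + 1) * X p q 2 + ?N p q))"
      unfolding quad1_res_def by (simp add: algebra_simps)
    also have "\<dots> = ?e\<^sup>2 * (A p \<epsilon> j t * A q \<epsilon> j t) * ((((lam p + lam q)\<^sup>2 + c1) * X p q 1 + 2 * (\<Sum>i\<in>I. lam i * r i 1 * kap i p q))
         - (p1 * (e p * e q + 1) * X p q 2 + ?N p q))"
      unfolding y by (simp add: algebra_simps)
    also have "\<dots> = 0" unfolding quad1[OF pq] by simp
    finally show ?thesis unfolding k by (simp only: right_minus_eq)
  qed
  have 1: "(\<Sum>i\<in>I. ?L i * E i j t) = (\<Sum>i\<in>I. ?pl i * E i j t) + (\<Sum>i\<in>I. lin1_res i \<epsilon> j t * E i j t)
      + (\<Sum>i\<in>I. ((?e\<^sup>2 * lam i * r i 1) * Q i \<epsilon> j t) * E i j t)"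
    unfolding sum.distrib[symmetric] distrib_right[symmetric] by (intro sum.cong refl) (simp only: lin)
  have 2: "(\<Sum>p\<in>I. \<Sum>q\<in>I. ?H p q * (E p j t * E q j t)) + (\<Sum>i\<in>I. ((?e\<^sup>2 * lam i * r i 1) * Q i \<epsilon> j t) * E i j t)
      = (\<Sum>p\<in>I. \<Sum>q\<in>I. (?pq p q + ?e\<^sup>2 * ?N p q * (A p \<epsilon> j t * A q \<epsilon> j t)) * (E p j t * E q j t))
        + (\<Sum>p\<in>I. \<Sum>q\<in>I. quad1_res p q \<epsilon> j t * (E p j t * E q j t))"
    unfolding kap_swap sum.distrib[symmetric] distrib_right[symmetric] by (intro sum.cong refl) (simp only: quad)
  have 3: "p1 * (psi 2 \<epsilon> (j + 1) t + psi 2 \<epsilon> j t) - c1 * psi 1 \<epsilon> j t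
      = (\<Sum>i\<in>I. ?pl i * E i j t) + (\<Sum>p\<in>I. \<Sum>q\<in>I. ?pq p q * (E p j t * E q j t))"
  proof -
    have "psi 2 \<epsilon> (j + 1) t = (\<Sum>i\<in>I. (?e * (r i 2 * A i \<epsilon> (j + 1) t + s i 2 * D i \<epsilon> (j + 1) t) * e i) * E i j t)
      + (\<Sum>p\<in>I. \<Sum>q\<in>I. (?e\<^sup>2 * X p q 2 * (A p \<epsilon> (j + 1) t * A q \<epsilon> (j + 1) t) * (e p * e q)) * (E p j t * E q j t))"
      unfolding psi_def by (intro arg_cong2[of _ _ _ _ "(+)"] sum.cong refl) (simp_all add: E_shift mult_ac)
    then show ?thesis
      unfolding psi_def
      by (simp only: distrib_left sum_distrib_left left_diff_distrib distrib_right sum.distrib sum_subtractf mult.assoc)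
        (simp only: algebra_simps)
  qed
  \<comment> \<open>The right spring reaches into cell j + 1; replacing its amplitude by the one of
    cell j splits off the difference part \<open>T1\<close>.\<close>
  have z1: "z 2 \<epsilon> (j + 1) t - z 1 \<epsilon> j t = ?e * (S1 \<epsilon> j t + T1 \<epsilon> j t)"
    unfolding z_def S1_def T1_def sum.distrib[symmetric] sum_subtractf[symmetric] sum_distrib_left
  proof (intro sum.cong refl)
    fix i assume i: "i \<in> I"
    show "?e * r i 2 * A i \<epsilon> (j + 1) t * E i (j + 1) t - ?e * r i 1 * A i \<epsilon> j t * E i j t
      = ?e * ((e i * r i 2 - r i 1) * A i \<epsilon> j t * E i j t + e i * r i 2 * D i \<epsilon> j t * E i j t)"
      unfolding E_shift[OF i] D_def by (simp add: algebra_simps)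
  qed
  define B where "B = (\<Sum>i\<in>I. ((r i 1 - r i 2) * A i \<epsilon> j t) * E i j t)"
  define Z where "Z = (\<Sum>i\<in>I. (r i 1 * A i \<epsilon> j t) * E i j t)"
  have z2: "z 1 \<epsilon> j t - z 2 \<epsilon> j t = ?e * B"
    unfolding z_def B_def sum_subtractf[symmetric] sum_distrib_left
    by (intro sum.cong refl) (simp add: algebra_simps)
  have z3: "z 1 \<epsilon> j t = ?e * Z"
    unfolding z_def Z_def sum_distrib_left by (intro sum.cong refl) (simp add: algebra_simps)
  have 4: "(\<Sum>p\<in>I. \<Sum>q\<in>I. (?e\<^sup>2 * ?N p q * (A p \<epsilon> j t * A q \<epsilon> j t)) * (E p j t * E q j t))
     = ?e\<^sup>2 * (n1 * ((S1 \<epsilon> j t)\<^sup>2 - B\<^sup>2) - m1 * Z\<^sup>2)"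
    unfolding S1_def B_def Z_def square_modes sum_subtractf[symmetric] sum_distrib_left
    by (intro sum.cong refl) (simp add: algebra_simps)
  have "force 1 \<epsilon> j t + res2 1 \<epsilon> j t = (\<Sum>i\<in>I. ?L i * E i j t) + (\<Sum>p\<in>I. \<Sum>q\<in>I. ?H p q * (E p j t * E q j t))"
  proof -
    have "force 1 \<epsilon> j t = (p1 * (psi 2 \<epsilon> (j + 1) t + psi 2 \<epsilon> j t) - c1 * psi 1 \<epsilon> j t)
        + (n1 * ((?e * (S1 \<epsilon> j t + T1 \<epsilon> j t))\<^sup>2 - (?e * B)\<^sup>2) - m1 * (z 1 \<epsilon> j t)\<^sup>2)"
      unfolding force_def z1 z2 by simp
    then have "force 1 \<epsilon> j t + res2 1 \<epsilon> j t = (p1 * (psi 2 \<epsilon> (j + 1) t + psi 2 \<epsilon> j t) - c1 * psi 1 \<epsilon> j t)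
        + (n1 * ((?e * (S1 \<epsilon> j t + T1 \<epsilon> j t))\<^sup>2 - (?e * B)\<^sup>2) - m1 * (?e * Z)\<^sup>2)
        + ((\<Sum>i\<in>I. lin1_res i \<epsilon> j t * E i j t) + (\<Sum>p\<in>I. \<Sum>q\<in>I. quad1_res p q \<epsilon> j t * (E p j t * E q j t))
        - ?e\<^sup>2 * (n1 * ((2 * S1 \<epsilon> j t + T1 \<epsilon> j t) * T1 \<epsilon> j t)))"
      unfolding z3 res2_def by simp
    moreover have "n1 * ((?e * (S1 \<epsilon> j t + T1 \<epsilon> j t))\<^sup>2 - (?e * B)\<^sup>2) - m1 * (?e * Z)\<^sup>2
        = ?e\<^sup>2 * (n1 * ((S1 \<epsilon> j t)\<^sup>2 - B\<^sup>2) - m1 * Z\<^sup>2) + ?e\<^sup>2 * (n1 * ((2 * S1 \<epsilon> j t + T1 \<epsilon> j t) * T1 \<epsilon> j t))"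
      by (simp add: algebra_simps power2_eq_square)
    moreover have "(\<Sum>p\<in>I. \<Sum>q\<in>I. (?pq p q + ?e\<^sup>2 * ?N p q * (A p \<epsilon> j t * A q \<epsilon> j t)) * (E p j t * E q j t))
        = (\<Sum>p\<in>I. \<Sum>q\<in>I. ?pq p q * (E p j t * E q j t)) + ?e\<^sup>2 * (n1 * ((S1 \<epsilon> j t)\<^sup>2 - B\<^sup>2) - m1 * Z\<^sup>2)"
      unfolding 4[symmetric] sum.distrib[symmetric] distrib_right[symmetric] ..
    ultimately show ?thesis by (rule force_assemble[OF _ 3 _ _ 1 2])
  qed
  with phi_deriv_modes[OF eps t, of 1 j] show ?thesis by (simp only:)
qed

text \<open>For the second component the right spring lies inside the cell and the left one reaches
  into cell j - 1. Hence the backward differences, and the opposite sign of the strain correction in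
  \<open>res2\<close>.\<close>

lemma phi_deriv2:
  assumes eps: "0 < \<epsilon>" and t: "t \<in> {0..\<tau> / \<epsilon>}"
  shows "(phi 2 \<epsilon> j has_vector_derivative force 2 \<epsilon> j t + res2 2 \<epsilon> j t) (at t within {0..\<tau> / \<epsilon>})"
proof -
  let ?e = "of_real \<epsilon> :: complex"
  let ?L = "\<lambda>i. ?e * (lam i * r i 2 * (?e * At i \<epsilon> j t) + (r i 2 * g i + lam i * s i 2) * (?e * Dt i \<epsilon> j t))
         + lam i * (?e * (lam i * r i 2 * A i \<epsilon> j t + (r i 2 * g i + lam i * s i 2) * D i \<epsilon> j t))"
  let ?H = "\<lambda>p q. ?e\<^sup>2 * Y 2 p q * (A p \<epsilon> j t * (?e * At q \<epsilon> j t) + ?e * At p \<epsilon> j t * A q \<epsilon> j t)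
         + (lam p + lam q) * (?e\<^sup>2 * Y 2 p q * (A p \<epsilon> j t * A q \<epsilon> j t))"
  let ?pl = "\<lambda>i. p2 * (?e * (r i 1 * A i \<epsilon> j t + s i 1 * D i \<epsilon> j t) + ?e * (r i 1 * A i \<epsilon> (j - 1) t + s i 1 * D i \<epsilon> (j - 1) t) * ei i)
       - c2 * (?e * (r i 2 * A i \<epsilon> j t + s i 2 * D i \<epsilon> j t))"
  let ?pq = "\<lambda>p q. p2 * (?e\<^sup>2 * X p q 1 * (A p \<epsilon> j t * A q \<epsilon> j t) + ?e\<^sup>2 * X p q 1 * (A p \<epsilon> (j - 1) t * A q \<epsilon> (j - 1) t) * (ei p * ei q))
       - c2 * (?e\<^sup>2 * X p q 2 * (A p \<epsilon> j t * A q \<epsilon> j t))"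
  let ?N = "\<lambda>p q. n2 * ((r p 1 - r p 2) * (r q 1 - r q 2) - (r p 2 - ei p * r p 1) * (r q 2 - ei q * r q 1)) - m2 * r p 2 * r q 2"
  have A1: "A i \<epsilon> (j - 1) t = A i \<epsilon> j t - D i \<epsilon> (j - 1) t" for i by (simp add: D_def)
  have lin: "?L i = ?pl i + lin2_res i \<epsilon> j t + (?e\<^sup>2 * lam i * r i 2) * Q i \<epsilon> j t" if i: "i \<in> I" for i
  proof -
    have "?L i - (?pl i + lin2_res i \<epsilon> j t + (?e\<^sup>2 * lam i * r i 2) * Q i \<epsilon> j t)
      = ?e * A i \<epsilon> j t * (((lam i)\<^sup>2 + c2) * r i 2 - p2 * (1 + ei i) * r i 1)
       + ?e * D i \<epsilon> j t * (2 * lam i * g i * r i 2 + ((lam i)\<^sup>2 + c2) * s i 2 - (p2 * (1 + ei i) * s i 1 - p2 * ei i * r i 1))"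
      unfolding lin2_res_def At_eq[OF i eps t] A1 by (simp add: algebra_simps power2_eq_square)
    also have "\<dots> = 0" unfolding kernel2[OF i] lin2[OF i] by simp
    finally show ?thesis by (simp only: right_minus_eq)
  qed
  have quad: "?H p q + (\<Sum>i\<in>I. (?e\<^sup>2 * lam i * r i 2) * kap i p q) * (A p \<epsilon> j t * A q \<epsilon> j t)
      = ?pq p q + ?e\<^sup>2 * ?N p q * (A p \<epsilon> j t * A q \<epsilon> j t) + quad2_res p q \<epsilon> j t" if pq: "p \<in> I" "q \<in> I" for p q
  proof -
    have k: "(\<Sum>i\<in>I. (?e\<^sup>2 * lam i * r i 2) * kap i p q) = ?e\<^sup>2 * (\<Sum>i\<in>I. lam i * r i 2 * kap i p q)"
      by (simp add: sum_distrib_left mult.assoc)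
    have y: "(lam p + lam q) * Y 2 p q = (\<Sum>i\<in>I. lam i * r i 2 * kap i p q) + (lam p + lam q)\<^sup>2 * X p q 2"
      unfolding Y_def distrib_left lam_kap[OF pq] by (simp add: power2_eq_square mult.assoc)
    have "?H p q + ?e\<^sup>2 * (\<Sum>i\<in>I. lam i * r i 2 * kap i p q) * (A p \<epsilon> j t * A q \<epsilon> j t)
      - (?pq p q + ?e\<^sup>2 * ?N p q * (A p \<epsilon> j t * A q \<epsilon> j t) + quad2_res p q \<epsilon> j t)
      = ?e\<^sup>2 * (A p \<epsilon> j t * A q \<epsilon> j t) * ((lam p + lam q) * Y 2 p q + (\<Sum>i\<in>I. lam i * r i 2 * kap i p q)
         + c2 * X p q 2 - (p2 * (1 + ei p * ei q) * X p q 1 + ?N p q))"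
      unfolding quad2_res_def by (simp add: algebra_simps)
    also have "\<dots> = ?e\<^sup>2 * (A p \<epsilon> j t * A q \<epsilon> j t) * ((((lam p + lam q)\<^sup>2 + c2) * X p q 2 + 2 * (\<Sum>i\<in>I. lam i * r i 2 * kap i p q))
         - (p2 * (1 + ei p * ei q) * X p q 1 + ?N p q))"
      unfolding y by (simp add: algebra_simps)
    also have "\<dots> = 0" unfolding quad2[OF pq] by simp
    finally show ?thesis unfolding k by (simp only: right_minus_eq)
  qed
  have 1: "(\<Sum>i\<in>I. ?L i * E i j t) = (\<Sum>i\<in>I. ?pl i * E i j t) + (\<Sum>i\<in>I. lin2_res i \<epsilon> j t * E i j t)
      + (\<Sum>i\<in>I. ((?e\<^sup>2 * lam i * r i 2) * Q i \<epsilon> j t) * E i j t)"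
    unfolding sum.distrib[symmetric] distrib_right[symmetric] by (intro sum.cong refl) (simp only: lin)
  have 2: "(\<Sum>p\<in>I. \<Sum>q\<in>I. ?H p q * (E p j t * E q j t)) + (\<Sum>i\<in>I. ((?e\<^sup>2 * lam i * r i 2) * Q i \<epsilon> j t) * E i j t)
      = (\<Sum>p\<in>I. \<Sum>q\<in>I. (?pq p q + ?e\<^sup>2 * ?N p q * (A p \<epsilon> j t * A q \<epsilon> j t)) * (E p j t * E q j t))
        + (\<Sum>p\<in>I. \<Sum>q\<in>I. quad2_res p q \<epsilon> j t * (E p j t * E q j t))"
    unfolding kap_swap sum.distrib[symmetric] distrib_right[symmetric] by (intro sum.cong refl) (simp only: quad)
  have 3: "p2 * (psi 1 \<epsilon> j t + psi 1 \<epsilon> (j - 1) t) - c2 * psi 2 \<epsilon> j t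
      = (\<Sum>i\<in>I. ?pl i * E i j t) + (\<Sum>p\<in>I. \<Sum>q\<in>I. ?pq p q * (E p j t * E q j t))"
  proof -
    have "psi 1 \<epsilon> (j - 1) t = (\<Sum>i\<in>I. (?e * (r i 1 * A i \<epsilon> (j - 1) t + s i 1 * D i \<epsilon> (j - 1) t) * ei i) * E i j t)
      + (\<Sum>p\<in>I. \<Sum>q\<in>I. (?e\<^sup>2 * X p q 1 * (A p \<epsilon> (j - 1) t * A q \<epsilon> (j - 1) t) * (ei p * ei q)) * (E p j t * E q j t))"
      unfolding psi_def by (intro arg_cong2[of _ _ _ _ "(+)"] sum.cong refl) (simp_all add: E_back mult_ac)
    then show ?thesis
      unfolding psi_def
      by (simp only: distrib_left sum_distrib_left left_diff_distrib distrib_right sum.distrib sum_subtractf mult.assoc)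
        (simp only: algebra_simps)
  qed
  have z1: "z 2 \<epsilon> j t - z 1 \<epsilon> (j - 1) t = ?e * (S2 \<epsilon> j t + T2 \<epsilon> j t)"
    unfolding z_def S2_def T2_def sum.distrib[symmetric] sum_subtractf[symmetric] sum_distrib_left
  proof (intro sum.cong refl)
    fix i assume i: "i \<in> I"
    show "?e * r i 2 * A i \<epsilon> j t * E i j t - ?e * r i 1 * A i \<epsilon> (j - 1) t * E i (j - 1) t
      = ?e * ((r i 2 - ei i * r i 1) * A i \<epsilon> j t * E i j t + ei i * r i 1 * D i \<epsilon> (j - 1) t * E i j t)"
      unfolding E_back[OF i] A1 by (simp add: algebra_simps)
  qed
  define B where "B = (\<Sum>i\<in>I. ((r i 1 - r i 2) * A i \<epsilon> j t) * E i j t)"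
  define Z where "Z = (\<Sum>i\<in>I. (r i 2 * A i \<epsilon> j t) * E i j t)"
  have z2: "z 1 \<epsilon> j t - z 2 \<epsilon> j t = ?e * B"
    unfolding z_def B_def sum_subtractf[symmetric] sum_distrib_left
    by (intro sum.cong refl) (simp add: algebra_simps)
  have z3: "z 2 \<epsilon> j t = ?e * Z"
    unfolding z_def Z_def sum_distrib_left by (intro sum.cong refl) (simp add: algebra_simps)
  have 4: "(\<Sum>p\<in>I. \<Sum>q\<in>I. (?e\<^sup>2 * ?N p q * (A p \<epsilon> j t * A q \<epsilon> j t)) * (E p j t * E q j t))
     = ?e\<^sup>2 * (n2 * (B\<^sup>2 - (S2 \<epsilon> j t)\<^sup>2) - m2 * Z\<^sup>2)"
    unfolding S2_def B_def Z_def square_modes sum_subtractf[symmetric] sum_distrib_left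
    by (intro sum.cong refl) (simp add: algebra_simps)
  have "force 2 \<epsilon> j t + res2 2 \<epsilon> j t = (\<Sum>i\<in>I. ?L i * E i j t) + (\<Sum>p\<in>I. \<Sum>q\<in>I. ?H p q * (E p j t * E q j t))"
  proof -
    have "force 2 \<epsilon> j t = (p2 * (psi 1 \<epsilon> j t + psi 1 \<epsilon> (j - 1) t) - c2 * psi 2 \<epsilon> j t)
        + (n2 * ((?e * B)\<^sup>2 - (?e * (S2 \<epsilon> j t + T2 \<epsilon> j t))\<^sup>2) - m2 * (z 2 \<epsilon> j t)\<^sup>2)"
      unfolding force_def z1 z2 by simp
    then have "force 2 \<epsilon> j t + res2 2 \<epsilon> j t = (p2 * (psi 1 \<epsilon> j t + psi 1 \<epsilon> (j - 1) t) - c2 * psi 2 \<epsilon> j t)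
        + (n2 * ((?e * B)\<^sup>2 - (?e * (S2 \<epsilon> j t + T2 \<epsilon> j t))\<^sup>2) - m2 * (?e * Z)\<^sup>2)
        + ((\<Sum>i\<in>I. lin2_res i \<epsilon> j t * E i j t) + (\<Sum>p\<in>I. \<Sum>q\<in>I. quad2_res p q \<epsilon> j t * (E p j t * E q j t))
        - - (?e\<^sup>2 * (n2 * ((2 * S2 \<epsilon> j t + T2 \<epsilon> j t) * T2 \<epsilon> j t))))"
      unfolding z3 res2_def by simp
    moreover have "n2 * ((?e * B)\<^sup>2 - (?e * (S2 \<epsilon> j t + T2 \<epsilon> j t))\<^sup>2) - m2 * (?e * Z)\<^sup>2
        = ?e\<^sup>2 * (n2 * (B\<^sup>2 - (S2 \<epsilon> j t)\<^sup>2) - m2 * Z\<^sup>2) + - (?e\<^sup>2 * (n2 * ((2 * S2 \<epsilon> j t + T2 \<epsilon> j t) * T2 \<epsilon> j t)))"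
      by (simp add: algebra_simps power2_eq_square)
    moreover have "(\<Sum>p\<in>I. \<Sum>q\<in>I. (?pq p q + ?e\<^sup>2 * ?N p q * (A p \<epsilon> j t * A q \<epsilon> j t)) * (E p j t * E q j t))
        = (\<Sum>p\<in>I. \<Sum>q\<in>I. ?pq p q * (E p j t * E q j t)) + ?e\<^sup>2 * (n2 * (B\<^sup>2 - (S2 \<epsilon> j t)\<^sup>2) - m2 * Z\<^sup>2)"
      unfolding 4[symmetric] sum.distrib[symmetric] distrib_right[symmetric] ..
    ultimately show ?thesis by (rule force_assemble[OF _ 3 _ _ 1 2])
  qed
  with phi_deriv_modes[OF eps t, of 2 j] show ?thesis by (simp only:)
qed

end

section \<open>Modes of the diatomic chain\<close>

text \<open>Solvability of - H(\<Omega>, \<Theta>) x = F for the dispersion matrix H with constants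
  c1, c2, a1, a2. It is phrased as existence so that singular H, where F must satisfy a condition,
  is covered as well.\<close>

definition Sol :: "real \<Rightarrow> real \<Rightarrow> real \<Rightarrow> real \<Rightarrow> real \<Rightarrow> real \<Rightarrow> complex \<Rightarrow> complex \<Rightarrow> bool" where
  "Sol c1 c2 a1 a2 \<Omega> \<Theta> F1 F2 \<longleftrightarrow> (\<exists>x1 x2. of_real (c1 - \<Omega>\<^sup>2) * x1 = of_real a1 * (cis \<Theta> + 1) * x2 + F1
     \<and> of_real (c2 - \<Omega>\<^sup>2) * x2 = of_real a2 * (1 + cis (- \<Theta>)) * x1 + F2)"

text \<open>The quadratic force on an odd site as a symmetric bilinear form in two modes:
  differences of products of right and left strains, minus the on-site product. \<open>N2\<close> is
  the same for an even site.\<close>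

definition N1 :: "real \<Rightarrow> real \<Rightarrow> complex \<Rightarrow> complex \<Rightarrow> (nat \<Rightarrow> complex) \<Rightarrow> (nat \<Rightarrow> complex) \<Rightarrow> complex" where
  "N1 n m ep eq p q = of_real n * ((ep * p 2 - p 1) * (eq * q 2 - q 1) - (p 1 - p 2) * (q 1 - q 2)) - of_real m * p 1 * q 1"

definition N2 :: "real \<Rightarrow> real \<Rightarrow> complex \<Rightarrow> complex \<Rightarrow> (nat \<Rightarrow> complex) \<Rightarrow> (nat \<Rightarrow> complex) \<Rightarrow> complex" where
  "N2 n m ep eq p q = of_real n * ((p 1 - p 2) * (q 1 - q 2) - (p 2 - ep * p 1) * (q 2 - eq * q 1)) - of_real m * p 2 * q 2"

lemma Sol_cnj: "Sol c1 c2 a1 a2 \<Omega> \<Theta> F1 F2 \<Longrightarrow> Sol c1 c2 a1 a2 (- \<Omega>) (- \<Theta>) (cnj F1) (cnj F2)"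
proof -
  assume "Sol c1 c2 a1 a2 \<Omega> \<Theta> F1 F2"
  then obtain x1 x2 where 1: "of_real (c1 - \<Omega>\<^sup>2) * x1 = of_real a1 * (cis \<Theta> + 1) * x2 + F1"
    and 2: "of_real (c2 - \<Omega>\<^sup>2) * x2 = of_real a2 * (1 + cis (- \<Theta>)) * x1 + F2"
    unfolding Sol_def by blast
  from arg_cong[OF 1, of cnj] arg_cong[OF 2, of cnj] show ?thesis
    unfolding Sol_def by (intro exI[of _ "cnj x1"] exI[of _ "cnj x2"]) (simp add: cis_cnj)
qed

text \<open>The integers n and -n encode mode n and its complex conjugate: for negative indices
  amplitudes are conjugated, and frequency and wave number change sign.\<close>

definition cj :: "int \<Rightarrow> complex \<Rightarrow> complex" where "cj i x = (if i > 0 then x else cnj x)"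
definition sgd :: "(nat \<Rightarrow> real) \<Rightarrow> int \<Rightarrow> real" where "sgd f i = (if i > 0 then f (nat i) else - f (nat (- i)))"
definition idx :: "int \<Rightarrow> nat" where "idx i = nat \<bar>i\<bar>"

lemma idx_simps: "idx 1 = 1" "idx 2 = 2" "idx (- 1) = 1" "idx (- 2) = 2"
  by (simp_all add: idx_def)

text \<open>The term K1 cnj b1 b2 in the equation of mode 1 is shared between the ordered pairs (-1,
  2) and (2, -1), hence the halves; the term K2 b1^2 of mode 2 comes from (1, 1) alone. The other
  two lines are their conjugates.\<close>

definition kapS :: "complex \<Rightarrow> complex \<Rightarrow> int \<Rightarrow> int \<Rightarrow> int \<Rightarrow> complex" where
  "kapS K1 K2 i p q = (if (i = 1 \<and> (p = - 1 \<and> q = 2 \<or> p = 2 \<and> q = - 1)) then K1 / 2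
    else if (i = - 1 \<and> (p = 1 \<and> q = - 2 \<or> p = - 2 \<and> q = 1)) then cnj K1 / 2
    else if (i = 2 \<and> p = 1 \<and> q = 1) then K2
    else if (i = - 2 \<and> p = - 1 \<and> q = - 1) then cnj K2 else 0)"

abbreviation signed_modes :: "int set" where "signed_modes \<equiv> {1, 2, - 1, - 2}"

lemma l2O_cmod_cong: "(\<And>\<epsilon> j t. cmod (f \<epsilon> j t) = cmod (g \<epsilon> j t)) \<Longrightarrow> l2O \<tau> n f \<Longrightarrow> l2O \<tau> n g"
  unfolding l2O_def by simp

lemma bddO_cmod_cong: "(\<And>\<epsilon> j t. cmod (f \<epsilon> j t) = cmod (g \<epsilon> j t)) \<Longrightarrow> bddO \<tau> f \<Longrightarrow> bddO \<tau> g"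
  unfolding bddO_def by simp

text \<open>A single K for all times makes the spatial estimates uniform in the slow time \<epsilon>
  t.\<close>

lemma sampling:
  fixes b b' :: "real \<Rightarrow> real \<Rightarrow> complex"
  assumes H: "\<And>t. t \<in> {0..\<tau>} \<Longrightarrow> H4_norm_le K (b t)"
    and d: "\<And>t y. t \<in> {0..\<tau>} \<Longrightarrow> ((\<lambda>y. b t y) has_vector_derivative b' t y) (at y)"
  shows "bddO \<tau> (\<lambda>\<epsilon> j t. b (\<epsilon> * t) (\<epsilon> * of_int j))"
    and "l2O \<tau> 1 (\<lambda>\<epsilon> j t. of_real \<epsilon> * b (\<epsilon> * t) (\<epsilon> * of_int j))"
    and "l2O \<tau> 1 (\<lambda>\<epsilon> j t. of_real \<epsilon> * b' (\<epsilon> * t) (\<epsilon> * of_int j))"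
    and "l2O \<tau> 1 (\<lambda>\<epsilon> j t. b' (\<epsilon> * t) (\<epsilon> * of_int (j + 1)) - b' (\<epsilon> * t) (\<epsilon> * of_int j))"
    and "l2O \<tau> 3 (\<lambda>\<epsilon> j t. b (\<epsilon> * t) (\<epsilon> * of_int (j + 1)) - b (\<epsilon> * t) (\<epsilon> * of_int j) - of_real \<epsilon> * b' (\<epsilon> * t) (\<epsilon> * of_int j))"
proof -
  have et: "\<epsilon> * t \<in> {0..\<tau>}" if "0 < \<epsilon>" "t \<in> {0..\<tau> / \<epsilon>}" for \<epsilon> t
    using that by (simp add: pos_le_divide_eq mult.commute)
  have H': "H4_norm_le K (b (\<epsilon> * t))" "\<And>y. (b (\<epsilon> * t) has_vector_derivative b' (\<epsilon> * t) y) (at y)"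
    if "0 < \<epsilon>" "t \<in> {0..\<tau> / \<epsilon>}" for \<epsilon> t
    using H d et[OF that] by auto
  have sh: "\<epsilon> * of_int (j + 1) = \<epsilon> * of_int j + \<epsilon>" for \<epsilon> :: real and j by (simp add: algebra_simps)
  have sq: "(\<Sum>j\<in>F. (cmod (of_real \<epsilon> * f j))\<^sup>2) = \<epsilon> * (\<epsilon> * (\<Sum>j\<in>F. (cmod (f j))\<^sup>2))" for \<epsilon> F and f :: "int \<Rightarrow> complex"
    by (simp add: norm_mult power_mult_distrib sum_distrib_left power2_eq_square[of \<epsilon>] mult.assoc)
  show "bddO \<tau> (\<lambda>\<epsilon> j t. b (\<epsilon> * t) (\<epsilon> * of_int j))"
    by (rule bddO_I[of "200 * (\<bar>K\<bar> + 1)"], simp) (rule H4_sampling(1)[OF H'])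
  show "l2O \<tau> 1 (\<lambda>\<epsilon> j t. of_real \<epsilon> * b (\<epsilon> * t) (\<epsilon> * of_int j))"
  proof (rule l2O_I[of "20000 * K\<^sup>2"])
    fix \<epsilon> t F assume a: "0 < \<epsilon>" "\<epsilon> < 1" "t \<in> {0..\<tau> / \<epsilon>}" "finite (F :: int set)"
    show "(\<Sum>j\<in>F. (cmod (of_real \<epsilon> * b (\<epsilon> * t) (\<epsilon> * of_int j)))\<^sup>2) \<le> 20000 * K\<^sup>2 * \<epsilon> ^ 1"
      unfolding sq using mult_left_mono[OF H4_sampling(2)[OF H'[OF a(1,3)] a(1,2,4)], of \<epsilon>] a(1) by (simp add: mult.commute)
  qed simp
  show "l2O \<tau> 1 (\<lambda>\<epsilon> j t. of_real \<epsilon> * b' (\<epsilon> * t) (\<epsilon> * of_int j))"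
  proof (rule l2O_I[of "20000 * K\<^sup>2"])
    fix \<epsilon> t F assume a: "0 < \<epsilon>" "\<epsilon> < 1" "t \<in> {0..\<tau> / \<epsilon>}" "finite (F :: int set)"
    show "(\<Sum>j\<in>F. (cmod (of_real \<epsilon> * b' (\<epsilon> * t) (\<epsilon> * of_int j)))\<^sup>2) \<le> 20000 * K\<^sup>2 * \<epsilon> ^ 1"
      unfolding sq using mult_left_mono[OF H4_sampling(3)[OF H'[OF a(1,3)] a(1,2,4)], of \<epsilon>] a(1) by (simp add: mult.commute)
  qed simp
  show "l2O \<tau> 1 (\<lambda>\<epsilon> j t. b' (\<epsilon> * t) (\<epsilon> * of_int (j + 1)) - b' (\<epsilon> * t) (\<epsilon> * of_int j))"
  proof (rule l2O_I[of "8 * K\<^sup>2"])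
    fix \<epsilon> t F assume a: "0 < \<epsilon>" "\<epsilon> < 1" "t \<in> {0..\<tau> / \<epsilon>}" "finite (F :: int set)"
    show "(\<Sum>j\<in>F. (cmod (b' (\<epsilon> * t) (\<epsilon> * of_int (j + 1)) - b' (\<epsilon> * t) (\<epsilon> * of_int j)))\<^sup>2) \<le> 8 * K\<^sup>2 * \<epsilon> ^ 1"
      unfolding sh power_one_right by (rule H4_sampling(4)[OF H'[OF a(1,3)] a(1,4)])
  qed simp
  show "l2O \<tau> 3 (\<lambda>\<epsilon> j t. b (\<epsilon> * t) (\<epsilon> * of_int (j + 1)) - b (\<epsilon> * t) (\<epsilon> * of_int j) - of_real \<epsilon> * b' (\<epsilon> * t) (\<epsilon> * of_int j))"
  proof (rule l2O_I[of "8 * K\<^sup>2"])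
    fix \<epsilon> t F assume a: "0 < \<epsilon>" "\<epsilon> < 1" "t \<in> {0..\<tau> / \<epsilon>}" "finite (F :: int set)"
    show "(\<Sum>j\<in>F. (cmod (b (\<epsilon> * t) (\<epsilon> * of_int (j + 1)) - b (\<epsilon> * t) (\<epsilon> * of_int j) - of_real \<epsilon> * b' (\<epsilon> * t) (\<epsilon> * of_int j)))\<^sup>2) \<le> 8 * K\<^sup>2 * \<epsilon> ^ 3"
      unfolding sh by (rule H4_sampling(5)[OF H'[OF a(1,3)] a(1,4)])
  qed simp
qed

lemma cis_deriv: "((\<lambda>t. cis (a * t + c)) has_vector_derivative (\<i> * of_real a) * cis (a * t + c)) (at t within S)"
proof -
  have "((\<lambda>z. exp (\<i> * of_real a * z + \<i> * of_real c)) has_field_derivative (\<i> * of_real a) * exp (\<i> * of_real a * of_real t + \<i> * of_real c)) (at (of_real t))"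
    by (auto intro!: derivative_eq_intros)
  from has_vector_derivative_real_field[OF this]
  show ?thesis by (simp add: cis_conv_exp algebra_simps)
qed

definition "lamS om i = \<i> * of_real (sgd om i)"
definition "eS th i = cis (sgd th i)"
definition "eiS th i = cis (- sgd th i)"
definition "ES om th i j t = cis (sgd om i * t + of_int j * sgd th i)"
definition "rS R i c = cj i (R (idx i) c)"
definition "bS b i t y = cj i (b (idx i) t y)"

lemma signed_cases: "i \<in> signed_modes \<Longrightarrow> (\<exists>n\<in>{1,2}. idx i = n \<and> i > 0 \<and> (\<forall>f. sgd f i = f n))
   \<or> (\<exists>n\<in>{1,2}. idx i = n \<and> \<not> i > 0 \<and> (\<forall>f. sgd f i = - f n))"
  by (auto simp: idx_def sgd_def)

lemma signed_cnj_simps: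
  assumes "i \<in> signed_modes"
  shows "lamS om (- i) = cnj (lamS om i)" "eS th (- i) = cnj (eS th i)" "eiS th (- i) = cnj (eiS th i)"
    "rS R (- i) c = cnj (rS R i c)" "sgd f (- i) = - sgd f i"
  using assms by (auto simp: lamS_def eS_def eiS_def rS_def cj_def idx_def sgd_def cis_cnj)

lemma kapS_cnj: "i \<in> signed_modes \<Longrightarrow> p \<in> signed_modes \<Longrightarrow> q \<in> signed_modes \<Longrightarrow> kapS K1 K2 (- i) (- p) (- q) = cnj (kapS K1 K2 i p q)"
  by (auto simp: kapS_def)

lemma kapS_sym: "kapS K1 K2 i p q = kapS K1 K2 i q p"
  by (auto simp: kapS_def)

text \<open>Sixteen ordered pairs of signed modes have to be solved for. Symmetry in the pair and
  complex conjugation reduce them to (1,1), (2,2), (1,2), (-1,2) and to a mode with its own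
  conjugate, which interact at frequency and wave number 0. In the resonant cases only (1,1) and
  (-1,2) hit modes that are present; there the coefficients K2 and K1 enter the forcing.\<close>

lemma modulation_of_modes:
  fixes c1 c2 a1 a2 n1 n2 m1 m2 \<tau> K :: real and om th gr :: "nat \<Rightarrow> real" and R :: "nat \<Rightarrow> nat \<Rightarrow> complex"
    and K1 K2 :: complex and b bt b' :: "nat \<Rightarrow> real \<Rightarrow> real \<Rightarrow> complex"
  assumes tau: "\<tau> > 0"
    and ker1: "\<And>n. n \<in> {1,2} \<Longrightarrow> of_real (c1 - (om n)\<^sup>2) * R n 1 = of_real a1 * (cis (th n) + 1) * R n 2"
    and ker2: "\<And>n. n \<in> {1,2} \<Longrightarrow> of_real (c2 - (om n)\<^sup>2) * R n 2 = of_real a2 * (1 + cis (- th n)) * R n 1"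
    and lin: "\<And>n. n \<in> {1,2} \<Longrightarrow> Sol c1 c2 a1 a2 (om n) (th n)
        (of_real a1 * cis (th n) * R n 2 - 2 * (\<i> * of_real (om n)) * of_real (gr n) * R n 1)
        (- (of_real a2 * cis (- th n) * R n 1) - 2 * (\<i> * of_real (om n)) * of_real (gr n) * R n 2)"
    and S11: "Sol c1 c2 a1 a2 (2 * om 1) (2 * th 1)
        (N1 n1 m1 (cis (th 1)) (cis (th 1)) (R 1) (R 1) - 2 * (\<i> * of_real (om 2) * R 2 1 * K2))
        (N2 n2 m2 (cis (- th 1)) (cis (- th 1)) (R 1) (R 1) - 2 * (\<i> * of_real (om 2) * R 2 2 * K2))"
    and S22: "\<And>F1 F2. Sol c1 c2 a1 a2 (2 * om 2) (2 * th 2) F1 F2"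
    and S12: "\<And>F1 F2. Sol c1 c2 a1 a2 (om 1 + om 2) (th 1 + th 2) F1 F2"
    and S00: "\<And>F1 F2. Sol c1 c2 a1 a2 0 0 F1 F2"
    and S21: "Sol c1 c2 a1 a2 (om 2 - om 1) (th 2 - th 1)
        (N1 n1 m1 (cis (- th 1)) (cis (th 2)) (\<lambda>c. cnj (R 1 c)) (R 2) - \<i> * of_real (om 1) * R 1 1 * K1)
        (N2 n2 m2 (cis (th 1)) (cis (- th 2)) (\<lambda>c. cnj (R 1 c)) (R 2) - \<i> * of_real (om 1) * R 1 2 * K1)"
    and res: "K1 \<noteq> 0 \<or> K2 \<noteq> 0 \<Longrightarrow> om 2 = 2 * om 1 \<and> (\<exists>k::int. th 2 = 2 * th 1 + 2 * pi * of_int k)"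
    and pde1: "\<And>t y. t \<in> {0..\<tau>} \<Longrightarrow> bt 1 t y = of_real (gr 1) * b' 1 t y + K1 * cnj (b 1 t y) * b 2 t y"
    and pde2: "\<And>t y. t \<in> {0..\<tau>} \<Longrightarrow> bt 2 t y = of_real (gr 2) * b' 2 t y + K2 * (b 1 t y)\<^sup>2"
    and bd: "\<And>n t y. n \<in> {1,2} \<Longrightarrow> t \<in> {0..\<tau>} \<Longrightarrow> ((\<lambda>t. b n t y) has_vector_derivative bt n t y) (at t within {0..\<tau>})"
    and by': "\<And>n t y. n \<in> {1,2} \<Longrightarrow> t \<in> {0..\<tau>} \<Longrightarrow> ((\<lambda>y. b n t y) has_vector_derivative b' n t y) (at y)"
    and H4: "\<And>n t. n \<in> {1,2} \<Longrightarrow> t \<in> {0..\<tau>} \<Longrightarrow> H4_norm_le K (b n t)"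
  shows "\<exists>s X. modulation signed_modes (lamS om) (eS th) (eiS th) (\<lambda>i. of_real (gr (idx i))) (rS R) s
     (kapS K1 K2) X (ES om th) (bS b) (bS bt) (bS b') \<tau> (of_real c1) (of_real c2) (of_real a1) (of_real a2)
     (of_real n1) (of_real n2) (of_real m1) (of_real m2)"
proof -
  define F1 where "F1 = (\<lambda>p q. N1 n1 m1 (eS th p) (eS th q) (rS R p) (rS R q) - 2 * (\<Sum>i\<in>signed_modes. lamS om i * rS R i 1 * kapS K1 K2 i p q))"
  define F2 where "F2 = (\<lambda>p q. N2 n2 m2 (eiS th p) (eiS th q) (rS R p) (rS R q) - 2 * (\<Sum>i\<in>signed_modes. lamS om i * rS R i 2 * kapS K1 K2 i p q))"
  define P where "P = (\<lambda>p q. Sol c1 c2 a1 a2 (sgd om p + sgd om q) (sgd th p + sgd th q) (F1 p q) (F2 p q))"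
  have sym: "P q p" if "P p q" for p q
  proof -
    have "F1 p q = F1 q p" "F2 p q = F2 q p"
      unfolding F1_def F2_def N1_def N2_def kapS_sym[of _ _ _ p q] by (simp_all add: mult_ac)
    then show ?thesis using that unfolding P_def by (simp add: add.commute)
  qed
  \<comment> \<open>Conjugating the system for (p, q) yields the one for (-p, -q), as every datum of
    a negative mode is the conjugate of the positive one.\<close>
  have conj: "P (- p) (- q)" if "P p q" "p \<in> signed_modes" "q \<in> signed_modes" for p q
  proof -
    have sums: "(\<Sum>i\<in>signed_modes. lamS om i * rS R i c * kapS K1 K2 i (- p) (- q)) = cnj (\<Sum>i\<in>signed_modes. lamS om i * rS R i c * kapS K1 K2 i p q)" for c
    proof -
      have "(\<Sum>i\<in>signed_modes. lamS om i * rS R i c * kapS K1 K2 i (- p) (- q))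
          = (\<Sum>i\<in>signed_modes. lamS om (- i) * rS R (- i) c * kapS K1 K2 (- i) (- p) (- q))"
        by (rule sum.reindex_bij_witness[of _ uminus uminus]) auto
      also have "\<dots> = (\<Sum>i\<in>signed_modes. cnj (lamS om i * rS R i c * kapS K1 K2 i p q))"
      proof (rule sum.cong[OF refl])
        fix i assume i: "i \<in> signed_modes"
        show "lamS om (- i) * rS R (- i) c * kapS K1 K2 (- i) (- p) (- q) = cnj (lamS om i * rS R i c * kapS K1 K2 i p q)"
          unfolding signed_cnj_simps[OF i] kapS_cnj[OF i that(2,3)] by simp
      qed
      finally show ?thesis by (simp only: cnj_sum)
    qed
    have "F1 (- p) (- q) = cnj (F1 p q)" "F2 (- p) (- q) = cnj (F2 p q)"
      unfolding F1_def F2_def N1_def N2_def sums signed_cnj_simps[OF that(2)] signed_cnj_simps[OF that(3)] by simp_all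
    then show ?thesis using Sol_cnj[OF that(1)[unfolded P_def]]
      unfolding P_def signed_cnj_simps[OF that(2)] signed_cnj_simps[OF that(3)] by simp
  qed
  have r1: "rS R 1 = R 1" "rS R 2 = R 2" "rS R (- 1) = (\<lambda>c. cnj (R 1 c))" "rS R (- 2) = (\<lambda>c. cnj (R 2 c))"
    by (simp_all add: rS_def[abs_def] cj_def idx_simps)
  have sg: "sgd f 1 = f 1" "sgd f 2 = f 2" "sgd f (- 1) = - f 1" "sgd f (- 2) = - f 2" for f
    by (simp_all add: sgd_def)
  have ee: "eS th 1 = cis (th 1)" "eS th 2 = cis (th 2)" "eS th (- 1) = cis (- th 1)" "eiS th 1 = cis (- th 1)"
      "eiS th 2 = cis (- th 2)" "eiS th (- 1) = cis (th 1)"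
    by (simp_all add: eS_def eiS_def sg)
  have P11: "P 1 1"
  proof -
    have "F1 1 1 = N1 n1 m1 (cis (th 1)) (cis (th 1)) (R 1) (R 1) - 2 * (\<i> * of_real (om 2) * R 2 1 * K2)"
      "F2 1 1 = N2 n2 m2 (cis (- th 1)) (cis (- th 1)) (R 1) (R 1) - 2 * (\<i> * of_real (om 2) * R 2 2 * K2)"
      unfolding F1_def F2_def ee r1 by (simp_all add: kapS_def lamS_def r1 sg)
    then show ?thesis using S11 unfolding P_def sg by simp
  qed
  have P21: "P (- 1) 2"
  proof -
    have "F1 (- 1) 2 = N1 n1 m1 (cis (- th 1)) (cis (th 2)) (\<lambda>c. cnj (R 1 c)) (R 2) - \<i> * of_real (om 1) * R 1 1 * K1"
      "F2 (- 1) 2 = N2 n2 m2 (cis (th 1)) (cis (- th 2)) (\<lambda>c. cnj (R 1 c)) (R 2) - \<i> * of_real (om 1) * R 1 2 * K1"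
      unfolding F1_def F2_def ee r1 by (simp_all add: kapS_def lamS_def r1 sg)
    then show ?thesis using S21 unfolding P_def sg by simp
  qed
  have P12: "P 1 2" unfolding P_def sg by (rule S12)
  have P22: "P 2 2" using S22 unfolding P_def sg by simp
  have P10: "P 1 (- 1)" "P 2 (- 2)" using S00 unfolding P_def sg by simp_all
  have allP: "P p q" if "p \<in> signed_modes" "q \<in> signed_modes" for p q
  proof -
    note c = conj[OF P11] conj[OF P21] conj[OF P12] conj[OF P22]
    have "P (- 1) (- 1)" "P 1 (- 2)" "P (- 1) (- 2)" "P (- 2) (- 2)" using c by simp_all
    then show ?thesis using that P11 P21 P12 P22 P10
        sym[OF P21] sym[OF P12] sym[OF P10(1)] sym[OF P10(2)] sym[OF \<open>P 1 (- 2)\<close>] sym[OF \<open>P (- 1) (- 2)\<close>]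
      by auto
  qed
  \<comment> \<open>The two unknowns are packed into a function on the component index, so that
    bounded choice delivers X at once.\<close>
  have "\<forall>p\<in>signed_modes. \<forall>q\<in>signed_modes. \<exists>x :: nat \<Rightarrow> complex. of_real (c1 - (sgd om p + sgd om q)\<^sup>2) * x 1 = of_real a1 * (cis (sgd th p + sgd th q) + 1) * x 2 + F1 p q
     \<and> of_real (c2 - (sgd om p + sgd om q)\<^sup>2) * x 2 = of_real a2 * (1 + cis (- (sgd th p + sgd th q))) * x 1 + F2 p q"
  proof (intro ballI)
    fix p q assume "p \<in> signed_modes" "q \<in> signed_modes"
    from allP[OF this] obtain x1 x2 where "of_real (c1 - (sgd om p + sgd om q)\<^sup>2) * x1 = of_real a1 * (cis (sgd th p + sgd th q) + 1) * x2 + F1 p q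
     \<and> of_real (c2 - (sgd om p + sgd om q)\<^sup>2) * x2 = of_real a2 * (1 + cis (- (sgd th p + sgd th q))) * x1 + F2 p q"
      unfolding P_def Sol_def by blast
    then show "\<exists>x :: nat \<Rightarrow> complex. of_real (c1 - (sgd om p + sgd om q)\<^sup>2) * x 1 = of_real a1 * (cis (sgd th p + sgd th q) + 1) * x 2 + F1 p q
     \<and> of_real (c2 - (sgd om p + sgd om q)\<^sup>2) * x 2 = of_real a2 * (1 + cis (- (sgd th p + sgd th q))) * x 1 + F2 p q"
      by (intro exI[of _ "\<lambda>c. if c = 1 then x1 else x2"]) simp
  qed
  then obtain X where X: "\<And>p q. p \<in> signed_modes \<Longrightarrow> q \<in> signed_modes \<Longrightarrow> of_real (c1 - (sgd om p + sgd om q)\<^sup>2) * X p q 1 = of_real a1 * (cis (sgd th p + sgd th q) + 1) * X p q (2::nat) + F1 p q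
     \<and> of_real (c2 - (sgd om p + sgd om q)\<^sup>2) * X p q 2 = of_real a2 * (1 + cis (- (sgd th p + sgd th q))) * X p q 1 + F2 p q"
    unfolding bchoice_iff by blast
  have "\<exists>s :: nat \<Rightarrow> complex. of_real (c1 - (sgd om i)\<^sup>2) * s 1 = of_real a1 * (eS th i + 1) * s 2
        + (of_real a1 * eS th i * rS R i 2 - 2 * lamS om i * of_real (gr (idx i)) * rS R i 1)
     \<and> of_real (c2 - (sgd om i)\<^sup>2) * s 2 = of_real a2 * (1 + eiS th i) * s 1
        + (- (of_real a2 * eiS th i * rS R i 1) - 2 * lamS om i * of_real (gr (idx i)) * rS R i 2)" if i: "i \<in> signed_modes" for i
  proof -
    have "Sol c1 c2 a1 a2 (sgd om i) (sgd th i)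
        (of_real a1 * eS th i * rS R i 2 - 2 * lamS om i * of_real (gr (idx i)) * rS R i 1)
        (- (of_real a2 * eiS th i * rS R i 1) - 2 * lamS om i * of_real (gr (idx i)) * rS R i 2)"
      using signed_cases[OF i]
    proof (elim disjE bexE conjE)
      fix n assume n: "n \<in> {1::nat,2}" "idx i = n" "i > 0" "\<forall>f. sgd f i = f n"
      then show ?thesis using lin[OF n(1)] by (simp add: eS_def eiS_def lamS_def rS_def cj_def)
    next
      fix n assume n: "n \<in> {1::nat,2}" "idx i = n" "\<not> i > 0" "\<forall>f. sgd f i = - f n"
      then show ?thesis using Sol_cnj[OF lin[OF n(1)]]
        by (simp add: eS_def eiS_def lamS_def rS_def cj_def cis_cnj)
    qed
    then obtain x1 x2 where "of_real (c1 - (sgd om i)\<^sup>2) * x1 = of_real a1 * (cis (sgd th i) + 1) * x2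
        + (of_real a1 * eS th i * rS R i 2 - 2 * lamS om i * of_real (gr (idx i)) * rS R i 1)"
     "of_real (c2 - (sgd om i)\<^sup>2) * x2 = of_real a2 * (1 + cis (- sgd th i)) * x1
        + (- (of_real a2 * eiS th i * rS R i 1) - 2 * lamS om i * of_real (gr (idx i)) * rS R i 2)"
      unfolding Sol_def by blast
    then show ?thesis
      by (intro exI[of _ "\<lambda>c. if c = 1 then x1 else x2"]) (simp add: eS_def[symmetric] eiS_def[symmetric])
  qed
  then have "\<forall>i\<in>signed_modes. \<exists>s :: nat \<Rightarrow> complex. of_real (c1 - (sgd om i)\<^sup>2) * s 1 = of_real a1 * (eS th i + 1) * s 2
        + (of_real a1 * eS th i * rS R i 2 - 2 * lamS om i * of_real (gr (idx i)) * rS R i 1)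
     \<and> of_real (c2 - (sgd om i)\<^sup>2) * s 2 = of_real a2 * (1 + eiS th i) * s 1
        + (- (of_real a2 * eiS th i * rS R i 1) - 2 * lamS om i * of_real (gr (idx i)) * rS R i 2)" by blast
  then obtain s where s: "\<And>i. i \<in> signed_modes \<Longrightarrow> of_real (c1 - (sgd om i)\<^sup>2) * s i (1::nat) = of_real a1 * (eS th i + 1) * s i 2
        + (of_real a1 * eS th i * rS R i 2 - 2 * lamS om i * of_real (gr (idx i)) * rS R i 1)
     \<and> of_real (c2 - (sgd om i)\<^sup>2) * s i 2 = of_real a2 * (1 + eiS th i) * s i 1
        + (- (of_real a2 * eiS th i * rS R i 1) - 2 * lamS om i * of_real (gr (idx i)) * rS R i 2)"
    unfolding bchoice_iff by blast
  have lam2: "(lamS om i)\<^sup>2 + of_real c = of_real (c - (sgd om i)\<^sup>2)" for i c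
    by (simp add: lamS_def power_mult_distrib)
  have lam2': "(lamS om p + lamS om q)\<^sup>2 + of_real c = of_real (c - (sgd om p + sgd om q)\<^sup>2)" for p q c
  proof -
    have "lamS om p + lamS om q = \<i> * of_real (sgd om p + sgd om q)" by (simp add: lamS_def distrib_left)
    then show ?thesis by (simp only: power_mult_distrib) simp
  qed
  have ee2: "eS th p * eS th q = cis (sgd th p + sgd th q)" "eiS th p * eiS th q = cis (- (sgd th p + sgd th q))" for p q
    by (simp_all add: eS_def eiS_def cis_mult)
  have smp: "bddO \<tau> (\<lambda>\<epsilon> j t. bS b i (\<epsilon> * t) (\<epsilon> * of_int j))"
     "l2O \<tau> 1 (\<lambda>\<epsilon> j t. of_real \<epsilon> * bS b i (\<epsilon> * t) (\<epsilon> * of_int j))"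
     "l2O \<tau> 1 (\<lambda>\<epsilon> j t. of_real \<epsilon> * bS b' i (\<epsilon> * t) (\<epsilon> * of_int j))"
     "l2O \<tau> 1 (\<lambda>\<epsilon> j t. bS b' i (\<epsilon> * t) (\<epsilon> * of_int (j + 1)) - bS b' i (\<epsilon> * t) (\<epsilon> * of_int j))"
     "l2O \<tau> 3 (\<lambda>\<epsilon> j t. bS b i (\<epsilon> * t) (\<epsilon> * of_int (j + 1)) - bS b i (\<epsilon> * t) (\<epsilon> * of_int j)
        - of_real \<epsilon> * bS b' i (\<epsilon> * t) (\<epsilon> * of_int j))" if i: "i \<in> signed_modes" for i
  proof -
    have n: "idx i \<in> {1,2}" using i by (auto simp: idx_def)
    note sm = sampling[OF H4[OF n] by'[OF n]]
    have cn: "cmod (cj i x) = cmod x" "cj i x - cj i y = cj i (x - y)" "of_real u * cj i x = cj i (of_real u * x)" for x y u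
      by (simp_all add: cj_def)
    show "bddO \<tau> (\<lambda>\<epsilon> j t. bS b i (\<epsilon> * t) (\<epsilon> * of_int j))"
      by (rule bddO_cmod_cong[OF _ sm(1)]) (simp only: bS_def cn)
    show "l2O \<tau> 1 (\<lambda>\<epsilon> j t. of_real \<epsilon> * bS b i (\<epsilon> * t) (\<epsilon> * of_int j))"
      by (rule l2O_cmod_cong[OF _ sm(2)]) (simp only: bS_def cn)
    show "l2O \<tau> 1 (\<lambda>\<epsilon> j t. of_real \<epsilon> * bS b' i (\<epsilon> * t) (\<epsilon> * of_int j))"
      by (rule l2O_cmod_cong[OF _ sm(3)]) (simp only: bS_def cn)
    show "l2O \<tau> 1 (\<lambda>\<epsilon> j t. bS b' i (\<epsilon> * t) (\<epsilon> * of_int (j + 1)) - bS b' i (\<epsilon> * t) (\<epsilon> * of_int j))"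
      by (rule l2O_cmod_cong[OF _ sm(4)]) (simp only: bS_def cn)
    show "l2O \<tau> 3 (\<lambda>\<epsilon> j t. bS b i (\<epsilon> * t) (\<epsilon> * of_int (j + 1)) - bS b i (\<epsilon> * t) (\<epsilon> * of_int j)
        - of_real \<epsilon> * bS b' i (\<epsilon> * t) (\<epsilon> * of_int j))"
      by (rule l2O_cmod_cong[OF _ sm(5)]) (simp only: bS_def cn)
  qed
  \<comment> \<open>Wave numbers agree only modulo 2 pi. As j is an integer the carriers coincide
    nevertheless; conjugate triples have the opposite winding number.\<close>
  have kres: "lamS om i = lamS om p + lamS om q \<and> ES om th i j t = ES om th p j t * ES om th q j t"
    if "i \<in> signed_modes" "p \<in> signed_modes" "q \<in> signed_modes" "kapS K1 K2 i p q \<noteq> 0" for i p q j t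
  proof -
    have KK: "K1 \<noteq> 0 \<or> K2 \<noteq> 0" using that(4) by (auto simp: kapS_def split: if_splits)
    from res[OF KK] obtain k :: int where k: "om 2 = 2 * om 1" "th 2 = 2 * th 1 + 2 * pi * of_int k" by blast
    have om: "sgd om i = sgd om p + sgd om q"
      using that(4) k(1) by (auto simp: kapS_def sg split: if_splits)
    have "\<exists>l::int. sgd th i = sgd th p + sgd th q + 2 * pi * of_int l"
    proof -
      have "sgd th i = sgd th p + sgd th q + 2 * pi * of_int k \<or> sgd th i = sgd th p + sgd th q + 2 * pi * of_int (- k)"
        using that(4) k(2) by (auto simp: kapS_def sg split: if_splits)
      then show ?thesis by blast
    qed
    then obtain l :: int where l: "sgd th i = sgd th p + sgd th q + 2 * pi * of_int l" by blast
    have "ES om th i j t = cis ((sgd om p * t + of_int j * sgd th p) + (sgd om q * t + of_int j * sgd th q) + 2 * pi * of_int (j * l))"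
      unfolding ES_def om l by (simp add: algebra_simps)
    also have "\<dots> = ES om th p j t * ES om th q j t * cis (2 * pi * of_int (j * l))"
      unfolding ES_def cis_mult by simp
    also have "cis (2 * pi * of_int (j * l)) = 1" by (rule cis_multiple_2pi) simp
    finally show ?thesis using om by (simp add: lamS_def distrib_left)
  qed
  have "modulation signed_modes (lamS om) (eS th) (eiS th) (\<lambda>i. of_real (gr (idx i))) (rS R) s
     (kapS K1 K2) X (ES om th) (bS b) (bS bt) (bS b') \<tau> (of_real c1) (of_real c2) (of_real a1) (of_real a2)
     (of_real n1) (of_real n2) (of_real m1) (of_real m2)"
  proof (unfold_locales)
    fix i assume i: "i \<in> signed_modes"
    have n: "idx i \<in> {1,2}" using i by (auto simp: idx_def)
    show "eS th i * eiS th i = 1" by (simp add: eS_def eiS_def cis_mult)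
    show "ES om th i (j + 1) t = eS th i * ES om th i j t" for j t
      by (simp add: ES_def eS_def cis_mult algebra_simps)
    show "cmod (ES om th i j t) \<le> 1" for j t by (simp add: ES_def)
    show "(ES om th i j has_vector_derivative lamS om i * ES om th i j t) (at t within S)" for j t S
      unfolding ES_def[abs_def] lamS_def by (rule cis_deriv)
    have k: "of_real (c1 - (sgd om i)\<^sup>2) * rS R i 1 = of_real a1 * (eS th i + 1) * rS R i 2
        \<and> of_real (c2 - (sgd om i)\<^sup>2) * rS R i 2 = of_real a2 * (1 + eiS th i) * rS R i 1"
      using signed_cases[OF i]
    proof (elim disjE bexE conjE)
      fix n assume n: "n \<in> {1::nat,2}" "idx i = n" "i > 0" "\<forall>f. sgd f i = f n"
      then show ?thesis using ker1[OF n(1)] ker2[OF n(1)] by (simp add: eS_def eiS_def rS_def cj_def)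
    next
      fix n assume n: "n \<in> {1::nat,2}" "idx i = n" "\<not> i > 0" "\<forall>f. sgd f i = - f n"
      then show ?thesis using arg_cong[OF ker1[OF n(1)], of cnj] arg_cong[OF ker2[OF n(1)], of cnj]
        by (simp add: eS_def eiS_def rS_def cj_def cis_cnj)
    qed
    show "((lamS om i)\<^sup>2 + of_real c1) * rS R i 1 = of_real a1 * (eS th i + 1) * rS R i 2" unfolding lam2 using k by blast
    show "((lamS om i)\<^sup>2 + of_real c2) * rS R i 2 = of_real a2 * (1 + eiS th i) * rS R i 1" unfolding lam2 using k by blast
    show "2 * lamS om i * of_real (gr (idx i)) * rS R i 1 + ((lamS om i)\<^sup>2 + of_real c1) * s i 1
      = of_real a1 * (eS th i + 1) * s i 2 + of_real a1 * eS th i * rS R i 2"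
      unfolding lam2 s[OF i, THEN conjunct1] by simp
    show "2 * lamS om i * of_real (gr (idx i)) * rS R i 2 + ((lamS om i)\<^sup>2 + of_real c2) * s i 2
      = of_real a2 * (1 + eiS th i) * s i 1 - of_real a2 * eiS th i * rS R i 1"
      unfolding lam2 s[OF i, THEN conjunct2] by simp
    show "bS bt i t y = of_real (gr (idx i)) * bS b' i t y
        + (\<Sum>p\<in>signed_modes. \<Sum>q\<in>signed_modes. kapS K1 K2 i p q * bS b p t y * bS b q t y)" if t: "t \<in> {0..\<tau>}" for t y
      using i pde1[OF t, of y] pde2[OF t, of y] arg_cong[OF pde1[OF t, of y], of cnj] arg_cong[OF pde2[OF t, of y], of cnj]
      by (auto simp: kapS_def bS_def cj_def idx_simps power2_eq_square)
    show "((\<lambda>t. bS b i t y) has_vector_derivative bS bt i t y) (at t within {0..\<tau>})" if t: "t \<in> {0..\<tau>}" for t y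
    proof (cases "i > 0")
      case True
      then show ?thesis using bd[OF n t, of y] by (simp add: bS_def cj_def)
    next
      case False
      then show ?thesis using has_vector_derivative_cnj[OF bd[OF n t, of y]] by (simp add: bS_def cj_def)
    qed
    show "bddO \<tau> (\<lambda>\<epsilon> j t. bS b i (\<epsilon> * t) (\<epsilon> * of_int j))"
     "l2O \<tau> 1 (\<lambda>\<epsilon> j t. of_real \<epsilon> * bS b i (\<epsilon> * t) (\<epsilon> * of_int j))"
     "l2O \<tau> 1 (\<lambda>\<epsilon> j t. of_real \<epsilon> * bS b' i (\<epsilon> * t) (\<epsilon> * of_int j))"
     "l2O \<tau> 1 (\<lambda>\<epsilon> j t. bS b' i (\<epsilon> * t) (\<epsilon> * of_int (j + 1)) - bS b' i (\<epsilon> * t) (\<epsilon> * of_int j))"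
     "l2O \<tau> 3 (\<lambda>\<epsilon> j t. bS b i (\<epsilon> * t) (\<epsilon> * of_int (j + 1)) - bS b i (\<epsilon> * t) (\<epsilon> * of_int j)
        - of_real \<epsilon> * bS b' i (\<epsilon> * t) (\<epsilon> * of_int j))"
      by (rule smp[OF i])+
  next
    fix p q assume pq: "p \<in> signed_modes" "q \<in> signed_modes"
    show "((lamS om p + lamS om q)\<^sup>2 + of_real c1) * X p q 1 + 2 * (\<Sum>i\<in>signed_modes. lamS om i * rS R i 1 * kapS K1 K2 i p q)
      = of_real a1 * (eS th p * eS th q + 1) * X p q 2
       + (of_real n1 * ((eS th p * rS R p 2 - rS R p 1) * (eS th q * rS R q 2 - rS R q 1) - (rS R p 1 - rS R p 2) * (rS R q 1 - rS R q 2))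
          - of_real m1 * rS R p 1 * rS R q 1)"
      unfolding lam2' ee2 X[OF pq, THEN conjunct1] F1_def N1_def by (simp only: diff_add_cancel add_diff_eq add.assoc)
    show "((lamS om p + lamS om q)\<^sup>2 + of_real c2) * X p q 2 + 2 * (\<Sum>i\<in>signed_modes. lamS om i * rS R i 2 * kapS K1 K2 i p q)
      = of_real a2 * (1 + eiS th p * eiS th q) * X p q 1
       + (of_real n2 * ((rS R p 1 - rS R p 2) * (rS R q 1 - rS R q 2) - (rS R p 2 - eiS th p * rS R p 1) * (rS R q 2 - eiS th q * rS R q 1))
          - of_real m2 * rS R p 2 * rS R q 2)"
      unfolding lam2' ee2 X[OF pq, THEN conjunct2] F2_def N2_def by (simp only: diff_add_cancel add_diff_eq add.assoc)
  qed (use tau kres in auto)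
  then show ?thesis by blast
qed

section \<open>Solvability of the two-by-two mode systems\<close>

lemma cis_plus_one_mult: "(cis \<theta> + 1) * (1 + cis (- \<theta>)) = of_real (2 + 2 * cos \<theta>)"
  by (simp add: complex_eq_iff algebra_simps power2_eq_square[symmetric])

lemma cis_eq_minus_one:
  assumes "cis \<theta> + 1 = 0" "- pi < \<theta>" "\<theta> \<le> pi"
  shows "\<theta> = pi"
proof -
  have "cos \<theta> = -1" using assms(1) by (simp add: complex_eq_iff)
  then have "cos \<bar>\<theta>\<bar> = cos pi" by simp
  then have "\<bar>\<theta>\<bar> = pi" using cos_inj_pi[of "\<bar>\<theta>\<bar>" pi] assms(2,3) by auto
  then show ?thesis using assms(2) by (auto simp: abs_if split: if_splits)
qed

lemma det_Hmat:
  "det (Hmat v w \<Omega> \<Theta>) = of_real ((cc v w 1 - \<Omega>\<^sup>2) * (cc v w 2 - \<Omega>\<^sup>2) - v 1 1 * v 2 1 * (2 + 2 * cos \<Theta>))"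
proof -
  have "det (Hmat v w \<Omega> \<Theta>) = of_real ((\<Omega>\<^sup>2 - cc v w 1) * (\<Omega>\<^sup>2 - cc v w 2))
     - of_real (v 1 1) * of_real (v 2 1) * ((cis \<Theta> + 1) * (1 + cis (- \<Theta>)))"
    by (simp add: Hmat_def det_2 vector_2 cis_conv_exp)
  then show ?thesis unfolding cis_plus_one_mult by (simp add: algebra_simps)
qed

lemma Sol_shift: "Sol c1 c2 a1 a2 \<Omega> (\<Theta> + 2 * pi * of_int k) F1 F2 = Sol c1 c2 a1 a2 \<Omega> \<Theta> F1 F2"
proof -
  have one: "cis (2 * pi * of_int k) = 1" "cis (- (2 * pi * of_int k)) = 1"
    using cis_multiple_2pi[of "of_int k"] cis_multiple_2pi[of "of_int (- k)"] by simp_all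
  have split: "cis (\<Theta> + 2 * pi * of_int k) = cis \<Theta> * cis (2 * pi * of_int k)"
    "cis (- (\<Theta> + 2 * pi * of_int k)) = cis (- \<Theta>) * cis (- (2 * pi * of_int k))"
    by (simp_all only: cis_mult minus_add_distrib)
  have "cis (\<Theta> + 2 * pi * of_int k) = cis \<Theta>" "cis (- (\<Theta> + 2 * pi * of_int k)) = cis (- \<Theta>)"
    by (rule split(1)[unfolded one mult_1_right], rule split(2)[unfolded one mult_1_right])
  then show ?thesis unfolding Sol_def by simp
qed

text \<open>Cramer's rule; d is the determinant of H.\<close>

lemma Sol_nonresonant:
  assumes "(c1 - \<Omega>\<^sup>2) * (c2 - \<Omega>\<^sup>2) - a1 * a2 * (2 + 2 * cos \<Theta>) \<noteq> 0"
  shows "Sol c1 c2 a1 a2 \<Omega> \<Theta> F1 F2"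
proof -
  define d where "d = (of_real ((c1 - \<Omega>\<^sup>2) * (c2 - \<Omega>\<^sup>2) - a1 * a2 * (2 + 2 * cos \<Theta>)) :: complex)"
  have d0: "d \<noteq> 0" using assms by (simp only: d_def of_real_eq_0_iff) simp
  define p where "p = (of_real (c1 - \<Omega>\<^sup>2) :: complex)"
  define q where "q = (of_real (c2 - \<Omega>\<^sup>2) :: complex)"
  define \<beta> where "\<beta> = of_real a1 * (cis \<Theta> + 1)"
  define \<gamma> where "\<gamma> = of_real a2 * (1 + cis (- \<Theta>))"
  have "\<beta> * \<gamma> = of_real a1 * of_real a2 * ((cis \<Theta> + 1) * (1 + cis (- \<Theta>)))"
    by (simp add: \<beta>_def \<gamma>_def)
  then have d: "d = p * q - \<beta> * \<gamma>" unfolding cis_plus_one_mult by (simp add: d_def p_def q_def)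
  have "p * ((q * F1 + \<beta> * F2) / d) = \<beta> * ((\<gamma> * F1 + p * F2) / d) + F1"
    "q * ((\<gamma> * F1 + p * F2) / d) = \<gamma> * ((q * F1 + \<beta> * F2) / d) + F2"
    using d0 by (simp_all add: field_simps) (simp_all add: d algebra_simps)
  then show ?thesis unfolding Sol_def p_def[symmetric] q_def[symmetric] \<beta>_def[symmetric] \<gamma>_def[symmetric] by blast
qed

text \<open>The singular matrix has the left null vector (c2 - \<Omega>^2, a1 (cis \<Theta> + 1)),
  and F is orthogonal to it. A solution with first component 0 then exists because the off-diagonal
  entry is nonzero.\<close>

lemma Sol_resonant:
  assumes det: "(c1 - \<Omega>\<^sup>2) * (c2 - \<Omega>\<^sup>2) = a1 * a2 * (2 + 2 * cos \<Theta>)"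
    and nz: "cis \<Theta> + 1 \<noteq> 0" "a1 \<noteq> 0"
    and F: "of_real (c2 - \<Omega>\<^sup>2) * F1 + of_real a1 * (cis \<Theta> + 1) * F2 = 0"
  shows "Sol c1 c2 a1 a2 \<Omega> \<Theta> F1 F2"
proof -
  define \<beta> where "\<beta> = of_real a1 * (cis \<Theta> + 1)"
  have b: "\<beta> \<noteq> 0" using nz by (simp add: \<beta>_def)
  have "of_real (c2 - \<Omega>\<^sup>2) * (- F1 / \<beta>) = F2"
    using F b unfolding \<beta>_def[symmetric] by (simp add: field_simps add_eq_0_iff)
  then show ?thesis unfolding Sol_def \<beta>_def[symmetric]
    using b by (intro exI[of _ 0] exI[of _ "- F1 / \<beta>"]) simp
qed

text \<open>At wave number pi the coupling vanishes and the matrix is diagonal, so the only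
  condition concerns the component whose diagonal entry is 0.\<close>

lemma Sol_edge1:
  assumes "cis \<Theta> = -1" "\<Omega>\<^sup>2 = c1" "c1 \<noteq> c2" "F1 = 0"
  shows "Sol c1 c2 a1 a2 \<Omega> \<Theta> F1 F2"
  unfolding Sol_def using assms
  by (intro exI[of _ 0] exI[of _ "F2 / of_real (c2 - c1)"]) (simp add: of_real_diff[symmetric] del: of_real_diff)

lemma Sol_edge2:
  assumes "cis \<Theta> = -1" "\<Omega>\<^sup>2 = c2" "c1 \<noteq> c2" "F2 = 0"
  shows "Sol c1 c2 a1 a2 \<Omega> \<Theta> F1 F2"
proof -
  have "cis (- \<Theta>) = -1" using arg_cong[OF assms(1), of cnj] by (simp add: cis_cnj)
  then show ?thesis
    unfolding Sol_def using assms
    by (intro exI[of _ "F1 / of_real (c1 - c2)"] exI[of _ 0]) (simp add: of_real_diff[symmetric] del: of_real_diff)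
qed

lemma group_velocity_arith:
  fixes om q a b s :: real
  assumes "om \<noteq> 0" "q \<noteq> 0"
  shows "(inverse om / 2) * ((inverse q / 2 * (8 * a * b * (- s))) / 2) = - (a * b * s) / (om * q)"
    "(inverse om / 2) * (- (inverse (- q) / 2 * (8 * a * b * (- s))) / 2) = - (a * b * s) / (om * q)"
  using assms by (simp_all add: field_simps)

section \<open>Dispersion branches, kernel vectors and group velocity\<close>

locale chain_coeffs =
  fixes v w :: "nat \<Rightarrow> nat \<Rightarrow> real"
  assumes vv: "v 1 1 * v 2 1 > 0" and c12: "cc v w 1 < cc v w 2"
begin

abbreviation "c1 \<equiv> cc v w 1"
abbreviation "c2 \<equiv> cc v w 2"
abbreviation "a1 \<equiv> v 1 1"
abbreviation "a2 \<equiv> v 2 1"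

text \<open>Kernel vector of the dispersion matrix: (1, -\<rho>) in the interior, and at the band
  edge, where \<rho> has no meaning, the unit vector of the component with zero diagonal entry. The
  edge is \<open>th = pi\<close> alone since wave numbers range over (-pi, pi].\<close>

definition "Rv om th c = (if th = pi then (if om\<^sup>2 = c1 then (if c = (1::nat) then 1 else 0) else (if c = 1 then 0 else 1))
   else (if c = 1 then 1 else - rho v w om th))"
text \<open>The derivative of the branch through (\<theta>, \<omega>), by implicit differentiation
  of det H = 0. The sign of 2 \<omega>^2 - c1 - c2 tells the branches apart, so one formula serves
  both.\<close>

definition "gv om th = - (a1 * a2 * sin th) / (om * (2 * om\<^sup>2 - c1 - c2))"
definition "is_mode om th \<longleftrightarrow> om > 0 \<and> - pi < th \<and> th \<le> pi \<and> (c1 - om\<^sup>2) * (c2 - om\<^sup>2) = a1 * a2 * (2 + 2 * cos th)"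

lemma a_nz: "a1 \<noteq> 0" "a2 \<noteq> 0" using vv by auto

lemma disc_eq: assumes "is_mode om th"
  shows "(2 * om\<^sup>2 - c1 - c2)\<^sup>2 = (c1 - c2)\<^sup>2 + 8 * a1 * a2 * (cos th + 1)"
proof -
  have "(2 * om\<^sup>2 - c1 - c2)\<^sup>2 = (c1 - c2)\<^sup>2 + 4 * ((c1 - om\<^sup>2) * (c2 - om\<^sup>2))"
    by (simp add: power2_eq_square algebra_simps)
  then show ?thesis using assms by (simp add: is_mode_def algebra_simps)
qed

lemma disc_pos: "(c1 - c2)\<^sup>2 + 8 * a1 * a2 * (cos th + 1) > 0"
proof -
  have "8 * (a1 * a2) * (cos th + 1) \<ge> 0" 
  proof (rule mult_nonneg_nonneg)
    show "8 * (a1 * a2) \<ge> 0" using vv by simp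
    show "cos th + 1 \<ge> 0" using cos_ge_minus_one[of th] by linarith
  qed
  moreover have "(c1 - c2)\<^sup>2 > 0" using c12 by simp
  ultimately show ?thesis by (simp only: mult.assoc)
qed

lemma diff_nz: assumes "is_mode om th" shows "2 * om\<^sup>2 - c1 - c2 \<noteq> 0"
  using disc_eq[OF assms] disc_pos[of th] by (metis less_irrefl power_zero_numeral)

lemma om_cases: assumes "is_mode om th"
  shows "om = om_plus v w th \<and> 2 * om\<^sup>2 - c1 - c2 = sqrt ((c1 - c2)\<^sup>2 + 8 * a1 * a2 * (cos th + 1))
    \<or> om = om_minus v w th \<and> 2 * om\<^sup>2 - c1 - c2 = - sqrt ((c1 - c2)\<^sup>2 + 8 * a1 * a2 * (cos th + 1))"
proof -
  let ?q = "sqrt ((c1 - c2)\<^sup>2 + 8 * a1 * a2 * (cos th + 1))"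
  have om: "om > 0" using assms by (simp add: is_mode_def)
  have "?q = \<bar>2 * om\<^sup>2 - c1 - c2\<bar>" unfolding disc_eq[OF assms, symmetric] by simp
  then consider "2 * om\<^sup>2 - c1 - c2 = ?q" | "2 * om\<^sup>2 - c1 - c2 = - ?q" by linarith
  then show ?thesis
  proof cases
    case 1
    then have "om\<^sup>2 = (c1 + c2 + ?q) / 2" by simp
    then have "om = om_plus v w th" unfolding om_plus_def using om by (metis less_imp_le real_sqrt_unique)
    with 1 show ?thesis by simp
  next
    case 2
    then have "om\<^sup>2 = (c1 + c2 - ?q) / 2" by simp
    then have "om = om_minus v w th" unfolding om_minus_def using om by (metis less_imp_le real_sqrt_unique)
    with 2 show ?thesis by simp
  qed
qed

lemma om_plus_sq: assumes "is_mode om th" "om = om_plus v w th"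
  shows "2 * om\<^sup>2 - c1 - c2 = sqrt ((c1 - c2)\<^sup>2 + 8 * a1 * a2 * (cos th + 1))"
proof -
  let ?q = "sqrt ((c1 - c2)\<^sup>2 + 8 * a1 * a2 * (cos th + 1))"
  have "(c1 + c2 + ?q) / 2 \<ge> 0" using assms unfolding is_mode_def om_plus_def by (metis less_imp_le real_sqrt_gt_0_iff)
  then have "om\<^sup>2 = (c1 + c2 + ?q) / 2" unfolding assms(2) om_plus_def by simp
  then show ?thesis by simp
qed

lemma om_minus_sq: assumes "is_mode om th" "om = om_minus v w th"
  shows "2 * om\<^sup>2 - c1 - c2 = - sqrt ((c1 - c2)\<^sup>2 + 8 * a1 * a2 * (cos th + 1))"
proof -
  let ?q = "sqrt ((c1 - c2)\<^sup>2 + 8 * a1 * a2 * (cos th + 1))"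
  have "(c1 + c2 - ?q) / 2 \<ge> 0" using assms unfolding is_mode_def om_minus_def by (metis less_imp_le real_sqrt_gt_0_iff)
  then have "om\<^sup>2 = (c1 + c2 - ?q) / 2" unfolding assms(2) om_minus_def by simp
  then show ?thesis by simp
qed

lemma deriv_om_plus: assumes m: "is_mode om th" and o: "om = om_plus v w th"
  shows "deriv (om_plus v w) th = gv om th"
proof -
  let ?d = "\<lambda>th. (c1 - c2)\<^sup>2 + 8 * a1 * a2 * (cos th + 1)"
  have om0: "om > 0" using m by (simp add: is_mode_def)
  have q: "sqrt (?d th) = 2 * om\<^sup>2 - c1 - c2" using om_plus_sq[OF m o] by simp
  have q0: "sqrt (?d th) > 0" using disc_pos[of th] by simp
  have in0: "(c1 + c2 + sqrt (?d th)) / 2 > 0" unfolding q using om0 by simp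
  have "((\<lambda>th. sqrt ((c1 + c2 + sqrt (?d th)) / 2)) has_real_derivative
     (inverse (sqrt ((c1 + c2 + sqrt (?d th)) / 2)) / 2) * ((inverse (sqrt (?d th)) / 2 * (8 * a1 * a2 * (- sin th))) / 2)) (at th)"
    using disc_pos[of th] in0 by (auto intro!: derivative_eq_intros)
  then have "deriv (om_plus v w) th = (inverse om / 2) * ((inverse (sqrt (?d th)) / 2 * (8 * a1 * a2 * (- sin th))) / 2)"
    using o unfolding om_plus_def[abs_def] by (simp add: DERIV_imp_deriv)
  also have "\<dots> = gv om th"
    using om0 q0 unfolding gv_def q by (intro group_velocity_arith) auto
  finally show ?thesis .
qed

lemma deriv_om_minus: assumes m: "is_mode om th" and o: "om = om_minus v w th"
  shows "deriv (om_minus v w) th = gv om th"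
proof -
  let ?d = "\<lambda>th. (c1 - c2)\<^sup>2 + 8 * a1 * a2 * (cos th + 1)"
  have om0: "om > 0" using m by (simp add: is_mode_def)
  have q: "sqrt (?d th) = - (2 * om\<^sup>2 - c1 - c2)" using om_minus_sq[OF m o] by simp
  have in0: "(c1 + c2 - sqrt (?d th)) / 2 > 0" unfolding q using om0 by simp
  have "((\<lambda>th. sqrt ((c1 + c2 - sqrt (?d th)) / 2)) has_real_derivative
     (inverse (sqrt ((c1 + c2 - sqrt (?d th)) / 2)) / 2) * (- (inverse (sqrt (?d th)) / 2 * (8 * a1 * a2 * (- sin th))) / 2)) (at th)"
    using disc_pos[of th] in0 by (auto intro!: derivative_eq_intros)
  then have "deriv (om_minus v w) th = (inverse om / 2) * (- (inverse (sqrt (?d th)) / 2 * (8 * a1 * a2 * (- sin th))) / 2)"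
    using o unfolding om_minus_def[abs_def] by (simp add: DERIV_imp_deriv)
  also have "\<dots> = gv om th"
  proof -
    have nz: "2 * om\<^sup>2 - c1 - c2 \<noteq> 0" by (rule diff_nz[OF m])
    show ?thesis unfolding gv_def q using om0 nz by (intro group_velocity_arith) auto
  qed
  finally show ?thesis .
qed

text \<open>Away from pi the product of the off-diagonal entries is nonzero, so det H = 0 forces
  both diagonal entries to be nonzero; the two formulas for \<rho> then agree.\<close>

lemma interior_mode:
  assumes m: "is_mode om th" and th: "th \<noteq> pi"
  shows "cis th + 1 \<noteq> 0" "1 + cis (- th) \<noteq> 0" "om\<^sup>2 \<noteq> c1" "om\<^sup>2 \<noteq> c2"
    "of_real a1 * (cis th + 1) * rho v w om th = of_real (om\<^sup>2 - c1)"
    "of_real (om\<^sup>2 - c2) * rho v w om th = of_real a2 * (1 + cis (- th))"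
    "rho v w om th \<noteq> 0"
proof -
  show n1: "cis th + 1 \<noteq> 0" using cis_eq_minus_one m th by (auto simp: is_mode_def)
  show n2: "1 + cis (- th) \<noteq> 0"
  proof
    assume "1 + cis (- th) = 0"
    from arg_cong[OF this, of cnj] show False using n1 by (simp add: cis_cnj add.commute)
  qed
  have "of_real (2 + 2 * cos th) \<noteq> (0::complex)" unfolding cis_plus_one_mult[symmetric] using n1 n2 by simp
  then have "2 + 2 * cos th \<noteq> 0" by (simp only: of_real_eq_0_iff) simp
  then have "(c1 - om\<^sup>2) * (c2 - om\<^sup>2) \<noteq> 0" using m a_nz by (simp add: is_mode_def)
  then show o1: "om\<^sup>2 \<noteq> c1" and o2: "om\<^sup>2 \<noteq> c2" by auto
  have rho: "rho v w om th = of_real (om\<^sup>2 - c1) / (of_real a1 * (cis th + 1))" by (simp add: rho_def cis_conv_exp)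
  show e1: "of_real a1 * (cis th + 1) * rho v w om th = of_real (om\<^sup>2 - c1)"
    unfolding rho using n1 a_nz by simp
  show "rho v w om th \<noteq> 0"
    unfolding rho divide_eq_0_iff mult_eq_0_iff of_real_eq_0_iff using n1 a_nz o1 by simp
  have "of_real a1 * (cis th + 1) * (of_real (om\<^sup>2 - c2) * rho v w om th)
      = of_real (om\<^sup>2 - c2) * (of_real a1 * (cis th + 1) * rho v w om th)" by (simp only: mult_ac)
  also have "\<dots> = of_real ((c1 - om\<^sup>2) * (c2 - om\<^sup>2))"
    unfolding e1 of_real_mult[symmetric] by (rule arg_cong[of _ _ of_real]) (simp add: algebra_simps)
  also have "\<dots> = of_real a1 * (cis th + 1) * (of_real a2 * (1 + cis (- th)))"
  proof -
    have "of_real ((c1 - om\<^sup>2) * (c2 - om\<^sup>2)) = of_real a1 * of_real a2 * (of_real (2 + 2 * cos th) :: complex)"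
      using m by (simp add: is_mode_def del: of_real_add of_real_diff)
    then show ?thesis unfolding cis_plus_one_mult[symmetric] by (simp only: mult_ac)
  qed
  finally show "of_real (om\<^sup>2 - c2) * rho v w om th = of_real a2 * (1 + cis (- th))"
    using n1 a_nz by simp
qed

lemma edge_mode: assumes m: "is_mode om pi" shows "om\<^sup>2 = c1 \<or> om\<^sup>2 = c2"
  using m by (auto simp: is_mode_def)

lemma cis_minus_pi: "cis (- pi) = -1"
  by (simp add: complex_eq_iff)

lemma kernel:
  assumes m: "is_mode om th"
  shows "of_real (c1 - om\<^sup>2) * Rv om th 1 = of_real a1 * (cis th + 1) * Rv om th 2"
    "of_real (c2 - om\<^sup>2) * Rv om th 2 = of_real a2 * (1 + cis (- th)) * Rv om th 1"
proof -
  have "of_real (c1 - om\<^sup>2) * Rv om th 1 = of_real a1 * (cis th + 1) * Rv om th 2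
    \<and> of_real (c2 - om\<^sup>2) * Rv om th 2 = of_real a2 * (1 + cis (- th)) * Rv om th 1"
  proof (cases "th = pi")
    case True
    then have "om\<^sup>2 = c1 \<or> om\<^sup>2 = c2" using edge_mode m by blast
    then show ?thesis using True c12 by (elim disjE) (simp_all add: Rv_def cis_minus_pi del: of_real_diff)
  next
    case False
    note i = interior_mode[OF m False]
    have "of_real (c1 - om\<^sup>2) = - (of_real (om\<^sup>2 - c1) :: complex)" "of_real (c2 - om\<^sup>2) = - (of_real (om\<^sup>2 - c2) :: complex)"
      by simp_all
    then show ?thesis using i(5,6) False by (simp only: Rv_def) (simp del: of_real_diff)
  qed
  then show "of_real (c1 - om\<^sup>2) * Rv om th 1 = of_real a1 * (cis th + 1) * Rv om th 2"
    "of_real (c2 - om\<^sup>2) * Rv om th 2 = of_real a2 * (1 + cis (- th)) * Rv om th 1" by blast+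
qed

text \<open>The projection of the slope terms onto the left null vector vanishes precisely when the
  amplitude travels with the group velocity. At the band edge that velocity is 0 and the constrained
  component of the forcing is 0 by itself.\<close>

lemma transport_solvable:
  assumes m: "is_mode om th"
  shows "Sol c1 c2 a1 a2 om th
     (of_real a1 * cis th * Rv om th 2 - 2 * (\<i> * of_real om) * of_real (gv om th) * Rv om th 1)
     (- (of_real a2 * cis (- th) * Rv om th 1) - 2 * (\<i> * of_real om) * of_real (gv om th) * Rv om th 2)"
proof (cases "th = pi")
  case True
  have g: "gv om pi = 0" by (simp add: gv_def)
  show ?thesis
  proof (cases "om\<^sup>2 = c1")
    case c: True
    show ?thesis unfolding True g by (rule Sol_edge1) (use c c12 in \<open>auto simp: Rv_def\<close>)
  next
    case c: False
    then have "om\<^sup>2 = c2" using edge_mode m True by blast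
    then show ?thesis unfolding True g by (intro Sol_edge2) (use c c12 in \<open>auto simp: Rv_def\<close>)
  qed
next
  case False
  note i = interior_mode[OF m False]
  let ?\<rho> = "rho v w om th"
  have om0: "om \<noteq> 0" using m by (simp add: is_mode_def)
  \<comment> \<open>The differentiated dispersion relation; it cancels against the imaginary part of
    cis th - cis (- th) below.\<close>
  have g: "2 * om * gv om th * (2 * om\<^sup>2 - c1 - c2) = - 2 * a1 * a2 * sin th"
    using om0 diff_nz[OF m] by (simp add: gv_def)
  show ?thesis
  proof (rule Sol_resonant)
    show "(c1 - om\<^sup>2) * (c2 - om\<^sup>2) = a1 * a2 * (2 + 2 * cos th)" using m by (simp add: is_mode_def)
    have R: "Rv om th 1 = 1" "Rv om th 2 = - ?\<rho>" using False by (simp_all add: Rv_def)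
    have "of_real (c2 - om\<^sup>2) * (of_real a1 * cis th * Rv om th 2 - 2 * (\<i> * of_real om) * of_real (gv om th) * Rv om th 1)
       + of_real a1 * (cis th + 1) * (- (of_real a2 * cis (- th) * Rv om th 1) - 2 * (\<i> * of_real om) * of_real (gv om th) * Rv om th 2)
      = of_real a1 * cis th * (of_real (om\<^sup>2 - c2) * ?\<rho>) - of_real a1 * of_real a2 * ((cis th + 1) * cis (- th))
       + 2 * \<i> * of_real om * of_real (gv om th) * (of_real (om\<^sup>2 - c2) + of_real a1 * (cis th + 1) * ?\<rho>)"
      unfolding R by (simp add: algebra_simps)
    also have "\<dots> = of_real a1 * of_real a2 * (cis th * (1 + cis (- th)) - (cis th + 1) * cis (- th))
       + \<i> * of_real (2 * om * gv om th * (2 * om\<^sup>2 - c1 - c2))"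
      unfolding i(5,6) by (simp add: algebra_simps)
    also have "\<dots> = 0" unfolding g by (simp add: complex_eq_iff algebra_simps)
    finally show "of_real (c2 - om\<^sup>2) * (of_real a1 * cis th * Rv om th 2 - 2 * (\<i> * of_real om) * of_real (gv om th) * Rv om th 1)
       + of_real a1 * (cis th + 1) * (- (of_real a2 * cis (- th) * Rv om th 1) - 2 * (\<i> * of_real om) * of_real (gv om th) * Rv om th 2) = 0" .
  qed (use i a_nz in auto)
qed

lemma mult_regroup: "p * q * z = w' \<Longrightarrow> s * p * q * c * z = s * c * w'" "p * z = w' \<Longrightarrow> s * p * c * z = s * c * w'"
  for p q z s c w' :: complex
  by (auto simp: mult_ac)

lemma neg_sum_zero: "x - y = z \<Longrightarrow> - x + y + z = 0" for x :: complex
  by auto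

text \<open>Solvability at a resonant wave number: \<open>d\<close> is the projection of the quadratic forcing
  onto the left null vector of the dispersion matrix.\<close>

lemma forced_solvable:
  assumes m: "is_mode om th" and th: "th \<noteq> pi"
    and d: "of_real (om\<^sup>2 - c2) * d = of_real (om\<^sup>2 - c2) * M1 - of_real a1 * (cis th + 1) * M2"
    and G: "G = d * of_real ((om\<^sup>2 - c2) / (2 * om\<^sup>2 - c1 - c2))"
  shows "Sol c1 c2 a1 a2 om th (M1 - G) (M2 + G * rho v w om th)"
proof (rule Sol_resonant)
  note i = interior_mode[OF m th]
  show "(c1 - om\<^sup>2) * (c2 - om\<^sup>2) = a1 * a2 * (2 + 2 * cos th)" using m by (simp add: is_mode_def)
  have "G * of_real (2 * om\<^sup>2 - c1 - c2) = d * of_real (om\<^sup>2 - c2)"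
    unfolding G mult.assoc of_real_mult[symmetric] using diff_nz[OF m] by simp
  then have "of_real (om\<^sup>2 - c2) * M1 - of_real a1 * (cis th + 1) * M2 = G * of_real (2 * om\<^sup>2 - c1 - c2)"
    using d by (simp only: mult.commute[of d])
  then have *: "- (of_real (om\<^sup>2 - c2) * M1) + of_real a1 * (cis th + 1) * M2 + G * of_real (2 * om\<^sup>2 - c1 - c2) = 0"
    by (rule neg_sum_zero)
  have "of_real (c2 - om\<^sup>2) * (M1 - G) + of_real a1 * (cis th + 1) * (M2 + G * rho v w om th)
    = - (of_real (om\<^sup>2 - c2) * M1) + of_real a1 * (cis th + 1) * M2
      + G * (of_real (om\<^sup>2 - c2) + of_real a1 * (cis th + 1) * rho v w om th)" by (simp add: algebra_simps)
  also have "\<dots> = - (of_real (om\<^sup>2 - c2) * M1) + of_real a1 * (cis th + 1) * M2 + G * of_real (2 * om\<^sup>2 - c1 - c2)"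
    unfolding i(5) of_real_add[symmetric] by (simp add: algebra_simps)
  also have "\<dots> = 0" by (rule *)
  finally show "of_real (c2 - om\<^sup>2) * (M1 - G) + of_real a1 * (cis th + 1) * (M2 + G * rho v w om th) = 0" .
qed (use interior_mode[OF m th] a_nz in auto)

lemma Rv_interior: "th \<noteq> pi \<Longrightarrow> Rv om th 1 = 1" "th \<noteq> pi \<Longrightarrow> Rv om th 2 = - rho v w om th"
  by (simp_all add: Rv_def)

lemma cnj_rho_interior:
  assumes m: "is_mode om th" and th: "th \<noteq> pi"
  shows "of_real (om\<^sup>2 - c2) * cnj (rho v w om th) = of_real a2 * (1 + cis th)"
  using arg_cong[OF interior_mode(6)[OF m th], of cnj] by (simp add: cis_cnj)

lemma exp_cis: "exp (\<i> * of_real x) = cis x" by (simp add: cis_conv_exp)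

text \<open>\<open>Dcoef\<close> is the kernel ratio \<open>a1 (e^{i \<vartheta>} + 1) / (\<omega>^2 - c2)\<close> times a product of two \<open>\<rho>\<close>'s, for either mode.\<close>

lemma Dcoef_eq:
  assumes m1: "is_mode (om 1) (th 1)" "th 1 \<noteq> pi" and m2: "is_mode (om 2) (th 2)" "th 2 \<noteq> pi"
    and th2: "th 2 = 2 * th 1 + 2 * pi * of_int k"
  shows "of_real ((om 1)\<^sup>2 - c2) * Dcoef v w om th
      = of_real a1 * (cis (th 1) + 1) * cnj (rho v w (om 1) (th 1)) * rho v w (om 2) (th 2)"
    "of_real ((om 2)\<^sup>2 - c2) * Dcoef v w om th
      = of_real a1 * (cis (th 2) + 1) * (rho v w (om 1) (th 1))\<^sup>2"
proof -
  define x where "x = cis (th 1)"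
  define y where "y = cis (- th 1)"
  have xy: "x * y = 1" by (simp add: x_def y_def cis_mult)
  have x2: "cis (th 2) = x\<^sup>2" and y2: "cis (- th 2) = y\<^sup>2"
  proof -
    have "cis (th 2) = cis (2 * th 1) * cis (2 * pi * of_int k)" unfolding th2 by (simp only: cis_mult)
    then show "cis (th 2) = x\<^sup>2" using cis_multiple_2pi[of "of_int k"] by (simp add: x_def power2_eq_square cis_mult)
    from arg_cong[OF this, of cnj] show "cis (- th 2) = y\<^sup>2" by (simp add: x_def y_def cis_cnj)
  qed
  define u1 where "u1 = (of_real ((om 1)\<^sup>2 - c2) :: complex)"
  define u2 where "u2 = (of_real ((om 2)\<^sup>2 - c2) :: complex)"
  have u: "u1 \<noteq> 0" "u2 \<noteq> 0"
    using interior_mode(4)[OF m1] interior_mode(4)[OF m2] unfolding u1_def u2_def of_real_eq_0_iff by simp_all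
  \<comment> \<open>The trigonometric numerator of \<open>Dcoef\<close> factors in two ways because
    x y = 1. One factorisation matches the conjugate of \<rho>1 times \<rho>2, the other the square
    of \<rho>1.\<close>
  define tri where "tri = (of_real (2 + 4 * cos (th 1) + 2 * cos (th 2)) :: complex)"
  have tri: "tri = (1 + x)\<^sup>2 * (1 + y\<^sup>2)" "tri = (1 + y)\<^sup>2 * (1 + x\<^sup>2)"
  proof -
    have c: "of_real (2 * cos t) = cis t + cis (- t)" for t by (simp add: complex_eq_iff)
    have "tri = 2 + 2 * of_real (2 * cos (th 1)) + of_real (2 * cos (th 2))" by (simp add: tri_def)
    then have t: "tri = 2 + 2 * (x + y) + (x\<^sup>2 + y\<^sup>2)" unfolding c x2 y2 x_def[symmetric] y_def[symmetric] .
    show "tri = (1 + x)\<^sup>2 * (1 + y\<^sup>2)" "tri = (1 + y)\<^sup>2 * (1 + x\<^sup>2)" using t xy by algebra+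
  qed
  have D: "Dcoef v w om th * (u1\<^sup>2 * u2) = of_real a1 * (of_real a2)\<^sup>2 * tri"
  proof -
    have "Dcoef v w om th = of_real a1 * (of_real a2)\<^sup>2 * tri / (u1\<^sup>2 * u2)"
      by (simp add: Dcoef_def tri_def u1_def u2_def)
    then show ?thesis using u by simp
  qed
  define \<rho>1 where "\<rho>1 = rho v w (om 1) (th 1)"
  define \<rho>2 where "\<rho>2 = rho v w (om 2) (th 2)"
  have r1: "u1 * \<rho>1 = of_real a2 * (1 + y)" and r1c: "u1 * cnj \<rho>1 = of_real a2 * (1 + x)"
    and r2: "u2 * \<rho>2 = of_real a2 * (1 + y\<^sup>2)"
    using interior_mode(6)[OF m1] cnj_rho_interior[OF m1] interior_mode(6)[OF m2]
    unfolding u1_def u2_def \<rho>1_def \<rho>2_def x_def[symmetric] y_def[symmetric] y2 by simp_all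
  have "(u1 * u2) * (u1 * Dcoef v w om th) = of_real a1 * (of_real a2)\<^sup>2 * tri" using D by (simp add: power2_eq_square mult_ac)
  also have "\<dots> = of_real a1 * (1 + x) * (u1 * cnj \<rho>1) * (u2 * \<rho>2)"
    unfolding tri(1) r1c r2 by (simp add: power2_eq_square mult_ac)
  also have "\<dots> = (u1 * u2) * (of_real a1 * (x + 1) * cnj \<rho>1 * \<rho>2)" by (simp add: mult_ac add.commute)
  finally show "of_real ((om 1)\<^sup>2 - c2) * Dcoef v w om th
      = of_real a1 * (cis (th 1) + 1) * cnj (rho v w (om 1) (th 1)) * rho v w (om 2) (th 2)"
    using u unfolding u1_def[symmetric] x_def[symmetric] \<rho>1_def[symmetric] \<rho>2_def[symmetric] by simp
  have "u1\<^sup>2 * (u2 * Dcoef v w om th) = of_real a1 * (of_real a2)\<^sup>2 * tri" using D by (simp add: mult_ac)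
  also have "\<dots> = of_real a1 * (1 + x\<^sup>2) * (u1 * \<rho>1)\<^sup>2"
    unfolding tri(2) r1 by (simp add: power2_eq_square mult_ac)
  also have "\<dots> = u1\<^sup>2 * (of_real a1 * (x\<^sup>2 + 1) * \<rho>1\<^sup>2)" by (simp add: power_mult_distrib mult_ac add.commute)
  finally show "of_real ((om 2)\<^sup>2 - c2) * Dcoef v w om th
      = of_real a1 * (cis (th 2) + 1) * (rho v w (om 1) (th 1))\<^sup>2"
    using u unfolding u2_def[symmetric] x2 \<rho>1_def[symmetric] by simp
qed

text \<open>Identifies the given d1 as the projection that \<open>forced_solvable\<close> asks for,
  in the interaction of mode 2 with the conjugate of mode 1. The weight of \<open>N2\<close> in that
  projection is \<open>Dcoef\<close> times (\<omega>1^2 - c2) divided by the two \<rho>'s; this is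
  where the reciprocals in d1 come from.\<close>

lemma d1coef_eq:
  assumes m1: "is_mode (om 1) (th 1)" "th 1 \<noteq> pi" and m2: "is_mode (om 2) (th 2)" "th 2 \<noteq> pi"
    and th2: "th 2 = 2 * th 1 + 2 * pi * of_int k"
  shows "of_real ((om 1)\<^sup>2 - c2) * d1coef v w om th
    = of_real ((om 1)\<^sup>2 - c2) * N1 (v 1 2) (w 1 2) (cis (- th 1)) (cis (th 2)) (\<lambda>c. cnj (Rv (om 1) (th 1) c)) (Rv (om 2) (th 2))
     - of_real a1 * (cis (th 1) + 1) * N2 (v 2 2) (w 2 2) (cis (th 1)) (cis (- th 2)) (\<lambda>c. cnj (Rv (om 1) (th 1) c)) (Rv (om 2) (th 2))"
proof -
  define x where "x = cis (th 1)"
  define y where "y = cis (- th 1)"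
  have xy: "x * y = 1" by (simp add: x_def y_def cis_mult)
  have x2: "cis (th 2) = x\<^sup>2" and y2: "cis (- th 2) = y\<^sup>2"
  proof -
    have "cis (th 2) = cis (2 * th 1) * cis (2 * pi * of_int k)" unfolding th2 by (simp only: cis_mult)
    then show "cis (th 2) = x\<^sup>2" using cis_multiple_2pi[of "of_int k"] by (simp add: x_def power2_eq_square cis_mult)
    from arg_cong[OF this, of cnj] show "cis (- th 2) = y\<^sup>2" by (simp add: x_def y_def cis_cnj)
  qed
  define u where "u = (of_real ((om 1)\<^sup>2 - c2) :: complex)"
  define D where "D = Dcoef v w om th"
  define p where "p = cnj (rho v w (om 1) (th 1))"
  define q where "q = rho v w (om 2) (th 2)"
  have pq: "p \<noteq> 0" "q \<noteq> 0" using interior_mode(7)[OF m1] interior_mode(7)[OF m2] by (simp_all add: p_def q_def)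
  have D: "u * D = of_real a1 * (x + 1) * p * q" unfolding u_def D_def p_def q_def x_def by (rule Dcoef_eq(1)[OF m1 m2 th2])
  have e: "exp (\<i> * of_real (-1 * th 1)) = y" "exp (\<i> * of_real (-2 * th 1)) = y\<^sup>2" "exp (\<i> * of_real (1 * th 1)) = x"
    "exp (\<i> * of_real (2 * th 1)) = x\<^sup>2"
    unfolding exp_cis by (simp_all add: x_def y_def power2_eq_square cis_mult)
  have "d1coef v w om th = D * of_real (v 2 2) * ((y - 1) / (p * q) + (y\<^sup>2 - 1) / q + (x - 1) / p)
         + of_real (v 1 2) * (p * q * (x - 1) + q * (x\<^sup>2 - 1) + p * (y - 1)) + D * of_real (w 2 2) - of_real (w 1 2)"
    unfolding d1coef_def Let_def e D_def p_def q_def ..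
  then have "u * d1coef v w om th = (u * D) * of_real (v 2 2) * ((y - 1) / (p * q) + (y\<^sup>2 - 1) / q + (x - 1) / p)
         + u * of_real (v 1 2) * (p * q * (x - 1) + q * (x\<^sup>2 - 1) + p * (y - 1)) + (u * D) * of_real (w 2 2) - u * of_real (w 1 2)"
    by (simp only: distrib_left right_diff_distrib mult.assoc)
  also have "\<dots> = of_real a1 * (x + 1) * of_real (v 2 2) * ((y - 1) + p * (y\<^sup>2 - 1) + q * (x - 1))
         + u * of_real (v 1 2) * (p * q * (x - 1) + q * (x\<^sup>2 - 1) + p * (y - 1)) + of_real a1 * (x + 1) * p * q * of_real (w 2 2) - u * of_real (w 1 2)"
  proof -
    \<comment> \<open>Multiplying out the reciprocals leaves a polynomial in x, y, p, q, and the
      rest is algebra with x y = 1.\<close>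
    have "p * q * ((y - 1) / (p * q) + (y\<^sup>2 - 1) / q + (x - 1) / p) = (y - 1) + p * (y\<^sup>2 - 1) + q * (x - 1)"
      using pq by (simp add: field_simps)
    then have "of_real a1 * (x + 1) * p * q * of_real (v 2 2) * ((y - 1) / (p * q) + (y\<^sup>2 - 1) / q + (x - 1) / p)
      = of_real a1 * (x + 1) * of_real (v 2 2) * ((y - 1) + p * (y\<^sup>2 - 1) + q * (x - 1))" by (rule mult_regroup(1))
    then show ?thesis unfolding D by simp
  qed
  also have "\<dots> = u * (of_real (v 1 2) * ((y * (- p) - 1) * (x\<^sup>2 * (- q) - 1) - (1 - (- p)) * (1 - (- q))) - of_real (w 1 2) * 1 * 1)
     - of_real a1 * (x + 1) * (of_real (v 2 2) * ((1 - (- p)) * (1 - (- q)) - ((- p) - x * 1) * ((- q) - y\<^sup>2 * 1)) - of_real (w 2 2) * (- p) * (- q))"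
    using xy by algebra
  finally show ?thesis
    unfolding N1_def N2_def Rv_interior[OF m1(2)] Rv_interior[OF m2(2)] x2 y2 complex_cnj_one complex_cnj_minus
      x_def[symmetric] y_def[symmetric] p_def[symmetric] q_def[symmetric] u_def[symmetric] .
qed

text \<open>The analogue for mode 1 interacting with itself, projected at mode 2; the weight now
  involves the square of \<rho>1.\<close>

lemma d2coef_eq:
  assumes m1: "is_mode (om 1) (th 1)" "th 1 \<noteq> pi" and m2: "is_mode (om 2) (th 2)" "th 2 \<noteq> pi"
    and th2: "th 2 = 2 * th 1 + 2 * pi * of_int k"
  shows "of_real ((om 2)\<^sup>2 - c2) * d2coef v w om th
    = of_real ((om 2)\<^sup>2 - c2) * N1 (v 1 2) (w 1 2) (cis (th 1)) (cis (th 1)) (Rv (om 1) (th 1)) (Rv (om 1) (th 1))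
     - of_real a1 * (cis (th 2) + 1) * N2 (v 2 2) (w 2 2) (cis (- th 1)) (cis (- th 1)) (Rv (om 1) (th 1)) (Rv (om 1) (th 1))"
proof -
  define x where "x = cis (th 1)"
  define y where "y = cis (- th 1)"
  have x2: "cis (th 2) = x\<^sup>2"
  proof -
    have "cis (th 2) = cis (2 * th 1) * cis (2 * pi * of_int k)" unfolding th2 by (simp only: cis_mult)
    then show "cis (th 2) = x\<^sup>2" using cis_multiple_2pi[of "of_int k"] by (simp add: x_def power2_eq_square cis_mult)
  qed
  define u where "u = (of_real ((om 2)\<^sup>2 - c2) :: complex)"
  define D where "D = Dcoef v w om th"
  define p where "p = rho v w (om 1) (th 1)"
  have p0: "p \<noteq> 0" using interior_mode(7)[OF m1] by (simp add: p_def)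
  have D: "u * D = of_real a1 * (x\<^sup>2 + 1) * p\<^sup>2" unfolding u_def D_def p_def x2[symmetric] by (rule Dcoef_eq(2)[OF m1 m2 th2])
  have e: "exp (\<i> * of_real (-1 * th 1)) = y" "exp (\<i> * of_real (-2 * th 1)) = y\<^sup>2" "exp (\<i> * of_real (1 * th 1)) = x"
    "exp (\<i> * of_real (2 * th 1)) = x\<^sup>2"
    unfolding exp_cis by (simp_all add: x_def y_def power2_eq_square cis_mult)
  have "d2coef v w om th = D * of_real (v 2 2) * ((y\<^sup>2 - 1) / p\<^sup>2 + 2 * (y - 1) / p)
         + of_real (v 1 2) * (p\<^sup>2 * (x\<^sup>2 - 1) + 2 * p * (x - 1)) + D * of_real (w 2 2) - of_real (w 1 2)"
    unfolding d2coef_def Let_def e D_def p_def ..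
  then have "u * d2coef v w om th = (u * D) * of_real (v 2 2) * ((y\<^sup>2 - 1) / p\<^sup>2 + 2 * (y - 1) / p)
         + u * of_real (v 1 2) * (p\<^sup>2 * (x\<^sup>2 - 1) + 2 * p * (x - 1)) + (u * D) * of_real (w 2 2) - u * of_real (w 1 2)"
    by (simp only: distrib_left right_diff_distrib mult.assoc)
  also have "\<dots> = of_real a1 * (x\<^sup>2 + 1) * of_real (v 2 2) * ((y\<^sup>2 - 1) + 2 * p * (y - 1))
         + u * of_real (v 1 2) * (p\<^sup>2 * (x\<^sup>2 - 1) + 2 * p * (x - 1)) + of_real a1 * (x\<^sup>2 + 1) * p\<^sup>2 * of_real (w 2 2) - u * of_real (w 1 2)"
  proof -
    have "p\<^sup>2 * ((y\<^sup>2 - 1) / p\<^sup>2 + 2 * (y - 1) / p) = (y\<^sup>2 - 1) + 2 * p * (y - 1)"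
      using p0 by (simp add: field_simps power2_eq_square)
    then have "of_real a1 * (x\<^sup>2 + 1) * p\<^sup>2 * of_real (v 2 2) * ((y\<^sup>2 - 1) / p\<^sup>2 + 2 * (y - 1) / p)
      = of_real a1 * (x\<^sup>2 + 1) * of_real (v 2 2) * ((y\<^sup>2 - 1) + 2 * p * (y - 1))" by (rule mult_regroup(2))
    then show ?thesis unfolding D by simp
  qed
  also have "\<dots> = u * (of_real (v 1 2) * ((x * (- p) - 1) * (x * (- p) - 1) - (1 - (- p)) * (1 - (- p))) - of_real (w 1 2) * 1 * 1)
     - of_real a1 * (x\<^sup>2 + 1) * (of_real (v 2 2) * ((1 - (- p)) * (1 - (- p)) - ((- p) - y * 1) * ((- p) - y * 1)) - of_real (w 2 2) * (- p) * (- p))"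
    by (simp add: algebra_simps power2_eq_square)
  finally show ?thesis
    unfolding N1_def N2_def Rv_interior[OF m1(2)] x2 x_def[symmetric] y_def[symmetric] p_def[symmetric] u_def[symmetric] .
qed

end

lemma angle_unique:
  assumes "- pi < a" "a \<le> pi" "- pi < b" "b \<le> pi" "a = b + 2 * pi * of_int l"
  shows "a = b"
proof -
  have "2 * pi * of_int l < 2 * pi * 1" "2 * pi * (-1) < 2 * pi * of_int l" using assms by linarith+
  then have "real_of_int l < 1" "-1 < real_of_int l"
    using mult_less_cancel_left_pos[of "2 * pi" "of_int l" 1] mult_less_cancel_left_pos[of "2 * pi" "-1" "of_int l"]
      pi_gt_zero by simp_all
  then have "l = 0" by linarith
  then show ?thesis using assms(5) by simp
qed

section \<open>The amplitude systems as solvability conditions\<close>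

context chain_coeffs begin

lemma is_modeI:
  assumes "det (Hmat v w om th) = 0" "om > 0" "th \<in> {- pi<..pi}"
  shows "is_mode om th"
proof -
  have "(cc v w 1 - om\<^sup>2) * (cc v w 2 - om\<^sup>2) - v 1 1 * v 2 1 * (2 + 2 * cos th) = 0"
    using assms(1) unfolding det_Hmat of_real_eq_0_iff .
  then show ?thesis using assms(2,3) by (simp add: is_mode_def)
qed

lemma Sol_of_det: "det (Hmat v w om th) \<noteq> 0 \<Longrightarrow> Sol c1 c2 a1 a2 om th F1 F2"
  unfolding det_Hmat of_real_eq_0_iff by (rule Sol_nonresonant)

text \<open>The component that carries the evolving amplitude: the second one for an edge mode on
  the upper branch, otherwise the first.\<close>

definition "k0 om th = (if th = pi \<and> om\<^sup>2 \<noteq> c1 then 2 else (1::nat))"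

lemma forced_solvable_mode:
  assumes m: "is_mode om th" and th: "th \<noteq> pi"
    and d: "of_real (om\<^sup>2 - c2) * d = of_real (om\<^sup>2 - c2) * M1 - of_real a1 * (cis th + 1) * M2"
    and G: "G = d * of_real ((om\<^sup>2 - c2) / (2 * om\<^sup>2 - c1 - c2))"
  shows "Sol c1 c2 a1 a2 om th (M1 - G * Rv om th 1) (M2 - G * Rv om th 2)"
  using forced_solvable[OF assms] by (simp only: Rv_interior[OF th]) simp

lemma d1tilde_eq:
  assumes m1: "is_mode (om 1) (th 1)" and s: "s = 1 \<or> s = -1" and th1: "th 1 = s * (pi / 2)"
    and th2: "th 2 = pi" and o2: "(om 2)\<^sup>2 \<noteq> c1"
  shows "of_real ((om 1)\<^sup>2 - c2) * d1tilde v w om th s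
    = of_real ((om 1)\<^sup>2 - c2) * N1 (v 1 2) (w 1 2) (cis (- th 1)) (cis (th 2)) (\<lambda>c. cnj (Rv (om 1) (th 1) c)) (Rv (om 2) (th 2))
     - of_real a1 * (cis (th 1) + 1) * N2 (v 2 2) (w 2 2) (cis (th 1)) (cis (- th 2)) (\<lambda>c. cnj (Rv (om 1) (th 1) c)) (Rv (om 2) (th 2))"
proof -
  define x where "x = cis (th 1)"
  define y where "y = cis (- th 1)"
  have xy: "x * y = 1" by (simp add: x_def y_def cis_mult)
  have xs: "x = of_real s * \<i>" "y = - (of_real s * \<i>)"
    unfolding x_def y_def th1 using s by (auto simp: complex_eq_iff)
  have xx: "x * x = -1" unfolding xs using s by auto
  have thn: "th 1 \<noteq> pi" unfolding th1 using s by auto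
  define u where "u = (of_real ((om 1)\<^sup>2 - c2) :: complex)"
  define P where "P = (of_real ((om 1)\<^sup>2 - c1) :: complex)"
  define \<rho> where "\<rho> = rho v w (om 1) (th 1)"
  note i = interior_mode[OF m1 thn]
  have u0: "u \<noteq> 0" unfolding u_def of_real_eq_0_iff using i(4) by simp
  have r: "u * \<rho> = of_real a2 * (1 + y)" "u * cnj \<rho> = of_real a2 * (1 + x)"
    unfolding u_def \<rho>_def x_def y_def by (rule i(6), rule cnj_rho_interior[OF m1 thn])
  have Pc: "of_real a1 * (y + 1) * cnj \<rho> = P"
    using arg_cong[OF i(5), of cnj] by (simp add: P_def \<rho>_def y_def cis_cnj)
  have Px: "of_real a1 * (x + 1) * cnj \<rho> = x * P" unfolding Pc[symmetric] using xy by algebra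
  \<comment> \<open>The dispersion relation at cos \<theta>1 = 0; it produces the quotient v22 / v21
    in the stated coefficient.\<close>
  have uP: "u * P = 2 * of_real a1 * of_real a2"
  proof -
    have "cos (th 1) = 0" unfolding th1 using s by auto
    then have "((om 1)\<^sup>2 - c2) * ((om 1)\<^sup>2 - c1) = 2 * a1 * a2"
      using m1 unfolding is_mode_def by (simp add: algebra_simps)
    then show ?thesis unfolding u_def P_def of_real_mult[symmetric] by simp
  qed
  have d: "d1tilde v w om th s = (of_real (v 2 2) / of_real a2 - of_real s * \<i> * of_real (w 2 2) / u) * P
      + of_real (v 1 2) * (\<rho> * (1 + of_real s * \<i>) + 2)"
    by (simp add: d1tilde_def u_def P_def \<rho>_def)
  have "u * d1tilde v w om th s = (u * P) * of_real (v 2 2) / of_real a2 - x * of_real (w 2 2) * P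
      + of_real (v 1 2) * ((u * \<rho>) * (1 + x) + 2 * u)"
    unfolding d xs(1)[symmetric] using u0 by (simp add: field_simps)
  also have "(u * P) * of_real (v 2 2) / of_real a2 = 2 * of_real a1 * of_real (v 2 2)"
    unfolding uP using a_nz by simp
  also have "2 * of_real a1 * of_real (v 2 2) - x * of_real (w 2 2) * P + of_real (v 1 2) * ((u * \<rho>) * (1 + x) + 2 * u)
     = u * (of_real (v 1 2) * ((y * (- cnj \<rho>) - 1) * ((-1) * 1 - 0) - (1 - (- cnj \<rho>)) * (0 - 1)) - of_real (w 1 2) * 1 * 0)
     - of_real a1 * (x + 1) * (of_real (v 2 2) * ((1 - (- cnj \<rho>)) * (0 - 1) - ((- cnj \<rho>) - x * 1) * (1 - (-1) * 0)) - of_real (w 2 2) * (- cnj \<rho>) * 1)"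
  proof -
    have "u * (of_real (v 1 2) * ((y * (- cnj \<rho>) - 1) * ((-1) * 1 - 0) - (1 - (- cnj \<rho>)) * (0 - 1)) - of_real (w 1 2) * 1 * 0)
       = of_real (v 1 2) * ((u * cnj \<rho>) * (y + 1) + 2 * u)" by (simp add: algebra_simps)
    also have "(u * cnj \<rho>) * (y + 1) = (u * \<rho>) * (1 + x)" unfolding r by (simp add: algebra_simps)
    finally have 1: "u * (of_real (v 1 2) * ((y * (- cnj \<rho>) - 1) * ((-1) * 1 - 0) - (1 - (- cnj \<rho>)) * (0 - 1)) - of_real (w 1 2) * 1 * 0)
       = of_real (v 1 2) * ((u * \<rho>) * (1 + x) + 2 * u)" .
    have "of_real a1 * (x + 1) * (of_real (v 2 2) * ((1 - (- cnj \<rho>)) * (0 - 1) - ((- cnj \<rho>) - x * 1) * (1 - (-1) * 0)) - of_real (w 2 2) * (- cnj \<rho>) * 1)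
       = of_real a1 * of_real (v 2 2) * (x * x - 1) + of_real (w 2 2) * (of_real a1 * (x + 1) * cnj \<rho>)" by (simp add: algebra_simps)
    also have "\<dots> = - (2 * of_real a1 * of_real (v 2 2)) + x * of_real (w 2 2) * P" unfolding Px xx by simp
    finally show ?thesis unfolding 1 by simp
  qed
  finally show ?thesis
    unfolding N1_def N2_def Rv_interior[OF thn] th2 complex_cnj_one complex_cnj_minus cis_pi cis_minus_pi
      x_def[symmetric] y_def[symmetric] \<rho>_def[symmetric] u_def[symmetric]
    using o2 by (simp add: Rv_def)
qed

lemma om_plus_pi: assumes "is_mode om pi" "om = om_plus v w pi" shows "om\<^sup>2 = c2"
  using om_plus_sq[OF assms] c12 by simp

lemma om_minus_pi: assumes "is_mode om pi" "om = om_minus v w pi" shows "om\<^sup>2 = c1"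
  using om_minus_sq[OF assms] c12 by simp

text \<open>Each case supplies what \<open>modulation_of_modes\<close> needs. In the non-resonant
  case all interactions are solvable for arbitrary forcing, and K1 = K2 = 0. In the resonant case (2
  \<omega>1, 2 \<theta>1) is mode 2 and (\<omega>2 - \<omega>1, \<theta>2 - \<theta>1) is mode 1 up
  to multiples of 2 pi, and the coefficients of the amplitude system are those that restore
  solvability there.\<close>

lemma modulation_exists:
  fixes om th :: "nat \<Rightarrow> real" and A At Ay :: "nat \<Rightarrow> nat \<Rightarrow> real \<Rightarrow> real \<Rightarrow> complex" and \<tau>0 :: real
  assumes det0: "c1 * c2 \<noteq> 4 * a1 * a2"
    and om_pos: "om 2 > om 1" "om 1 > 0"
    and th_range: "th 1 \<in> {-pi<..pi}" "th 2 \<in> {-pi<..pi}"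
    and disp: "det (Hmat v w (om 1) (th 1)) = 0" "det (Hmat v w (om 2) (th 2)) = 0"
    and cases: "NR_case v w om th \<tau>0 A At Ay \<or> R_case v w om th \<tau>0 A At Ay"
    and tau0: "\<tau>0 > 0"
    and derivs: "\<forall>n\<in>{1,2}. \<forall>k\<in>{1,2}. \<forall>\<tau>\<in>{0..\<tau>0}. \<forall>y.
        ((\<lambda>s. A n k s y) has_vector_derivative At n k \<tau> y) (at \<tau> within {0..\<tau>0}) \<and>
        ((\<lambda>z. A n k \<tau> z) has_vector_derivative Ay n k \<tau> y) (at y)"
    and H4: "\<forall>n\<in>{1,2}. \<forall>k\<in>{1,2}. \<forall>\<tau>\<in>{0..\<tau>0}. H4_norm_le K (A n k \<tau>)"
  shows "\<exists>K1 K2 s X. (\<forall>n\<in>{1,2}. \<forall>c\<in>{1,2}. \<forall>\<tau>\<in>{0..\<tau>0}. \<forall>y. A n c \<tau> y = Rv (om n) (th n) c * A n (k0 (om n) (th n)) \<tau> y)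
    \<and> modulation signed_modes (lamS om) (eS th) (eiS th) (\<lambda>i. of_real (gv (om (idx i)) (th (idx i)))) (rS (\<lambda>n. Rv (om n) (th n))) s
     (kapS K1 K2) X (ES om th) (bS (\<lambda>n. A n (k0 (om n) (th n)))) (bS (\<lambda>n. At n (k0 (om n) (th n)))) (bS (\<lambda>n. Ay n (k0 (om n) (th n)))) \<tau>0
     (of_real c1) (of_real c2) (of_real a1) (of_real a2)
     (of_real (v 1 2)) (of_real (v 2 2)) (of_real (w 1 2)) (of_real (w 2 2))"
proof -
  let ?R = "\<lambda>n. Rv (om n) (th n)"
  let ?k = "\<lambda>n. k0 (om n) (th n)"
  let ?g = "\<lambda>n. gv (om n) (th n)"
  have m1: "is_mode (om 1) (th 1)" and m2: "is_mode (om 2) (th 2)"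
    using disp om_pos th_range by (intro is_modeI; simp)+
  then have m: "is_mode (om n) (th n)" if "n \<in> {1,2}" for n using that by auto
  have k: "?k n \<in> {1,2}" for n by (simp add: k0_def)
  have om0: "of_real (om 1) \<noteq> (0::complex)" "of_real (om 2) \<noteq> (0::complex)" using om_pos by auto
  \<comment> \<open>A mode and its own conjugate interact at (0, 0); \<open>det0\<close> says that H
    is invertible there.\<close>
  have S00: "Sol c1 c2 a1 a2 0 0 F1 F2" for F1 F2 by (rule Sol_nonresonant) (use det0 in auto)
  have bd: "((\<lambda>t. A n (?k n) t y) has_vector_derivative At n (?k n) t y) (at t within {0..\<tau>0})"
    and byy: "((\<lambda>y. A n (?k n) t y) has_vector_derivative Ay n (?k n) t y) (at y)"
    and h4: "H4_norm_le K (A n (?k n) t)" if "n \<in> {1,2}" "t \<in> {0..\<tau>0}" for n t y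
    using derivs H4 k that by blast+
  have mod: "\<exists>s X. modulation signed_modes (lamS om) (eS th) (eiS th) (\<lambda>i. of_real (gv (om (idx i)) (th (idx i)))) (rS ?R) s
     (kapS K1 K2) X (ES om th) (bS (\<lambda>n. A n (?k n))) (bS (\<lambda>n. At n (?k n))) (bS (\<lambda>n. Ay n (?k n))) \<tau>0
     (of_real c1) (of_real c2) (of_real a1) (of_real a2)
     (of_real (v 1 2)) (of_real (v 2 2)) (of_real (w 1 2)) (of_real (w 2 2))"
    if "Sol c1 c2 a1 a2 (2 * om 1) (2 * th 1)
        (N1 (v 1 2) (w 1 2) (cis (th 1)) (cis (th 1)) (?R 1) (?R 1) - 2 * (\<i> * of_real (om 2) * ?R 2 1 * K2))
        (N2 (v 2 2) (w 2 2) (cis (- th 1)) (cis (- th 1)) (?R 1) (?R 1) - 2 * (\<i> * of_real (om 2) * ?R 2 2 * K2))"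
      and "\<And>F1 F2. Sol c1 c2 a1 a2 (2 * om 2) (2 * th 2) F1 F2"
      and "\<And>F1 F2. Sol c1 c2 a1 a2 (om 1 + om 2) (th 1 + th 2) F1 F2"
      and "Sol c1 c2 a1 a2 (om 2 - om 1) (th 2 - th 1)
        (N1 (v 1 2) (w 1 2) (cis (- th 1)) (cis (th 2)) (\<lambda>c. cnj (?R 1 c)) (?R 2) - \<i> * of_real (om 1) * ?R 1 1 * K1)
        (N2 (v 2 2) (w 2 2) (cis (th 1)) (cis (- th 2)) (\<lambda>c. cnj (?R 1 c)) (?R 2) - \<i> * of_real (om 1) * ?R 1 2 * K1)"
      and "K1 \<noteq> 0 \<or> K2 \<noteq> 0 \<Longrightarrow> om 2 = 2 * om 1 \<and> (\<exists>k::int. th 2 = 2 * th 1 + 2 * pi * of_int k)"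
      and "\<And>t y. t \<in> {0..\<tau>0} \<Longrightarrow> At 1 (?k 1) t y = of_real (?g 1) * Ay 1 (?k 1) t y + K1 * cnj (A 1 (?k 1) t y) * A 2 (?k 2) t y"
      and "\<And>t y. t \<in> {0..\<tau>0} \<Longrightarrow> At 2 (?k 2) t y = of_real (?g 2) * Ay 2 (?k 2) t y + K2 * (A 1 (?k 1) t y)\<^sup>2"
    for K1 K2
    by (rule modulation_of_modes[where K=K, OF tau0];
        rule kernel(1)[OF m] kernel(2)[OF m] transport_solvable[OF m] that S00 bd byy h4; assumption)
  show ?thesis using cases
  proof
    assume NR: "NR_case v w om th \<tau>0 A At Ay"
    then have dets: "det (Hmat v w (2 * om 1) (2 * th 1)) \<noteq> 0" "det (Hmat v w (2 * om 2) (2 * th 2)) \<noteq> 0"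
      "det (Hmat v w (om 1 + om 2) (th 1 + th 2)) \<noteq> 0" "det (Hmat v w (om 1 - om 2) (th 1 - th 2)) \<noteq> 0"
      unfolding NR_case_def by auto
    \<comment> \<open>The determinant is even in frequency and in wave number, so the order of the
      difference is immaterial.\<close>
    have "det (Hmat v w (om 2 - om 1) (th 2 - th 1)) \<noteq> 0"
    proof -
      have "(om 2 - om 1)\<^sup>2 = (om 1 - om 2)\<^sup>2" by (rule power2_commute)
      moreover have "cos (th 2 - th 1) = cos (th 1 - th 2)" by (metis cos_minus minus_diff_eq)
      ultimately show ?thesis using dets(4) unfolding det_Hmat by simp
    qed
    note S = Sol_of_det[OF dets(1)] Sol_of_det[OF dets(2)] Sol_of_det[OF dets(3)] Sol_of_det[OF this]
    have nr: "((th n \<noteq> pi \<and> th n \<noteq> - pi) \<longrightarrow>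
            A n 2 \<tau> y = - rho v w (om n) (th n) * A n 1 \<tau> y \<and>
            (om n = om_plus v w (th n) \<longrightarrow>
               At n 1 \<tau> y - of_real (deriv (om_plus v w) (th n)) * Ay n 1 \<tau> y = 0) \<and>
            (om n = om_minus v w (th n) \<longrightarrow>
               At n 1 \<tau> y - of_real (deriv (om_minus v w) (th n)) * Ay n 1 \<tau> y = 0)) \<and>
        ((th n = pi \<or> th n = - pi) \<and> (om n)\<^sup>2 = cc v w 1 \<longrightarrow> A n 2 \<tau> y = 0 \<and> At n 1 \<tau> y = 0) \<and>
        ((th n = pi \<or> th n = - pi) \<and> (om n)\<^sup>2 = cc v w 2 \<longrightarrow> A n 1 \<tau> y = 0 \<and> At n 2 \<tau> y = 0)"
      if "n \<in> {1,2}" "\<tau> \<in> {0..\<tau>0}" for n \<tau> y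
      using NR that unfolding NR_case_def by blast
    have both: "At n (?k n) \<tau> y = of_real (?g n) * Ay n (?k n) \<tau> y
        \<and> (\<forall>c\<in>{1,2}. A n c \<tau> y = ?R n c * A n (?k n) \<tau> y)" if n: "n \<in> {1,2}" and t: "\<tau> \<in> {0..\<tau>0}" for n \<tau> y
    proof (cases "th n = pi")
      case True
      have g: "?g n = 0" by (simp add: True gv_def)
      have "(om n)\<^sup>2 = c1 \<or> (om n)\<^sup>2 = c2" using edge_mode m[OF n] True by simp
      then show ?thesis
      proof
        assume "(om n)\<^sup>2 = c1"
        with nr[OF n t, of y] True g show ?thesis by (simp add: k0_def Rv_def)
      next
        assume "(om n)\<^sup>2 = c2"
        with nr[OF n t, of y] True g c12 show ?thesis by (simp add: k0_def Rv_def)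
      qed
    next
      case False
      have "th n \<noteq> - pi" using m[OF n] by (auto simp: is_mode_def)
      with False nr[OF n t, of y] om_cases[OF m[OF n]] deriv_om_plus[OF m[OF n]] deriv_om_minus[OF m[OF n]]
      show ?thesis by (auto simp: k0_def Rv_def)
    qed
    have "\<exists>s X. modulation signed_modes (lamS om) (eS th) (eiS th) (\<lambda>i. of_real (gv (om (idx i)) (th (idx i)))) (rS ?R) s
     (kapS 0 0) X (ES om th) (bS (\<lambda>n. A n (?k n))) (bS (\<lambda>n. At n (?k n))) (bS (\<lambda>n. Ay n (?k n))) \<tau>0
     (of_real c1) (of_real c2) (of_real a1) (of_real a2)
     (of_real (v 1 2)) (of_real (v 2 2)) (of_real (w 1 2)) (of_real (w 2 2))"
      by (rule mod[OF S]) (use both in auto)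
    then show ?thesis using both by blast
  next
    assume R: "R_case v w om th \<tau>0 A At Ay"
    obtain l :: int where o1: "om 1 = om_minus v w (th 1)" and th2: "th 2 = 2 * th 1 + 2 * pi * of_int l"
      and o2: "om 2 = om_plus v w (th 2)" and oo: "om 2 = 2 * om 1"
      and d3: "det (Hmat v w (real 3 * om 1) (real 3 * th 1)) \<noteq> 0"
      and d4: "det (Hmat v w (real 4 * om 1) (real 4 * th 1)) \<noteq> 0"
      using R unfolding R_case_def by auto
    \<comment> \<open>Mode 2 with itself is the fourth harmonic of mode 1; modes 1 and 2 together,
      treated next, are the third.\<close>
    have S22: "Sol c1 c2 a1 a2 (2 * om 2) (2 * th 2) F1 F2" for F1 F2
    proof -
      have eq: "2 * om 2 = real 4 * om 1" "2 * th 2 = real 4 * th 1 + 2 * pi * of_int (2 * l)" by (simp_all add: oo th2)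
      show ?thesis unfolding eq Sol_shift by (rule Sol_of_det[OF d4])
    qed
    have S12: "Sol c1 c2 a1 a2 (om 1 + om 2) (th 1 + th 2) F1 F2" for F1 F2
    proof -
      have eq: "om 1 + om 2 = real 3 * om 1" "th 1 + th 2 = real 3 * th 1 + 2 * pi * of_int l" by (simp_all add: oo th2)
      show ?thesis unfolding eq Sol_shift by (rule Sol_of_det[OF d3])
    qed
    have sh21: "Sol c1 c2 a1 a2 (om 2 - om 1) (th 2 - th 1) F1 F2 = Sol c1 c2 a1 a2 (om 1) (th 1) F1 F2" for F1 F2
    proof -
      have eq: "om 2 - om 1 = om 1" "th 2 - th 1 = th 1 + 2 * pi * of_int l" by (simp_all add: oo th2)
      show ?thesis unfolding eq Sol_shift ..
    qed
    have sh11: "Sol c1 c2 a1 a2 (2 * om 1) (2 * th 1) F1 F2 = Sol c1 c2 a1 a2 (om 2) (th 2) F1 F2" for F1 F2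
      unfolding th2 Sol_shift oo ..
    have res: "om 2 = 2 * om 1 \<and> (\<exists>k::int. th 2 = 2 * th 1 + 2 * pi * of_int k)" using oo th2 by blast
    let ?q1 = "of_real (((om 1)\<^sup>2 - c2) / (2 * (om 1)\<^sup>2 - c1 - c2)) :: complex"
    let ?q2 = "of_real (((om 2)\<^sup>2 - c2) / (2 * (om 2)\<^sup>2 - c1 - c2)) :: complex"
    have G1: "\<i> * of_real (om 1) * r * (d / (\<i> * of_real (om 1)) * q) = (d * q) * r" for d q r :: complex
      using om0 by simp
    have G2: "2 * (\<i> * of_real (om 2) * r * (d / (2 * \<i> * of_real (om 2)) * q)) = (d * q) * r" for d q r :: complex
      using om0 by simp
    \<comment> \<open>On the upper branch 2 \<omega>^2 - c1 - c2 is positive, whereas \<omega>^2 =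
      c1 would make it c1 - c2 < 0. So an edge mode 2 has the kernel vector (0, 1).\<close>
    have o2c1: "(om 2)\<^sup>2 \<noteq> c1"
    proof
      assume "(om 2)\<^sup>2 = c1"
      with om_plus_sq[OF m2 o2] have "c1 - c2 = sqrt ((c1 - c2)\<^sup>2 + 8 * a1 * a2 * (cos (th 2) + 1))" by simp
      moreover have "sqrt ((c1 - c2)\<^sup>2 + 8 * a1 * a2 * (cos (th 2) + 1)) > 0" using disc_pos by simp
      ultimately show False using c12 by simp
    qed
    consider (1) "th 1 \<notin> {pi/2, -pi/2, pi, -pi}" | (2) "th 1 = pi/2 \<or> th 1 = -pi/2" | (3) "th 1 = pi"
      using th_range by auto
    then show ?thesis
    proof cases
      case 1
      have e: "A 1 2 \<tau> y = - rho v w (om 1) (th 1) * A 1 1 \<tau> y" "A 2 2 \<tau> y = - rho v w (om 2) (th 2) * A 2 1 \<tau> y"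
          "At 1 1 \<tau> y - of_real (deriv (om_minus v w) (th 1)) * Ay 1 1 \<tau> y
            = d1coef v w om th / (\<i> * of_real (om 1)) * ?q1 * cnj (A 1 1 \<tau> y) * A 2 1 \<tau> y"
          "At 2 1 \<tau> y - of_real (deriv (om_plus v w) (th 2)) * Ay 2 1 \<tau> y
            = d2coef v w om th / (2 * \<i> * of_real (om 2)) * ?q2 * (A 1 1 \<tau> y)\<^sup>2" if "\<tau> \<in> {0..\<tau>0}" for \<tau> y
        using R 1 that unfolding R_case_def Let_def by blast+
      have t1: "th 1 \<noteq> pi" using 1 by blast
      \<comment> \<open>\<theta>2 = pi would make 2 \<theta>1 - pi or 2 \<theta>1 + pi, whichever
        lies in (-pi, pi], a multiple of 2 pi, hence 0, and \<theta>1 would be pi/2 or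
        -pi/2.\<close>
      have t2: "th 2 \<noteq> pi"
      proof
        assume p: "th 2 = pi"
        show False
        proof (cases "th 1 > 0")
          case True
          have "2 * th 1 - pi = 0" by (rule angle_unique[of _ _ "- l"]) (use True th_range th2 p in auto)
          then show False using 1 by auto
        next
          case False
          have "2 * th 1 + pi = 0" by (rule angle_unique[of _ _ "1 - l"]) (use False th_range th2 p in \<open>auto simp: algebra_simps\<close>)
          then show False using 1 by auto
        qed
      qed
      have kk: "?k 1 = 1" "?k 2 = 1" using t1 t2 by (simp_all add: k0_def)
      have alg: "\<forall>n\<in>{1,2}. \<forall>c\<in>{1,2}. \<forall>\<tau>\<in>{0..\<tau>0}. \<forall>y. A n c \<tau> y = ?R n c * A n (?k n) \<tau> y"
        using e(1,2) by (auto simp: kk Rv_interior[OF t1] Rv_interior[OF t2] simp del: One_nat_def)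
      have "\<exists>s X. modulation signed_modes (lamS om) (eS th) (eiS th) (\<lambda>i. of_real (gv (om (idx i)) (th (idx i)))) (rS ?R) s
       (kapS (d1coef v w om th / (\<i> * of_real (om 1)) * ?q1) (d2coef v w om th / (2 * \<i> * of_real (om 2)) * ?q2)) X (ES om th) (bS (\<lambda>n. A n (?k n))) (bS (\<lambda>n. At n (?k n))) (bS (\<lambda>n. Ay n (?k n))) \<tau>0
       (of_real c1) (of_real c2) (of_real a1) (of_real a2)
       (of_real (v 1 2)) (of_real (v 2 2)) (of_real (w 1 2)) (of_real (w 2 2))"
      proof (rule mod[OF _ S22 S12 _ res])
        show "Sol c1 c2 a1 a2 (2 * om 1) (2 * th 1)
          (N1 (v 1 2) (w 1 2) (cis (th 1)) (cis (th 1)) (?R 1) (?R 1) - 2 * (\<i> * of_real (om 2) * ?R 2 1 * (d2coef v w om th / (2 * \<i> * of_real (om 2)) * ?q2)))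
          (N2 (v 2 2) (w 2 2) (cis (- th 1)) (cis (- th 1)) (?R 1) (?R 1) - 2 * (\<i> * of_real (om 2) * ?R 2 2 * (d2coef v w om th / (2 * \<i> * of_real (om 2)) * ?q2)))"
          unfolding sh11 G2 by (rule forced_solvable_mode[OF m2 t2 d2coef_eq[OF m1 t1 m2 t2 th2] refl])
        show "Sol c1 c2 a1 a2 (om 2 - om 1) (th 2 - th 1)
          (N1 (v 1 2) (w 1 2) (cis (- th 1)) (cis (th 2)) (\<lambda>c. cnj (?R 1 c)) (?R 2) - \<i> * of_real (om 1) * ?R 1 1 * (d1coef v w om th / (\<i> * of_real (om 1)) * ?q1))
          (N2 (v 2 2) (w 2 2) (cis (th 1)) (cis (- th 2)) (\<lambda>c. cnj (?R 1 c)) (?R 2) - \<i> * of_real (om 1) * ?R 1 2 * (d1coef v w om th / (\<i> * of_real (om 1)) * ?q1))"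
          unfolding sh21 G1 by (rule forced_solvable_mode[OF m1 t1 d1coef_eq[OF m1 t1 m2 t2 th2] refl])
        fix t y assume t: "t \<in> {0..\<tau>0}"
        show "At 1 (?k 1) t y = of_real (?g 1) * Ay 1 (?k 1) t y + d1coef v w om th / (\<i> * of_real (om 1)) * ?q1 * cnj (A 1 (?k 1) t y) * A 2 (?k 2) t y"
          using e(3)[OF t, of y] unfolding kk deriv_om_minus[OF m1 o1] by (simp only: diff_eq_eq add.commute)
        show "At 2 (?k 2) t y = of_real (?g 2) * Ay 2 (?k 2) t y + d2coef v w om th / (2 * \<i> * of_real (om 2)) * ?q2 * (A 1 (?k 1) t y)\<^sup>2"
          using e(4)[OF t, of y] unfolding kk deriv_om_plus[OF m2 o2] by (simp only: diff_eq_eq add.commute)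
      qed
      with alg show ?thesis by blast
    next
      case 2
      define s where "s = (if th 1 = pi/2 then 1 else -1 :: real)"
      have s: "s = 1 \<or> s = -1" "th 1 = s * (pi / 2)" using 2 by (auto simp: s_def)
      have e: "A 1 2 \<tau> y = - rho v w (om 1) (th 1) * A 1 1 \<tau> y" "A 2 1 \<tau> y = 0"
          "At 1 1 \<tau> y - of_real (deriv (om_minus v w) (th 1)) * Ay 1 1 \<tau> y
            = d1tilde v w om th s / (\<i> * of_real (om 1)) * ?q1 * cnj (A 1 1 \<tau> y) * A 2 2 \<tau> y"
          "At 2 2 \<tau> y = 1 / (2 * \<i> * of_real (om 2))
              * (2 * of_real (v 2 2) * (1 + rho v w (om 1) (th 1) * (1 + of_real s * \<i>)) - of_real (w 2 2) * (rho v w (om 1) (th 1))\<^sup>2)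
              * (A 1 1 \<tau> y)\<^sup>2" if "\<tau> \<in> {0..\<tau>0}" for \<tau> y
        using R 2 that unfolding R_case_def Let_def s_def[symmetric] by blast+
      have t1: "th 1 \<noteq> pi" using s by auto
      have t2: "th 2 = pi"
      proof (cases "th 1 = pi / 2")
        case True
        show ?thesis 
        proof (rule angle_unique)
          show "th 2 = pi + 2 * pi * of_int l" unfolding th2 True by simp
        qed (use th_range in auto)
      next
        case False
        then have "th 1 = - pi / 2" using 2 by simp
        show ?thesis
        proof (rule angle_unique)
          show "th 2 = pi + 2 * pi * of_int (l - 1)" unfolding th2 \<open>th 1 = - pi / 2\<close> by (simp add: algebra_simps)
        qed (use th_range in auto)
      qed
      have o2c: "(om 2)\<^sup>2 = c2" using om_plus_pi[of "om 2"] m2 o2 unfolding t2 by blast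
      have kk: "?k 1 = 1" "?k 2 = 2" using t1 t2 o2c1 by (simp_all add: k0_def)
      have g2: "?g 2 = 0" by (simp add: gv_def t2)
      have R2: "?R 2 1 = 0" "?R 2 2 = 1" using o2c1 by (simp_all add: Rv_def t2)
      have alg: "\<forall>n\<in>{1,2}. \<forall>c\<in>{1,2}. \<forall>\<tau>\<in>{0..\<tau>0}. \<forall>y. A n c \<tau> y = ?R n c * A n (?k n) \<tau> y"
        using e(1,2) by (auto simp: kk Rv_interior[OF t1] R2 simp del: One_nat_def)
      define K2 where "K2 = 1 / (2 * \<i> * of_real (om 2))
              * (2 * of_real (v 2 2) * (1 + rho v w (om 1) (th 1) * (1 + of_real s * \<i>)) - of_real (w 2 2) * (rho v w (om 1) (th 1))\<^sup>2)"
      \<comment> \<open>For the edge mode the projection is just the second component, so K2 has to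
        cancel \<open>N2\<close> directly and no quotient of frequencies appears.\<close>
      have K2: "2 * (\<i> * of_real (om 2) * 1 * K2) = 2 * of_real (v 2 2) * (1 + rho v w (om 1) (th 1) * (1 + of_real s * \<i>)) - of_real (w 2 2) * (rho v w (om 1) (th 1))\<^sup>2"
        unfolding K2_def using om0 by simp
      have y: "cis (- th 1) = - (of_real s * \<i>)" unfolding s(2) using s(1) by (auto simp: complex_eq_iff)
      have "\<exists>s' X. modulation signed_modes (lamS om) (eS th) (eiS th) (\<lambda>i. of_real (gv (om (idx i)) (th (idx i)))) (rS ?R) s'
       (kapS (d1tilde v w om th s / (\<i> * of_real (om 1)) * ?q1) K2) X (ES om th) (bS (\<lambda>n. A n (?k n))) (bS (\<lambda>n. At n (?k n))) (bS (\<lambda>n. Ay n (?k n))) \<tau>0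
       (of_real c1) (of_real c2) (of_real a1) (of_real a2)
       (of_real (v 1 2)) (of_real (v 2 2)) (of_real (w 1 2)) (of_real (w 2 2))"
      proof (rule mod[OF _ S22 S12 _ res])
        show "Sol c1 c2 a1 a2 (2 * om 1) (2 * th 1)
          (N1 (v 1 2) (w 1 2) (cis (th 1)) (cis (th 1)) (?R 1) (?R 1) - 2 * (\<i> * of_real (om 2) * ?R 2 1 * K2))
          (N2 (v 2 2) (w 2 2) (cis (- th 1)) (cis (- th 1)) (?R 1) (?R 1) - 2 * (\<i> * of_real (om 2) * ?R 2 2 * K2))"
          unfolding sh11
        proof (rule Sol_edge2)
          show "cis (th 2) = -1" by (simp add: t2)
          show "c1 \<noteq> c2" using c12 by simp
          define \<rho> where "\<rho> = rho v w (om 1) (th 1)"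
          define j where "j = of_real s * \<i>"
          have "j * j = -1" using s(1) by (auto simp: j_def)
          then show "N2 (v 2 2) (w 2 2) (cis (- th 1)) (cis (- th 1)) (?R 1) (?R 1) - 2 * (\<i> * of_real (om 2) * ?R 2 2 * K2) = 0"
            unfolding R2 K2 N2_def Rv_interior[OF t1] y \<rho>_def[symmetric] j_def[symmetric]
            by (simp add: algebra_simps power2_eq_square)
        qed (rule o2c)
        show "Sol c1 c2 a1 a2 (om 2 - om 1) (th 2 - th 1)
          (N1 (v 1 2) (w 1 2) (cis (- th 1)) (cis (th 2)) (\<lambda>c. cnj (?R 1 c)) (?R 2) - \<i> * of_real (om 1) * ?R 1 1 * (d1tilde v w om th s / (\<i> * of_real (om 1)) * ?q1))
          (N2 (v 2 2) (w 2 2) (cis (th 1)) (cis (- th 2)) (\<lambda>c. cnj (?R 1 c)) (?R 2) - \<i> * of_real (om 1) * ?R 1 2 * (d1tilde v w om th s / (\<i> * of_real (om 1)) * ?q1))"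
          unfolding sh21 G1 by (rule forced_solvable_mode[OF m1 t1 d1tilde_eq[OF m1 s t2 o2c1] refl])
        fix t y assume t: "t \<in> {0..\<tau>0}"
        show "At 1 (?k 1) t y = of_real (?g 1) * Ay 1 (?k 1) t y + d1tilde v w om th s / (\<i> * of_real (om 1)) * ?q1 * cnj (A 1 (?k 1) t y) * A 2 (?k 2) t y"
          using e(3)[OF t, of y] unfolding kk deriv_om_minus[OF m1 o1] by (simp only: diff_eq_eq add.commute)
        show "At 2 (?k 2) t y = of_real (?g 2) * Ay 2 (?k 2) t y + K2 * (A 1 (?k 1) t y)\<^sup>2"
          using e(4)[OF t, of y] unfolding kk g2 K2_def by simp
      qed
      with alg show ?thesis by blast
    next
      case 3
      have e: "A 1 2 \<tau> y = 0" "A 2 2 \<tau> y = - rho v w (om 2) (th 2) * A 2 1 \<tau> y"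
          "At 1 1 \<tau> y = - of_real (w 1 2) / (\<i> * of_real (om 1)) * ?q1 * cnj (A 1 1 \<tau> y) * A 2 1 \<tau> y"
          "At 2 1 \<tau> y = - of_real (w 1 2) / (2 * \<i> * of_real (om 2)) * ?q2 * (A 1 1 \<tau> y)\<^sup>2" if "\<tau> \<in> {0..\<tau>0}" for \<tau> y
        using R 3 that unfolding R_case_def Let_def by blast+
      have t2: "th 2 = 0"
      proof (rule angle_unique)
        show "th 2 = 0 + 2 * pi * of_int (l + 1)" unfolding th2 3 by (simp add: algebra_simps)
      qed (use th_range in auto)
      have t2': "th 2 \<noteq> pi" by (simp add: t2)
      have o1c: "(om 1)\<^sup>2 = c1" using om_minus_pi[of "om 1"] m1 o1 unfolding 3 by blast
      have kk: "?k 1 = 1" "?k 2 = 1" unfolding k0_def t2 o1c by simp_all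
      have g: "?g 1 = 0" "?g 2 = 0" unfolding gv_def t2 3 by simp_all
      have R1: "?R 1 1 = 1" "?R 1 2 = 0" unfolding Rv_def 3 using o1c by simp_all
      have alg: "\<forall>n\<in>{1,2}. \<forall>c\<in>{1,2}. \<forall>\<tau>\<in>{0..\<tau>0}. \<forall>y. A n c \<tau> y = ?R n c * A n (?k n) \<tau> y"
        using e(1,2) by (auto simp: kk Rv_interior[OF t2'] R1 simp del: One_nat_def)
      \<comment> \<open>With \<omega>1^2 = c1 numerator and denominator coincide.\<close>
      have q1: "?q1 = 1" unfolding o1c using c12 by simp
      have "\<exists>s X. modulation signed_modes (lamS om) (eS th) (eiS th) (\<lambda>i. of_real (gv (om (idx i)) (th (idx i)))) (rS ?R) s
       (kapS (- of_real (w 1 2) / (\<i> * of_real (om 1)) * ?q1) (- of_real (w 1 2) / (2 * \<i> * of_real (om 2)) * ?q2)) X (ES om th) (bS (\<lambda>n. A n (?k n))) (bS (\<lambda>n. At n (?k n))) (bS (\<lambda>n. Ay n (?k n))) \<tau>0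
       (of_real c1) (of_real c2) (of_real a1) (of_real a2)
       (of_real (v 1 2)) (of_real (v 2 2)) (of_real (w 1 2)) (of_real (w 2 2))"
      proof (rule mod[OF _ S22 S12 _ res])
        show "Sol c1 c2 a1 a2 (2 * om 1) (2 * th 1)
          (N1 (v 1 2) (w 1 2) (cis (th 1)) (cis (th 1)) (?R 1) (?R 1) - 2 * (\<i> * of_real (om 2) * ?R 2 1 * (- of_real (w 1 2) / (2 * \<i> * of_real (om 2)) * ?q2)))
          (N2 (v 2 2) (w 2 2) (cis (- th 1)) (cis (- th 1)) (?R 1) (?R 1) - 2 * (\<i> * of_real (om 2) * ?R 2 2 * (- of_real (w 1 2) / (2 * \<i> * of_real (om 2)) * ?q2)))"
          unfolding sh11 G2
        \<comment> \<open>Mode 1 has wave number pi and even sites at rest, so at each site the left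
          and right strains have equal squares. The spring parts of \<open>N1\<close> and
          \<open>N2\<close> cancel, and only the on-site coefficient w12 survives.\<close>
        proof (rule forced_solvable_mode[OF m2 t2' _ refl])
          show "of_real ((om 2)\<^sup>2 - c2) * - of_real (w 1 2) = of_real ((om 2)\<^sup>2 - c2) * N1 (v 1 2) (w 1 2) (cis (th 1)) (cis (th 1)) (?R 1) (?R 1)
            - of_real a1 * (cis (th 2) + 1) * N2 (v 2 2) (w 2 2) (cis (- th 1)) (cis (- th 1)) (?R 1) (?R 1)"
            unfolding N1_def N2_def R1 unfolding 3 cis_pi cis_minus_pi by simp
        qed
        show "Sol c1 c2 a1 a2 (om 2 - om 1) (th 2 - th 1)
          (N1 (v 1 2) (w 1 2) (cis (- th 1)) (cis (th 2)) (\<lambda>c. cnj (?R 1 c)) (?R 2) - \<i> * of_real (om 1) * ?R 1 1 * (- of_real (w 1 2) / (\<i> * of_real (om 1)) * ?q1))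
          (N2 (v 2 2) (w 2 2) (cis (th 1)) (cis (- th 2)) (\<lambda>c. cnj (?R 1 c)) (?R 2) - \<i> * of_real (om 1) * ?R 1 2 * (- of_real (w 1 2) / (\<i> * of_real (om 1)) * ?q1))"
          unfolding sh21 G1
        \<comment> \<open>Again the spring part of \<open>N1\<close> cancels: from one spring to the
          next both the strain of mode 1 and that of mode 2 change sign, so the products agree. K1
          cancels the remaining on-site term.\<close>
        proof (rule Sol_edge1)
          show "cis (th 1) = -1" unfolding 3 by simp
          show "c1 \<noteq> c2" using c12 by simp
          show "N1 (v 1 2) (w 1 2) (cis (- th 1)) (cis (th 2)) (\<lambda>c. cnj (?R 1 c)) (?R 2) - - of_real (w 1 2) * ?q1 * ?R 1 1 = 0"
            unfolding q1 N1_def R1 Rv_interior[OF t2'] unfolding 3 cis_minus_pi t2 cis_zero by simp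
        qed (rule o1c)
        fix t y assume t: "t \<in> {0..\<tau>0}"
        show "At 1 (?k 1) t y = of_real (?g 1) * Ay 1 (?k 1) t y + - of_real (w 1 2) / (\<i> * of_real (om 1)) * ?q1 * cnj (A 1 (?k 1) t y) * A 2 (?k 2) t y"
          using e(3)[OF t, of y] unfolding kk g by (simp only: of_real_0 mult_zero_left add_0)
        show "At 2 (?k 2) t y = of_real (?g 2) * Ay 2 (?k 2) t y + - of_real (w 1 2) / (2 * \<i> * of_real (om 2)) * ?q2 * (A 1 (?k 1) t y)\<^sup>2"
          using e(4)[OF t, of y] unfolding kk g by (simp only: of_real_0 mult_zero_left add_0)
      qed
      with alg show ?thesis by blast
    qed
  qed
qed

end

section \<open>Nonlinear error estimate\<close>

text \<open>The Landau hypothesis constrains V' only near but not at 0. Continuity yields V'(0) = 0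
  and the difference quotient V''(0) = \<alpha>. The Lipschitz-type bound then comes from the mean
  value theorem, as V'' differs from \<alpha> by at most a multiple of |x|.\<close>

lemma derivative_expansion:
  fixes V :: "real \<Rightarrow> real" and \<alpha> \<beta> :: real
  assumes V: "Ck 4 V" and O: "(\<lambda>x. deriv V x - \<alpha> * x - \<beta> * x^2) \<in> O[at 0](\<lambda>x. \<bar>x\<bar>^3)"
  shows "\<exists>\<eta> C. 0 < \<eta> \<and> 0 \<le> C \<and>
    (\<forall>a b. \<bar>a\<bar> \<le> \<eta> \<longrightarrow> \<bar>b\<bar> \<le> \<eta> \<longrightarrow> \<bar>(deriv V a - \<alpha> * a) - (deriv V b - \<alpha> * b)\<bar> \<le> C * (\<bar>a\<bar> + \<bar>b\<bar>) * \<bar>a - b\<bar>) \<and>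
    (\<forall>x. \<bar>x\<bar> \<le> \<eta> \<longrightarrow> \<bar>deriv V x - \<alpha> * x - \<beta> * x\<^sup>2\<bar> \<le> C * \<bar>x\<bar> ^ 3)"
proof -
  define g where "g = deriv V"
  have dg: "(g has_real_derivative deriv g x) (at x)" for x
    using V[unfolded Ck_def, THEN conjunct1, rule_format, of 1 x]
    by (simp add: g_def DERIV_deriv_iff_real_differentiable)
  have ddg: "(deriv g has_real_derivative deriv (deriv g) x) (at x)" for x
    using V[unfolded Ck_def, THEN conjunct1, rule_format, of 2 x]
    by (simp add: g_def DERIV_deriv_iff_real_differentiable numeral_2_eq_2)
  define f where "f x = g x - \<alpha> * x - \<beta> * x\<^sup>2" for x
  obtain c d where c: "c > 0" and d: "d > 0" and fb: "\<And>x. x \<noteq> 0 \<Longrightarrow> \<bar>x\<bar> < d \<Longrightarrow> \<bar>f x\<bar> \<le> c * \<bar>x\<bar> ^ 3"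
  proof -
    from landau_o.bigE[OF O] obtain c where "c > 0" and ev: "\<forall>\<^sub>F x in at 0. norm (f x) \<le> c * norm (\<bar>x\<bar> ^ 3)"
      unfolding f_def g_def by blast
    from ev[unfolded eventually_at] obtain d where "d > 0" and *: "\<forall>x\<in>UNIV. x \<noteq> 0 \<and> dist x 0 < d \<longrightarrow> norm (f x) \<le> c * norm (\<bar>x\<bar> ^ 3)" by blast
    show ?thesis by (rule that[OF \<open>c > 0\<close> \<open>d > 0\<close>]) (use * in simp)
  qed
  have df: "(f has_real_derivative deriv g x - \<alpha> - 2 * \<beta> * x) (at x)" for x
    unfolding f_def by (auto intro!: derivative_eq_intros dg)
  have ev: "\<forall>\<^sub>F x in at 0. x \<noteq> 0 \<and> \<bar>x\<bar> < d"
    unfolding eventually_at using d by (intro exI[of _ d]) auto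
  have "f \<midarrow>0\<rightarrow> f 0" using DERIV_isCont[OF df] by (simp add: isCont_def)
  moreover have "f \<midarrow>0\<rightarrow> 0"
  proof (rule Lim_null_comparison)
    show "\<forall>\<^sub>F x in at 0. norm (f x) \<le> c * \<bar>x\<bar> ^ 3" using ev by eventually_elim (use fb in simp)
    show "((\<lambda>x. c * \<bar>x\<bar> ^ 3) \<longlongrightarrow> 0) (at 0)" by (auto intro!: tendsto_eq_intros)
  qed
  \<comment> \<open>The filter \<open>at 0\<close> omits the point 0 itself, so this value has to be
    recovered as a limit.\<close>
  ultimately have f0: "f 0 = 0" by (rule LIM_unique)
  have "(\<lambda>x. f x / x) \<midarrow>0\<rightarrow> deriv g 0 - \<alpha>" using df[of 0] by (simp add: DERIV_def f0)
  moreover have "(\<lambda>x. f x / x) \<midarrow>0\<rightarrow> 0"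
  proof (rule Lim_null_comparison)
    show "\<forall>\<^sub>F x in at 0. norm (f x / x) \<le> c * \<bar>x\<bar> ^ 2" using ev
    proof eventually_elim
      case (elim x)
      then show ?case using fb[of x] by (simp add: field_simps power3_eq_cube power2_eq_square)
    qed
    show "((\<lambda>x. c * \<bar>x\<bar> ^ 2) \<longlongrightarrow> 0) (at 0)" by (auto intro!: tendsto_eq_intros)
  qed
  ultimately have "deriv g 0 - \<alpha> = 0" by (rule LIM_unique)
  then have g0: "deriv g 0 = \<alpha>" by simp
  \<comment> \<open>Near 0 the difference quotient of V'' stays within 1 of the third derivative of
    V at 0.\<close>
  define k where "k = \<bar>deriv (deriv g) 0\<bar> + 1"
  obtain d2 where d2: "d2 > 0" and hb: "\<And>x. \<bar>x\<bar> < d2 \<Longrightarrow> \<bar>deriv g x - \<alpha>\<bar> \<le> k * \<bar>x\<bar>"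
  proof -
    have "(\<lambda>x. (deriv g x - \<alpha>) / x) \<midarrow>0\<rightarrow> deriv (deriv g) 0" using ddg[of 0] by (simp add: DERIV_def g0)
    from LIM_D[OF this, of 1] obtain d2 where "d2 > 0"
      and *: "\<And>x. x \<noteq> 0 \<Longrightarrow> \<bar>x\<bar> < d2 \<Longrightarrow> \<bar>(deriv g x - \<alpha>) / x - deriv (deriv g) 0\<bar> < 1" by auto
    show ?thesis
    proof (rule that[OF \<open>d2 > 0\<close>])
      fix x :: real assume x: "\<bar>x\<bar> < d2"
      show "\<bar>deriv g x - \<alpha>\<bar> \<le> k * \<bar>x\<bar>"
      proof (cases "x = 0")
        case False
        from *[OF False x] have "\<bar>(deriv g x - \<alpha>) / x\<bar> \<le> k" unfolding k_def by linarith
        then show ?thesis using False by (simp add: abs_divide field_simps)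
      qed (simp add: g0)
    qed
  qed
  have k: "k \<ge> 0" by (simp add: k_def)
  define \<eta> where "\<eta> = min d d2 / 2"
  have eta: "\<eta> > 0" "\<eta> < d" "\<eta> < d2" using d d2 by (auto simp: \<eta>_def)
  have dG: "((\<lambda>x. g x - \<alpha> * x) has_real_derivative deriv g x - \<alpha>) (at x)" for x
    by (auto intro!: derivative_eq_intros dg)
  have lip: "\<bar>(g a - \<alpha> * a) - (g b - \<alpha> * b)\<bar> \<le> k * (\<bar>a\<bar> + \<bar>b\<bar>) * \<bar>a - b\<bar>" if ab: "\<bar>a\<bar> \<le> \<eta>" "\<bar>b\<bar> \<le> \<eta>" "b < a" for a b
  proof -
    from MVT2[OF that(3), of "\<lambda>x. g x - \<alpha> * x" "\<lambda>x. deriv g x - \<alpha>"] dG obtain x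
      where x: "b < x" "x < a" "(g a - \<alpha> * a) - (g b - \<alpha> * b) = (a - b) * (deriv g x - \<alpha>)" by blast
    have "\<bar>x\<bar> \<le> \<bar>a\<bar> + \<bar>b\<bar>" "\<bar>x\<bar> < d2" using x ab eta by linarith+
    then have "\<bar>deriv g x - \<alpha>\<bar> \<le> k * (\<bar>a\<bar> + \<bar>b\<bar>)"
      using hb[of x] mult_left_mono[OF _ k] by (meson order_trans)
    then have "\<bar>a - b\<bar> * \<bar>deriv g x - \<alpha>\<bar> \<le> \<bar>a - b\<bar> * (k * (\<bar>a\<bar> + \<bar>b\<bar>))" by (rule mult_left_mono) simp
    then show ?thesis unfolding x(3) by (simp add: abs_mult mult_ac)
  qed
  have lip': "\<bar>(g a - \<alpha> * a) - (g b - \<alpha> * b)\<bar> \<le> k * (\<bar>a\<bar> + \<bar>b\<bar>) * \<bar>a - b\<bar>" if ab: "\<bar>a\<bar> \<le> \<eta>" "\<bar>b\<bar> \<le> \<eta>" for a b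
    using lip[OF ab] lip[OF ab(2,1)] by (cases a b rule: linorder_cases) (simp_all add: abs_minus_commute add.commute)
  show ?thesis
  proof (rule exI[of _ \<eta>], rule exI[of _ "max k c"], intro conjI allI impI)
    fix a b :: real assume "\<bar>a\<bar> \<le> \<eta>" "\<bar>b\<bar> \<le> \<eta>"
    from lip'[OF this] show "\<bar>(deriv V a - \<alpha> * a) - (deriv V b - \<alpha> * b)\<bar> \<le> max k c * (\<bar>a\<bar> + \<bar>b\<bar>) * \<bar>a - b\<bar>"
      unfolding g_def by (rule order_trans) (intro mult_right_mono; simp)
  next
    fix x :: real assume x: "\<bar>x\<bar> \<le> \<eta>"
    have "\<bar>f x\<bar> \<le> c * \<bar>x\<bar> ^ 3" using fb[of x] x eta by (cases "x = 0") (auto simp: f0)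
    also have "\<dots> \<le> max k c * \<bar>x\<bar> ^ 3" by (intro mult_right_mono) auto
    finally show "\<bar>deriv V x - \<alpha> * x - \<beta> * x\<^sup>2\<bar> \<le> max k c * \<bar>x\<bar> ^ 3" by (simp add: f_def g_def)
  qed (use eta k in auto)
qed

text \<open>Two faces of G = V' minus its linear part: on arguments of size \<epsilon> it is
  Lipschitz with constant O(\<epsilon>), which bounds the feedback of the error, and it is its
  quadratic term up to a cubic remainder, which bounds the residual.\<close>

definition expands :: "real \<Rightarrow> real \<Rightarrow> real \<Rightarrow> (real \<Rightarrow> real) \<Rightarrow> bool" where
  "expands \<eta> C \<beta> G \<longleftrightarrow> (\<forall>a b. \<bar>a\<bar> \<le> \<eta> \<longrightarrow> \<bar>b\<bar> \<le> \<eta> \<longrightarrow> \<bar>G a - G b\<bar> \<le> C * (\<bar>a\<bar> + \<bar>b\<bar>) * \<bar>a - b\<bar>) \<and>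
     (\<forall>x. \<bar>x\<bar> \<le> \<eta> \<longrightarrow> \<bar>G x - \<beta> * x\<^sup>2\<bar> \<le> C * \<bar>x\<bar> ^ 3)"

lemma expands_mono:
  assumes "expands \<eta> C \<beta> G" "\<eta>' \<le> \<eta>" "C \<le> C'" shows "expands \<eta>' C' \<beta> G"
  unfolding expands_def
proof (intro conjI allI impI)
  fix a b :: real assume "\<bar>a\<bar> \<le> \<eta>'" "\<bar>b\<bar> \<le> \<eta>'"
  then have "\<bar>G a - G b\<bar> \<le> C * (\<bar>a\<bar> + \<bar>b\<bar>) * \<bar>a - b\<bar>" using assms unfolding expands_def by auto
  also have "\<dots> \<le> C' * (\<bar>a\<bar> + \<bar>b\<bar>) * \<bar>a - b\<bar>" by (intro mult_right_mono assms) auto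
  finally show "\<bar>G a - G b\<bar> \<le> C' * (\<bar>a\<bar> + \<bar>b\<bar>) * \<bar>a - b\<bar>" .
next
  fix x :: real assume "\<bar>x\<bar> \<le> \<eta>'"
  then have "\<bar>G x - \<beta> * x\<^sup>2\<bar> \<le> C * \<bar>x\<bar> ^ 3" using assms unfolding expands_def by auto
  also have "\<dots> \<le> C' * \<bar>x\<bar> ^ 3" by (intro mult_right_mono assms) auto
  finally show "\<bar>G x - \<beta> * x\<^sup>2\<bar> \<le> C' * \<bar>x\<bar> ^ 3" .
qed

lemma derivative_expands:
  fixes V :: "real \<Rightarrow> real" and \<alpha> \<beta> :: real
  assumes "Ck 4 V" and "(\<lambda>x. deriv V x - \<alpha> * x - \<beta> * x^2) \<in> O[at 0](\<lambda>x. \<bar>x\<bar>^3)"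
  shows "\<exists>\<eta>>0. \<exists>C\<ge>0. expands \<eta> C \<beta> (\<lambda>x. deriv V x - \<alpha> * x)"
  using derivative_expansion[OF assms] unfolding expands_def by blast

text \<open>Pass from the true strain a to the profile strain P, from G(P) to its quadratic term,
  and from P to the leading strain Z. The constants are those of |a| + |P| \<le> (4 K + 2)
  \<epsilon>, P^2 \<le> 4 K^2 \<epsilon>^2 and |P + Z| \<le> 4 K \<epsilon>. In the cubic term one
  factor |P| is kept, since the bound must be summable over the sites. The 2's arise because strains
  are differences of two displacements.\<close>

lemma expands_defect:
  assumes G: "expands \<eta> C \<beta> G" and C: "0 \<le> C" and K: "0 \<le> K" and e: "0 < \<epsilon>" "\<epsilon> < 1" "2 * (K + 1) * \<epsilon> \<le> \<eta>"
    and a: "\<bar>a - P\<bar> \<le> 2 * \<epsilon>" and P: "\<bar>P\<bar> \<le> 2 * K * \<epsilon>" and Z: "\<bar>Z\<bar> \<le> 2 * K * \<epsilon>" and b: "\<bar>\<beta>\<bar> \<le> B"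
  shows "\<bar>G a - \<beta> * Z\<^sup>2\<bar> \<le> (C * (4 * K + 2) + 4 * C * K\<^sup>2 + 4 * B * K) * (\<epsilon> * \<bar>a - P\<bar> + (\<epsilon>\<^sup>2 * \<bar>P\<bar> + \<epsilon> * \<bar>P - Z\<bar>))"
proof -
  let ?M = "C * (4 * K + 2) + 4 * C * K\<^sup>2 + 4 * B * K"
  have B: "0 \<le> B" using b by linarith
  have M: "C * (4 * K + 2) \<le> ?M" "4 * C * K\<^sup>2 \<le> ?M" "4 * B * K \<le> ?M" using C K B by auto
  have Pe: "\<bar>P\<bar> \<le> \<eta>" "\<bar>a\<bar> \<le> \<eta>" using a P e by (simp_all add: algebra_simps)
  have "\<bar>a\<bar> + \<bar>P\<bar> \<le> (4 * K + 2) * \<epsilon>" using a P by (simp add: algebra_simps)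
  have "\<bar>G a - G P\<bar> \<le> C * (\<bar>a\<bar> + \<bar>P\<bar>) * \<bar>a - P\<bar>" using G Pe unfolding expands_def by blast
  also have "\<dots> \<le> C * ((4 * K + 2) * \<epsilon>) * \<bar>a - P\<bar>"
    by (intro mult_right_mono mult_left_mono C) (fact, simp)
  also have "\<dots> = (C * (4 * K + 2)) * (\<epsilon> * \<bar>a - P\<bar>)" by (simp add: mult_ac)
  also have "\<dots> \<le> ?M * (\<epsilon> * \<bar>a - P\<bar>)" using e by (intro mult_right_mono M) auto
  finally have 1: "\<bar>G a - G P\<bar> \<le> ?M * (\<epsilon> * \<bar>a - P\<bar>)" .
  have "\<bar>P\<bar>\<^sup>2 \<le> (2 * K * \<epsilon>)\<^sup>2" by (intro power_mono P) simp
  have "\<bar>G P - \<beta> * P\<^sup>2\<bar> \<le> C * \<bar>P\<bar> ^ 3" using G Pe unfolding expands_def by blast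
  also have "\<dots> = C * (\<bar>P\<bar>\<^sup>2 * \<bar>P\<bar>)" by (simp only: power3_eq_cube power2_eq_square)
  also have "\<dots> \<le> C * ((2 * K * \<epsilon>)\<^sup>2 * \<bar>P\<bar>)" by (intro mult_left_mono mult_right_mono C) (fact, simp)
  also have "\<dots> = (4 * C * K\<^sup>2) * (\<epsilon>\<^sup>2 * \<bar>P\<bar>)" by (simp add: power_mult_distrib mult_ac)
  also have "\<dots> \<le> ?M * (\<epsilon>\<^sup>2 * \<bar>P\<bar>)" by (intro mult_right_mono M) auto
  finally have 2: "\<bar>G P - \<beta> * P\<^sup>2\<bar> \<le> ?M * (\<epsilon>\<^sup>2 * \<bar>P\<bar>)" .
  have "\<beta> * P\<^sup>2 - \<beta> * Z\<^sup>2 = \<beta> * (P + Z) * (P - Z)" by (simp add: power2_eq_square algebra_simps)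
  then have "\<bar>\<beta> * P\<^sup>2 - \<beta> * Z\<^sup>2\<bar> = \<bar>\<beta>\<bar> * \<bar>P + Z\<bar> * \<bar>P - Z\<bar>" by (simp add: abs_mult)
  also have "\<dots> \<le> B * (4 * K * \<epsilon>) * \<bar>P - Z\<bar>"
    by (intro mult_right_mono mult_mono b) (use P Z B in auto)
  also have "\<dots> = (4 * B * K) * (\<epsilon> * \<bar>P - Z\<bar>)" by (simp add: mult_ac)
  also have "\<dots> \<le> ?M * (\<epsilon> * \<bar>P - Z\<bar>)" using e by (intro mult_right_mono M) auto
  finally have 3: "\<bar>\<beta> * P\<^sup>2 - \<beta> * Z\<^sup>2\<bar> \<le> ?M * (\<epsilon> * \<bar>P - Z\<bar>)" .
  have "\<bar>G a - \<beta> * Z\<^sup>2\<bar> \<le> \<bar>G a - G P\<bar> + \<bar>G P - \<beta> * P\<^sup>2\<bar> + \<bar>\<beta> * P\<^sup>2 - \<beta> * Z\<^sup>2\<bar>" by linarith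
  then show ?thesis using 1 2 3 unfolding distrib_left by linarith
qed

text \<open>Three uses of \<open>expands_defect\<close>, for the two springs and the on-site force.
  The middle site occurs in all three, hence the factor 3 in Q.\<close>

lemma force_defect:
  assumes V: "expands \<eta> C n GV" and W: "expands \<eta> C m GW" and C: "0 \<le> C" and K: "0 \<le> K"
    and e: "0 < \<epsilon>" "\<epsilon> < 1" "2 * (K + 1) * \<epsilon> \<le> \<eta>" and b: "\<bar>n\<bar> \<le> B" "\<bar>m\<bar> \<le> B"
    and R: "\<bar>x0 - P0\<bar> \<le> \<epsilon>" "\<bar>x1 - P1\<bar> \<le> \<epsilon>" "\<bar>x2 - P2\<bar> \<le> \<epsilon>"
    and P: "\<bar>P0\<bar> \<le> K * \<epsilon>" "\<bar>P1\<bar> \<le> K * \<epsilon>" "\<bar>P2\<bar> \<le> K * \<epsilon>"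
    and Z: "\<bar>Z0\<bar> \<le> K * \<epsilon>" "\<bar>Z1\<bar> \<le> K * \<epsilon>" "\<bar>Z2\<bar> \<le> K * \<epsilon>"
  defines "H \<equiv> \<lambda>p z. \<epsilon>\<^sup>2 * \<bar>p\<bar> + \<epsilon> * \<bar>p - z\<bar>"
  defines "Q \<equiv> 3 * (C * (4 * K + 2) + 4 * C * K\<^sup>2 + 4 * B * K)"
  shows "\<bar>GV (x2 - x1) - GV (x1 - x0) - GW x1 - (n * ((Z2 - Z1)\<^sup>2 - (Z1 - Z0)\<^sup>2) - m * Z1\<^sup>2)\<bar>
    \<le> Q * \<epsilon> * (\<bar>x0 - P0\<bar> + \<bar>x1 - P1\<bar> + \<bar>x2 - P2\<bar>) + Q * (H P0 Z0 + H P1 Z1 + H P2 Z2)"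
proof -
  define M where "M = C * (4 * K + 2) + 4 * C * K\<^sup>2 + 4 * B * K"
  have B: "0 \<le> B" using b by linarith
  have M: "0 \<le> M" using C K B by (simp add: M_def)
  have Ke: "0 \<le> K * \<epsilon>" using K e by simp
  have tri: "\<epsilon> * \<bar>p - q\<bar> \<le> \<epsilon> * (\<bar>p\<bar> + \<bar>q\<bar>)" "\<epsilon>\<^sup>2 * \<bar>p - q\<bar> \<le> \<epsilon>\<^sup>2 * (\<bar>p\<bar> + \<bar>q\<bar>)" for p q
    using e by (intro mult_left_mono abs_triangle_ineq4; simp)+
  have two: "\<bar>GV (y - x) - n * (Zy - Zx)\<^sup>2\<bar> \<le> M * (\<epsilon> * (\<bar>y - Py\<bar> + \<bar>x - Px\<bar>) + (H Py Zy + H Px Zx))"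
    if "\<bar>y - Py\<bar> \<le> \<epsilon>" "\<bar>x - Px\<bar> \<le> \<epsilon>" "\<bar>Py\<bar> \<le> K * \<epsilon>" "\<bar>Px\<bar> \<le> K * \<epsilon>" "\<bar>Zy\<bar> \<le> K * \<epsilon>" "\<bar>Zx\<bar> \<le> K * \<epsilon>" for x y Px Py Zx Zy
  proof -
    have "\<bar>GV (y - x) - n * (Zy - Zx)\<^sup>2\<bar> \<le> M * (\<epsilon> * \<bar>(y - x) - (Py - Px)\<bar> + (\<epsilon>\<^sup>2 * \<bar>Py - Px\<bar> + \<epsilon> * \<bar>(Py - Px) - (Zy - Zx)\<bar>))"
      unfolding M_def by (rule expands_defect[OF V C K e _ _ _ b(1)]) (use that in linarith)+
    also have "\<dots> \<le> M * (\<epsilon> * (\<bar>y - Py\<bar> + \<bar>x - Px\<bar>) + (H Py Zy + H Px Zx))"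
    proof (rule mult_left_mono[OF _ M])
      have eqs: "(y - x) - (Py - Px) = (y - Py) - (x - Px)" "(Py - Px) - (Zy - Zx) = (Py - Zy) - (Px - Zx)" by simp_all
      show "\<epsilon> * \<bar>(y - x) - (Py - Px)\<bar> + (\<epsilon>\<^sup>2 * \<bar>Py - Px\<bar> + \<epsilon> * \<bar>(Py - Px) - (Zy - Zx)\<bar>)
        \<le> \<epsilon> * (\<bar>y - Py\<bar> + \<bar>x - Px\<bar>) + (H Py Zy + H Px Zx)"
        unfolding eqs H_def
        using tri(1)[of "y - Py" "x - Px"] tri(1)[of "Py - Zy" "Px - Zx"] tri(2)[of Py Px]
        unfolding distrib_left by linarith
    qed
    finally show ?thesis .
  qed
  have w: "\<bar>GW x1 - m * Z1\<^sup>2\<bar> \<le> M * (\<epsilon> * \<bar>x1 - P1\<bar> + H P1 Z1)"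
    unfolding M_def H_def by (rule expands_defect[OF W C K e _ _ _ b(2)]) (use R P Z Ke e in linarith)+
  have Hn: "0 \<le> H p z" for p z using e by (simp add: H_def)
  have MR: "0 \<le> M * (\<epsilon> * \<bar>r\<bar>)" "0 \<le> M * H p z" for r p z using M e Hn[of p z] by auto
  have "\<bar>GV (x2 - x1) - GV (x1 - x0) - GW x1 - (n * ((Z2 - Z1)\<^sup>2 - (Z1 - Z0)\<^sup>2) - m * Z1\<^sup>2)\<bar>
    \<le> \<bar>GV (x2 - x1) - n * (Z2 - Z1)\<^sup>2\<bar> + \<bar>GV (x1 - x0) - n * (Z1 - Z0)\<^sup>2\<bar> + \<bar>GW x1 - m * Z1\<^sup>2\<bar>"
    unfolding right_diff_distrib by linarith
  also have "\<dots> \<le> M * (\<epsilon> * (\<bar>x2 - P2\<bar> + \<bar>x1 - P1\<bar>) + (H P2 Z2 + H P1 Z1)) + M * (\<epsilon> * (\<bar>x1 - P1\<bar> + \<bar>x0 - P0\<bar>) + (H P1 Z1 + H P0 Z0))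
     + M * (\<epsilon> * \<bar>x1 - P1\<bar> + H P1 Z1)"
    by (intro add_mono two w R P Z)
  also have "\<dots> \<le> (3 * M) * \<epsilon> * (\<bar>x0 - P0\<bar> + \<bar>x1 - P1\<bar> + \<bar>x2 - P2\<bar>) + (3 * M) * (H P0 Z0 + H P1 Z1 + H P2 Z2)"
    using MR(1)[of "x0 - P0"] MR(1)[of "x2 - P2"] MR(2)[of P0 Z0] MR(2)[of P2 Z2]
    unfolding distrib_left mult.assoc by linarith
  finally show ?thesis unfolding Q_def M_def .
qed

section \<open>Continuity of the error in the l2 norm\<close>

definition l2_cont :: "real \<Rightarrow> (int \<Rightarrow> real \<Rightarrow> real) \<Rightarrow> (int \<Rightarrow> real \<Rightarrow> real) \<Rightarrow> bool" where
  "l2_cont T x y \<longleftrightarrow> (\<forall>t\<in>{0..T}. (\<lambda>k. (x k t)\<^sup>2 + (y k t)\<^sup>2) summable_on UNIV) \<and>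
    (\<forall>t0\<in>{0..T}. ((\<lambda>t. \<Sum>\<^sub>\<infinity>k. (x k t - x k t0)\<^sup>2 + (y k t - y k t0)\<^sup>2) \<longlongrightarrow> 0) (at t0 within {0..T}))"

lemma sum_sq_bound: "((a::real) - b)\<^sup>2 \<le> 2 * a\<^sup>2 + 2 * b\<^sup>2"
  using sum_squares_bound[of a "- b"] by (simp add: power2_eq_square algebra_simps)

lemma sq_diff_infsum:
  fixes x y p q :: "int \<Rightarrow> real"
  assumes s: "(\<lambda>k. (x k)\<^sup>2 + (y k)\<^sup>2) summable_on UNIV" "(\<lambda>k. (p k)\<^sup>2 + (q k)\<^sup>2) summable_on UNIV"
  shows "(\<lambda>k. (x k - p k)\<^sup>2 + (y k - q k)\<^sup>2) summable_on UNIV"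
    and "(\<Sum>\<^sub>\<infinity>k. (x k - p k)\<^sup>2 + (y k - q k)\<^sup>2) \<le> 2 * (\<Sum>\<^sub>\<infinity>k. (x k)\<^sup>2 + (y k)\<^sup>2) + 2 * (\<Sum>\<^sub>\<infinity>k. (p k)\<^sup>2 + (q k)\<^sup>2)"
proof -
  have b: "(x k - p k)\<^sup>2 + (y k - q k)\<^sup>2 \<le> 2 * ((x k)\<^sup>2 + (y k)\<^sup>2) + 2 * ((p k)\<^sup>2 + (q k)\<^sup>2)" for k
    using sum_sq_bound[of "x k" "p k"] sum_sq_bound[of "y k" "q k"] unfolding distrib_left by linarith
  have s2: "(\<lambda>k. 2 * ((x k)\<^sup>2 + (y k)\<^sup>2) + 2 * ((p k)\<^sup>2 + (q k)\<^sup>2)) summable_on UNIV"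
    by (intro summable_on_add summable_on_cmult_right s)
  show S: "(\<lambda>k. (x k - p k)\<^sup>2 + (y k - q k)\<^sup>2) summable_on UNIV"
    by (rule summable_on_comparison_test[OF s2]) (use b in auto)
  have "(\<Sum>\<^sub>\<infinity>k. (x k - p k)\<^sup>2 + (y k - q k)\<^sup>2) \<le> (\<Sum>\<^sub>\<infinity>k. 2 * ((x k)\<^sup>2 + (y k)\<^sup>2) + 2 * ((p k)\<^sup>2 + (q k)\<^sup>2))"
    by (rule infsum_mono[OF S s2 b])
  also have "\<dots> = 2 * (\<Sum>\<^sub>\<infinity>k. (x k)\<^sup>2 + (y k)\<^sup>2) + 2 * (\<Sum>\<^sub>\<infinity>k. (p k)\<^sup>2 + (q k)\<^sup>2)"
    by (subst infsum_add) (intro summable_on_cmult_right s, intro summable_on_cmult_right s, simp only: infsum_cmult_right')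
  finally show "(\<Sum>\<^sub>\<infinity>k. (x k - p k)\<^sup>2 + (y k - q k)\<^sup>2) \<le> 2 * (\<Sum>\<^sub>\<infinity>k. (x k)\<^sup>2 + (y k)\<^sup>2) + 2 * (\<Sum>\<^sub>\<infinity>k. (p k)\<^sup>2 + (q k)\<^sup>2)" .
qed

lemma l2_cont_diff:
  assumes xy: "l2_cont T x y" and pq: "l2_cont T p q"
  shows "l2_cont T (\<lambda>k t. x k t - p k t) (\<lambda>k t. y k t - q k t)"
  unfolding l2_cont_def
proof (intro conjI ballI)
  note s = xy[unfolded l2_cont_def, THEN conjunct1, rule_format] pq[unfolded l2_cont_def, THEN conjunct1, rule_format]
  fix t0 assume t0: "t0 \<in> {0..T}"
  show "(\<lambda>k. (x k t0 - p k t0)\<^sup>2 + (y k t0 - q k t0)\<^sup>2) summable_on UNIV" by (intro sq_diff_infsum s t0)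
  let ?X = "\<lambda>t. \<Sum>\<^sub>\<infinity>k. (x k t - x k t0)\<^sup>2 + (y k t - y k t0)\<^sup>2"
  let ?P = "\<lambda>t. \<Sum>\<^sub>\<infinity>k. (p k t - p k t0)\<^sup>2 + (q k t - q k t0)\<^sup>2"
  show "((\<lambda>t. \<Sum>\<^sub>\<infinity>k. (x k t - p k t - (x k t0 - p k t0))\<^sup>2 + (y k t - q k t - (y k t0 - q k t0))\<^sup>2) \<longlongrightarrow> 0) (at t0 within {0..T})"
  proof (rule Lim_null_comparison[where g="\<lambda>t. 2 * ?X t + 2 * ?P t"])
    show "\<forall>\<^sub>F t in at t0 within {0..T}. norm (\<Sum>\<^sub>\<infinity>k. (x k t - p k t - (x k t0 - p k t0))\<^sup>2 + (y k t - q k t - (y k t0 - q k t0))\<^sup>2) \<le> 2 * ?X t + 2 * ?P t"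
      unfolding eventually_at_filter
    proof (intro always_eventually allI impI)
      fix t assume t: "t \<in> {0..T}"
      have e: "x k t - p k t - (x k t0 - p k t0) = (x k t - x k t0) - (p k t - p k t0)"
        "y k t - q k t - (y k t0 - q k t0) = (y k t - y k t0) - (q k t - q k t0)" for k by simp_all
      have "0 \<le> (\<Sum>\<^sub>\<infinity>k. ((x k t - x k t0) - (p k t - p k t0))\<^sup>2 + ((y k t - y k t0) - (q k t - q k t0))\<^sup>2)"
        by (rule infsum_nonneg) simp
      then show "norm (\<Sum>\<^sub>\<infinity>k. (x k t - p k t - (x k t0 - p k t0))\<^sup>2 + (y k t - q k t - (y k t0 - q k t0))\<^sup>2) \<le> 2 * ?X t + 2 * ?P t"
        unfolding e real_norm_def
        using sq_diff_infsum(2)[OF sq_diff_infsum(1)[OF s(1)[OF t] s(1)[OF t0]] sq_diff_infsum(1)[OF s(2)[OF t] s(2)[OF t0]]]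
        by linarith
    qed
    have "((\<lambda>t. 2 * ?X t + 2 * ?P t) \<longlongrightarrow> 2 * 0 + 2 * 0) (at t0 within {0..T})"
      using xy pq t0 unfolding l2_cont_def by (intro tendsto_intros) blast+
    then show "((\<lambda>t. 2 * ?X t + 2 * ?P t) \<longlongrightarrow> 0) (at t0 within {0..T})" by simp
  qed
qed

text \<open>Young's inequality, arranged so that the coefficient of b^2 is as small as desired.
  Summed over the sites this gives continuity of the squared norm without a uniform bound near
  t0.\<close>

lemma square_diff_bound: "0 < \<delta> \<Longrightarrow> \<bar>(a::real)\<^sup>2 - b\<^sup>2\<bar> \<le> (1 + 1 / \<delta>) * (a - b)\<^sup>2 + \<delta> * b\<^sup>2"
proof -
  assume d: "0 < \<delta>"
  have "2 * \<bar>b * (a - b)\<bar> \<le> (a - b)\<^sup>2 / \<delta> + \<delta> * b\<^sup>2"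
  proof -
    have "0 \<le> (\<bar>a - b\<bar> - \<delta> * \<bar>b\<bar>)\<^sup>2 / \<delta>" using d by simp
    moreover have "(p - \<delta> * q)\<^sup>2 / \<delta> = p\<^sup>2 / \<delta> - 2 * (q * p) + \<delta> * q\<^sup>2" for p q :: real
      using d by (simp add: power2_eq_square field_simps)
    ultimately show ?thesis by (simp add: abs_mult)
  qed
  moreover have "a\<^sup>2 - b\<^sup>2 = (a - b)\<^sup>2 + 2 * (b * (a - b))" by (simp add: power2_eq_square algebra_simps)
  moreover have "(1 + 1 / \<delta>) * (a - b)\<^sup>2 = (a - b)\<^sup>2 + (a - b)\<^sup>2 / \<delta>" by (simp add: distrib_right)
  ultimately show ?thesis using zero_le_power2[of "a - b"] by linarith
qed

lemma l2_cont_norm_continuous: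
  assumes xy: "l2_cont T x y"
  shows "continuous_on {0..T} (\<lambda>t. \<Sum>\<^sub>\<infinity>k. (x k t)\<^sup>2 + (y k t)\<^sup>2)"
  unfolding continuous_on_def
proof
  note s = xy[unfolded l2_cont_def, THEN conjunct1, rule_format]
  fix t0 assume t0: "t0 \<in> {0..T}"
  let ?N = "\<lambda>t. \<Sum>\<^sub>\<infinity>k. (x k t)\<^sup>2 + (y k t)\<^sup>2"
  let ?X = "\<lambda>t. \<Sum>\<^sub>\<infinity>k. (x k t - x k t0)\<^sup>2 + (y k t - y k t0)\<^sup>2"
  have N0: "0 \<le> ?N t0" by (rule infsum_nonneg) simp
  have key: "\<bar>?N t - ?N t0\<bar> \<le> (1 + 1 / \<delta>) * ?X t + \<delta> * ?N t0" if d: "0 < \<delta>" and t: "t \<in> {0..T}" for \<delta> t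
  proof -
    note sd = sq_diff_infsum(1)[OF s[OF t] s[OF t0]]
    let ?d = "\<lambda>k. ((x k t)\<^sup>2 + (y k t)\<^sup>2) - ((x k t0)\<^sup>2 + (y k t0)\<^sup>2)"
    let ?r = "\<lambda>k. (1 + 1 / \<delta>) * ((x k t - x k t0)\<^sup>2 + (y k t - y k t0)\<^sup>2) + \<delta> * ((x k t0)\<^sup>2 + (y k t0)\<^sup>2)"
    have b: "\<bar>?d k\<bar> \<le> ?r k" for k
      using square_diff_bound[OF d, of "x k t" "x k t0"] square_diff_bound[OF d, of "y k t" "y k t0"]
      unfolding distrib_left by linarith
    have sr: "?r summable_on UNIV" by (intro summable_on_add summable_on_cmult_right sd s t0)
    have sdd: "?d summable_on UNIV" using summable_on_add[OF s[OF t] summable_on_uminus[THEN iffD2, OF s[OF t0]]] by (simp only: add_uminus_conv_diff)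
    have eN: "?N t - ?N t0 = infsum ?d UNIV" 
      using infsum_add[OF s[OF t] summable_on_uminus[THEN iffD2, OF s[OF t0]]] by (simp only: infsum_uminus add_uminus_conv_diff)
    have eR: "infsum ?r UNIV = (1 + 1 / \<delta>) * ?X t + \<delta> * ?N t0"
      by (subst infsum_add) (intro summable_on_cmult_right s t0 sd, intro summable_on_cmult_right s t0 sd, simp only: infsum_cmult_right')
    have "infsum ?d UNIV \<le> infsum ?r UNIV" using b by (intro infsum_mono sdd sr) (simp add: abs_le_iff)
    have nb: "- ?d k \<le> ?r k" for k using abs_le_D2[OF b[of k]] .
    have "infsum (\<lambda>k. - ?d k) UNIV \<le> infsum ?r UNIV"
      by (rule infsum_mono[OF summable_on_uminus[THEN iffD2, OF sdd] sr nb])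
    then show ?thesis using \<open>infsum ?d UNIV \<le> infsum ?r UNIV\<close> unfolding eN eR[symmetric] by (simp add: infsum_uminus abs_le_iff del: minus_diff_eq)
  qed
  show "(?N \<longlongrightarrow> ?N t0) (at t0 within {0..T})"
  proof (rule tendstoI)
    fix e :: real assume e: "0 < e"
    define \<delta> where "\<delta> = e / (2 * (?N t0 + 1))"
    have d: "0 < \<delta>" using e N0 by (simp add: \<delta>_def)
    have dN: "\<delta> * ?N t0 \<le> e / 2"
    proof -
      have "\<delta> * ?N t0 \<le> \<delta> * (?N t0 + 1)" using d by simp
      also have "\<dots> = e / 2" using N0 by (simp add: \<delta>_def field_simps)
      finally show ?thesis .
    qed
    have "((\<lambda>t. (1 + 1 / \<delta>) * ?X t) \<longlongrightarrow> (1 + 1 / \<delta>) * 0) (at t0 within {0..T})"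
      using xy t0 unfolding l2_cont_def by (intro tendsto_mult tendsto_const) blast
    then have "\<forall>\<^sub>F t in at t0 within {0..T}. (1 + 1 / \<delta>) * ?X t < e / 2"
      using e by (intro order_tendstoD(2)[where y="(1 + 1 / \<delta>) * 0"]) auto
    then show "\<forall>\<^sub>F t in at t0 within {0..T}. dist (?N t) (?N t0) < e"
      unfolding eventually_at_filter
    proof eventually_elim
      case (elim t)
      show ?case
      proof (intro impI)
        assume t: "t \<noteq> t0" "t \<in> {0..T}"
        then show "dist (?N t) (?N t0) < e" using key[OF d t(2)] dN elim[rule_format, OF t] unfolding dist_real_def by linarith
      qed
    qed
  qed
qed

text \<open>Differentiability is known only component by component. For a finite set of sites the
  mean value theorem is applied to the scalar product of the increment u(t) - u(t0) with u(s); the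
  Lipschitz bound that results does not depend on the finite set.\<close>

lemma l2_cont_of_bounded_derivative:
  assumes B: "\<And>t F. t \<in> {0..T} \<Longrightarrow> finite F \<Longrightarrow> (\<Sum>k\<in>F. (x k t)\<^sup>2 + (y k t)\<^sup>2) \<le> B"
    and B': "\<And>t F. t \<in> {0..T} \<Longrightarrow> finite F \<Longrightarrow> (\<Sum>k\<in>F. (x' k t)\<^sup>2 + (y' k t)\<^sup>2) \<le> B'"
    and dx: "\<And>k t. t \<in> {0..T} \<Longrightarrow> (x k has_real_derivative x' k t) (at t within {0..T})"
    and dy: "\<And>k t. t \<in> {0..T} \<Longrightarrow> (y k has_real_derivative y' k t) (at t within {0..T})"
  shows "l2_cont T x y"
  unfolding l2_cont_def
proof (intro conjI ballI)
  have summ: "f summable_on UNIV" if "\<And>F. finite F \<Longrightarrow> sum f F \<le> b" "\<And>k. 0 \<le> f k" for f :: "int \<Rightarrow> real" and b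
    by (rule nonneg_bdd_above_summable_on) (use that in \<open>auto intro!: bdd_aboveI[of _ b]\<close>)
  fix t0 assume t0: "t0 \<in> {0..T}"
  show "(\<lambda>k. (x k t0)\<^sup>2 + (y k t0)\<^sup>2) summable_on UNIV" by (rule summ[OF B[OF t0]]) auto
  have lip: "(\<Sum>k\<in>F. (x k t - x k t0)\<^sup>2 + (y k t - y k t0)\<^sup>2) \<le> B' * (t - t0)\<^sup>2"
    if t: "t \<in> {0..T}" and F: "finite F" for t F
  proof -
    let ?a = "\<lambda>k. x k t - x k t0" and ?b = "\<lambda>k. y k t - y k t0"
    let ?W = "\<Sum>k\<in>F. (?a k)\<^sup>2 + (?b k)\<^sup>2"
    \<comment> \<open>Its increment from t0 to t is the squared length \<open>?W\<close> of the
      increment of (x, y).\<close>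
    let ?h = "\<lambda>s. \<Sum>k\<in>F. ?a k * x k s + ?b k * y k s"
    let ?h' = "\<lambda>s. \<Sum>k\<in>F. ?a k * x' k s + ?b k * y' k s"
    have dh: "(?h has_real_derivative ?h' s) (at s within {0..T})" if "s \<in> {0..T}" for s
      by (intro DERIV_sum DERIV_add DERIV_cmult dx dy that)
    have bd: "?h u - ?h s \<le> ?W / 2 + B' * (u - s)\<^sup>2 / 2 \<and> ?h s - ?h u \<le> ?W / 2 + B' * (u - s)\<^sup>2 / 2"
      if su: "s < u" "s \<in> {0..T}" "u \<in> {0..T}" for s u
    proof -
      have "\<exists>z\<in>{s<..<u}. ?h u - ?h s = ?h' z * (u - s)"
      proof (rule mvt_simple[OF su(1), where f="?h" and f'="\<lambda>z. (*) (?h' z)"])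
        fix z assume "s \<le> z" "z \<le> u"
        then have "z \<in> {0..T}" using su by auto
        from DERIV_subset[OF dh[OF this], of "{s..u}"] su
        show "(?h has_derivative (*) (?h' z)) (at z within {s..u})" unfolding has_field_derivative_def by auto
      qed
      then obtain z where z: "z \<in> {s<..<u}" "?h u - ?h s = ?h' z * (u - s)" by blast
      have zT: "z \<in> {0..T}" using z su by auto
      have "(\<Sum>k\<in>F. (x' k z)\<^sup>2 + (y' k z)\<^sup>2) * (u - s)\<^sup>2 \<le> B' * (u - s)\<^sup>2" by (intro mult_right_mono B' zT F) simp
      moreover have "\<bar>?h' z * (u - s)\<bar> \<le> ?W / 2 + (\<Sum>k\<in>F. (x' k z)\<^sup>2 + (y' k z)\<^sup>2) * (u - s)\<^sup>2 / 2"
      proof -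
        have yg: "\<bar>a * (p * (u - s))\<bar> \<le> a\<^sup>2 / 2 + p\<^sup>2 * (u - s)\<^sup>2 / 2" for a p :: real
          using sum_squares_bound[of a "p * (u - s)"] sum_squares_bound[of a "- (p * (u - s))"]
          by (simp add: power_mult_distrib abs_le_iff)
        have "\<bar>?h' z * (u - s)\<bar> = \<bar>\<Sum>k\<in>F. ?a k * (x' k z * (u - s)) + ?b k * (y' k z * (u - s))\<bar>"
          by (simp add: sum_distrib_right distrib_right mult.assoc)
        also have "\<dots> \<le> (\<Sum>k\<in>F. \<bar>?a k * (x' k z * (u - s)) + ?b k * (y' k z * (u - s))\<bar>)" by (rule sum_abs)
        also have "\<dots> \<le> (\<Sum>k\<in>F. ((?a k)\<^sup>2 + (?b k)\<^sup>2) / 2 + ((x' k z)\<^sup>2 + (y' k z)\<^sup>2) * (u - s)\<^sup>2 / 2)"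
        proof (rule sum_mono)
          fix k
          show "\<bar>?a k * (x' k z * (u - s)) + ?b k * (y' k z * (u - s))\<bar> \<le> ((?a k)\<^sup>2 + (?b k)\<^sup>2) / 2 + ((x' k z)\<^sup>2 + (y' k z)\<^sup>2) * (u - s)\<^sup>2 / 2"
            using yg[of "?a k" "x' k z"] yg[of "?b k" "y' k z"] unfolding distrib_right add_divide_distrib by linarith
        qed
        also have "\<dots> = ?W / 2 + (\<Sum>k\<in>F. (x' k z)\<^sup>2 + (y' k z)\<^sup>2) * (u - s)\<^sup>2 / 2"
          by (subst sum.distrib) (simp only: sum_distrib_right sum_divide_distrib)
        finally show ?thesis .
      qed
      moreover have "?h s - ?h u = - (?h' z * (u - s))" unfolding z(2)[symmetric] by (rule minus_diff_eq[symmetric])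
      ultimately show ?thesis unfolding z(2) by linarith
    qed
    \<comment> \<open>Together with \<open>bd\<close> this reads \<open>?W\<close> \<le>
      \<open>?W\<close> / 2 + B' (t - t0)^2 / 2, and half of \<open>?W\<close> is absorbed on the
      left.\<close>
    have hW: "?h t - ?h t0 = ?W"
      by (simp add: sum_subtractf[symmetric] power2_eq_square algebra_simps)
    have sq: "(t0 - t)\<^sup>2 = (t - t0)\<^sup>2" by (rule power2_commute)
    have "?h t - ?h t0 \<le> ?W / 2 + B' * (t - t0)\<^sup>2 / 2 \<or> t = t0"
      using bd[OF _ t0 t] bd[OF _ t t0] sq by (cases t t0 rule: linorder_cases) auto
    then show ?thesis unfolding hW by auto
  qed
  have le: "(\<Sum>\<^sub>\<infinity>k. (x k t - x k t0)\<^sup>2 + (y k t - y k t0)\<^sup>2) \<le> B' * (t - t0)\<^sup>2" if "t \<in> {0..T}" for t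
    by (rule infsum_le_finite_sums[OF summ[OF lip[OF that]] lip[OF that]]) auto
  show "((\<lambda>t. \<Sum>\<^sub>\<infinity>k. (x k t - x k t0)\<^sup>2 + (y k t - y k t0)\<^sup>2) \<longlongrightarrow> 0) (at t0 within {0..T})"
  proof (rule Lim_null_comparison)
    show "\<forall>\<^sub>F t in at t0 within {0..T}. norm (\<Sum>\<^sub>\<infinity>k. (x k t - x k t0)\<^sup>2 + (y k t - y k t0)\<^sup>2) \<le> B' * (t - t0)\<^sup>2"
      unfolding eventually_at_filter
      by (intro always_eventually allI impI) (simp add: le infsum_nonneg)
    show "((\<lambda>t. B' * (t - t0)\<^sup>2) \<longlongrightarrow> 0) (at t0 within {0..T})" by (auto intro!: tendsto_eq_intros)
  qed
qed

text \<open>Unfolds a function on cells with two components into one on the sites of the chain and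
  takes the real part. Integer division rounds down, so odd sites, negative ones included, fall into
  the right cell.\<close>

definition site :: "(nat \<Rightarrow> int \<Rightarrow> complex) \<Rightarrow> int \<Rightarrow> real" where
  "site f k = Re (if odd k then f 1 (k div 2) else f 2 (k div 2))"

lemma site_simps: "site f (2 * j + 1) = Re (f 1 j)" "site f (2 * j) = Re (f 2 j)"
  by (simp_all add: site_def)

lemma site_sum_le:
  assumes F: "finite F" and b: "\<And>G. finite G \<Longrightarrow> (\<Sum>j\<in>G. (cmod (f 1 j))\<^sup>2) \<le> B" "\<And>G. finite G \<Longrightarrow> (\<Sum>j\<in>G. (cmod (f 2 j))\<^sup>2) \<le> B'"
  shows "(\<Sum>k\<in>F. (site f k)\<^sup>2) \<le> B + B'"
proof -
  have Re2: "(Re y)\<^sup>2 \<le> (cmod y)\<^sup>2" for y using abs_Re_le_cmod[of y] by (simp add: abs_le_square_iff[symmetric])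
  have "(\<Sum>k\<in>F. (site f k)\<^sup>2) = (\<Sum>k\<in>F \<inter> {k. odd k}. (site f k)\<^sup>2) + (\<Sum>k\<in>F \<inter> - {k. odd k}. (site f k)\<^sup>2)"
    using F by (rule sum.Int_Diff[of F _ "{k. odd k}", unfolded Diff_eq])
  also have "\<dots> \<le> (\<Sum>k\<in>F \<inter> {k. odd k}. (cmod (f 1 (k div 2)))\<^sup>2) + (\<Sum>k\<in>F \<inter> - {k. odd k}. (cmod (f 2 (k div 2)))\<^sup>2)"
    by (intro add_mono sum_mono) (auto simp: site_def Re2 simp del: One_nat_def)
  also have "(\<Sum>k\<in>F \<inter> {k. odd k}. (cmod (f 1 (k div 2)))\<^sup>2) = (\<Sum>j\<in>(\<lambda>k. k div 2) ` (F \<inter> {k. odd k}). (cmod (f 1 j))\<^sup>2)"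
    by (rule sum.reindex[symmetric, unfolded o_def]) (auto simp: inj_on_def elim!: oddE)
  also have "(\<Sum>k\<in>F \<inter> - {k. odd k}. (cmod (f 2 (k div 2)))\<^sup>2) = (\<Sum>j\<in>(\<lambda>k. k div 2) ` (F \<inter> - {k. odd k}). (cmod (f 2 j))\<^sup>2)"
    by (rule sum.reindex[symmetric, unfolded o_def]) (auto simp: inj_on_def elim!: evenE)
  also have "(\<Sum>j\<in>(\<lambda>k. k div 2) ` (F \<inter> {k. odd k}). (cmod (f 1 j))\<^sup>2) + (\<Sum>j\<in>(\<lambda>k. k div 2) ` (F \<inter> - {k. odd k}). (cmod (f 2 j))\<^sup>2) \<le> B + B'"
    using F by (intro add_mono b) auto
  finally show ?thesis .
qed

lemma site_l2O:
  assumes "l2O \<tau> n (f 1)" "l2O \<tau> n (f 2)"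
  obtains B where "0 \<le> B" "\<And>\<epsilon> t F. 0 < \<epsilon> \<Longrightarrow> \<epsilon> < 1 \<Longrightarrow> t \<in> {0..\<tau> / \<epsilon>} \<Longrightarrow> finite F \<Longrightarrow>
    (\<Sum>k\<in>F. (site (\<lambda>c j. f c \<epsilon> j t) k)\<^sup>2) \<le> B * \<epsilon> ^ n"
proof -
  obtain C where C: "0 \<le> C" "\<And>\<epsilon> t F. 0 < \<epsilon> \<Longrightarrow> \<epsilon> < 1 \<Longrightarrow> t \<in> {0..\<tau> / \<epsilon>} \<Longrightarrow> finite F \<Longrightarrow> (\<Sum>j\<in>F. (cmod (f 1 \<epsilon> j t))\<^sup>2) \<le> C * \<epsilon> ^ n"
    by (rule l2O_E[OF assms(1)]) blast
  obtain C' where C': "0 \<le> C'" "\<And>\<epsilon> t F. 0 < \<epsilon> \<Longrightarrow> \<epsilon> < 1 \<Longrightarrow> t \<in> {0..\<tau> / \<epsilon>} \<Longrightarrow> finite F \<Longrightarrow> (\<Sum>j\<in>F. (cmod (f 2 \<epsilon> j t))\<^sup>2) \<le> C' * \<epsilon> ^ n"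
    by (rule l2O_E[OF assms(2)]) blast
  show ?thesis
  proof (rule that[of "C + C'"])
    fix \<epsilon> t :: real and F :: "int set" assume a: "0 < \<epsilon>" "\<epsilon> < 1" "t \<in> {0..\<tau> / \<epsilon>}" and F: "finite F"
    show "(\<Sum>k\<in>F. (site (\<lambda>c j. f c \<epsilon> j t) k)\<^sup>2) \<le> (C + C') * \<epsilon> ^ n"
      unfolding distrib_right by (rule site_sum_le[OF F]) (fact C(2)[OF a] C'(2)[OF a])+
  qed (use C C' in simp)
qed

lemma site_has_derivative:
  assumes "(f 1 (k div 2) has_vector_derivative f' 1 (k div 2)) F"
    and "(f 2 (k div 2) has_vector_derivative f' 2 (k div 2)) F"
  shows "((\<lambda>t. site (\<lambda>c j. f c j t) k) has_real_derivative site f' k) F"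
  unfolding site_def has_real_derivative_iff_has_vector_derivative
  using assms[THEN bounded_linear.has_vector_derivative[OF bounded_linear_Re]] by (cases "odd k") simp_all

lemma site_add: "site (\<lambda>c j. f c j + g c j) k = site f k + site g k"
  by (simp add: site_def)

lemma site_diff: "site (\<lambda>c j. f c j - g c j) k = site f k - site g k"
  by (simp add: site_def)

text \<open>The correctors s and X are obtained by choice and need not respect conjugation, so
  \<open>psi\<close> need not be real. Real parts may be taken in the linear equations because their
  coefficients are real; the squares require that the leading term \<open>z\<close> itself is real.
  The diagonal constant 2 p + w is split so that the linear force becomes a second difference plus
  an on-site term.\<close>

locale real_modulation =
  modulation I lam e ei g r s kap X E b bt by' \<tau> "of_real (2 * p1 + w1)" "of_real (2 * p2 + w2)" "of_real p1" "of_real p2"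
    "of_real n1" "of_real n2" "of_real m1" "of_real m2"
  for I :: "'i set" and lam e ei g :: "'i \<Rightarrow> complex" and r s :: "'i \<Rightarrow> nat \<Rightarrow> complex"
    and kap :: "'i \<Rightarrow> 'i \<Rightarrow> 'i \<Rightarrow> complex" and X :: "'i \<Rightarrow> 'i \<Rightarrow> nat \<Rightarrow> complex"
    and E :: "'i \<Rightarrow> int \<Rightarrow> real \<Rightarrow> complex" and b bt by' :: "'i \<Rightarrow> real \<Rightarrow> real \<Rightarrow> complex" and \<tau> :: real
    and p1 p2 w1 w2 n1 n2 m1 m2 :: real +
  assumes z_real: "\<And>c \<epsilon> j t. Im (z c \<epsilon> j t) = 0"
begin

definition "P \<epsilon> k t = site (\<lambda>c j. psi c \<epsilon> j t) k"
definition "Pd \<epsilon> k t = site (\<lambda>c j. phi c \<epsilon> j t) k"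
definition "Z \<epsilon> k t = site (\<lambda>c j. z c \<epsilon> j t) k"
definition "Zd \<epsilon> k t = site (\<lambda>c j. zd c \<epsilon> j t) k"
definition "e1 \<epsilon> k t = site (\<lambda>c j. res1 c \<epsilon> j t) k"
definition "e2 \<epsilon> k t = site (\<lambda>c j. res2 c \<epsilon> j t) k"
definition "par x y (k::int) = (if odd k then x else y :: real)"

lemma site_force: "site (\<lambda>c j. force c \<epsilon> j t) k =
  par p1 p2 k * (P \<epsilon> (k + 1) t - 2 * P \<epsilon> k t + P \<epsilon> (k - 1) t) - par w1 w2 k * P \<epsilon> k t
  + (par n1 n2 k * ((Z \<epsilon> (k + 1) t - Z \<epsilon> k t)\<^sup>2 - (Z \<epsilon> k t - Z \<epsilon> (k - 1) t)\<^sup>2) - par m1 m2 k * (Z \<epsilon> k t)\<^sup>2)"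
proof (cases "odd k")
  case True
  then obtain j where k: "k = 2 * j + 1" by (rule oddE)
  have n: "k + 1 = 2 * (j + 1)" "k - 1 = 2 * j" using k by simp_all
  show ?thesis unfolding P_def Z_def n site_simps unfolding k site_simps force_def
    by (simp add: par_def Re_power2 z_real algebra_simps del: One_nat_def)
next
  case False
  then obtain j where k: "k = 2 * j" by auto
  have n: "k + 1 = 2 * j + 1" "k - 1 = 2 * (j - 1) + 1" using k by simp_all
  show ?thesis unfolding P_def Z_def n site_simps unfolding k site_simps force_def
    by (simp add: par_def Re_power2 z_real algebra_simps del: One_nat_def)
qed

lemma P_deriv:
  assumes "0 < \<epsilon>" "t \<in> {0..\<tau> / \<epsilon>}"
  shows "(P \<epsilon> k has_real_derivative site (\<lambda>c j. phi c \<epsilon> j t + res1 c \<epsilon> j t) k) (at t within {0..\<tau> / \<epsilon>})"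
  unfolding P_def[abs_def] by (rule site_has_derivative) (rule psi_deriv[OF assms])+

lemma Pd_deriv:
  assumes "0 < \<epsilon>" "t \<in> {0..\<tau> / \<epsilon>}"
  shows "(Pd \<epsilon> k has_real_derivative site (\<lambda>c j. force c \<epsilon> j t + res2 c \<epsilon> j t) k) (at t within {0..\<tau> / \<epsilon>})"
  unfolding Pd_def[abs_def] by (rule site_has_derivative) (rule phi_deriv1[OF assms] phi_deriv2[OF assms])+

lemma z_bdd: "bddO \<tau> (z c)"
proof -
  obtain C where C: "0 \<le> C" "\<And>\<epsilon> t j. 0 < \<epsilon> \<Longrightarrow> \<epsilon> < 1 \<Longrightarrow> t \<in> {0..\<tau> / \<epsilon>} \<Longrightarrow> cmod (z c \<epsilon> j t) \<le> C * \<epsilon>"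
    using z_bound[of c] by blast
  show ?thesis
    by (rule bddO_I[OF C(1)], rule order_trans[OF C(2)]) (use C(1) in \<open>auto simp: mult_left_le\<close>)
qed

lemma force_l2: "l2O \<tau> 1 (force c)"
proof -
  have sh: "l2O \<tau> 1 (\<lambda>\<epsilon> j t. psi c \<epsilon> (j + 1) t)" "l2O \<tau> 1 (\<lambda>\<epsilon> j t. psi c \<epsilon> (j - 1) t)"
    "l2O \<tau> 1 (\<lambda>\<epsilon> j t. z c \<epsilon> (j + 1) t)" "l2O \<tau> 1 (\<lambda>\<epsilon> j t. z c \<epsilon> (j - 1) t)"
    "bddO \<tau> (\<lambda>\<epsilon> j t. z c \<epsilon> (j + 1) t)" "bddO \<tau> (\<lambda>\<epsilon> j t. z c \<epsilon> (j - 1) t)" for c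
    using l2O_shift[OF psi_l2[of c], of "\<lambda>j. j + 1"] l2O_shift[OF psi_l2[of c], of "\<lambda>j. j - 1"]
      l2O_shift[OF z_l2[of c], of "\<lambda>j. j + 1"] l2O_shift[OF z_l2[of c], of "\<lambda>j. j - 1"]
      bddO_shift[OF z_bdd[of c], of "\<lambda>j. j + 1"] bddO_shift[OF z_bdd[of c], of "\<lambda>j. j - 1"] by (simp_all add: inj_def)
  show ?thesis
  proof (cases "c = 1")
    case True
    then show ?thesis unfolding force_def[abs_def] power2_eq_square mult.assoc if_P[OF True]
      by (intro l2O_add l2O_diff l2O_mult_bdd[OF bddO_const] l2O_mult_bdd bddO_diff sh psi_l2 z_l2 z_bdd)
  next
    case False
    then show ?thesis unfolding force_def[abs_def] power2_eq_square mult.assoc if_not_P[OF False]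
      by (intro l2O_add l2O_diff l2O_mult_bdd[OF bddO_const] l2O_mult_bdd bddO_diff sh psi_l2 z_l2 z_bdd)
  qed
qed

lemma site_bounds:
  obtains B K where "0 \<le> B" "0 \<le> K"
    "\<And>\<epsilon> t F. 0 < \<epsilon> \<Longrightarrow> \<epsilon> < 1 \<Longrightarrow> t \<in> {0..\<tau> / \<epsilon>} \<Longrightarrow> finite F \<Longrightarrow>
      (\<Sum>k\<in>F. (P \<epsilon> k t)\<^sup>2) \<le> B * \<epsilon> \<and> (\<Sum>k\<in>F. (Pd \<epsilon> k t)\<^sup>2) \<le> B * \<epsilon> \<and>
      (\<Sum>k\<in>F. (Z \<epsilon> k t)\<^sup>2) \<le> B * \<epsilon> \<and> (\<Sum>k\<in>F. (Zd \<epsilon> k t)\<^sup>2) \<le> B * \<epsilon> \<and>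
      (\<Sum>k\<in>F. (P \<epsilon> k t - Z \<epsilon> k t)\<^sup>2) \<le> B * \<epsilon> ^ 3 \<and> (\<Sum>k\<in>F. (Pd \<epsilon> k t - Zd \<epsilon> k t)\<^sup>2) \<le> B * \<epsilon> ^ 3 \<and>
      (\<Sum>k\<in>F. (e1 \<epsilon> k t)\<^sup>2) \<le> B * \<epsilon> ^ 5 \<and> (\<Sum>k\<in>F. (e2 \<epsilon> k t)\<^sup>2) \<le> B * \<epsilon> ^ 5 \<and>
      (\<Sum>k\<in>F. (site (\<lambda>c j. phi c \<epsilon> j t + res1 c \<epsilon> j t) k)\<^sup>2) \<le> B * \<epsilon> \<and>
      (\<Sum>k\<in>F. (site (\<lambda>c j. force c \<epsilon> j t + res2 c \<epsilon> j t) k)\<^sup>2) \<le> B * \<epsilon>"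
    "\<And>\<epsilon> t k. 0 < \<epsilon> \<Longrightarrow> \<epsilon> < 1 \<Longrightarrow> t \<in> {0..\<tau> / \<epsilon>} \<Longrightarrow> \<bar>P \<epsilon> k t\<bar> \<le> K * \<epsilon> \<and> \<bar>Z \<epsilon> k t\<bar> \<le> K * \<epsilon>"
proof -
  let ?ok = "\<lambda>n f B. 0 \<le> B \<and> (\<forall>\<epsilon> t F. 0 < \<epsilon> \<longrightarrow> \<epsilon> < 1 \<longrightarrow> t \<in> {0..\<tau> / \<epsilon>} \<longrightarrow> finite F \<longrightarrow>
    (\<Sum>k\<in>F. (site (\<lambda>c j. f c \<epsilon> j t) k)\<^sup>2) \<le> B * \<epsilon> ^ n)"
  have ok: "\<exists>B. ?ok n f B" if "\<And>c. l2O \<tau> n (f c)" for n f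
    by (rule site_l2O[of \<tau> n f, OF that that]) blast
  have mono: "?ok n f B'" if "?ok n f B" "B \<le> B'" for n f B B'
  proof (intro conjI allI impI)
    show "0 \<le> B'" using that by simp
    fix \<epsilon> t :: real and F :: "int set" assume a: "0 < \<epsilon>" "\<epsilon> < 1" "t \<in> {0..\<tau> / \<epsilon>}" "finite F"
    have "(\<Sum>k\<in>F. (site (\<lambda>c j. f c \<epsilon> j t) k)\<^sup>2) \<le> B * \<epsilon> ^ n" using that(1) a by blast
    also have "\<dots> \<le> B' * \<epsilon> ^ n" using a that(2) by (intro mult_right_mono) auto
    finally show "(\<Sum>k\<in>F. (site (\<lambda>c j. f c \<epsilon> j t) k)\<^sup>2) \<le> B' * \<epsilon> ^ n" .
  qed
  have phir: "l2O \<tau> 1 (\<lambda>\<epsilon> j t. phi c \<epsilon> j t + res1 c \<epsilon> j t)"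
    and forcer: "l2O \<tau> 1 (\<lambda>\<epsilon> j t. force c \<epsilon> j t + res2 c \<epsilon> j t)" for c
    by (rule l2O_add[OF phi_l2 l2O_mono[OF res1_l2]] l2O_add[OF force_l2 l2O_mono[OF res2_l2]], simp)+
  obtain b1 where bs1: "?ok 1 psi b1" using ok[where n=1 and f="psi", OF psi_l2] by (rule exE)
  obtain b2 where bs2: "?ok 1 phi b2" using ok[where n=1 and f="phi", OF phi_l2] by (rule exE)
  obtain b3 where bs3: "?ok 1 z b3" using ok[where n=1 and f="z", OF z_l2] by (rule exE)
  obtain b4 where bs4: "?ok 1 zd b4" using ok[where n=1 and f="zd", OF zd_l2] by (rule exE)
  obtain b5 where bs5: "?ok 3 (\<lambda>c \<epsilon> j t. psi c \<epsilon> j t - z c \<epsilon> j t) b5" using ok[where n=3 and f="\<lambda>c \<epsilon> j t. psi c \<epsilon> j t - z c \<epsilon> j t", OF psi_z] by (rule exE)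
  obtain b6 where bs6: "?ok 3 (\<lambda>c \<epsilon> j t. phi c \<epsilon> j t - zd c \<epsilon> j t) b6" using ok[where n=3 and f="\<lambda>c \<epsilon> j t. phi c \<epsilon> j t - zd c \<epsilon> j t", OF phi_zd] by (rule exE)
  obtain b7 where bs7: "?ok 5 res1 b7" using ok[where n=5 and f="res1", OF res1_l2] by (rule exE)
  obtain b8 where bs8: "?ok 5 res2 b8" using ok[where n=5 and f="res2", OF res2_l2] by (rule exE)
  obtain b9 where bs9: "?ok 1 (\<lambda>c \<epsilon> j t. phi c \<epsilon> j t + res1 c \<epsilon> j t) b9" using ok[where n=1 and f="\<lambda>c \<epsilon> j t. phi c \<epsilon> j t + res1 c \<epsilon> j t", OF phir] by (rule exE)
  obtain b10 where bs10: "?ok 1 (\<lambda>c \<epsilon> j t. force c \<epsilon> j t + res2 c \<epsilon> j t) b10" using ok[where n=1 and f="\<lambda>c \<epsilon> j t. force c \<epsilon> j t + res2 c \<epsilon> j t", OF forcer] by (rule exE)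
  note bs = bs1 bs2 bs3 bs4 bs5 bs6 bs7 bs8 bs9 bs10
  define B where "B = b1 + b2 + b3 + b4 + b5 + b6 + b7 + b8 + b9 + b10"
  have pos: "0 \<le> b1" "0 \<le> b2" "0 \<le> b3" "0 \<le> b4" "0 \<le> b5" "0 \<le> b6" "0 \<le> b7" "0 \<le> b8" "0 \<le> b9" "0 \<le> b10"
    using bs[THEN conjunct1] by - assumption+
  have le: "b1 \<le> B" "b2 \<le> B" "b3 \<le> B" "b4 \<le> B" "b5 \<le> B" "b6 \<le> B" "b7 \<le> B" "b8 \<le> B" "b9 \<le> B" "b10 \<le> B"
    using pos unfolding B_def by linarith+
  have cb: "\<exists>C\<ge>0. \<forall>\<epsilon> t j. 0 < \<epsilon> \<longrightarrow> \<epsilon> < 1 \<longrightarrow> t \<in> {0..\<tau> / \<epsilon>} \<longrightarrow> \<bar>Re (f 1 \<epsilon> j t)\<bar> \<le> C * \<epsilon> \<and> \<bar>Re (f 2 \<epsilon> j t)\<bar> \<le> C * \<epsilon>"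
    if f: "\<And>c. \<exists>C\<ge>0. \<forall>\<epsilon> t j. 0 < \<epsilon> \<longrightarrow> \<epsilon> < 1 \<longrightarrow> t \<in> {0..\<tau> / \<epsilon>} \<longrightarrow> cmod (f c \<epsilon> j t) \<le> C * \<epsilon>"
    for f :: "nat \<Rightarrow> real \<Rightarrow> int \<Rightarrow> real \<Rightarrow> complex"
  proof -
    obtain C1 where C1: "C1 \<ge> 0" "\<And>\<epsilon> t j. 0 < \<epsilon> \<Longrightarrow> \<epsilon> < 1 \<Longrightarrow> t \<in> {0..\<tau> / \<epsilon>} \<Longrightarrow> cmod (f 1 \<epsilon> j t) \<le> C1 * \<epsilon>" using f[of 1] by blast
    obtain C2 where C2: "C2 \<ge> 0" "\<And>\<epsilon> t j. 0 < \<epsilon> \<Longrightarrow> \<epsilon> < 1 \<Longrightarrow> t \<in> {0..\<tau> / \<epsilon>} \<Longrightarrow> cmod (f 2 \<epsilon> j t) \<le> C2 * \<epsilon>" using f[of 2] by blast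
    show ?thesis
    proof (rule exI[of _ "C1 + C2"], intro conjI allI impI)
      fix \<epsilon> t :: real and j assume a: "0 < \<epsilon>" "\<epsilon> < 1" "t \<in> {0..\<tau> / \<epsilon>}"
      have "0 \<le> C1 * \<epsilon>" "0 \<le> C2 * \<epsilon>" using a C1(1) C2(1) by simp_all
      then show "\<bar>Re (f 1 \<epsilon> j t)\<bar> \<le> (C1 + C2) * \<epsilon>" "\<bar>Re (f 2 \<epsilon> j t)\<bar> \<le> (C1 + C2) * \<epsilon>"
        using order_trans[OF abs_Re_le_cmod C1(2)[OF a, of j]] order_trans[OF abs_Re_le_cmod C2(2)[OF a, of j]]
        unfolding distrib_right by linarith+
    qed (use C1 C2 in simp)
  qed
  obtain K1 where K1: "0 \<le> K1" "\<forall>\<epsilon> t j. 0 < \<epsilon> \<longrightarrow> \<epsilon> < 1 \<longrightarrow> t \<in> {0..\<tau> / \<epsilon>} \<longrightarrow> \<bar>Re (psi 1 \<epsilon> j t)\<bar> \<le> K1 * \<epsilon> \<and> \<bar>Re (psi 2 \<epsilon> j t)\<bar> \<le> K1 * \<epsilon>"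
    using cb[of psi, OF psi_bound] by (elim exE conjE) (rule that)
  obtain K2 where K2: "0 \<le> K2" "\<forall>\<epsilon> t j. 0 < \<epsilon> \<longrightarrow> \<epsilon> < 1 \<longrightarrow> t \<in> {0..\<tau> / \<epsilon>} \<longrightarrow> \<bar>Re (z 1 \<epsilon> j t)\<bar> \<le> K2 * \<epsilon> \<and> \<bar>Re (z 2 \<epsilon> j t)\<bar> \<le> K2 * \<epsilon>"
    using cb[of z, OF z_bound] by (elim exE conjE) (rule that)
  show ?thesis
  proof (rule that[of B "K1 + K2"])
    show "0 \<le> B" using pos unfolding B_def by simp
    show "0 \<le> K1 + K2" using K1 K2 by simp
    fix \<epsilon> t :: real
    assume a: "0 < \<epsilon>" "\<epsilon> < 1" "t \<in> {0..\<tau> / \<epsilon>}"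
    show "\<bar>P \<epsilon> k t\<bar> \<le> (K1 + K2) * \<epsilon> \<and> \<bar>Z \<epsilon> k t\<bar> \<le> (K1 + K2) * \<epsilon>" for k
    proof -
      have "0 \<le> K1 * \<epsilon>" "0 \<le> K2 * \<epsilon>" using a K1(1) K2(1) by simp_all
      moreover have "\<bar>P \<epsilon> k t\<bar> \<le> K1 * \<epsilon>" using K1(2)[rule_format, OF a] unfolding P_def site_def by auto
      moreover have "\<bar>Z \<epsilon> k t\<bar> \<le> K2 * \<epsilon>" using K2(2)[rule_format, OF a] unfolding Z_def site_def by auto
      ultimately show ?thesis unfolding distrib_right by linarith
    qed
    fix F :: "int set" assume F: "finite F"
    note app = mono[THEN conjunct2, rule_format, OF _ _ a F]
    note app1 = app[OF bs1 le(1), unfolded power_one_right]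
    note app2 = app[OF bs2 le(2), unfolded power_one_right]
    note app3 = app[OF bs3 le(3), unfolded power_one_right]
    note app4 = app[OF bs4 le(4), unfolded power_one_right]
    note app5 = app[OF bs5 le(5), unfolded power_one_right]
    note app6 = app[OF bs6 le(6), unfolded power_one_right]
    note app7 = app[OF bs7 le(7), unfolded power_one_right]
    note app8 = app[OF bs8 le(8), unfolded power_one_right]
    note app9 = app[OF bs9 le(9), unfolded power_one_right]
    note app10 = app[OF bs10 le(10), unfolded power_one_right]
    have q1: "(\<Sum>k\<in>F. (P \<epsilon> k t)\<^sup>2) \<le> B * \<epsilon>"
      using app1 unfolding P_def .
    have q2: "(\<Sum>k\<in>F. (Pd \<epsilon> k t)\<^sup>2) \<le> B * \<epsilon>"
      using app2 unfolding Pd_def .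
    have q3: "(\<Sum>k\<in>F. (Z \<epsilon> k t)\<^sup>2) \<le> B * \<epsilon>"
      using app3 unfolding Z_def .
    have q4: "(\<Sum>k\<in>F. (Zd \<epsilon> k t)\<^sup>2) \<le> B * \<epsilon>"
      using app4 unfolding Zd_def .
    have q5: "(\<Sum>k\<in>F. (P \<epsilon> k t - Z \<epsilon> k t)\<^sup>2) \<le> B * \<epsilon> ^ 3"
      using app5 unfolding site_diff P_def Z_def .
    have q6: "(\<Sum>k\<in>F. (Pd \<epsilon> k t - Zd \<epsilon> k t)\<^sup>2) \<le> B * \<epsilon> ^ 3"
      using app6 unfolding site_diff Pd_def Zd_def .
    have q7: "(\<Sum>k\<in>F. (e1 \<epsilon> k t)\<^sup>2) \<le> B * \<epsilon> ^ 5"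
      using app7 unfolding e1_def .
    have q8: "(\<Sum>k\<in>F. (e2 \<epsilon> k t)\<^sup>2) \<le> B * \<epsilon> ^ 5"
      using app8 unfolding e2_def .
    have q9: "(\<Sum>k\<in>F. (site (\<lambda>c j. phi c \<epsilon> j t + res1 c \<epsilon> j t) k)\<^sup>2) \<le> B * \<epsilon>"
      using app9 .
    have q10: "(\<Sum>k\<in>F. (site (\<lambda>c j. force c \<epsilon> j t + res2 c \<epsilon> j t) k)\<^sup>2) \<le> B * \<epsilon>"
      using app10 .
    show "(\<Sum>k\<in>F. (P \<epsilon> k t)\<^sup>2) \<le> B * \<epsilon> \<and> (\<Sum>k\<in>F. (Pd \<epsilon> k t)\<^sup>2) \<le> B * \<epsilon> \<and>
      (\<Sum>k\<in>F. (Z \<epsilon> k t)\<^sup>2) \<le> B * \<epsilon> \<and> (\<Sum>k\<in>F. (Zd \<epsilon> k t)\<^sup>2) \<le> B * \<epsilon> \<and>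
      (\<Sum>k\<in>F. (P \<epsilon> k t - Z \<epsilon> k t)\<^sup>2) \<le> B * \<epsilon> ^ 3 \<and> (\<Sum>k\<in>F. (Pd \<epsilon> k t - Zd \<epsilon> k t)\<^sup>2) \<le> B * \<epsilon> ^ 3 \<and>
      (\<Sum>k\<in>F. (e1 \<epsilon> k t)\<^sup>2) \<le> B * \<epsilon> ^ 5 \<and> (\<Sum>k\<in>F. (e2 \<epsilon> k t)\<^sup>2) \<le> B * \<epsilon> ^ 5 \<and>
      (\<Sum>k\<in>F. (site (\<lambda>c j. phi c \<epsilon> j t + res1 c \<epsilon> j t) k)\<^sup>2) \<le> B * \<epsilon> \<and>
      (\<Sum>k\<in>F. (site (\<lambda>c j. force c \<epsilon> j t + res2 c \<epsilon> j t) k)\<^sup>2) \<le> B * \<epsilon>"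
      by (intro conjI q1 q2 q3 q4 q5 q6 q7 q8 q9 q10)
  qed
qed

end

lemma summable_of_bounded_sums:
  fixes f :: "int \<Rightarrow> real"
  assumes "\<And>F. finite F \<Longrightarrow> sum f F \<le> b" "\<And>k. 0 \<le> f k"
  shows "f summable_on UNIV" "infsum f UNIV \<le> b"
proof -
  show s: "f summable_on UNIV"
    by (rule nonneg_bdd_above_summable_on) (use assms in \<open>auto intro!: bdd_aboveI[of _ b]\<close>)
  show "infsum f UNIV \<le> b" by (rule infsum_le_finite_sums[OF s]) (use assms in auto)
qed

lemma square_sum4: "((x::real) * (a + b + c) + d)\<^sup>2 \<le> 4 * (x\<^sup>2 * (a\<^sup>2 + b\<^sup>2 + c\<^sup>2) + d\<^sup>2)"
proof -
  have two: "(p + q)\<^sup>2 \<le> 2 * p\<^sup>2 + 2 * q\<^sup>2" for p q :: real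
    using sum_squares_bound[of p q] by (simp add: power2_eq_square algebra_simps)
  have "(x * (a + b + c) + d)\<^sup>2 = ((x * a + x * b) + (x * c + d))\<^sup>2" by (simp add: algebra_simps)
  also have "\<dots> \<le> 2 * (x * a + x * b)\<^sup>2 + 2 * (x * c + d)\<^sup>2" by (rule two)
  also have "\<dots> \<le> 2 * (2 * (x * a)\<^sup>2 + 2 * (x * b)\<^sup>2) + 2 * (2 * (x * c)\<^sup>2 + 2 * d\<^sup>2)"
    by (intro add_mono mult_left_mono two) simp_all
  also have "\<dots> = 4 * (x\<^sup>2 * (a\<^sup>2 + b\<^sup>2 + c\<^sup>2) + d\<^sup>2)" by (simp add: power_mult_distrib algebra_simps)
  finally show ?thesis .
qed

lemma sum_int_shift:
  assumes "\<And>F. finite F \<Longrightarrow> (\<Sum>k\<in>F. f k) \<le> B" "finite (F :: int set)"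
  shows "(\<Sum>k\<in>F. f (k + a)) \<le> (B::real)"
proof -
  have "(\<Sum>k\<in>F. f (k + a)) = (\<Sum>k\<in>(\<lambda>k. k + a) ` F. f k)"
    by (rule sum.reindex[symmetric, unfolded o_def]) (simp add: inj_on_def)
  then show ?thesis using assms by simp
qed

section \<open>Validity of the approximation for the nonlinear chain\<close>

context real_modulation begin

text \<open>The differences R = x - P and S = xd - Pd to the corrected profile solve a
  \<open>perturbed_chain\<close> with the first residual as defect and the nonlinear remainder as
  forcing. Passing between the corrected profile and the leading term, at time 0 and at the end,
  costs a squared error of order \<epsilon>^3, which is at most \<epsilon>^(2 \<beta>).\<close>

lemma validity:
  fixes V1 V2 W1 W2 :: "real \<Rightarrow> real"
  assumes V: "expands \<eta> C n1 (\<lambda>x. deriv V1 x - p1 * x)" "expands \<eta> C n2 (\<lambda>x. deriv V2 x - p2 * x)"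
    and W: "expands \<eta> C m1 (\<lambda>x. deriv W1 x - w1 * x)" "expands \<eta> C m2 (\<lambda>x. deriv W2 x - w2 * x)"
    and eta: "0 < \<eta>" and C: "0 \<le> C"
    and st: "p1 = v1 / M" "p2 = v1 / m" "M > 0" "m > 0" "w1 > 0" "w2 > 0" "4 * v1 + min (M * w1) (m * w2) > 0"
    and c: "0 < c" and \<beta>: "1 < \<beta>" "\<beta> \<le> 3 / 2"
  shows "\<exists>\<epsilon>0>0. \<exists>K>0. \<forall>\<epsilon>\<in>{0<..<\<epsilon>0}. \<forall>x xd. chain_solution V1 V2 W1 W2 (\<tau> / \<epsilon>) x xd \<longrightarrow>
    sqrt (\<Sum>\<^sub>\<infinity>k. (x k 0 - Z \<epsilon> k 0)\<^sup>2 + (xd k 0 - Zd \<epsilon> k 0)\<^sup>2) \<le> c * \<epsilon> powr \<beta> \<longrightarrow>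
    (\<forall>t\<in>{0..\<tau> / \<epsilon>}. sqrt (\<Sum>\<^sub>\<infinity>k. (x k t - Z \<epsilon> k t)\<^sup>2 + (xd k t - Zd \<epsilon> k t)\<^sup>2) \<le> K * \<epsilon> powr \<beta>)"
proof -
  obtain B K where B: "0 \<le> B" and K: "0 \<le> K" and
    bd: "\<And>\<epsilon> t F. 0 < \<epsilon> \<Longrightarrow> \<epsilon> < 1 \<Longrightarrow> t \<in> {0..\<tau> / \<epsilon>} \<Longrightarrow> finite F \<Longrightarrow>
      (\<Sum>k\<in>F. (P \<epsilon> k t)\<^sup>2) \<le> B * \<epsilon> \<and> (\<Sum>k\<in>F. (Pd \<epsilon> k t)\<^sup>2) \<le> B * \<epsilon> \<and>
      (\<Sum>k\<in>F. (Z \<epsilon> k t)\<^sup>2) \<le> B * \<epsilon> \<and> (\<Sum>k\<in>F. (Zd \<epsilon> k t)\<^sup>2) \<le> B * \<epsilon> \<and>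
      (\<Sum>k\<in>F. (P \<epsilon> k t - Z \<epsilon> k t)\<^sup>2) \<le> B * \<epsilon> ^ 3 \<and> (\<Sum>k\<in>F. (Pd \<epsilon> k t - Zd \<epsilon> k t)\<^sup>2) \<le> B * \<epsilon> ^ 3 \<and>
      (\<Sum>k\<in>F. (e1 \<epsilon> k t)\<^sup>2) \<le> B * \<epsilon> ^ 5 \<and> (\<Sum>k\<in>F. (e2 \<epsilon> k t)\<^sup>2) \<le> B * \<epsilon> ^ 5 \<and>
      (\<Sum>k\<in>F. (site (\<lambda>c j. phi c \<epsilon> j t + res1 c \<epsilon> j t) k)\<^sup>2) \<le> B * \<epsilon> \<and>
      (\<Sum>k\<in>F. (site (\<lambda>c j. force c \<epsilon> j t + res2 c \<epsilon> j t) k)\<^sup>2) \<le> B * \<epsilon>"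
    and PZ: "\<And>\<epsilon> t k. 0 < \<epsilon> \<Longrightarrow> \<epsilon> < 1 \<Longrightarrow> t \<in> {0..\<tau> / \<epsilon>} \<Longrightarrow> \<bar>P \<epsilon> k t\<bar> \<le> K * \<epsilon> \<and> \<bar>Z \<epsilon> k t\<bar> \<le> K * \<epsilon>"
    by (rule site_bounds) blast
  define N where "N = \<bar>n1\<bar> + \<bar>n2\<bar> + \<bar>m1\<bar> + \<bar>m2\<bar>"
  \<comment> \<open>The constant of \<open>force_defect\<close>, with N as a common bound for all
    quadratic coefficients.\<close>
  define L where "L = 3 * (C * (4 * K + 2) + 4 * C * K\<^sup>2 + 4 * N * K)"
  have N: "\<bar>par n1 n2 k\<bar> \<le> N" "\<bar>par m1 m2 k\<bar> \<le> N" "0 \<le> N" for k by (auto simp: N_def par_def)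
  have L: "0 \<le> L" using C K N(3) by (simp add: L_def)
  \<comment> \<open>From \<open>square_sum4\<close>: three shifted copies of H, each of squared norm
    at most 4 B \<epsilon>^5, and the residual. It also exceeds B, as the defect of R' = S
    requires.\<close>
  define D where "D = 4 * (L\<^sup>2 * (12 * B) + B)"
  have LB: "0 \<le> L\<^sup>2 * (12 * B)" using B by simp
  have D: "0 \<le> D" "B \<le> D" using B LB by (auto simp: D_def)
  \<comment> \<open>Twice the squared initial error plus twice the squared distance 2 B
    \<epsilon>^(2 \<beta>) of profile and leading term.\<close>
  define c' where "c' = 2 * c\<^sup>2 + 4 * B"
  have c': "0 \<le> c'" using B by (simp add: c'_def)
  have pos: "0 < M * w1" "0 < m * w2" using st by simp_all
  \<comment> \<open>The masses bound the kinetic part from below, M w1 and m w2 the on-site part,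
    and the last entry the on-site part lowered by a negative v1.\<close>
  define c0 where "c0 = min (min M m) (min (min (M * w1) (m * w2)) (4 * v1 + min (M * w1) (m * w2)))"
  have c0_le: "c0 \<le> M" "c0 \<le> m" "c0 \<le> M * w1" "c0 \<le> m * w2" "c0 \<le> 4 * v1 + min (M * w1) (m * w2)"
    unfolding c0_def min_le_iff_disj by blast+
  then have c0_le': "c0 \<le> M * w1 + 4 * v1" "c0 \<le> m * w2 + 4 * v1" by linarith+
  have "0 < c0" unfolding c0_def min_less_iff_conj using st pos by simp
  then have c0: "0 < c0" "c0 \<le> par M m k" "c0 \<le> par M m k * par w1 w2 k" "c0 \<le> par M m k * par w1 w2 k + 4 * v1" for k
    using c0_le(1-4) c0_le' by (cases "odd k"; simp add: par_def)+
  define Bm where "Bm = M + m + M * w1 + m * w2 + \<bar>v1\<bar>"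
  have "M \<le> Bm" "m \<le> Bm" "M * w1 \<le> Bm" "m * w2 \<le> Bm" "\<bar>v1\<bar> \<le> Bm" using st(3,4) pos unfolding Bm_def by linarith+
  then have Bm: "par M m k \<le> Bm" "par M m k * par w1 w2 k \<le> Bm" "\<bar>v1\<bar> \<le> Bm" for k
    by (cases "odd k"; simp add: par_def)+
  obtain C' \<epsilon>1 where C': "C' > 0" and \<epsilon>1: "\<epsilon>1 > 0" and boot:
    "\<forall>\<epsilon> T R S p q d. 0 < \<epsilon> \<longrightarrow> \<epsilon> < \<epsilon>1 \<longrightarrow> 0 \<le> T \<longrightarrow> \<epsilon> * T \<le> \<tau> \<longrightarrow>
    perturbed_chain v1 (par M m) (par w1 w2) T R S p q \<longrightarrow>
    (\<forall>t\<in>{0..T}. (\<forall>k. \<bar>R k t\<bar> \<le> \<epsilon>) \<longrightarrow>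
      (\<forall>k. \<bar>q k t\<bar> \<le> L * \<epsilon> * (\<bar>R (k - 1) t\<bar> + \<bar>R k t\<bar> + \<bar>R (k + 1) t\<bar>) + \<bar>d k t\<bar>)) \<longrightarrow>
    (\<forall>t\<in>{0..T}. \<forall>F. finite F \<longrightarrow> (\<Sum>k\<in>F. (d k t)\<^sup>2) \<le> D * \<epsilon> ^ 5 \<and> (\<Sum>k\<in>F. (p k t)\<^sup>2) \<le> D * \<epsilon> ^ 5) \<longrightarrow>
    (\<Sum>\<^sub>\<infinity>k. (R k 0)\<^sup>2 + (S k 0)\<^sup>2) \<le> c' * \<epsilon> powr (2 * \<beta>) \<longrightarrow>
    (\<forall>t\<in>{0..T}. (\<Sum>\<^sub>\<infinity>k. (R k t)\<^sup>2 + (S k t)\<^sup>2) \<le> C' * \<epsilon> powr (2 * \<beta>))"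
    using energy_bootstrap[where \<mu>="par M m" and \<omega>="par w1 w2", OF c0 Bm L D(1) less_imp_le[OF tau] c' \<beta>]
    by - (elim exE conjE, rule that)
  \<comment> \<open>The last entry ensures 2 (K + 1) \<epsilon> \<le> \<eta>: while |R| \<le>
    \<epsilon>, all strains stay where the expansions hold.\<close>
  define \<epsilon>0 where "\<epsilon>0 = min \<epsilon>1 (min 1 (\<eta> / (2 * (K + 1))))"
  define Kf where "Kf = sqrt (2 * C' + 4 * B)"
  have Kf: "Kf > 0" using C' B by (simp add: Kf_def)
  have \<epsilon>0: "\<epsilon>0 > 0" using \<epsilon>1 eta K by (simp add: \<epsilon>0_def)
  show ?thesis
  proof (rule exI[of _ \<epsilon>0], rule conjI[OF \<epsilon>0], rule exI[of _ Kf], rule conjI[OF Kf], intro ballI allI impI)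
    fix \<epsilon> assume "\<epsilon> \<in> {0<..<\<epsilon>0}"
    then have e: "0 < \<epsilon>" "\<epsilon> < 1" "\<epsilon> < \<epsilon>1" and "\<epsilon> < \<eta> / (2 * (K + 1))" by (auto simp: \<epsilon>0_def)
    then have eK: "2 * (K + 1) * \<epsilon> \<le> \<eta>" using K by (simp add: field_simps)
    define T where "T = \<tau> / \<epsilon>"
    have T: "0 \<le> T" "\<epsilon> * T \<le> \<tau>" using e tau by (simp_all add: T_def)
    have T0: "0 \<in> {0..T}" using T by simp
    note bdT = bd[OF e(1,2), folded T_def] and PZT = PZ[OF e(1,2), folded T_def]
    have e3: "\<epsilon> ^ 3 \<le> \<epsilon> powr (2 * \<beta>)"
    proof -
      have "\<epsilon> powr 3 \<le> \<epsilon> powr (2 * \<beta>)" using e \<beta> by (intro powr_mono') auto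
      then show ?thesis using e by simp
    qed
    have eb: "(\<epsilon> powr \<beta>)\<^sup>2 = \<epsilon> powr (2 * \<beta>)" by (simp add: power2_eq_square powr_add[symmetric])
    fix x xd assume sol: "chain_solution V1 V2 W1 W2 (\<tau> / \<epsilon>) x xd"
      and init: "sqrt (\<Sum>\<^sub>\<infinity>k. (x k 0 - Z \<epsilon> k 0)\<^sup>2 + (xd k 0 - Zd \<epsilon> k 0)\<^sup>2) \<le> c * \<epsilon> powr \<beta>"
    from sol have dx: "(x k has_real_derivative xd k t) (at t within {0..T})"
      and dxd: "(xd k has_real_derivative chain_rhs V1 V2 W1 W2 (\<lambda>i. x i t) k) (at t within {0..T})"
      and sx: "(\<lambda>k. (x k t)\<^sup>2) summable_on UNIV" "(\<lambda>k. (xd k t)\<^sup>2) summable_on UNIV"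
      and lx: "((\<lambda>s. \<Sum>\<^sub>\<infinity>k. (x k s - x k t)\<^sup>2 + (xd k s - xd k t)\<^sup>2) \<longlongrightarrow> 0) (at t within {0..T})"
      if "t \<in> {0..T}" for k t
      using that unfolding chain_solution_def T_def by blast+
    have lcx: "l2_cont T x xd" unfolding l2_cont_def by (intro conjI ballI summable_on_add sx lx)
    define R where "R k t = x k t - P \<epsilon> k t" for k t
    define S where "S k t = xd k t - Pd \<epsilon> k t" for k t
    \<comment> \<open>Whatever the linear chain leaves over. It turns out to be the difference
      between the true nonlinear force and its quadratic model at Z, minus the second
      residual.\<close>
    define q where "q k t = chain_rhs V1 V2 W1 W2 (\<lambda>i. x i t) k - site (\<lambda>c j. force c \<epsilon> j t + res2 c \<epsilon> j t) k
      - (par p1 p2 k * (R (k + 1) t - 2 * R k t + R (k - 1) t) - par w1 w2 k * R k t)" for k t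
    define H where "H k t = \<epsilon>\<^sup>2 * \<bar>P \<epsilon> k t\<bar> + \<epsilon> * \<bar>P \<epsilon> k t - Z \<epsilon> k t\<bar>" for k t
    define d where "d k t = L * (H (k - 1) t + H k t + H (k + 1) t) + \<bar>e2 \<epsilon> k t\<bar>" for k t
    have lcP: "l2_cont T (P \<epsilon>) (Pd \<epsilon>)"
    \<comment> \<open>The profile is differentiable only site by site, but its derivatives are
      bounded in l2.\<close>
    proof (rule l2_cont_of_bounded_derivative)
      fix t and F :: "int set" assume "t \<in> {0..T}" "finite F"
      note b = bdT[OF this]
      show "(\<Sum>k\<in>F. (P \<epsilon> k t)\<^sup>2 + (Pd \<epsilon> k t)\<^sup>2) \<le> B * \<epsilon> + B * \<epsilon>" using b unfolding sum.distrib by linarith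
      show "(\<Sum>k\<in>F. (site (\<lambda>c j. phi c \<epsilon> j t + res1 c \<epsilon> j t) k)\<^sup>2 + (site (\<lambda>c j. force c \<epsilon> j t + res2 c \<epsilon> j t) k)\<^sup>2) \<le> B * \<epsilon> + B * \<epsilon>"
        using b unfolding sum.distrib by linarith
    next
      fix t k assume "t \<in> {0..T}"
      then show "(P \<epsilon> k has_real_derivative site (\<lambda>c j. phi c \<epsilon> j t + res1 c \<epsilon> j t) k) (at t within {0..T})"
        "(Pd \<epsilon> k has_real_derivative site (\<lambda>c j. force c \<epsilon> j t + res2 c \<epsilon> j t) k) (at t within {0..T})"
        unfolding T_def by (intro P_deriv Pd_deriv e(1); assumption)+
    qed
    have lcR: "l2_cont T R S" using l2_cont_diff[OF lcx lcP] by (simp only: R_def[abs_def] S_def[abs_def])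
    have pc: "perturbed_chain v1 (par M m) (par w1 w2) T R S (\<lambda>k t. - e1 \<epsilon> k t) q"
      unfolding perturbed_chain_def
    proof (intro conjI allI ballI)
      show "(\<lambda>k. (R k t)\<^sup>2 + (S k t)\<^sup>2) summable_on UNIV" if "t \<in> {0..T}" for t
        using lcR that unfolding l2_cont_def by blast
      show "continuous_on {0..T} (\<lambda>t. \<Sum>\<^sub>\<infinity>k. (R k t)\<^sup>2 + (S k t)\<^sup>2)" by (rule l2_cont_norm_continuous[OF lcR])
      fix k t assume t: "t \<in> {0..T}"
      have "(R k has_real_derivative xd k t - site (\<lambda>c j. phi c \<epsilon> j t + res1 c \<epsilon> j t) k) (at t within {0..T})"
        unfolding R_def[abs_def] by (intro DERIV_diff dx t P_deriv[OF e(1), folded T_def])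
      then show "(R k has_real_derivative S k t + - e1 \<epsilon> k t) (at t within {0..T})"
        by (simp add: site_add S_def Pd_def e1_def algebra_simps)
      have "(S k has_real_derivative chain_rhs V1 V2 W1 W2 (\<lambda>i. x i t) k - site (\<lambda>c j. force c \<epsilon> j t + res2 c \<epsilon> j t) k) (at t within {0..T})"
        unfolding S_def[abs_def] by (intro DERIV_diff dxd t Pd_deriv[OF e(1), folded T_def])
      moreover have "par p1 p2 k = v1 / par M m k" by (simp add: par_def st)
      ultimately show "(S k has_real_derivative v1 / par M m k * (R (k + 1) t - 2 * R k t + R (k - 1) t) - par w1 w2 k * R k t + q k t) (at t within {0..T})"
        by (simp add: q_def)
    qed
    have qb: "\<bar>q k t\<bar> \<le> L * \<epsilon> * (\<bar>R (k - 1) t\<bar> + \<bar>R k t\<bar> + \<bar>R (k + 1) t\<bar>) + \<bar>d k t\<bar>"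
      if t: "t \<in> {0..T}" and small: "\<forall>k. \<bar>R k t\<bar> \<le> \<epsilon>" for t k
    proof -
      let ?GV = "\<lambda>y. if odd k then deriv V1 y - p1 * y else deriv V2 y - p2 * y"
      let ?GW = "\<lambda>y. if odd k then deriv W1 y - w1 * y else deriv W2 y - w2 * y"
      let ?f = "?GV (x (k + 1) t - x k t) - ?GV (x k t - x (k - 1) t) - ?GW (x k t)
        - (par n1 n2 k * ((Z \<epsilon> (k + 1) t - Z \<epsilon> k t)\<^sup>2 - (Z \<epsilon> k t - Z \<epsilon> (k - 1) t)\<^sup>2) - par m1 m2 k * (Z \<epsilon> k t)\<^sup>2)"
      have V': "expands \<eta> C (par n1 n2 k) ?GV" and W': "expands \<eta> C (par m1 m2 k) ?GW"
        using V W by (cases "odd k"; simp add: par_def)+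
      have qf: "q k t = ?f - e2 \<epsilon> k t"
        unfolding q_def site_add site_force e2_def[symmetric]
        by (cases "odd k") (simp_all add: chain_rhs_def par_def R_def algebra_simps)
      have HR: "\<bar>?f\<bar> \<le> L * \<epsilon> * (\<bar>x (k - 1) t - P \<epsilon> (k - 1) t\<bar> + \<bar>x k t - P \<epsilon> k t\<bar> + \<bar>x (k + 1) t - P \<epsilon> (k + 1) t\<bar>)
         + L * (H (k - 1) t + H k t + H (k + 1) t)"
        unfolding L_def H_def
        by (rule force_defect[OF V' W' C K e(1,2) eK N(1,2)])
          (use small PZT[OF t] in \<open>simp_all only: R_def\<close>)
      have Hn: "0 \<le> H j t" for j using e by (simp add: H_def)
      have "0 \<le> L * (H (k - 1) t + H k t + H (k + 1) t)" using L Hn[of "k - 1"] Hn[of k] Hn[of "k + 1"] by simp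
      then have "\<bar>d k t\<bar> = L * (H (k - 1) t + H k t + H (k + 1) t) + \<bar>e2 \<epsilon> k t\<bar>" unfolding d_def by linarith
      then show ?thesis using HR unfolding qf R_def by linarith
    qed
    have dp: "(\<Sum>k\<in>F. (d k t)\<^sup>2) \<le> D * \<epsilon> ^ 5 \<and> (\<Sum>k\<in>F. (- e1 \<epsilon> k t)\<^sup>2) \<le> D * \<epsilon> ^ 5"
      if t: "t \<in> {0..T}" and F: "finite F" for t F
    proof
      have e5: "0 \<le> \<epsilon> ^ 5" using e by simp
      have "(\<Sum>k\<in>F. (- e1 \<epsilon> k t)\<^sup>2) \<le> B * \<epsilon> ^ 5" using bdT[OF t F] by simp
      also have "\<dots> \<le> D * \<epsilon> ^ 5" by (rule mult_right_mono[OF D(2) e5])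
      finally show "(\<Sum>k\<in>F. (- e1 \<epsilon> k t)\<^sup>2) \<le> D * \<epsilon> ^ 5" .
      \<comment> \<open>2 \<epsilon>^4 times B \<epsilon> from the profile and 2 \<epsilon>^2 times
        B \<epsilon>^3 from its distance to the leading term.\<close>
      have Hs: "(\<Sum>k\<in>F. (H k t)\<^sup>2) \<le> 4 * B * \<epsilon> ^ 5" if F: "finite F" for F
      proof -
        have "(H k t)\<^sup>2 \<le> 2 * \<epsilon> ^ 4 * (P \<epsilon> k t)\<^sup>2 + 2 * \<epsilon>\<^sup>2 * (P \<epsilon> k t - Z \<epsilon> k t)\<^sup>2" for k
          using sum_sq_bound[of "\<epsilon>\<^sup>2 * \<bar>P \<epsilon> k t\<bar>" "- (\<epsilon> * \<bar>P \<epsilon> k t - Z \<epsilon> k t\<bar>)"]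
          by (simp add: H_def power_mult_distrib)
        then have "(\<Sum>k\<in>F. (H k t)\<^sup>2) \<le> (\<Sum>k\<in>F. 2 * \<epsilon> ^ 4 * (P \<epsilon> k t)\<^sup>2 + 2 * \<epsilon>\<^sup>2 * (P \<epsilon> k t - Z \<epsilon> k t)\<^sup>2)" by (rule sum_mono)
        also have "\<dots> = 2 * \<epsilon> ^ 4 * (\<Sum>k\<in>F. (P \<epsilon> k t)\<^sup>2) + 2 * \<epsilon>\<^sup>2 * (\<Sum>k\<in>F. (P \<epsilon> k t - Z \<epsilon> k t)\<^sup>2)"
          by (simp only: sum.distrib sum_distrib_left)
        also have "\<dots> \<le> 2 * \<epsilon> ^ 4 * (B * \<epsilon>) + 2 * \<epsilon>\<^sup>2 * (B * \<epsilon> ^ 3)"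
          by (intro add_mono mult_left_mono) (use bdT[OF t F] in auto)
        also have "\<dots> = 4 * B * \<epsilon> ^ 5" by (simp add: eval_nat_numeral)
        finally show ?thesis .
      qed
      have "(\<Sum>k\<in>F. (d k t)\<^sup>2) \<le> (\<Sum>k\<in>F. 4 * (L\<^sup>2 * ((H (k - 1) t)\<^sup>2 + (H k t)\<^sup>2 + (H (k + 1) t)\<^sup>2) + (e2 \<epsilon> k t)\<^sup>2))"
        unfolding d_def by (intro sum_mono order_trans[OF square_sum4]) simp
      also have "\<dots> = 4 * (L\<^sup>2 * ((\<Sum>k\<in>F. (H (k - 1) t)\<^sup>2) + (\<Sum>k\<in>F. (H k t)\<^sup>2) + (\<Sum>k\<in>F. (H (k + 1) t)\<^sup>2)) + (\<Sum>k\<in>F. (e2 \<epsilon> k t)\<^sup>2))"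
        by (simp only: sum.distrib sum_distrib_left[symmetric])
      also have "\<dots> \<le> 4 * (L\<^sup>2 * (4 * B * \<epsilon> ^ 5 + 4 * B * \<epsilon> ^ 5 + 4 * B * \<epsilon> ^ 5) + B * \<epsilon> ^ 5)"
      proof (intro add_mono mult_left_mono)
        show "(\<Sum>k\<in>F. (H (k - 1) t)\<^sup>2) \<le> 4 * B * \<epsilon> ^ 5"
          using sum_int_shift[OF Hs F, of "-1"] by simp
        show "(\<Sum>k\<in>F. (H (k + 1) t)\<^sup>2) \<le> 4 * B * \<epsilon> ^ 5" by (rule sum_int_shift[OF Hs F])
      qed (use Hs[OF F] bdT[OF t F] in auto)
      also have "\<dots> = D * \<epsilon> ^ 5" by (simp add: D_def algebra_simps)
      finally show "(\<Sum>k\<in>F. (d k t)\<^sup>2) \<le> D * \<epsilon> ^ 5" .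
    qed
    have sP: "(\<lambda>k. (P \<epsilon> k t - Z \<epsilon> k t)\<^sup>2 + (Pd \<epsilon> k t - Zd \<epsilon> k t)\<^sup>2) summable_on UNIV"
        "(\<Sum>\<^sub>\<infinity>k. (P \<epsilon> k t - Z \<epsilon> k t)\<^sup>2 + (Pd \<epsilon> k t - Zd \<epsilon> k t)\<^sup>2) \<le> 2 * B * \<epsilon> powr (2 * \<beta>)"
      if t: "t \<in> {0..T}" for t
    proof -
      have Be: "B * \<epsilon> ^ 3 \<le> B * \<epsilon> powr (2 * \<beta>)" by (rule mult_left_mono[OF e3 B])
      have f: "(\<Sum>k\<in>F. (P \<epsilon> k t - Z \<epsilon> k t)\<^sup>2 + (Pd \<epsilon> k t - Zd \<epsilon> k t)\<^sup>2) \<le> 2 * B * \<epsilon> powr (2 * \<beta>)" if "finite F" for F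
        using bdT[OF t that] Be unfolding sum.distrib by linarith
      show "(\<lambda>k. (P \<epsilon> k t - Z \<epsilon> k t)\<^sup>2 + (Pd \<epsilon> k t - Zd \<epsilon> k t)\<^sup>2) summable_on UNIV"
        "(\<Sum>\<^sub>\<infinity>k. (P \<epsilon> k t - Z \<epsilon> k t)\<^sup>2 + (Pd \<epsilon> k t - Zd \<epsilon> k t)\<^sup>2) \<le> 2 * B * \<epsilon> powr (2 * \<beta>)"
        by (rule summable_of_bounded_sums[OF f]; simp)+
    qed
    have sZ: "(\<lambda>k. (Z \<epsilon> k t)\<^sup>2 + (Zd \<epsilon> k t)\<^sup>2) summable_on UNIV" if t: "t \<in> {0..T}" for t
    proof (rule summable_of_bounded_sums(1))
      show "(\<Sum>k\<in>F. (Z \<epsilon> k t)\<^sup>2 + (Zd \<epsilon> k t)\<^sup>2) \<le> B * \<epsilon> + B * \<epsilon>" if "finite F" for F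
        using bdT[OF t that] unfolding sum.distrib by linarith
    qed simp
    let ?E = "\<lambda>t. \<Sum>\<^sub>\<infinity>k. (x k t - Z \<epsilon> k t)\<^sup>2 + (xd k t - Zd \<epsilon> k t)\<^sup>2"
    let ?N = "\<lambda>t. \<Sum>\<^sub>\<infinity>k. (R k t)\<^sup>2 + (S k t)\<^sup>2"
    have NE: "?N t \<le> 2 * ?E t + 4 * B * \<epsilon> powr (2 * \<beta>)" if t: "t \<in> {0..T}" for t
    proof -
      have sxz: "(\<lambda>k. (x k t - Z \<epsilon> k t)\<^sup>2 + (xd k t - Zd \<epsilon> k t)\<^sup>2) summable_on UNIV"
        by (rule sq_diff_infsum(1)[OF summable_on_add[OF sx[OF t]] sZ[OF t]])
      have "x k t - Z \<epsilon> k t - (P \<epsilon> k t - Z \<epsilon> k t) = R k t" "xd k t - Zd \<epsilon> k t - (Pd \<epsilon> k t - Zd \<epsilon> k t) = S k t" for k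
        by (simp_all add: R_def S_def)
      with sq_diff_infsum(2)[OF sxz sP(1)[OF t]] sP(2)[OF t] show ?thesis by simp
    qed
    have EN: "?E t \<le> 2 * ?N t + 4 * B * \<epsilon> powr (2 * \<beta>)" if t: "t \<in> {0..T}" for t
    proof -
      have sR: "(\<lambda>k. (R k t)\<^sup>2 + (S k t)\<^sup>2) summable_on UNIV" using lcR t unfolding l2_cont_def by blast
      have sP': "(\<lambda>k. (Z \<epsilon> k t - P \<epsilon> k t)\<^sup>2 + (Zd \<epsilon> k t - Pd \<epsilon> k t)\<^sup>2) summable_on UNIV"
        "(\<Sum>\<^sub>\<infinity>k. (Z \<epsilon> k t - P \<epsilon> k t)\<^sup>2 + (Zd \<epsilon> k t - Pd \<epsilon> k t)\<^sup>2) \<le> 2 * B * \<epsilon> powr (2 * \<beta>)"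
        using sP[OF t] by (simp_all only: power2_commute[of "P \<epsilon> _ t"] power2_commute[of "Pd \<epsilon> _ t"])
      have "R k t - (Z \<epsilon> k t - P \<epsilon> k t) = x k t - Z \<epsilon> k t" "S k t - (Zd \<epsilon> k t - Pd \<epsilon> k t) = xd k t - Zd \<epsilon> k t" for k
        by (simp_all add: R_def S_def)
      with sq_diff_infsum(2)[OF sR sP'(1)] sP'(2) show ?thesis by simp
    qed
    have "?E 0 \<le> (c * \<epsilon> powr \<beta>)\<^sup>2" by (rule sqrt_le_D[OF init])
    then have "?E 0 \<le> c\<^sup>2 * \<epsilon> powr (2 * \<beta>)" by (simp add: power_mult_distrib eb)
    then have N0: "?N 0 \<le> c' * \<epsilon> powr (2 * \<beta>)" using NE[OF T0] unfolding c'_def distrib_right by linarith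
    have Nt: "\<forall>t\<in>{0..T}. ?N t \<le> C' * \<epsilon> powr (2 * \<beta>)"
    proof
      fix t assume "t \<in> {0..T}"
      show "?N t \<le> C' * \<epsilon> powr (2 * \<beta>)"
      proof (rule boot[rule_format, OF e(1,3) T pc _ _ N0 \<open>t \<in> {0..T}\<close>, where d=d])
        fix t k assume "t \<in> {0..T}" "\<And>k. \<bar>R k t\<bar> \<le> \<epsilon>"
        then show "\<bar>q k t\<bar> \<le> L * \<epsilon> * (\<bar>R (k - 1) t\<bar> + \<bar>R k t\<bar> + \<bar>R (k + 1) t\<bar>) + \<bar>d k t\<bar>" by (intro qb allI)
      qed (rule dp)
    qed
    fix t assume "t \<in> {0..\<tau> / \<epsilon>}"
    then have t: "t \<in> {0..T}" by (simp add: T_def)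
    have "?E t \<le> 2 * (C' * \<epsilon> powr (2 * \<beta>)) + 4 * B * \<epsilon> powr (2 * \<beta>)"
      using EN[OF t] bspec[OF Nt t] by linarith
    also have "\<dots> = (Kf * \<epsilon> powr \<beta>)\<^sup>2"
      using C' B by (simp add: Kf_def power_mult_distrib eb algebra_simps)
    finally show "sqrt (?E t) \<le> Kf * \<epsilon> powr \<beta>" using Kf by (intro real_le_lsqrt) simp_all
  qed
qed

end

section \<open>Identification with the stated approximation and error\<close>

lemma has_derivative_within_unique:
  fixes f :: "real \<Rightarrow> complex"
  assumes "(f has_vector_derivative a) (at t within {0..\<tau>})" "(g has_vector_derivative b) (at t within {0..\<tau>})"
    and "\<And>s. s \<in> {0..\<tau>} \<Longrightarrow> f s = g s" and t: "t \<in> {0..\<tau>}" and "0 < \<tau>"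
  shows "a = b"
proof -
  have "(f has_vector_derivative b) (at t within {0..\<tau>})"
    by (rule has_vector_derivative_transform[OF t _ assms(2)]) (simp add: assms(3))
  then show ?thesis
    by (rule vector_derivative_unique_within_closed_interval[of 0 \<tau>, unfolded box_real, OF \<open>0 < \<tau>\<close> t assms(1)])
qed

lemma infsum_cells_sites:
  fixes h :: "int \<Rightarrow> real"
  shows "(\<Sum>\<^sub>\<infinity>(j, k::nat)\<in>UNIV \<times> {1, 2}. h (if k = 1 then 2 * j + 1 else 2 * j)) = (\<Sum>\<^sub>\<infinity>i. h i)"
proof -
  have "bij_betw (\<lambda>(j, k::nat). if k = 1 then 2 * j + 1 else 2 * j) (UNIV \<times> {1, 2}) (UNIV :: int set)"
    by (rule bij_betw_byWitness[where f'="\<lambda>i. (i div 2, if odd i then 1 else 2)"]) (auto split: if_splits)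
  from infsum_reindex_bij_betw[OF this, of h] show ?thesis by (simp add: case_prod_unfold)
qed

lemma sum_signed_modes: "(\<Sum>i\<in>signed_modes. f i) = f 1 + f 2 + (f (- 1) + f (- 2))" for f :: "int \<Rightarrow> complex"
  by (simp add: add.assoc)

lemma signed_one_two:
  "idx 1 = 1" "idx 2 = 2" "idx (- 1) = 1" "idx (- 2) = 2"
  "cj 1 x = x" "cj 2 x = x" "cj (- 1) x = cnj x" "cj (- 2) x = cnj x"
  "sgd f 1 = f 1" "sgd f 2 = f 2" "sgd f (- 1) = - f 1" "sgd f (- 2) = - f 2"
  by (simp_all add: idx_def cj_def sgd_def)

lemma cis_neg_phase: "cis (- a * t + j * - b) = cnj (cis (a * t + j * b))"
  by (simp add: cis_cnj algebra_simps)

text \<open>Both w_i > 0 and 4 a_i + w_i > 0 together say 2 |a_i| < 2 a_i + w_i, for either sign of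
  a_i. Multiplied, they show det H(0, 0) \<noteq> 0: the standing mode generated by each mode and
  its conjugate is never resonant.\<close>

lemma standing_determinant:
  fixes a1 a2 w1 w2 :: real
  assumes "w1 > 0" "w2 > 0" "4 * a1 + w1 > 0" "4 * a2 + w2 > 0" "a1 * a2 > 0"
  shows "(2 * a1 + w1) * (2 * a2 + w2) \<noteq> 4 * a1 * a2"
proof -
  have g: "2 * \<bar>a1\<bar> < 2 * a1 + w1" "2 * \<bar>a2\<bar> < 2 * a2 + w2" using assms by linarith+
  have "(2 * \<bar>a1\<bar>) * (2 * \<bar>a2\<bar>) < (2 * a1 + w1) * (2 * a2 + w2)"
    by (rule mult_strict_mono'[OF g]) simp_all
  moreover have "(2 * \<bar>a1\<bar>) * (2 * \<bar>a2\<bar>) = 4 * a1 * a2" using assms(5) by (simp add: abs_mult[symmetric])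
  ultimately show ?thesis by linarith
qed

theorem theorem4p1:
  fixes V1 V2 W1 W2 :: "real \<Rightarrow> real"
    and v w :: "nat \<Rightarrow> nat \<Rightarrow> real"
    and v1 M m :: real
    and om th :: "nat \<Rightarrow> real"
    and \<tau>0 :: real
    and A At Ay :: "nat \<Rightarrow> nat \<Rightarrow> real \<Rightarrow> real \<Rightarrow> complex"
  assumes reg: "Ck 4 V1" "Ck 4 V2" "Ck 4 W1" "Ck 4 W2"
    and expV1: "(\<lambda>x. deriv V1 x - v 1 1 * x - v 1 2 * x^2) \<in> O[at 0](\<lambda>x. \<bar>x\<bar>^3)"
    and expV2: "(\<lambda>x. deriv V2 x - v 2 1 * x - v 2 2 * x^2) \<in> O[at 0](\<lambda>x. \<bar>x\<bar>^3)"
    and expW1: "(\<lambda>x. deriv W1 x - w 1 1 * x - w 1 2 * x^2) \<in> O[at 0](\<lambda>x. \<bar>x\<bar>^3)"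
    and expW2: "(\<lambda>x. deriv W2 x - w 2 1 * x - w 2 2 * x^2) \<in> O[at 0](\<lambda>x. \<bar>x\<bar>^3)"
    and st: "v 1 1 = v1 / M" "v 2 1 = v1 / m" "M > 0" "m > 0" "v1 \<noteq> 0"
      "w 1 1 > 0" "w 2 1 > 0" "4 * v1 + min (M * w 1 1) (m * w 2 1) > 0"
      "4 * v 1 1 + w 1 1 > 0" "4 * v 2 1 + w 2 1 > 0" "v 1 1 * v 2 1 > 0"
      "cc v w 2 > cc v w 1"
    and om_pos: "om 2 > om 1" "om 1 > 0"
    and th_range: "th 1 \<in> {-pi<..pi}" "th 2 \<in> {-pi<..pi}"
    and disp: "det (Hmat v w (om 1) (th 1)) = 0" "det (Hmat v w (om 2) (th 2)) = 0"
    and cases: "NR_case v w om th \<tau>0 A At Ay \<or> R_case v w om th \<tau>0 A At Ay"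
    and tau0: "\<tau>0 > 0"
    and derivs: "\<forall>n\<in>{1,2}. \<forall>k\<in>{1,2}. \<forall>\<tau>\<in>{0..\<tau>0}. \<forall>y.
        ((\<lambda>s. A n k s y) has_vector_derivative At n k \<tau> y) (at \<tau> within {0..\<tau>0}) \<and>
        ((\<lambda>z. A n k \<tau> z) has_vector_derivative Ay n k \<tau> y) (at y)"
    and H4: "\<exists>K. \<forall>n\<in>{1,2}. \<forall>k\<in>{1,2}. \<forall>\<tau>\<in>{0..\<tau>0}. H4_norm_le K (A n k \<tau>)"
  shows "\<forall>c>0. \<forall>\<beta>\<in>{1<..3/2}. \<exists>\<epsilon>0>0. \<exists>C>0. \<forall>\<epsilon>\<in>{0<..<\<epsilon>0}. \<forall>x xd.
           chain_solution V1 V2 W1 W2 (\<tau>0 / \<epsilon>) x xd \<longrightarrow>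
           approx_err \<epsilon> om th A At x xd 0 \<le> c * \<epsilon> powr \<beta> \<longrightarrow>
           (\<forall>t\<in>{0..\<tau>0 / \<epsilon>}. approx_err \<epsilon> om th A At x xd t \<le> C * \<epsilon> powr \<beta>)"
proof (intro allI impI ballI)
  fix c \<beta> :: real assume c: "0 < c" and "\<beta> \<in> {1<..3/2}"
  then have \<beta>: "1 < \<beta>" "\<beta> \<le> 3 / 2" by auto
  interpret chain_coeffs v w by unfold_locales (use st in auto)
  obtain K where K: "\<forall>n\<in>{1,2}. \<forall>k\<in>{1,2}. \<forall>\<tau>\<in>{0..\<tau>0}. H4_norm_le K (A n k \<tau>)" using H4 by blast
  have det0: "cc v w 1 * cc v w 2 \<noteq> 4 * v 1 1 * v 2 1"
    unfolding cc_def using standing_determinant[OF st(6,7,9-11)] .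
  let ?R = "\<lambda>n. Rv (om n) (th n)" and ?k = "\<lambda>n. k0 (om n) (th n)"
  obtain K1 K2 s X where alg: "\<forall>n\<in>{1,2}. \<forall>c\<in>{1,2}. \<forall>\<tau>\<in>{0..\<tau>0}. \<forall>y. A n c \<tau> y = ?R n c * A n (?k n) \<tau> y"
    and mo: "modulation signed_modes (lamS om) (eS th) (eiS th) (\<lambda>i. of_real (gv (om (idx i)) (th (idx i)))) (rS ?R) s
     (kapS K1 K2) X (ES om th) (bS (\<lambda>n. A n (?k n))) (bS (\<lambda>n. At n (?k n))) (bS (\<lambda>n. Ay n (?k n))) \<tau>0
     (of_real (cc v w 1)) (of_real (cc v w 2)) (of_real (v 1 1)) (of_real (v 2 1))
     (of_real (v 1 2)) (of_real (v 2 2)) (of_real (w 1 2)) (of_real (w 2 2))"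
    using modulation_exists[OF det0 om_pos th_range disp cases tau0 derivs K] by (elim exE conjE) (rule that)
  have kk: "?k n \<in> {1,2}" for n by (simp add: k0_def)
  \<comment> \<open>The algebraic relations between the components hold on the whole time interval,
    so they pass to the time derivatives, one-sided ones at the end points included.\<close>
  have algt: "At n c \<tau> y = ?R n c * At n (?k n) \<tau> y" if n: "n \<in> {1,2}" and c: "c \<in> {1,2}" and t: "\<tau> \<in> {0..\<tau>0}" for n c \<tau> y
  proof (rule has_derivative_within_unique[OF _ _ _ t tau0])
    show "((\<lambda>s. A n c s y) has_vector_derivative At n c \<tau> y) (at \<tau> within {0..\<tau>0})" using derivs n c t by blast
    have "((\<lambda>s. A n (?k n) s y) has_vector_derivative At n (?k n) \<tau> y) (at \<tau> within {0..\<tau>0})" using derivs n kk t by blast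
    then show "((\<lambda>s. ?R n c * A n (?k n) s y) has_vector_derivative ?R n c * At n (?k n) \<tau> y) (at \<tau> within {0..\<tau>0})"
      by (rule has_vector_derivative_mult_right)
    show "A n c s y = ?R n c * A n (?k n) s y" if "s \<in> {0..\<tau>0}" for s using alg n c that by blast
  qed
  interpret M: modulation signed_modes "lamS om" "eS th" "eiS th" "\<lambda>i. of_real (gv (om (idx i)) (th (idx i)))" "rS ?R" s
     "kapS K1 K2" X "ES om th" "bS (\<lambda>n. A n (?k n))" "bS (\<lambda>n. At n (?k n))" "bS (\<lambda>n. Ay n (?k n))" \<tau>0
     "of_real (2 * v 1 1 + w 1 1)" "of_real (2 * v 2 1 + w 2 1)" "of_real (v 1 1)" "of_real (v 2 1)"
     "of_real (v 1 2)" "of_real (v 2 2)" "of_real (w 1 2)" "of_real (w 2 2)"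
    using mo unfolding cc_def .
  \<comment> \<open>The sum over signed modes is the sum over n = 1, 2 plus its complex conjugate,
    so the abstract leading term is exactly the approximation of the theorem and is real.\<close>
  have z_eq: "M.z k \<epsilon> j t = (let z = of_real \<epsilon> * (\<Sum>n\<in>{1,2}. ?R n k * A n (?k n) (\<epsilon>*t) (\<epsilon> * of_int j)
        * cis (om n * t + of_int j * th n)) in z + cnj z)" for k \<epsilon> j t
    unfolding M.z_def sum_signed_modes M.A_def rS_def bS_def ES_def signed_one_two cis_neg_phase Let_def
    by (simp add: algebra_simps)
  have zd_eq: "M.zd k \<epsilon> j t = (let z = of_real \<epsilon> * (\<Sum>n\<in>{1,2}. ?R n k * (of_real \<epsilon> * At n (?k n) (\<epsilon>*t) (\<epsilon> * of_int j)
        + \<i> * of_real (om n) * A n (?k n) (\<epsilon>*t) (\<epsilon> * of_int j)) * cis (om n * t + of_int j * th n)) in z + cnj z)" for k \<epsilon> j t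
    unfolding M.zd_def sum_signed_modes M.A_def M.At_def rS_def bS_def ES_def lamS_def signed_one_two cis_neg_phase Let_def
    by (simp add: algebra_simps)
  have Im_add_cnj: "Im (y + cnj y) = 0" for y by simp
  interpret RM: real_modulation signed_modes "lamS om" "eS th" "eiS th" "\<lambda>i. of_real (gv (om (idx i)) (th (idx i)))" "rS ?R" s
     "kapS K1 K2" X "ES om th" "bS (\<lambda>n. A n (?k n))" "bS (\<lambda>n. At n (?k n))" "bS (\<lambda>n. Ay n (?k n))" \<tau>0
     "v 1 1" "v 2 1" "w 1 1" "w 2 1" "v 1 2" "v 2 2" "w 1 2" "w 2 2"
    by unfold_locales (unfold z_eq Let_def, rule Im_add_cnj)
  \<comment> \<open>Restricted to times with \<epsilon> t in [0, \<tau>0], since outside the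
    amplitudes need not obey the algebraic relations.\<close>
  have U: "Uapp \<epsilon> om th A j k t = Re (M.z k \<epsilon> j t)" "Udot \<epsilon> om th A At j k t = Re (M.zd k \<epsilon> j t)"
    if k: "k \<in> {1,2}" and t: "\<epsilon> * t \<in> {0..\<tau>0}" for \<epsilon> j k t
  proof -
    have a: "A n k (\<epsilon> * t) y = ?R n k * A n (?k n) (\<epsilon> * t) y" "At n k (\<epsilon> * t) y = ?R n k * At n (?k n) (\<epsilon> * t) y"
      if "n \<in> {1,2}" for n y using alg algt k t that by blast+
    have "(\<Sum>n\<in>{1,2}. A n k (\<epsilon>*t) (\<epsilon> * of_int j) * exp (\<i> * of_real (om n * t + of_int j * th n)))
      = (\<Sum>n\<in>{1,2}. ?R n k * A n (?k n) (\<epsilon>*t) (\<epsilon> * of_int j) * cis (om n * t + of_int j * th n))"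
      by (intro sum.cong refl) (simp only: a cis_conv_exp)
    then show "Uapp \<epsilon> om th A j k t = Re (M.z k \<epsilon> j t)" unfolding Uapp_def z_eq Let_def by (simp only:)
    have "(\<Sum>n\<in>{1,2}. (of_real \<epsilon> * At n k (\<epsilon>*t) (\<epsilon> * of_int j) + \<i> * of_real (om n) * A n k (\<epsilon>*t) (\<epsilon> * of_int j))
        * exp (\<i> * of_real (om n * t + of_int j * th n)))
      = (\<Sum>n\<in>{1,2}. ?R n k * (of_real \<epsilon> * At n (?k n) (\<epsilon>*t) (\<epsilon> * of_int j)
        + \<i> * of_real (om n) * A n (?k n) (\<epsilon>*t) (\<epsilon> * of_int j)) * cis (om n * t + of_int j * th n))"
      by (intro sum.cong refl) (simp only: a cis_conv_exp distrib_left mult_ac)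
    then show "Udot \<epsilon> om th A At j k t = Re (M.zd k \<epsilon> j t)" unfolding Udot_def zd_eq Let_def by (simp only:)
  qed
  have err: "approx_err \<epsilon> om th A At x xd t = sqrt (\<Sum>\<^sub>\<infinity>k. (x k t - RM.Z \<epsilon> k t)\<^sup>2 + (xd k t - RM.Zd \<epsilon> k t)\<^sup>2)"
    if t: "\<epsilon> * t \<in> {0..\<tau>0}" for \<epsilon> x xd t
  proof -
    let ?h = "\<lambda>k. (x k t - RM.Z \<epsilon> k t)\<^sup>2 + (xd k t - RM.Zd \<epsilon> k t)\<^sup>2"
    have "(case p of (j, k) \<Rightarrow> (ucomp x j k t - Uapp \<epsilon> om th A j k t)\<^sup>2 + (ucomp xd j k t - Udot \<epsilon> om th A At j k t)\<^sup>2)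
      = (case p of (j, k) \<Rightarrow> ?h (if k = 1 then 2 * j + 1 else 2 * j))" if "p \<in> UNIV \<times> {1,2}" for p
    proof -
      obtain j k where p: "p = (j, k)" and k: "k \<in> {1,2}" using \<open>p \<in> UNIV \<times> {1,2}\<close> by auto
      consider "k = 1" | "k \<noteq> 1" "k = 2" using k by auto
      then show ?thesis
        unfolding p prod.case U[OF k t] ucomp_def RM.Z_def RM.Zd_def
        by cases (simp_all only: if_True if_False simp_thms site_simps)
    qed
    then have "(\<Sum>\<^sub>\<infinity>(j,k)\<in>UNIV \<times> {1,2}. (ucomp x j k t - Uapp \<epsilon> om th A j k t)\<^sup>2 + (ucomp xd j k t - Udot \<epsilon> om th A At j k t)\<^sup>2)
      = (\<Sum>\<^sub>\<infinity>(j,k::nat)\<in>UNIV \<times> {1,2}. ?h (if k = 1 then 2 * j + 1 else 2 * j))" by (rule infsum_cong)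
    also have "\<dots> = (\<Sum>\<^sub>\<infinity>i. ?h i)" by (rule infsum_cells_sites[of ?h])
    finally show ?thesis unfolding approx_err_def by (rule arg_cong)
  qed
  obtain \<eta>1 C1 where E1: "\<eta>1 > 0" "C1 \<ge> 0" "expands \<eta>1 C1 (v 1 2) (\<lambda>x. deriv V1 x - v 1 1 * x)"
    using derivative_expands[OF reg(1) expV1] by blast
  obtain \<eta>2 C2 where E2: "\<eta>2 > 0" "C2 \<ge> 0" "expands \<eta>2 C2 (v 2 2) (\<lambda>x. deriv V2 x - v 2 1 * x)"
    using derivative_expands[OF reg(2) expV2] by blast
  obtain \<eta>3 C3 where E3: "\<eta>3 > 0" "C3 \<ge> 0" "expands \<eta>3 C3 (w 1 2) (\<lambda>x. deriv W1 x - w 1 1 * x)"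
    using derivative_expands[OF reg(3) expW1] by blast
  obtain \<eta>4 C4 where E4: "\<eta>4 > 0" "C4 \<ge> 0" "expands \<eta>4 C4 (w 2 2) (\<lambda>x. deriv W2 x - w 2 1 * x)"
    using derivative_expands[OF reg(4) expW2] by blast
  \<comment> \<open>The smallest neighbourhood and the sum of the constants serve all four
    potentials.\<close>
  define \<eta> C where "\<eta> = min (min \<eta>1 \<eta>2) (min \<eta>3 \<eta>4)" and "C = C1 + C2 + C3 + C4"
  have ex: "expands \<eta> C (v 1 2) (\<lambda>x. deriv V1 x - v 1 1 * x)" "expands \<eta> C (v 2 2) (\<lambda>x. deriv V2 x - v 2 1 * x)"
    "expands \<eta> C (w 1 2) (\<lambda>x. deriv W1 x - w 1 1 * x)" "expands \<eta> C (w 2 2) (\<lambda>x. deriv W2 x - w 2 1 * x)"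
    by (rule expands_mono[OF E1(3)] expands_mono[OF E2(3)] expands_mono[OF E3(3)] expands_mono[OF E4(3)];
        use E1 E2 E3 E4 in \<open>simp add: \<eta>_def C_def\<close>)+
  have "0 < \<eta>" "0 \<le> C" using E1 E2 E3 E4 by (simp_all add: \<eta>_def C_def)
  from RM.validity[OF ex this st(1-4,6-8) c \<beta>] obtain \<epsilon>0 L where "\<epsilon>0 > 0" "L > 0"
    and val: "\<And>\<epsilon> x xd t. \<epsilon> \<in> {0<..<\<epsilon>0} \<Longrightarrow> chain_solution V1 V2 W1 W2 (\<tau>0 / \<epsilon>) x xd \<Longrightarrow>
      sqrt (\<Sum>\<^sub>\<infinity>k. (x k 0 - RM.Z \<epsilon> k 0)\<^sup>2 + (xd k 0 - RM.Zd \<epsilon> k 0)\<^sup>2) \<le> c * \<epsilon> powr \<beta> \<Longrightarrow> t \<in> {0..\<tau>0 / \<epsilon>} \<Longrightarrow>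
      sqrt (\<Sum>\<^sub>\<infinity>k. (x k t - RM.Z \<epsilon> k t)\<^sup>2 + (xd k t - RM.Zd \<epsilon> k t)\<^sup>2) \<le> L * \<epsilon> powr \<beta>" by blast
  show "\<exists>\<epsilon>0>0. \<exists>C>0. \<forall>\<epsilon>\<in>{0<..<\<epsilon>0}. \<forall>x xd. chain_solution V1 V2 W1 W2 (\<tau>0 / \<epsilon>) x xd \<longrightarrow>
    approx_err \<epsilon> om th A At x xd 0 \<le> c * \<epsilon> powr \<beta> \<longrightarrow> (\<forall>t\<in>{0..\<tau>0 / \<epsilon>}. approx_err \<epsilon> om th A At x xd t \<le> C * \<epsilon> powr \<beta>)"
  proof (rule exI[of _ \<epsilon>0], rule conjI[OF \<open>\<epsilon>0 > 0\<close>], rule exI[of _ L], rule conjI[OF \<open>L > 0\<close>], intro ballI allI impI)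
    fix \<epsilon> x xd t assume e: "\<epsilon> \<in> {0<..<\<epsilon>0}" and sol: "chain_solution V1 V2 W1 W2 (\<tau>0 / \<epsilon>) x xd"
      and init: "approx_err \<epsilon> om th A At x xd 0 \<le> c * \<epsilon> powr \<beta>" and t: "t \<in> {0..\<tau>0 / \<epsilon>}"
    have "\<epsilon> * 0 \<in> {0..\<tau>0}" "\<epsilon> * t \<in> {0..\<tau>0}" using e t tau0 by (auto simp: field_simps)
    then show "approx_err \<epsilon> om th A At x xd t \<le> L * \<epsilon> powr \<beta>"
      using val[OF e sol _ t] init by (simp only: err)
  qed
qed

end
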